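(* Let $(Y,d)$ be a compact geodesic metric space (with more than one point), let $\mu$ be a Borel probability measure on $Y$ such that $(Y,d,\mu)$ is Ahlfors regular, and let $\Gamma$ be a finitely generated group acting on $Y$ by Lipschitz homeomorphisms. Assume that the action preserves $\mu$ and is ergodic, and that $\Gamma$ has Lafforgue's Banach property (T). Then any family $(G_t)_{t>0}$ of graphs of uniformly bounded degree that is quasi-isometric to the warped cone $\mathcal{O}_\Gamma Y=(tY,d_\Gamma)_{t>0}$ is an expander with respect to every Banach space $X$ of non-trivial (Rademacher) type.
   Context: **Ahlfors regularity.** $(Y,d,\mu)$ is Ahlfors regular if there are constants $c,m>0$ and $C\ge 1$ such that $c r^m\le \mu(B(y,r))\le C c r^m$ for all $y\in Y$ and $0<r\le 2\operatorname{diam} Y$, where $B(y,r)$ is the open ball. **Non-trivial type.** A Banach space has non-trivial type if it has Rademacher type $p$ for some $p>1$. **Lafforgue's Banach property (T)** (for a discrete group $\Gamma$). A class $\mathcal{E}$ of (complex) Banach spaces is said to be of type $>1$ if there are $p>1$ and $T<\infty$ such that every $E\in\mathcal{E}$ has Rademacher type $p$ with constant at most $T$. For a class $\mathcal{E}$, stable under duality and complex conjugation, let $C_{\mathcal{E}}(\Gamma)$ be the completion of the group algebra $\mathbb{C}[\Gamma]$ with respect to the (semi)norm $\|f\|=\sup\|\pi(f)\|$, the supremum being over all isometric representations $\pi$ of $\Gamma$ on spaces $E\in\mathcal{E}$. The group $\Gamma$ has Banach property (T) if for every class $\mathcal{E}$ of type $>1$ stable under duality and complex conjugation there is an idempotent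 $p\in C_{\mathcal{E}}(\Gamma)$ such that for every isometric representation $\pi$ of $\Gamma$ on a space $E\in\mathcal{E}$ the operator $\pi(p)$ is a projection onto the subspace of $\pi(\Gamma)$-invariant vectors of $E$. **Warped cone.** Fix a finite generating set $S$ of $\Gamma$ closed under inverses. $\mathcal{O}_\Gamma Y$ is the family of metric spaces $(tY)_{t>0}$, where $tY$ denotes the set $\{t\}\times Y$ (with points written $ty$, $y\in Y$), equipped with the largest metric $d_\Gamma$ such that $d_\Gamma(tx,ty)\le t\,d(x,y)$ for all $x,y\in Y$ and $d_\Gamma(ty,tsy)\le 1$ for all $y\in Y$, $s\in S$. (Another finite symmetric generating set yields uniformly Lipschitz equivalent metrics.) **Quasi-isometry.** A map $f\colon(Y_1,d_1)\to(Y_2,d_2)$ is a quasi-isometry if there are constants $A\ge0$, $C\ge1$, $B>0$ such that $C^{-1}d_1(x,y)-A\le d_2(f(x),f(y))\le C d_1(x,y)+A$ for all $x,y\in Y_1$ and the $B$-neighbourhood of the image of $f$ is all of $Y_2$. Two families of metric spaces with the same index set are quasi-isometric if there are quasi-isometries between the members with the same index, with constants $A,B,C$ independent of the index. Graphs are regarded as metric spaces (on their vertex sets) with the shortest-path metric. **Expander with respect to $X$.** A family $(G_i)_{i\in I}$ of finite graphs with uniformly bounded vertex degrees and unbounded cardinalities is an expander with respect to $X$ if there is a constant $\eta>0$ such that for every $i\in I$ and every function $f\colon G_i\to X$ (defined on vertices) $$\sum_{x\sim y}\|f(x)-f(y)\|_X^2\ \ge\ \frac{\eta}{\# G_i}\sum_{x,y\in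 G_i}\|f(x)-f(y)\|_X^2,$$ where the sums run over pairs of vertices of $G_i$, $x\sim y$ means that $x$ and $y$ are joined by an edge, and $\# G_i$ is the number of vertices. *)

theory Defs
  imports "HOL-Probability.Probability" "HOL-Algebra.Algebra" "HOL-Algebra.Algebraic_Closure_Type"
begin

section \<open>Compact metric measure spaces and group actions\<close>

definition geodesic_space :: "'y::metric_space itself \<Rightarrow> bool" where
  "geodesic_space _ \<longleftrightarrow>
     (\<forall>x y::'y. \<exists>\<gamma>::real \<Rightarrow> 'y. \<gamma> 0 = x \<and> \<gamma> (dist x y) = y \<and>
        (\<forall>s\<in>{0..dist x y}. \<forall>t\<in>{0..dist x y}. dist (\<gamma> s) (\<gamma> t) = \<bar>s - t\<bar>))"

definition ahlfors_regular :: "'y::metric_space measure \<Rightarrow> bool" where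
  "ahlfors_regular \<mu> \<longleftrightarrow>
     (\<exists>c>0. \<exists>m>0. \<exists>C\<ge>1. \<forall>y r. 0 < r \<and> r \<le> 2 * diameter (UNIV :: 'y set) \<longrightarrow>
        c * r powr m \<le> measure \<mu> (ball y r) \<and> measure \<mu> (ball y r) \<le> C * c * r powr m)"

definition acts_by_lipschitz_homeos ::
    "('g, 'r) monoid_scheme \<Rightarrow> ('g \<Rightarrow> 'y::metric_space \<Rightarrow> 'y) \<Rightarrow> bool" where
  "acts_by_lipschitz_homeos G \<phi> \<longleftrightarrow> group_action G UNIV \<phi> \<and>
     (\<forall>g\<in>carrier G. (\<exists>\<psi>. homeomorphism UNIV UNIV (\<phi> g) \<psi>) \<and> (\<exists>L. L-lipschitz_on UNIV (\<phi> g)))"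

definition preserves_measure ::
    "('g, 'r) monoid_scheme \<Rightarrow> ('g \<Rightarrow> 'y \<Rightarrow> 'y) \<Rightarrow> 'y measure \<Rightarrow> bool" where
  "preserves_measure G \<phi> \<mu> \<longleftrightarrow>
     (\<forall>g\<in>carrier G. \<phi> g \<in> measurable \<mu> \<mu> \<and> distr \<mu> \<mu> (\<phi> g) = \<mu>)"

definition ergodic_action ::
    "('g, 'r) monoid_scheme \<Rightarrow> ('g \<Rightarrow> 'y \<Rightarrow> 'y) \<Rightarrow> 'y measure \<Rightarrow> bool" where
  "ergodic_action G \<phi> \<mu> \<longleftrightarrow>
     (\<forall>A\<in>sets \<mu>. (\<forall>g\<in>carrier G. \<phi> g ` A = A) \<longrightarrow> measure \<mu> A = 0 \<or> measure \<mu> (space \<mu> - A) = 0)"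


section \<open>Warped cones\<close>

text \<open>The level \<open>tY\<close> is represented by the type of points of \<open>Y\<close>, the point \<open>ty\<close> by \<open>y\<close>.\<close>

definition warped_metric ::
    "('g \<Rightarrow> 'y::metric_space \<Rightarrow> 'y) \<Rightarrow> 'g set \<Rightarrow> real \<Rightarrow> ('y \<Rightarrow> 'y \<Rightarrow> real) \<Rightarrow> bool" where
  "warped_metric \<phi> S t D \<longleftrightarrow> Metric_space UNIV D \<and>
     (\<forall>x y. D x y \<le> t * dist x y) \<and> (\<forall>y. \<forall>s\<in>S. D y (\<phi> s y) \<le> 1)"

text \<open>The order on metrics is the pointwise one, and the largest one exists for \<open>t > 0\<close>;
  see \<open>warped_dist_metric\<close> and \<open>warped_dist_largest\<close> below.\<close>

definition warped_dist ::
    "('g \<Rightarrow> 'y::metric_space \<Rightarrow> 'y) \<Rightarrow> 'g set \<Rightarrow> real \<Rightarrow> 'y \<Rightarrow> 'y \<Rightarrow> real" where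
  "warped_dist \<phi> S t = (GREATEST D. warped_metric \<phi> S t D)"

lemma ex_largest_warped_metric:
  fixes \<phi> :: "'g \<Rightarrow> 'y::metric_space \<Rightarrow> 'y"
  assumes t: "t > 0"
  shows "\<exists>D. warped_metric \<phi> S t D \<and> (\<forall>D'. warped_metric \<phi> S t D' \<longrightarrow> D' \<le> D)"
proof -
  define F where "F = {D. warped_metric \<phi> S t D}"
  define D0 where "D0 = (\<lambda>x y::'y. min (t * dist x y) 1)"
  have "D0 \<in> F"
  proof -
    have "D0 x z \<le> D0 x y + D0 y z" for x y z
    proof -
      have "t * dist x z \<le> t * dist x y + t * dist y z"
        using t dist_triangle[of x z y] by (simp flip: distrib_left)
      moreover have "0 \<le> t * dist x y" "0 \<le> t * dist y z" using t by auto
      ultimately show ?thesis unfolding D0_def by linarith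
    qed
    moreover have "0 \<le> D0 x y" "D0 x y = D0 y x" "D0 x y = 0 \<longleftrightarrow> x = y" for x y
      using t by (auto simp: D0_def dist_commute min_def)
    ultimately have "Metric_space UNIV D0" by unfold_locales blast+
    then show ?thesis by (auto simp: F_def warped_metric_def D0_def)
  qed
  define D where "D = (\<lambda>x y. SUP D'\<in>F. D' x y)"
  have ne: "F \<noteq> {}" using \<open>D0 \<in> F\<close> by auto
  have bdd: "bdd_above ((\<lambda>D'. D' x y) ` F)" for x y
    by (rule bdd_aboveI2[where M = "t * dist x y"]) (auto simp: F_def warped_metric_def)
  have up: "D' x y \<le> D x y" if "D' \<in> F" for D' x y
    unfolding D_def using that bdd by (rule cSUP_upper)
  have least: "D x y \<le> c" if "\<And>D'. D' \<in> F \<Longrightarrow> D' x y \<le> c" for x y c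
    unfolding D_def using ne that by (rule cSUP_least)
  have ms: "Metric_space UNIV D'" if "D' \<in> F" for D'
    using that by (auto simp: F_def warped_metric_def)
  have "Metric_space UNIV D"
  proof
    fix x y z :: 'y
    show n: "0 \<le> D x y" for x y
      using up[OF \<open>D0 \<in> F\<close>, of x y] Metric_space.nonneg[OF ms[OF \<open>D0 \<in> F\<close>], of x y] by linarith
    show "D x y = D y x"
      unfolding D_def by (rule SUP_cong[OF refl]) (rule Metric_space.commute[OF ms])
    show "D x y = 0 \<longleftrightarrow> x = y"
    proof
      assume "D x y = 0"
      then have "D0 x y \<le> 0" using up[OF \<open>D0 \<in> F\<close>, of x y] by simp
      then show "x = y" using t by (auto simp: D0_def min_def mult_le_0_iff split: if_splits)
    next
      assume "x = y"
      have "D' x y \<le> 0" if "D' \<in> F" for D'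
        using Metric_space.zero[OF ms[OF that], of x y] \<open>x = y\<close> by simp
      then have "D x y \<le> 0" by (rule least)
      then show "D x y = 0" using n[of x y] by simp
    qed
    show "D x z \<le> D x y + D y z"
    proof (rule least)
      fix D' assume "D' \<in> F"
      then have "D' x z \<le> D' x y + D' y z" by (simp add: Metric_space.triangle[OF ms])
      then show "D' x z \<le> D x y + D y z" using up[OF \<open>D' \<in> F\<close>, of x y] up[OF \<open>D' \<in> F\<close>, of y z] by linarith
    qed
  qed
  moreover have "D x y \<le> t * dist x y" for x y
    by (rule least) (auto simp: F_def warped_metric_def)
  moreover have "D y (\<phi> s y) \<le> 1" if "s \<in> S" for s y
    by (rule least) (use that in \<open>auto simp: F_def warped_metric_def\<close>)
  ultimately have "warped_metric \<phi> S t D" by (auto simp: warped_metric_def)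
  moreover have "\<forall>D'. warped_metric \<phi> S t D' \<longrightarrow> D' \<le> D"
    using up by (auto simp: F_def le_fun_def)
  ultimately show ?thesis by blast
qed

lemma
  assumes "t > 0"
  shows warped_dist_metric: "warped_metric \<phi> S t (warped_dist \<phi> S t)"
    and warped_dist_largest: "warped_metric \<phi> S t D \<Longrightarrow> D x y \<le> warped_dist \<phi> S t x y"
proof -
  obtain D0 where D0: "warped_metric \<phi> S t D0" "\<And>D'. warped_metric \<phi> S t D' \<Longrightarrow> D' \<le> D0"
    using ex_largest_warped_metric[OF assms] by blast
  have "warped_dist \<phi> S t = D0"
    unfolding warped_dist_def by (rule Greatest_equality) (use D0 in auto)
  then show "warped_metric \<phi> S t (warped_dist \<phi> S t)"
    and "warped_metric \<phi> S t D \<Longrightarrow> D x y \<le> warped_dist \<phi> S t x y"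
    using D0 by (auto simp: le_fun_def)
qed


section \<open>Graphs, quasi-isometries, expanders\<close>

text \<open>Simple graphs with vertex set \<open>V\<close> and adjacency relation \<open>E\<close>; vertex sets may be infinite.\<close>

definition graph_on :: "'v set \<Rightarrow> ('v \<Rightarrow> 'v \<Rightarrow> bool) \<Rightarrow> bool" where
  "graph_on V E \<longleftrightarrow> (\<forall>x y. E x y \<longrightarrow> x \<in> V \<and> y \<in> V \<and> x \<noteq> y \<and> E y x)"

text \<open>The shortest-path distance is a (finite) metric only on connected graphs.\<close>

definition connected_graph_on :: "'v set \<Rightarrow> ('v \<Rightarrow> 'v \<Rightarrow> bool) \<Rightarrow> bool" where
  "connected_graph_on V E \<longleftrightarrow> graph_on V E \<and> (\<forall>x\<in>V. \<forall>y\<in>V. E\<^sup>*\<^sup>* x y)"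

definition path_dist :: "('v \<Rightarrow> 'v \<Rightarrow> bool) \<Rightarrow> 'v \<Rightarrow> 'v \<Rightarrow> real" where
  "path_dist E x y = real (LEAST n. (E ^^ n) x y)"

definition uniformly_bounded_degree ::
    "'i set \<Rightarrow> ('i \<Rightarrow> 'v set) \<Rightarrow> ('i \<Rightarrow> 'v \<Rightarrow> 'v \<Rightarrow> bool) \<Rightarrow> bool" where
  "uniformly_bounded_degree I V E \<longleftrightarrow>
     (\<exists>k. \<forall>i\<in>I. \<forall>x\<in>V i. finite {y. E i x y} \<and> card {y. E i x y} \<le> k)"

definition is_quasi_isometry ::
    "real \<Rightarrow> real \<Rightarrow> real \<Rightarrow> 'a set \<Rightarrow> ('a \<Rightarrow> 'a \<Rightarrow> real) \<Rightarrow> 'b set \<Rightarrow> ('b \<Rightarrow> 'b \<Rightarrow> real) \<Rightarrow>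
      ('a \<Rightarrow> 'b) \<Rightarrow> bool" where
  "is_quasi_isometry A B C Y\<^sub>1 d\<^sub>1 Y\<^sub>2 d\<^sub>2 f \<longleftrightarrow> f \<in> Y\<^sub>1 \<rightarrow> Y\<^sub>2 \<and>
     (\<forall>x\<in>Y\<^sub>1. \<forall>y\<in>Y\<^sub>1. d\<^sub>1 x y / C - A \<le> d\<^sub>2 (f x) (f y) \<and> d\<^sub>2 (f x) (f y) \<le> C * d\<^sub>1 x y + A) \<and>
     (\<forall>z\<in>Y\<^sub>2. \<exists>x\<in>Y\<^sub>1. d\<^sub>2 z (f x) < B)"

definition quasi_isometric_families ::
    "'i set \<Rightarrow> ('i \<Rightarrow> 'a set) \<Rightarrow> ('i \<Rightarrow> 'a \<Rightarrow> 'a \<Rightarrow> real) \<Rightarrow>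
      ('i \<Rightarrow> 'b set) \<Rightarrow> ('i \<Rightarrow> 'b \<Rightarrow> 'b \<Rightarrow> real) \<Rightarrow> bool" where
  "quasi_isometric_families I Y\<^sub>1 d\<^sub>1 Y\<^sub>2 d\<^sub>2 \<longleftrightarrow>
     (\<exists>A\<ge>0. \<exists>C\<ge>1. \<exists>B>0. \<forall>i\<in>I. \<exists>f. is_quasi_isometry A B C (Y\<^sub>1 i) (d\<^sub>1 i) (Y\<^sub>2 i) (d\<^sub>2 i) f)"

definition expander_wrt ::
    "'x::real_normed_vector itself \<Rightarrow> 'i set \<Rightarrow> ('i \<Rightarrow> 'v set) \<Rightarrow> ('i \<Rightarrow> 'v \<Rightarrow> 'v \<Rightarrow> bool) \<Rightarrow> bool" where
  "expander_wrt _ I V E \<longleftrightarrow>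
     (\<forall>i\<in>I. graph_on (V i) (E i) \<and> finite (V i)) \<and>
     uniformly_bounded_degree I V E \<and>
     (\<forall>N. \<exists>i\<in>I. card (V i) > N) \<and>
     (\<exists>\<eta>>0. \<forall>i\<in>I. \<forall>f :: 'v \<Rightarrow> 'x.
        (\<Sum>(x, y) \<in> {(x, y) \<in> V i \<times> V i. E i x y}. (norm (f x - f y))\<^sup>2)
          \<ge> \<eta> / real (card (V i)) * (\<Sum>(x, y) \<in> V i \<times> V i. (norm (f x - f y))\<^sup>2))"


section \<open>Rademacher type of Banach spaces given by a type class\<close>

definition signs :: "nat \<Rightarrow> (nat \<Rightarrow> 'k::ring_1) set" where
  "signs n = {..<n} \<rightarrow>\<^sub>E {-1, 1}"

definition rademacher_type :: "'x::real_normed_vector itself \<Rightarrow> real \<Rightarrow> real \<Rightarrow> bool" where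
  "rademacher_type _ p T \<longleftrightarrow>
     (\<forall>n (x :: nat \<Rightarrow> 'x).
        ((\<Sum>\<epsilon>\<in>signs n. norm (\<Sum>i<n. \<epsilon> i *\<^sub>R x i) powr p) / 2 ^ n) powr (1 / p)
          \<le> T * (\<Sum>i<n. norm (x i) powr p) powr (1 / p))"

definition nontrivial_type :: "'x::real_normed_vector itself \<Rightarrow> bool" where
  "nontrivial_type B \<longleftrightarrow> (\<exists>p>1. \<exists>T. rademacher_type B p T)"


section \<open>Complex Banach spaces with explicit carrier\<close>

text \<open>Classes of Banach spaces have to be quantified over, so here a Banach space is a record: a
  module in the sense of HOL-Algebra over the field of complex numbers, together with a norm. The
  fields \<open>mult\<close> and \<open>one\<close> inherited from rings are never used.\<close>

record 'u cnspace = "(complex, 'u) module" +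
  vnorm :: "'u \<Rightarrow> real"

definition complex_banach :: "'u cnspace \<Rightarrow> bool" where
  "complex_banach E \<longleftrightarrow>
     Module.module (ring_of_type_algebra :: complex ring) E \<and>
     (\<forall>x\<in>carrier E. vnorm E x \<ge> 0 \<and> (vnorm E x = 0 \<longleftrightarrow> x = \<zero>\<^bsub>E\<^esub>)) \<and>
     (\<forall>x\<in>carrier E. \<forall>y\<in>carrier E. vnorm E (x \<oplus>\<^bsub>E\<^esub> y) \<le> vnorm E x + vnorm E y) \<and>
     (\<forall>c. \<forall>x\<in>carrier E. vnorm E (c \<odot>\<^bsub>E\<^esub> x) = cmod c * vnorm E x) \<and>
     (\<forall>\<sigma> :: nat \<Rightarrow> 'u. range \<sigma> \<subseteq> carrier E \<and>
        (\<forall>e>0. \<exists>N. \<forall>m\<ge>N. \<forall>n\<ge>N. vnorm E (\<sigma> m \<ominus>\<^bsub>E\<^esub> \<sigma> n) < e) \<longrightarrow>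
        (\<exists>x\<in>carrier E. (\<lambda>n. vnorm E (\<sigma> n \<ominus>\<^bsub>E\<^esub> x)) \<longlonglongrightarrow> 0))"

definition cn_rademacher_type :: "'u cnspace \<Rightarrow> real \<Rightarrow> real \<Rightarrow> bool" where
  "cn_rademacher_type E p T \<longleftrightarrow>
     (\<forall>n. \<forall>x \<in> {..<n} \<rightarrow> carrier E.
        ((\<Sum>\<epsilon>\<in>signs n. vnorm E (\<Oplus>\<^bsub>E\<^esub>i\<in>{..<n}. \<epsilon> i \<odot>\<^bsub>E\<^esub> x i) powr p) / 2 ^ n) powr (1 / p)
          \<le> T * (\<Sum>i<n. vnorm E (x i) powr p) powr (1 / p))"

definition cn_linear :: "'u cnspace \<Rightarrow> 'w cnspace \<Rightarrow> ('u \<Rightarrow> 'w) \<Rightarrow> bool" where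
  "cn_linear E F f \<longleftrightarrow> f \<in> carrier E \<rightarrow> carrier F \<and>
     (\<forall>x\<in>carrier E. \<forall>y\<in>carrier E. f (x \<oplus>\<^bsub>E\<^esub> y) = f x \<oplus>\<^bsub>F\<^esub> f y) \<and>
     (\<forall>c. \<forall>x\<in>carrier E. f (c \<odot>\<^bsub>E\<^esub> x) = c \<odot>\<^bsub>F\<^esub> f x)"

definition cn_isometric :: "'u cnspace \<Rightarrow> 'w cnspace \<Rightarrow> bool" where
  "cn_isometric E F \<longleftrightarrow>
     (\<exists>f. cn_linear E F f \<and> bij_betw f (carrier E) (carrier F) \<and>
       (\<forall>x\<in>carrier E. vnorm F (f x) = vnorm E x))"

text \<open>Functionals are restricted to the carrier, so that equal functionals are equal as functions.\<close>

definition cn_dual :: "'u cnspace \<Rightarrow> ('u \<Rightarrow> complex) cnspace" where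
  "cn_dual E =
     \<lparr>carrier = {f \<in> extensional (carrier E).
        (\<forall>x\<in>carrier E. \<forall>y\<in>carrier E. f (x \<oplus>\<^bsub>E\<^esub> y) = f x + f y) \<and>
        (\<forall>c. \<forall>x\<in>carrier E. f (c \<odot>\<^bsub>E\<^esub> x) = c * f x) \<and>
        (\<exists>K. \<forall>x\<in>carrier E. cmod (f x) \<le> K * vnorm E x)},
      mult = undefined, one = undefined,
      ring.zero = (\<lambda>x\<in>carrier E. 0),
      ring.add = (\<lambda>f g. \<lambda>x\<in>carrier E. f x + g x),
      module.smult = (\<lambda>c f. \<lambda>x\<in>carrier E. c * f x),
      vnorm = (\<lambda>f. SUP x\<in>{x \<in> carrier E. vnorm E x \<le> 1}. cmod (f x))\<rparr>"

definition cn_conj :: "'u cnspace \<Rightarrow> 'u cnspace" where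
  "cn_conj E = E\<lparr>module.smult := (\<lambda>c x. cnj c \<odot>\<^bsub>E\<^esub> x)\<rparr>"

text \<open>A class of complex Banach spaces is a set of spaces whose points are taken from the universe
  \<open>'u\<close>. The dual of such a space has points in another type, whence stability under duality and
  conjugation is understood up to isometric isomorphism.\<close>

definition class_stable :: "'u cnspace set \<Rightarrow> bool" where
  "class_stable \<E> \<longleftrightarrow>
     (\<forall>E\<in>\<E>. (\<exists>F\<in>\<E>. cn_isometric (cn_dual E) F) \<and> (\<exists>F\<in>\<E>. cn_isometric (cn_conj E) F))"

definition class_type_gt_1 :: "'u cnspace set \<Rightarrow> bool" where
  "class_type_gt_1 \<E> \<longleftrightarrow> (\<exists>p>1. \<exists>T. \<forall>E\<in>\<E>. cn_rademacher_type E p T)"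


section \<open>Banach property (T)\<close>

definition isometric_rep ::
    "('g, 'r) monoid_scheme \<Rightarrow> 'u cnspace \<Rightarrow> ('g \<Rightarrow> 'u \<Rightarrow> 'u) \<Rightarrow> bool" where
  "isometric_rep G E \<pi> \<longleftrightarrow> group_action G (carrier E) \<pi> \<and>
     (\<forall>g\<in>carrier G. cn_linear E E (\<pi> g) \<and> (\<forall>x\<in>carrier E. vnorm E (\<pi> g x) = vnorm E x))"

definition invariant_vectors ::
    "('g, 'r) monoid_scheme \<Rightarrow> 'u cnspace \<Rightarrow> ('g \<Rightarrow> 'u \<Rightarrow> 'u) \<Rightarrow> 'u set" where
  "invariant_vectors G E \<pi> = {x \<in> carrier E. \<forall>g\<in>carrier G. \<pi> g x = x}"

abbreviation supp :: "('g \<Rightarrow> complex) \<Rightarrow> 'g set" where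
  "supp f \<equiv> {g. f g \<noteq> 0}"

definition group_algebra :: "('g, 'r) monoid_scheme \<Rightarrow> ('g \<Rightarrow> complex) ring" where
  "group_algebra G =
     \<lparr>carrier = {f. finite (supp f) \<and> supp f \<subseteq> carrier G},
      mult = (\<lambda>f h g. if g \<in> carrier G then \<Sum>a\<in>supp f. f a * h (inv\<^bsub>G\<^esub> a \<otimes>\<^bsub>G\<^esub> g) else 0),
      one = (\<lambda>g. if g = \<one>\<^bsub>G\<^esub> then 1 else 0),
      ring.zero = (\<lambda>g. 0),
      ring.add = (\<lambda>f h g. f g + h g)\<rparr>"

definition rep_op ::
    "'u cnspace \<Rightarrow> ('g \<Rightarrow> 'u \<Rightarrow> 'u) \<Rightarrow> ('g \<Rightarrow> complex) \<Rightarrow> 'u \<Rightarrow> 'u" where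
  "rep_op E \<pi> f x = (\<Oplus>\<^bsub>E\<^esub>g\<in>supp f. f g \<odot>\<^bsub>E\<^esub> \<pi> g x)"

definition op_norm :: "'u cnspace \<Rightarrow> ('u \<Rightarrow> 'u) \<Rightarrow> real" where
  "op_norm E A = (SUP x\<in>{x \<in> carrier E. vnorm E x \<le> 1}. vnorm E (A x))"

text \<open>Inserting \<open>0\<close> only matters for the empty class. The set is bounded above by the \<open>\<ell>\<^sup>1\<close>-norm
  of \<open>f\<close>.\<close>

definition class_norm ::
    "('g, 'r) monoid_scheme \<Rightarrow> 'u cnspace set \<Rightarrow> ('g \<Rightarrow> complex) \<Rightarrow> real" where
  "class_norm G \<E> f =
     Sup (insert 0 {op_norm E (rep_op E \<pi> f) | E \<pi>. E \<in> \<E> \<and> isometric_rep G E \<pi>})"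

text \<open>The completion \<open>C\<^sub>\<E>(\<Gamma>)\<close> of the group algebra: Cauchy sequences modulo null sequences.\<close>

definition cauchy_ring ::
    "('g, 'r) monoid_scheme \<Rightarrow> 'u cnspace set \<Rightarrow> (nat \<Rightarrow> 'g \<Rightarrow> complex) ring" where
  "cauchy_ring G \<E> =
     \<lparr>carrier = {u. range u \<subseteq> carrier (group_algebra G) \<and>
        (\<forall>e>0. \<exists>N. \<forall>m\<ge>N. \<forall>n\<ge>N. class_norm G \<E> (\<lambda>g. u m g - u n g) < e)},
      mult = (\<lambda>u v n. u n \<otimes>\<^bsub>group_algebra G\<^esub> v n),
      one = (\<lambda>n. \<one>\<^bsub>group_algebra G\<^esub>),
      ring.zero = (\<lambda>n. \<zero>\<^bsub>group_algebra G\<^esub>),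
      ring.add = (\<lambda>u v n. u n \<oplus>\<^bsub>group_algebra G\<^esub> v n)\<rparr>"

definition null_ideal ::
    "('g, 'r) monoid_scheme \<Rightarrow> 'u cnspace set \<Rightarrow> (nat \<Rightarrow> 'g \<Rightarrow> complex) set" where
  "null_ideal G \<E> = {u \<in> carrier (cauchy_ring G \<E>). (\<lambda>n. class_norm G \<E> (u n)) \<longlonglongrightarrow> 0}"

definition class_algebra ::
    "('g, 'r) monoid_scheme \<Rightarrow> 'u cnspace set \<Rightarrow> (nat \<Rightarrow> 'g \<Rightarrow> complex) set ring" where
  "class_algebra G \<E> = cauchy_ring G \<E> Quot null_ideal G \<E>"

text \<open>Extension of \<open>\<pi>\<close> from the group algebra to the completion by continuity.\<close>

definition class_rep_op ::
    "'u cnspace \<Rightarrow> ('g \<Rightarrow> 'u \<Rightarrow> 'u) \<Rightarrow> (nat \<Rightarrow> 'g \<Rightarrow> complex) set \<Rightarrow> 'u \<Rightarrow> 'u" where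
  "class_rep_op E \<pi> P x =
     (THE y. y \<in> carrier E \<and> (\<forall>u\<in>P. (\<lambda>n. vnorm E (rep_op E \<pi> (u n) x \<ominus>\<^bsub>E\<^esub> y)) \<longlonglongrightarrow> 0))"

definition projection_onto :: "'u cnspace \<Rightarrow> ('u \<Rightarrow> 'u) \<Rightarrow> 'u set \<Rightarrow> bool" where
  "projection_onto E A W \<longleftrightarrow>
     cn_linear E E A \<and> A ` carrier E = W \<and> (\<forall>x\<in>carrier E. A (A x) = A x)"

text \<open>The property relative to the universe \<open>'u\<close>. As the classes over \<open>'u\<close> are among all classes
  of Banach spaces, the unrestricted property implies the one for each \<open>'u\<close>. Over a finite
  universe it would be vacuous (only zero spaces exist); over one with at least continuum many
  elements every separable Banach space is represented.\<close>

definition banach_property_T :: "'u itself \<Rightarrow> ('g, 'r) monoid_scheme \<Rightarrow> bool" where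
  "banach_property_T _ G \<longleftrightarrow>
     (\<forall>\<E> :: 'u cnspace set.
        (\<forall>E\<in>\<E>. complex_banach E) \<and> class_type_gt_1 \<E> \<and> class_stable \<E> \<longrightarrow>
        (\<exists>p\<in>carrier (class_algebra G \<E>).
           p \<otimes>\<^bsub>class_algebra G \<E>\<^esub> p = p \<and>
           (\<forall>E\<in>\<E>. \<forall>\<pi>. isometric_rep G E \<pi> \<longrightarrow>
              projection_onto E (class_rep_op E \<pi> p) (invariant_vectors G E \<pi>))))"

end

theory Submission
  imports Defs "HOL-Library.Function_Algebras"
begin

text \<open>The proof has an analytic half, a spectral gap for the action on \<open>Y\<close> that
  holds for functions with values in \<open>X\<close>, and a geometric half, which carries the
  resulting Poincare inequality from \<open>Y\<close> over to the graphs.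

  Spectral gap (\<open>spectral_gap\<close>). There is a constant \<open>\<kappa>\<close>
  such that every simple function \<open>g : Y \<rightarrow> X\<close> is, up to the factor
  \<open>\<kappa>\<close>, as close to a constant in mean square as its mean square displacements
  under the generators allow. A simple function takes values in a finite-dimensional subspace
  \<open>F\<close> of \<open>X\<close>, and \<open>L\<^sup>2(Y; F)\<close> is a Hilbert space with
  an equivalent norm. The constants of equivalence depend on \<open>F\<close>, so a uniform
  \<open>\<kappa>\<close> has to come from Banach property (T), applied to one class of spaces that
  contains (the complexifications of) all these \<open>L\<^sup>2(Y; F)\<close>. That class must be
  of type \<open>> 1\<close> and stable under duality. It is taken to be
  \<open>hilbert_class C \<beta>\<close>: the complex Hilbert spaces with an equivalent norm for
  which the second moment of a Rademacher sum of \<open>n\<close> vectors is at most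
  \<open>C n\<^sup>\<beta>\<close> times the sum of their squared norms, where
  \<open>\<beta> < 1\<close>, the same being required of the dual norm. Five facts make this
  work.

  (1) Growth with \<open>\<beta> < 1\<close> implies type \<open>p > 1\<close> with a
  constant that depends on \<open>C\<close> and \<open>\<beta>\<close> only
  (\<open>signed_powr_sum_le\<close>). (2) If \<open>X\<close> has type \<open>> 1\<close>, then for
  each \<open>q > 0\<close> the second moment is at most \<open>q n\<close> times the sum of squares
  for large \<open>n\<close> (\<open>rad_bound_of_type\<close>), and by Fubini
  \<open>L\<^sup>2(Y; F)\<close> inherits this (\<open>L2_span_norm_rad_bound\<close>). (3) For
  \<open>q < 1\<close> one such inequality improves itself to growth with some
  \<open>\<beta> < 1\<close>, because the optimal factors are submultiplicative in the number of
  vectors (\<open>rad_bound_mult\<close>, \<open>rad_growth_of_bound\<close>). (4) The inequality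
  passes to the dual norm with the same \<open>q\<close> if \<open>n\<close> is replaced by
  \<open>2\<^sup>n\<close> (\<open>rad_bound_dual\<close>). (5) The norms are equivalent to a
  Hilbert norm, so the bidual norm is the original one (\<open>bidual\<close>), and the class is
  stable under duality.

  Property (T) gives an idempotent in the completed group algebra. It is approximated,
  uniformly over the class, by one finitely supported function \<open>f\<close>. On functions of
  mean zero \<open>f\<close> acts with norm at most \<open>1/4\<close>, since by ergodicity no such
  function other than zero is invariant, and the constant functions show that the total mass of
  \<open>f\<close> is within \<open>1/4\<close> of \<open>1\<close>. So a function of mean zero is
  controlled by its displacements under the finitely many elements of the support of
  \<open>f\<close> (\<open>gap_of_approximation\<close>), hence by those under the generators
  (\<open>property_T_gap\<close>). The carriers of all spaces in the class must be sets of elements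
  of one type, which is why classes of square integrable functions are coded by real numbers
  (\<open>L2_code_exists\<close>).

  Transfer (\<open>Poincare_transfer\<close>). Let \<open>q : V \<rightarrow> tY\<close>
  be a quasi-isometry, and cover \<open>Y\<close> by the warped balls \<open>U v\<close> of radius
  \<open>B\<close> around the points \<open>q v\<close>. A function \<open>f\<close> on
  \<open>V\<close> becomes a simple function on \<open>Y\<close> by a measurable choice of a vertex
  \<open>v\<close> with \<open>y \<in> U v\<close>. Points at warped distance at most
  \<open>1\<close> get vertices at bounded graph distance, so the displacement of the function on
  \<open>Y\<close> is bounded by the energy of \<open>f\<close>. The sets \<open>U v\<close> overlap
  boundedly and have comparable measures: a warped ball contains a ball of radius \<open>B/t\<close>
  and is covered by a bounded number of balls whose radius is a constant multiple of that
  (\<open>warped_ball_measure\<close>). Therefore the variance of \<open>f\<close> is bounded by its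
  energy and the variance of the function on \<open>Y\<close>. This applies once the radii are at
  most \<open>2 diam Y\<close>, that is for \<open>t\<close> beyond a threshold; below it the
  connected graphs have boundedly many vertices and the inequality is elementary. The numbers of
  vertices are unbounded because the measures of the sets \<open>U v\<close>, which cover
  \<open>Y\<close>, tend to zero as \<open>t\<close> grows.\<close>

section \<open>Rademacher averages in a seminormed space\<close>

text \<open>Function types become real vector spaces pointwise, so that spaces of functions can be
  treated as subspaces.\<close>

instantiation "fun" :: (type, real_vector) real_vector
begin
definition scaleR_fun_def: "a *\<^sub>R f = (\<lambda>x. a *\<^sub>R f x)" for f :: "'a \<Rightarrow> 'b"
instance
  by standard (auto simp: scaleR_fun_def fun_eq_iff scaleR_add_right scaleR_add_left)
end

definition seminorm_on :: "'a::real_vector set \<Rightarrow> ('a \<Rightarrow> real) \<Rightarrow> bool" where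
  "seminorm_on H N \<longleftrightarrow> subspace H \<and> (\<forall>x\<in>H. 0 \<le> N x) \<and>
     (\<forall>x\<in>H. \<forall>y\<in>H. N (x + y) \<le> N x + N y) \<and> (\<forall>a. \<forall>x\<in>H. N (a *\<^sub>R x) = \<bar>a\<bar> * N x)"

lemma
  assumes "seminorm_on H N"
  shows seminorm_on_subspace: "subspace H"
    and seminorm_on_nonneg: "x \<in> H \<Longrightarrow> 0 \<le> N x"
    and seminorm_on_triangle: "x \<in> H \<Longrightarrow> y \<in> H \<Longrightarrow> N (x + y) \<le> N x + N y"
    and seminorm_on_scale: "x \<in> H \<Longrightarrow> N (a *\<^sub>R x) = \<bar>a\<bar> * N x"
  using assms by (auto simp: seminorm_on_def)

lemma seminorm_on_zero: "seminorm_on H N \<Longrightarrow> N 0 = 0"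
  using seminorm_on_scale[of H N 0 0] seminorm_on_subspace[of H N] by (auto simp: subspace_def)

lemma seminorm_on_minus: "seminorm_on H N \<Longrightarrow> x \<in> H \<Longrightarrow> N (- x) = N x"
  using seminorm_on_scale[of H N x "-1"] by simp

lemma seminorm_on_sum:
  assumes "seminorm_on H N" "finite A" "\<And>a. a \<in> A \<Longrightarrow> x a \<in> H"
  shows "N (\<Sum>a\<in>A. x a) \<le> (\<Sum>a\<in>A. N (x a))"
  using assms(2,3)
proof (induction A rule: finite_induct)
  case empty
  then show ?case by (simp add: seminorm_on_zero[OF assms(1)])
next
  case (insert a A)
  have "(\<Sum>a\<in>A. x a) \<in> H"
    by (rule subspace_sum[OF seminorm_on_subspace[OF assms(1)]]) (use insert in auto)
  with insert show ?case
    using seminorm_on_triangle[OF assms(1), of "x a" "\<Sum>a\<in>A. x a"] by fastforce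
qed

text \<open>The elements are undefined outside \<open>A\<close>, so that there are exactly
  \<open>2\<close> to the power \<open>card A\<close> of them.\<close>

definition sg :: "'i set \<Rightarrow> ('i \<Rightarrow> real) set" where
  "sg A = A \<rightarrow>\<^sub>E {-1, 1}"

lemma finite_sg: "finite A \<Longrightarrow> finite (sg A)"
  by (simp add: sg_def finite_PiE)

lemma card_sg: "finite A \<Longrightarrow> card (sg A) = 2 ^ card A"
  by (simp add: sg_def card_PiE numeral_2_eq_2[symmetric])

lemma sg_values: "\<epsilon> \<in> sg A \<Longrightarrow> a \<in> A \<Longrightarrow> \<epsilon> a = -1 \<or> \<epsilon> a = 1"
  by (auto simp: sg_def)

lemma sum_sg_insert:
  assumes "finite A" "a \<notin> A"
  shows "(\<Sum>\<epsilon>\<in>sg (insert a A). F \<epsilon>) = (\<Sum>\<epsilon>\<in>sg A. F (\<epsilon>(a := 1)) + F (\<epsilon>(a := -1)))"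
proof -
  have "(\<Sum>\<epsilon>\<in>sg (insert a A). F \<epsilon>) =
      (\<Sum>p\<in>{-1, 1} \<times> sg A. F ((\<lambda>(y, g). g(a := y)) p))"
    unfolding sg_def PiE_insert_eq
    by (rule sum.reindex[unfolded o_def]) (use assms inj_combinator[of a A "\<lambda>_. {-1, 1}"] in auto)
  also have "\<dots> = (\<Sum>y\<in>{-1, 1}. \<Sum>\<epsilon>\<in>sg A. F (\<epsilon>(a := y)))"
    by (subst sum.cartesian_product) (simp add: case_prod_beta)
  also have "\<dots> = (\<Sum>\<epsilon>\<in>sg A. F (\<epsilon>(a := 1)) + F (\<epsilon>(a := -1)))"
    by (simp add: sum.distrib add.commute)
  finally show ?thesis .
qed

text \<open>Multiplication by a fixed choice of signs permutes the choices of signs.\<close>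

lemma sum_sg_flip:
  assumes "\<sigma> \<in> A \<rightarrow> {-1, 1::real}"
  shows "(\<Sum>\<epsilon>\<in>sg A. F (\<lambda>a\<in>A. \<sigma> a * \<epsilon> a)) = (\<Sum>\<epsilon>\<in>sg A. F \<epsilon>)"
proof (rule sum.reindex_bij_witness[where i = "\<lambda>\<epsilon>. \<lambda>a\<in>A. \<sigma> a * \<epsilon> a" and j = "\<lambda>\<epsilon>. \<lambda>a\<in>A. \<sigma> a * \<epsilon> a"])
  have s: "\<sigma> a = -1 \<or> \<sigma> a = 1" if "a \<in> A" for a using assms that by auto
  fix \<epsilon> assume e: "\<epsilon> \<in> sg A"
  have v: "\<epsilon> a = -1 \<or> \<epsilon> a = 1" if "a \<in> A" for a using sg_values[OF e that] .
  have m: "(\<lambda>a\<in>A. \<sigma> a * \<epsilon> a) \<in> sg A"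
    unfolding sg_def
  proof (rule restrict_PiE_iff[THEN iffD2], rule ballI)
    fix a assume "a \<in> A"
    with s[of a] v[of a] show "\<sigma> a * \<epsilon> a \<in> {-1, 1}" by auto
  qed
  then show "(\<lambda>a\<in>A. \<sigma> a * \<epsilon> a) \<in> sg A" "(\<lambda>a\<in>A. \<sigma> a * \<epsilon> a) \<in> sg A" by auto
  have "(\<lambda>a\<in>A. \<sigma> a * (\<lambda>a\<in>A. \<sigma> a * \<epsilon> a) a) = \<epsilon>"
  proof
    fix a
    show "(\<lambda>a\<in>A. \<sigma> a * (\<lambda>a\<in>A. \<sigma> a * \<epsilon> a) a) a = \<epsilon> a"
      using s[of a] e by (cases "a \<in> A") (auto simp: sg_def PiE_def extensional_def)
  qed
  then show "(\<lambda>a\<in>A. \<sigma> a * (\<lambda>a\<in>A. \<sigma> a * \<epsilon> a) a) = \<epsilon>"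
      "(\<lambda>a\<in>A. \<sigma> a * (\<lambda>a\<in>A. \<sigma> a * \<epsilon> a) a) = \<epsilon>" by auto
qed auto

text \<open>The second moment of a Rademacher sum.\<close>

definition rad :: "('a::real_vector \<Rightarrow> real) \<Rightarrow> 'i set \<Rightarrow> ('i \<Rightarrow> 'a) \<Rightarrow> real" where
  "rad N A x = (\<Sum>\<epsilon>\<in>sg A. (N (\<Sum>a\<in>A. \<epsilon> a *\<^sub>R x a))\<^sup>2) / 2 ^ card A"

lemma rad_cong: "(\<And>a. a \<in> A \<Longrightarrow> x a = y a) \<Longrightarrow> rad N A x = rad N A y"
  by (simp add: rad_def cong: sum.cong)

lemma rad_flip:
  assumes "\<sigma> \<in> A \<rightarrow> {-1, 1::real}"
  shows "rad N A (\<lambda>a. \<sigma> a *\<^sub>R x a) = rad N A x"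
proof -
  have "(\<Sum>\<epsilon>\<in>sg A. (N (\<Sum>a\<in>A. \<epsilon> a *\<^sub>R \<sigma> a *\<^sub>R x a))\<^sup>2) =
      (\<Sum>\<epsilon>\<in>sg A. (N (\<Sum>a\<in>A. (\<lambda>a\<in>A. \<sigma> a * \<epsilon> a) a *\<^sub>R x a))\<^sup>2)"
    by (intro sum.cong refl arg_cong[where f = "\<lambda>v. (N v)\<^sup>2"]) (simp add: mult.commute)
  also have "\<dots> = (\<Sum>\<epsilon>\<in>sg A. (N (\<Sum>a\<in>A. \<epsilon> a *\<^sub>R x a))\<^sup>2)"
    by (rule sum_sg_flip[OF assms, of "\<lambda>\<epsilon>. (N (\<Sum>a\<in>A. \<epsilon> a *\<^sub>R x a))\<^sup>2"])
  finally show ?thesis by (simp add: rad_def)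
qed

text \<open>Signs that do not occur in the sum average out.\<close>

lemma rad_restrict:
  assumes "finite A" "B \<subseteq> A"
  shows "(\<Sum>\<epsilon>\<in>sg A. (N (\<Sum>a\<in>B. \<epsilon> a *\<^sub>R x a))\<^sup>2) / 2 ^ card A = rad N B x"
proof -
  have fB: "finite B" using assms finite_subset by auto
  have "(\<Sum>\<epsilon>\<in>sg (B \<union> C). (N (\<Sum>a\<in>B. \<epsilon> a *\<^sub>R x a))\<^sup>2) / 2 ^ card (B \<union> C) = rad N B x"
    if "finite C" "B \<inter> C = {}" for C
    using that
  proof (induction C rule: finite_induct)
    case empty
    then show ?case by (simp add: rad_def)
  next
    case (insert c C)
    have c: "c \<notin> B \<union> C" using insert by auto
    have e: "(\<Sum>a\<in>B. (\<epsilon>(c := y)) a *\<^sub>R x a) = (\<Sum>a\<in>B. \<epsilon> a *\<^sub>R x a)" for \<epsilon> and y :: real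
      by (rule sum.cong) (use c in auto)
    have "(\<Sum>\<epsilon>\<in>sg (B \<union> insert c C). (N (\<Sum>a\<in>B. \<epsilon> a *\<^sub>R x a))\<^sup>2) =
        2 * (\<Sum>\<epsilon>\<in>sg (B \<union> C). (N (\<Sum>a\<in>B. \<epsilon> a *\<^sub>R x a))\<^sup>2)"
      using sum_sg_insert[OF _ c, of "\<lambda>\<epsilon>. (N (\<Sum>a\<in>B. \<epsilon> a *\<^sub>R x a))\<^sup>2"] fB insert
      by (simp only: e Un_insert_right) (simp add: sum.distrib sum_distrib_left)
    moreover have "card (B \<union> insert c C) = Suc (card (B \<union> C))" using c fB insert by simp
    ultimately show ?case using insert by (simp add: field_simps)
  qed
  from this[of "A - B"] assms show ?thesis by (auto simp: Un_absorb1)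
qed

lemma rad_reindex:
  assumes "bij_betw h A B"
  shows "rad N B x = rad N A (\<lambda>a. x (h a))"
proof -
  define g where "g = inv_into A h"
  have g: "g b \<in> A" "h (g b) = b" if "b \<in> B" for b
    using that assms unfolding g_def
    by (auto simp: bij_betw_def inv_into_into f_inv_into_f)
  have h: "h a \<in> B" "g (h a) = a" if "a \<in> A" for a
    using that assms unfolding g_def by (auto simp: bij_betw_def)
  have "(\<Sum>\<epsilon>\<in>sg B. (N (\<Sum>b\<in>B. \<epsilon> b *\<^sub>R x b))\<^sup>2) =
      (\<Sum>\<epsilon>\<in>sg A. (N (\<Sum>a\<in>A. \<epsilon> a *\<^sub>R x (h a)))\<^sup>2)"
  proof (rule sum.reindex_bij_witness[where j = "\<lambda>\<epsilon>. \<lambda>a\<in>A. \<epsilon> (h a)" and i = "\<lambda>\<epsilon>. \<lambda>b\<in>B. \<epsilon> (g b)"])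
    fix \<epsilon> assume e: "\<epsilon> \<in> sg B"
    show "(\<lambda>b\<in>B. (\<lambda>a\<in>A. \<epsilon> (h a)) (g b)) = \<epsilon>"
      using e g by (auto simp: sg_def fun_eq_iff PiE_def extensional_def)
    show "(\<lambda>a\<in>A. \<epsilon> (h a)) \<in> sg A" using e h by (auto simp: sg_def)
    have "(\<Sum>a\<in>A. (\<lambda>a\<in>A. \<epsilon> (h a)) a *\<^sub>R x (h a)) = (\<Sum>a\<in>A. \<epsilon> (h a) *\<^sub>R x (h a))"
      by (rule sum.cong) auto
    also have "\<dots> = (\<Sum>b\<in>B. \<epsilon> b *\<^sub>R x b)" by (rule sum.reindex_bij_betw[OF assms])
    finally show "(N (\<Sum>a\<in>A. (\<lambda>a\<in>A. \<epsilon> (h a)) a *\<^sub>R x (h a)))\<^sup>2 = (N (\<Sum>b\<in>B. \<epsilon> b *\<^sub>R x b))\<^sup>2" by simp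
  next
    fix \<epsilon> assume e: "\<epsilon> \<in> sg A"
    show "(\<lambda>a\<in>A. (\<lambda>b\<in>B. \<epsilon> (g b)) (h a)) = \<epsilon>"
      using e h by (auto simp: sg_def fun_eq_iff PiE_def extensional_def)
    show "(\<lambda>b\<in>B. \<epsilon> (g b)) \<in> sg B" using e g by (auto simp: sg_def)
  qed
  then show ?thesis using bij_betw_same_card[OF assms] by (simp add: rad_def)
qed

lemma signed_sum_in:
  assumes "subspace H" "\<And>a. a \<in> A \<Longrightarrow> x a \<in> H"
  shows "(\<Sum>a\<in>A. (\<epsilon> a :: real) *\<^sub>R x a) \<in> H"
  by (intro subspace_sum[OF assms(1)] subspace_scale[OF assms(1)] assms(2))

lemma seminorm_signed_sum:
  assumes "seminorm_on H N" "finite A" "\<And>a. a \<in> A \<Longrightarrow> x a \<in> H" "\<And>a. a \<in> A \<Longrightarrow> \<bar>\<epsilon> a :: real\<bar> \<le> 1"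
  shows "N (\<Sum>a\<in>A. \<epsilon> a *\<^sub>R x a) \<le> (\<Sum>a\<in>A. N (x a))"
proof -
  have "N (\<Sum>a\<in>A. \<epsilon> a *\<^sub>R x a) \<le> (\<Sum>a\<in>A. N (\<epsilon> a *\<^sub>R x a))"
    by (rule seminorm_on_sum[OF assms(1,2)])
       (use assms(3) seminorm_on_subspace[OF assms(1)] in \<open>auto intro: subspace_scale\<close>)
  also have "\<dots> \<le> (\<Sum>a\<in>A. N (x a))"
  proof (rule sum_mono)
    fix a assume a: "a \<in> A"
    show "N (\<epsilon> a *\<^sub>R x a) \<le> N (x a)"
      using seminorm_on_scale[OF assms(1) assms(3)[OF a], of "\<epsilon> a"] assms(4)[OF a]
        seminorm_on_nonneg[OF assms(1) assms(3)[OF a]] mult_right_mono[of "\<bar>\<epsilon> a\<bar>" 1 "N (x a)"] by simp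
  qed
  finally show ?thesis .
qed

definition rad_bound :: "('a::real_vector \<Rightarrow> real) \<Rightarrow> 'a set \<Rightarrow> nat \<Rightarrow> real \<Rightarrow> bool" where
  "rad_bound N H n c \<longleftrightarrow>
     (\<forall>x\<in>{..<n} \<rightarrow> H. rad N {..<n} x \<le> c * (\<Sum>i<n. (N (x i))\<^sup>2))"

text \<open>A shorter family is extended by zero vectors.\<close>

lemma rad_bound_finite:
  assumes N: "seminorm_on H N" and b: "rad_bound N H n c" and A: "finite A" "card A \<le> n"
    and x: "\<And>a. a \<in> A \<Longrightarrow> x a \<in> H"
  shows "rad N A x \<le> c * (\<Sum>a\<in>A. (N (x a))\<^sup>2)"
proof -
  obtain h where h: "bij_betw h {..<card A} A"
    using A(1) ex_bij_betw_nat_finite[of A] by (auto simp: atLeast0LessThan)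
  define y where "y = (\<lambda>i. if i < card A then x (h i) else 0)"
  have z: "(0::'a) \<in> H" using seminorm_on_subspace[OF N] by (simp add: subspace_def)
  have y: "y \<in> {..<n} \<rightarrow> H"
    using bij_betwE[OF h] x z by (auto simp: y_def)
  have sub: "{..<card A} \<subseteq> {..<n}" using A by auto
  have "rad N A x = rad N {..<card A} y"
    by (subst rad_reindex[OF h]) (rule rad_cong, simp add: y_def)
  also have "\<dots> = (\<Sum>\<epsilon>\<in>sg {..<n}. (N (\<Sum>a\<in>{..<card A}. \<epsilon> a *\<^sub>R y a))\<^sup>2) / 2 ^ card {..<n}"
    by (rule rad_restrict[symmetric]) (use A in auto)
  also have "\<dots> = rad N {..<n} y"
    unfolding rad_def
    by (intro arg_cong2[where f = "(/)"] sum.cong refl arg_cong[where f = "\<lambda>v. (N v)\<^sup>2"]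
        sum.mono_neutral_left) (use A in \<open>auto simp: y_def\<close>)
  also have "\<dots> \<le> c * (\<Sum>i<n. (N (y i))\<^sup>2)"
    using b y by (auto simp: rad_bound_def)
  also have "(\<Sum>i<n. (N (y i))\<^sup>2) = (\<Sum>i<card A. (N (y i))\<^sup>2)"
    by (rule sum.mono_neutral_right) (use A in \<open>auto simp: y_def seminorm_on_zero[OF N]\<close>)
  also have "\<dots> = (\<Sum>i<card A. (N (x (h i)))\<^sup>2)" by (simp add: y_def)
  also have "\<dots> = (\<Sum>a\<in>A. (N (x a))\<^sup>2)"
    by (rule sum.reindex_bij_betw[OF h, of "\<lambda>a. (N (x a))\<^sup>2"])
  finally show ?thesis .
qed

text \<open>Split \<open>n * m\<close> vectors into \<open>n\<close> blocks of \<open>m\<close>. The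
  average does not change when all vectors of a block are multiplied by one more random sign. For
  fixed original signs, the bound for \<open>n\<close> vectors applies to the block sums; the bound
  for \<open>m\<close> vectors then applies in each block.\<close>

lemma rad_bound_mult:
  assumes N: "seminorm_on H N" and n: "rad_bound N H n c" and m: "rad_bound N H m d" and c: "0 \<le> c"
  shows "rad_bound N H (n * m) (c * d)"
  unfolding rad_bound_def
proof (intro ballI)
  fix x assume x: "x \<in> {..<n * m} \<rightarrow> H"
  show "rad N {..<n * m} x \<le> c * d * (\<Sum>i<n * m. (N (x i))\<^sup>2)"
  proof (cases "m = 0")
    case True
    then show ?thesis using seminorm_on_zero[OF N] by (simp add: rad_def)
  next
    case False
    define A where "A = {..<n * m}"
    define B where "B i = {a \<in> A. a div m = i}" for i
    have sH: "subspace H" by (rule seminorm_on_subspace[OF N])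
    have fA: "finite A" by (simp add: A_def)
    have fB: "finite (B i)" "B i \<subseteq> A" for i by (auto simp: B_def fA)
    have xA: "x a \<in> H" if "a \<in> A" for a using x that by (auto simp: A_def)
    have cardB: "card (B i) \<le> m" for i
    proof -
      have "B i \<subseteq> {i * m..<i * m + m}"
      proof
        fix a assume "a \<in> B i"
        then have "a div m = i" by (simp add: B_def)
        moreover have "a = a div m * m + a mod m" "a mod m < m" using False by simp_all
        ultimately show "a \<in> {i * m..<i * m + m}" by (metis atLeastLessThan_iff le_add1 nat_add_left_cancel_less)
      qed
      from card_mono[OF _ this] show ?thesis by simp
    qed
    have dv: "a div m < n" if "a \<in> A" for a
      using that False by (simp add: A_def less_mult_imp_div_less)
    have part: "(\<Sum>a\<in>A. f a) = (\<Sum>i<n. \<Sum>a\<in>B i. f a)" for f :: "nat \<Rightarrow> 'a"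
      unfolding B_def by (rule sum.group[symmetric]) (use fA dv in auto)
    have part': "(\<Sum>a\<in>A. f a) = (\<Sum>i<n. \<Sum>a\<in>B i. f a)" for f :: "nat \<Rightarrow> real"
      unfolding B_def by (rule sum.group[symmetric]) (use fA dv in auto)
    define S where "S i \<epsilon> = (\<Sum>a\<in>B i. \<epsilon> a *\<^sub>R x a)" for i and \<epsilon> :: "nat \<Rightarrow> real"
    have SH: "S i \<epsilon> \<in> H" for i \<epsilon>
      unfolding S_def by (rule signed_sum_in[OF sH]) (use fB xA in auto)
    \<comment> \<open>The sign \<open>\<delta> i\<close> multiplies the whole block
      \<open>i\<close>.\<close>
    have one: "rad N A x = (\<Sum>\<epsilon>\<in>sg A. (N (\<Sum>i<n. \<delta> i *\<^sub>R S i \<epsilon>))\<^sup>2) / 2 ^ card A" if "\<delta> \<in> sg {..<n}" for \<delta>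
    proof -
      have "rad N A x = rad N A (\<lambda>a. \<delta> (a div m) *\<^sub>R x a)"
        by (rule rad_flip[symmetric]) (use that dv in \<open>auto simp: sg_def\<close>)
      also have "\<dots> = (\<Sum>\<epsilon>\<in>sg A. (N (\<Sum>i<n. \<delta> i *\<^sub>R S i \<epsilon>))\<^sup>2) / 2 ^ card A"
      proof -
        have "(\<Sum>a\<in>A. \<epsilon> a *\<^sub>R \<delta> (a div m) *\<^sub>R x a) = (\<Sum>i<n. \<delta> i *\<^sub>R S i \<epsilon>)" for \<epsilon>
          unfolding part S_def scaleR_sum_right
          by (intro sum.cong refl) (auto simp: B_def)
        then show ?thesis by (simp add: rad_def)
      qed
      finally show ?thesis .
    qed
    have "2 ^ n * rad N A x = (\<Sum>\<delta>\<in>sg {..<n}. rad N A x)" by (simp add: card_sg)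
    also have "\<dots> = (\<Sum>\<delta>\<in>sg {..<n}. (\<Sum>\<epsilon>\<in>sg A. (N (\<Sum>i<n. \<delta> i *\<^sub>R S i \<epsilon>))\<^sup>2) / 2 ^ card A)"
      by (rule sum.cong) (use one in auto)
    also have "\<dots> = (\<Sum>\<epsilon>\<in>sg A. 2 ^ n * rad N {..<n} (\<lambda>i. S i \<epsilon>)) / 2 ^ card A"
      by (subst sum_divide_distrib[symmetric], subst sum.swap) (simp add: rad_def)
    also have "\<dots> \<le> (\<Sum>\<epsilon>\<in>sg A. 2 ^ n * (c * (\<Sum>i<n. (N (S i \<epsilon>))\<^sup>2))) / 2 ^ card A"
      by (intro divide_right_mono sum_mono mult_left_mono)
         (use n SH in \<open>auto simp: rad_bound_def Pi_def\<close>)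
    also have "\<dots> = 2 ^ n * (c * (\<Sum>i<n. (\<Sum>\<epsilon>\<in>sg A. (N (S i \<epsilon>))\<^sup>2) / 2 ^ card A))"
      by (subst sum_divide_distrib[symmetric], subst sum.swap) (simp add: sum_distrib_left)
    also have "\<dots> = 2 ^ n * (c * (\<Sum>i<n. rad N (B i) x))"
      unfolding S_def by (simp add: rad_restrict[OF fA fB(2)])
    finally have "rad N A x \<le> c * (\<Sum>i<n. rad N (B i) x)" by simp
    also have "\<dots> \<le> c * (\<Sum>i<n. d * (\<Sum>a\<in>B i. (N (x a))\<^sup>2))"
      by (intro mult_left_mono sum_mono rad_bound_finite[OF N m fB(1) cardB] c)
         (use fB xA in auto)
    also have "\<dots> = c * d * (\<Sum>a\<in>A. (N (x a))\<^sup>2)"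
      unfolding part' by (simp add: sum_distrib_left mult.assoc)
    finally show ?thesis by (simp add: A_def)
  qed
qed

lemma rad_bound_power:
  assumes N: "seminorm_on H N" and n: "rad_bound N H n c" and c: "0 \<le> c"
  shows "rad_bound N H (n ^ k) (c ^ k)"
proof (induction k)
  case 0
  have sg1: "sg {0::nat} = {(\<lambda>_. undefined)(0 := 1), (\<lambda>_. undefined)(0 := -1)}"
    unfolding sg_def by (auto simp: PiE_def extensional_def fun_eq_iff Pi_def)
  have "rad N {0} x = (N (x 0))\<^sup>2" if "x 0 \<in> H" for x :: "nat \<Rightarrow> 'a"
  proof -
    have "(\<Sum>\<epsilon>\<in>sg {0::nat}. (N (\<Sum>a\<in>{0}. \<epsilon> a *\<^sub>R x a))\<^sup>2) = (\<Sum>\<epsilon>\<in>sg {0::nat}. (N (x 0))\<^sup>2)"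
      using seminorm_on_minus[OF N that] by (intro sum.cong refl) (auto simp: sg1)
    then show ?thesis using card_sg[of "{0::nat}"] by (simp add: rad_def)
  qed
  then show ?case by (auto simp: rad_bound_def lessThan_Suc)
next
  case (Suc k)
  show ?case using rad_bound_mult[OF N n Suc c] by simp
qed

definition rad_growth :: "('a::real_vector \<Rightarrow> real) \<Rightarrow> 'a set \<Rightarrow> real \<Rightarrow> real \<Rightarrow> bool" where
  "rad_growth N H C \<beta> \<longleftrightarrow> (\<forall>n. rad_bound N H n (C * real n powr \<beta>))"

lemma rad_growth_mono:
  assumes "rad_growth N H C \<beta>" "0 \<le> C" "C \<le> C'" "\<beta> \<le> \<beta>'"
  shows "rad_growth N H C' \<beta>'"
  unfolding rad_growth_def rad_bound_def
proof (intro allI ballI)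
  fix n :: nat and x assume x: "x \<in> {..<n} \<rightarrow> H"
  have "rad N {..<n} x \<le> C * real n powr \<beta> * (\<Sum>i<n. (N (x i))\<^sup>2)"
    using assms x by (auto simp: rad_growth_def rad_bound_def)
  also have "\<dots> \<le> C' * real n powr \<beta>' * (\<Sum>i<n. (N (x i))\<^sup>2)"
    by (cases "n = 0") (use assms in \<open>auto intro!: mult_right_mono mult_mono powr_mono sum_nonneg\<close>)
  finally show "rad N {..<n} x \<le> C' * real n powr \<beta>' * (\<Sum>i<n. (N (x i))\<^sup>2)" .
qed

text \<open>The triangle and Cauchy-Schwarz inequalities give the factor \<open>n\<close>. Any
  improvement on it at a single \<open>n\<close> saves a power everywhere: powers of the inequality
  compare \<open>n\<^sup>k\<close> vectors with the factor \<open>c\<^sup>k\<close>, and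
  \<open>m\<close> vectors are treated as a subfamily for the least \<open>k\<close> with
  \<open>m \<le> n\<^sup>k\<close>.\<close>

lemma rad_growth_of_bound:
  assumes N: "seminorm_on H N" and n: "rad_bound N H n c" and c: "1 \<le> c" "c < real n"
  shows "rad_growth N H c (log (real n) c)"
  unfolding rad_growth_def rad_bound_def
proof (intro allI ballI)
  fix m :: nat and x assume x: "x \<in> {..<m} \<rightarrow> H"
  define \<beta> where "\<beta> = log (real n) c"
  have n1: "real n > 1" using c by auto
  then have n2: "n > 1" by simp
  have \<beta>0: "0 \<le> \<beta>" unfolding \<beta>_def using n1 c by simp
  have nb: "real n powr \<beta> = c" unfolding \<beta>_def using n1 c by simp
  define k where "k = (LEAST k. m \<le> n ^ k)"
  have "m \<le> 2 ^ m" using less_exp[of m] by simp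
  also have "\<dots> \<le> n ^ m" by (rule power_mono) (use n2 in auto)
  finally have mk: "m \<le> n ^ k" unfolding k_def by (rule LeastI)
  have "rad N {..<m} x \<le> c ^ k * (\<Sum>i<m. (N (x i))\<^sup>2)"
    by (rule rad_bound_finite[OF N rad_bound_power[OF N n, of k]]) (use mk x c in auto)
  also have "\<dots> \<le> c * real m powr \<beta> * (\<Sum>i<m. (N (x i))\<^sup>2)"
  proof (cases "m = 0")
    case False
    have "c ^ k \<le> c * real m powr \<beta>"
    proof (cases k)
      case 0
      have "1 \<le> real m powr \<beta>" using False \<beta>0 by (intro ge_one_powr_ge_zero) auto
      then show ?thesis using 0 c mult_mono[of 1 c 1 "real m powr \<beta>"] by simp
    next
      case (Suc j)
      have "\<not> m \<le> n ^ j" using not_less_Least[of j "\<lambda>k. m \<le> n ^ k"] Suc by (simp add: k_def)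
      then have "real (n ^ j) \<le> real m" by linarith
      then have "real n ^ j \<le> real m" by simp
      moreover have "c ^ j = (real n ^ j) powr \<beta>"
      proof -
        have "(real n ^ j) powr \<beta> = (real n powr real j) powr \<beta>" using n1 by (simp add: powr_realpow)
        also have "\<dots> = (real n powr \<beta>) powr real j" by (simp only: powr_powr mult.commute)
        also have "\<dots> = c ^ j" unfolding nb using c by (simp add: powr_realpow)
        finally show ?thesis by simp
      qed
      ultimately have "c ^ j \<le> real m powr \<beta>" using \<beta>0 by (simp add: powr_mono2)
      then show ?thesis using Suc c by simp
    qed
    then show ?thesis by (intro mult_right_mono sum_nonneg) auto
  qed simp
  finally show "rad N {..<m} x \<le> c * real m powr log (real n) c * (\<Sum>i<m. (N (x i))\<^sup>2)"
    by (simp add: \<beta>_def)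
qed


lemma weighted_Cauchy_Schwarz_sum:
  fixes b w :: "'k \<Rightarrow> real"
  assumes "finite A" "\<And>k. k \<in> A \<Longrightarrow> 0 < w k"
  shows "(\<Sum>k\<in>A. b k)\<^sup>2 \<le> (\<Sum>k\<in>A. w k) * (\<Sum>k\<in>A. (b k)\<^sup>2 / w k)"
proof -
  have "b k = sqrt (w k) * (b k / sqrt (w k))" if "k \<in> A" for k
    using assms(2)[OF that] by simp
  then have "(\<Sum>k\<in>A. b k) = (\<Sum>k\<in>A. sqrt (w k) * (b k / sqrt (w k)))"
    by (rule sum.cong[OF refl])
  then have "(\<Sum>k\<in>A. b k)\<^sup>2 = (\<Sum>k\<in>A. sqrt (w k) * (b k / sqrt (w k)))\<^sup>2" by (rule arg_cong)
  also have "\<dots> \<le> (\<Sum>k\<in>A. (sqrt (w k))\<^sup>2) * (\<Sum>k\<in>A. (b k / sqrt (w k))\<^sup>2)"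
    by (rule Cauchy_Schwarz_ineq_sum)
  also have "\<dots> = (\<Sum>k\<in>A. w k) * (\<Sum>k\<in>A. (b k)\<^sup>2 / w k)"
    by (intro arg_cong2[where f = "(*)"] sum.cong refl)
       (use assms(2) in \<open>auto simp: power_divide less_imp_le\<close>)
  finally show ?thesis .
qed

text \<open>Cauchy-Schwarz with geometric weights.\<close>

lemma rad_blocks:
  assumes N: "seminorm_on H N" and A: "finite A" and x: "\<And>a. a \<in> A \<Longrightarrow> x a \<in> H"
    and r: "0 < r" "r < 1"
    and B: "\<And>k. k < M \<Longrightarrow> B k \<subseteq> A" "disjoint_family_on B {..<M}" "(\<Union>k<M. B k) = A"
  shows "rad N A x \<le> (\<Sum>k<M. rad N (B k) x / r ^ k) / (1 - r)"
proof -
  have sH: "subspace H" by (rule seminorm_on_subspace[OF N])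
  have split: "(\<Sum>a\<in>A. f a) = (\<Sum>k<M. \<Sum>a\<in>B k. f a)" for f :: "'b \<Rightarrow> 'a"
    unfolding B(3)[symmetric]
    by (rule sum.UNION_disjoint_family) (use B A in \<open>auto intro: finite_subset\<close>)
  have "(N (\<Sum>a\<in>A. \<epsilon> a *\<^sub>R x a))\<^sup>2 \<le> (\<Sum>k<M. (N (\<Sum>a\<in>B k. \<epsilon> a *\<^sub>R x a))\<^sup>2 / r ^ k) / (1 - r)" for \<epsilon>
  proof -
    have inH: "(\<Sum>a\<in>B k. \<epsilon> a *\<^sub>R x a) \<in> H" if "k < M" for k
      by (rule signed_sum_in[OF sH]) (use B(1)[OF that] x in auto)
    have "(N (\<Sum>a\<in>A. \<epsilon> a *\<^sub>R x a))\<^sup>2 \<le> (\<Sum>k<M. N (\<Sum>a\<in>B k. \<epsilon> a *\<^sub>R x a))\<^sup>2"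
      unfolding split
      by (intro power_mono seminorm_on_sum[OF N] seminorm_on_nonneg[OF N] subspace_sum[OF sH, of "{..<M}"])
         (use inH in auto)
    also have "\<dots> \<le> (\<Sum>k<M. r ^ k) * (\<Sum>k<M. (N (\<Sum>a\<in>B k. \<epsilon> a *\<^sub>R x a))\<^sup>2 / r ^ k)"
      by (rule weighted_Cauchy_Schwarz_sum) (use r in auto)
    also have "\<dots> \<le> (1 / (1 - r)) * (\<Sum>k<M. (N (\<Sum>a\<in>B k. \<epsilon> a *\<^sub>R x a))\<^sup>2 / r ^ k)"
    proof (intro mult_right_mono sum_nonneg)
      show "(\<Sum>k<M. r ^ k) \<le> 1 / (1 - r)"
        using r by (simp add: sum_gp_strict divide_right_mono)
    qed (use r in auto)
    finally show ?thesis by simp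
  qed
  then have "rad N A x \<le> (\<Sum>\<epsilon>\<in>sg A. (\<Sum>k<M. (N (\<Sum>a\<in>B k. \<epsilon> a *\<^sub>R x a))\<^sup>2 / r ^ k) / (1 - r)) / 2 ^ card A"
    unfolding rad_def by (intro divide_right_mono sum_mono) auto
  also have "\<dots> = (\<Sum>k<M. ((\<Sum>\<epsilon>\<in>sg A. (N (\<Sum>a\<in>B k. \<epsilon> a *\<^sub>R x a))\<^sup>2) / 2 ^ card A) / r ^ k) / (1 - r)"
  proof -
    have "(\<Sum>\<epsilon>\<in>sg A. \<Sum>k<M. (N (\<Sum>a\<in>B k. \<epsilon> a *\<^sub>R x a))\<^sup>2 / r ^ k) =
        (\<Sum>k<M. (\<Sum>\<epsilon>\<in>sg A. (N (\<Sum>a\<in>B k. \<epsilon> a *\<^sub>R x a))\<^sup>2) / r ^ k)"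
      by (subst sum.swap) (simp only: sum_divide_distrib)
    moreover have "(\<Sum>k<M. S k / 2 ^ card A / r ^ k) = (\<Sum>k<M. S k / r ^ k) / 2 ^ card A" for S :: "nat \<Rightarrow> real"
      unfolding sum_divide_distrib by (rule sum.cong[OF refl]) (simp add: mult.commute)
    ultimately show ?thesis
      by (simp only: sum_divide_distrib[symmetric] divide_divide_eq_left mult.commute)
  qed
  also have "\<dots> = (\<Sum>k<M. rad N (B k) x / r ^ k) / (1 - r)"
    by (intro arg_cong2[where f = "(/)"] sum.cong refl rad_restrict A B) auto
  finally show ?thesis .
qed

section \<open>From growth of Rademacher averages to Rademacher type\<close>

text \<open>The bound on the sum of \<open>p\<close>-th powers allows at most
  \<open>2 powr ((k + 1) * p)\<close> vectors of norm about \<open>2\<^sup>-\<^sup>k\<close>, to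
  which the growth estimate is applied. The exponent \<open>p\<close> is chosen close enough to
  \<open>1\<close> that \<open>p * (1 + \<beta>)\<close> stays below \<open>2\<close> by
  \<open>(1 - \<beta>) / 2\<close>; this margin is the decay
  \<open>r\<^sup>2\<^sup>k\<close>.\<close>

lemma rad_dyadic_block:
  assumes N: "seminorm_on H N" and g: "rad_growth N H C \<beta>" and C: "0 \<le> C" and \<beta>: "0 \<le> \<beta>" "\<beta> < 1"
    and p: "p = 1 + (1 - \<beta>) / 4" and r: "r = 2 powr (- (1 - \<beta>) / 4)"
    and I: "finite I" "\<And>i. i \<in> I \<Longrightarrow> x i \<in> H"
      "\<And>i. i \<in> I \<Longrightarrow> 2 powr (- (real k + 1)) \<le> N (x i)" "\<And>i. i \<in> I \<Longrightarrow> N (x i) \<le> 2 powr (- real k)"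
    and le: "(\<Sum>i\<in>I. N (x i) powr p) \<le> 1"
  shows "rad N I x \<le> 4 * C * (r ^ k * r ^ k)"
proof -
  define n where "n = real (card I)"
  have p0: "p > 0" using p \<beta> by (simp add: field_simps)
  have "n * 2 powr (- (real k + 1) * p) = (\<Sum>i\<in>I. 2 powr (- (real k + 1) * p))"
    by (simp add: n_def)
  also have "\<dots> \<le> (\<Sum>i\<in>I. N (x i) powr p)"
  proof (rule sum_mono)
    fix i assume "i \<in> I"
    then have "(2 powr (- (real k + 1))) powr p \<le> N (x i) powr p"
      by (intro powr_mono2 I(3) less_imp_le[OF p0] powr_ge_zero)
    then show "2 powr (- (real k + 1) * p) \<le> N (x i) powr p" by (simp only: powr_powr)
  qed
  finally have "n * 2 powr (- (real k + 1) * p) \<le> 1" using le by simp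
  then have "n / 2 powr ((real k + 1) * p) \<le> 1"
    by (simp only: mult_minus_left powr_minus divide_inverse)
  moreover have "0 < (2::real) powr ((real k + 1) * p)" by (subst powr_gt_zero) simp
  ultimately have n: "n \<le> 2 powr ((real k + 1) * p)"
    using divide_le_eq_1_pos[of "2 powr ((real k + 1) * p)" n] by blast
  have n0: "0 \<le> n" by (simp add: n_def)
  have pb: "p * (1 + \<beta>) \<le> 2 - (1 - \<beta>) / 2"
  proof -
    have "2 - (1 - \<beta>) / 2 - p * (1 + \<beta>) = (1 - \<beta>) * (1 - \<beta>) / 4"
      unfolding p by (simp add: field_simps)
    moreover have "0 \<le> (1 - \<beta>) * (1 - \<beta>) / 4" by simp
    ultimately show ?thesis by linarith
  qed
  have "rad N I x \<le> C * n powr \<beta> * (\<Sum>i\<in>I. (N (x i))\<^sup>2)"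
    unfolding n_def
    by (rule rad_bound_finite[OF N _ I(1) order_refl]) (use g I in \<open>auto simp: rad_growth_def\<close>)
  also have "\<dots> \<le> C * n powr \<beta> * (\<Sum>i\<in>I. 2 powr (- 2 * real k))"
  proof (intro mult_left_mono sum_mono)
    fix i assume i: "i \<in> I"
    have "(N (x i))\<^sup>2 \<le> (2 powr (- real k))\<^sup>2"
      using I(4)[OF i] seminorm_on_nonneg[OF N I(2)[OF i]] by (rule power_mono)
    also have "\<dots> = 2 powr (- real k + - real k)" by (simp only: power2_eq_square powr_add)
    also have "- real k + - real k = - 2 * real k" by simp
    finally show "(N (x i))\<^sup>2 \<le> 2 powr (- 2 * real k)" .
  qed (use C in auto)
  also have "\<dots> = C * n powr (1 + \<beta>) * 2 powr (- 2 * real k)"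
  proof -
    have "n powr (1 + \<beta>) = n powr \<beta> * n" using n0 by (simp add: powr_add)
    then show ?thesis by (simp add: n_def[symmetric])
  qed
  also have "\<dots> \<le> C * 2 powr ((real k + 1) * (2 - (1 - \<beta>) / 2)) * 2 powr (- 2 * real k)"
  proof (intro mult_right_mono mult_left_mono C)
    have "n powr (1 + \<beta>) \<le> (2 powr ((real k + 1) * p)) powr (1 + \<beta>)"
      by (intro powr_mono2 n n0) (use \<beta> in auto)
    also have "\<dots> = 2 powr ((real k + 1) * (p * (1 + \<beta>)))" by (simp only: powr_powr mult.assoc)
    also have "\<dots> \<le> 2 powr ((real k + 1) * (2 - (1 - \<beta>) / 2))"
      by (intro powr_mono mult_left_mono pb) auto
    finally show "n powr (1 + \<beta>) \<le> 2 powr ((real k + 1) * (2 - (1 - \<beta>) / 2))" .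
  qed auto
  also have "\<dots> = C * 2 powr (2 - (1 - \<beta>) / 2) * (2 powr (- (1 - \<beta>) / 4 * real k) * 2 powr (- (1 - \<beta>) / 4 * real k))"
  proof -
    have "(real k + 1) * (2 - (1 - \<beta>) / 2) + (- 2 * real k) =
        (2 - (1 - \<beta>) / 2) + (- (1 - \<beta>) / 4 * real k + - (1 - \<beta>) / 4 * real k)"
      by (simp add: field_simps)
    then have "2 powr ((real k + 1) * (2 - (1 - \<beta>) / 2)) * 2 powr (- 2 * real k) =
        2 powr (2 - (1 - \<beta>) / 2) * (2 powr (- (1 - \<beta>) / 4 * real k) * (2::real) powr (- (1 - \<beta>) / 4 * real k))"
      by (simp only: powr_add[symmetric])
    then show ?thesis by (simp only: mult.assoc)
  qed
  also have "2 powr (- (1 - \<beta>) / 4 * real k) = r ^ k"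
  proof -
    have "r ^ k = r powr real k" by (rule powr_realpow[symmetric]) (simp add: r)
    then show ?thesis by (simp only: r powr_powr)
  qed
  also have "C * 2 powr (2 - (1 - \<beta>) / 2) * (r ^ k * r ^ k) \<le> C * 4 * (r ^ k * r ^ k)"
  proof (intro mult_right_mono mult_left_mono C)
    have "2 powr (2 - (1 - \<beta>) / 2) \<le> (2::real) powr 2" using \<beta> by (intro powr_mono) auto
    also have "(2::real) powr 2 = 4" by simp
    finally show "2 powr (2 - (1 - \<beta>) / 2) \<le> (4::real)" .
  qed (simp add: r)
  finally show ?thesis by (simp only: mult_ac)
qed

text \<open>The vectors are sorted by the dyadic size of their norms. One of the two factors
  \<open>r\<^sup>k\<close> of each block pays for putting the blocks together, and the other is
  summed.\<close>

lemma rad_le_of_powr_sum_pos: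
  assumes N: "seminorm_on H N" and g: "rad_growth N H C \<beta>" and C: "0 \<le> C" and \<beta>: "0 \<le> \<beta>" "\<beta> < 1"
    and p: "p = 1 + (1 - \<beta>) / 4" and r: "r = 2 powr (- (1 - \<beta>) / 4)"
    and A: "finite A" "\<And>i. i \<in> A \<Longrightarrow> x i \<in> H" "\<And>i. i \<in> A \<Longrightarrow> 0 < N (x i)"
    and le: "(\<Sum>i\<in>A. N (x i) powr p) \<le> 1"
  shows "rad N A x \<le> 4 * C / (1 - r) / (1 - r)"
proof -
  define f where "f i = nat \<lfloor>- log 2 (N (x i))\<rfloor>" for i
  have p0: "p > 0" using p \<beta> by (simp add: field_simps)
  have r1: "0 < r" "r < 1"
  proof -
    have "2 powr (- (1 - \<beta>) / 4) < (2::real) powr 0" using \<beta> by (intro powr_less_mono) auto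
    then show "0 < r" "r < 1" by (auto simp: r)
  qed
  have Nle: "N (x i) \<le> 1" if "i \<in> A" for i
  proof -
    have "N (x i) powr p \<le> (\<Sum>i\<in>A. N (x i) powr p)"
      by (rule member_le_sum) (use that A in auto)
    with le have "N (x i) powr p \<le> 1" by simp
    then show ?thesis using p0 A(3)[OF that] by (metis linorder_not_le powr_less_mono2 powr_one_eq_one zero_le_one)
  qed
  have f: "2 powr (- (real (f i) + 1)) \<le> N (x i)" "N (x i) \<le> 2 powr (- real (f i))" if "i \<in> A" for i
  proof -
    have l: "0 \<le> - log 2 (N (x i))" using Nle[OF that] A(3)[OF that] by simp
    have a: "real (f i) \<le> - log 2 (N (x i))" "- log 2 (N (x i)) \<le> real (f i) + 1"
      unfolding f_def using l by linarith+
    have e: "N (x i) = 2 powr (log 2 (N (x i)))" using A(3)[OF that] by simp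
    show "2 powr (- (real (f i) + 1)) \<le> N (x i)" using a by (subst e) (intro powr_mono, auto)
    show "N (x i) \<le> 2 powr (- real (f i))" using a by (subst e) (intro powr_mono, auto)
  qed
  define M where "M = Suc (Max (insert 0 (f ` A)))"
  have fM: "f i < M" if "i \<in> A" for i
    using that A(1) by (simp add: M_def less_Suc_eq_le)
  define B where "B k = {i \<in> A. f i = k}" for k
  have "rad N A x \<le> (\<Sum>k<M. rad N (B k) x / r ^ k) / (1 - r)"
    by (rule rad_blocks[OF N A(1,2) r1])
       (use fM in \<open>auto simp: B_def disjoint_family_on_def\<close>)
  also have "\<dots> \<le> (\<Sum>k<M. 4 * C * r ^ k) / (1 - r)"
  proof (intro divide_right_mono sum_mono)
    fix k
    have "rad N (B k) x \<le> 4 * C * (r ^ k * r ^ k)"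
    proof (rule rad_dyadic_block[OF N g C \<beta> p r])
      have "(\<Sum>i\<in>B k. N (x i) powr p) \<le> (\<Sum>i\<in>A. N (x i) powr p)"
        by (rule sum_mono2) (use A in \<open>auto simp: B_def\<close>)
      with le show "(\<Sum>i\<in>B k. N (x i) powr p) \<le> 1" by simp
    qed (use A f in \<open>auto simp: B_def\<close>)
    then show "rad N (B k) x / r ^ k \<le> 4 * C * r ^ k" using r1 by (simp add: field_simps)
  qed (use r1 in auto)
  also have "\<dots> = 4 * C * (\<Sum>k<M. r ^ k) / (1 - r)" by (simp add: sum_distrib_left)
  also have "\<dots> \<le> 4 * C * (1 / (1 - r)) / (1 - r)"
    using r1 C by (intro divide_right_mono mult_left_mono) (auto simp: sum_gp_strict divide_right_mono)
  finally show ?thesis by simp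
qed

text \<open>Vectors of seminorm zero do not change the average.\<close>

lemma rad_le_of_powr_sum:
  assumes N: "seminorm_on H N" and g: "rad_growth N H C \<beta>" and C: "0 \<le> C" and \<beta>: "0 \<le> \<beta>" "\<beta> < 1"
    and p: "p = 1 + (1 - \<beta>) / 4" and r: "r = 2 powr (- (1 - \<beta>) / 4)"
    and A: "finite A" "\<And>i. i \<in> A \<Longrightarrow> x i \<in> H"
    and le: "(\<Sum>i\<in>A. N (x i) powr p) \<le> 1"
  shows "rad N A x \<le> 4 * C / (1 - r) / (1 - r)"
proof -
  have sH: "subspace H" by (rule seminorm_on_subspace[OF N])
  define B where "B = {i \<in> A. 0 < N (x i)}"
  have BA: "B \<subseteq> A" "finite B" using A by (auto simp: B_def)
  have z: "N (x i) = 0" if "i \<in> A - B" for i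
    using that seminorm_on_nonneg[OF N A(2), of i] by (auto simp: B_def)
  have "N (\<Sum>a\<in>A. \<epsilon> a *\<^sub>R x a) \<le> N (\<Sum>a\<in>B. \<epsilon> a *\<^sub>R x a)" if "\<epsilon> \<in> sg A" for \<epsilon>
  proof -
    have "(\<Sum>a\<in>A. \<epsilon> a *\<^sub>R x a) = (\<Sum>a\<in>A - B. \<epsilon> a *\<^sub>R x a) + (\<Sum>a\<in>B. \<epsilon> a *\<^sub>R x a)"
      by (rule sum.subset_diff) (use BA A in auto)
    moreover have "N ((\<Sum>a\<in>A - B. \<epsilon> a *\<^sub>R x a) + (\<Sum>a\<in>B. \<epsilon> a *\<^sub>R x a))
        \<le> N (\<Sum>a\<in>A - B. \<epsilon> a *\<^sub>R x a) + N (\<Sum>a\<in>B. \<epsilon> a *\<^sub>R x a)"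
      by (intro seminorm_on_triangle[OF N] signed_sum_in[OF sH]) (use BA A in auto)
    moreover have "N (\<Sum>a\<in>A - B. \<epsilon> a *\<^sub>R x a) \<le> (\<Sum>a\<in>A - B. N (x a))"
      by (rule seminorm_signed_sum[OF N]) (use A sg_values[OF that] in force)+
    moreover have "(\<Sum>a\<in>A - B. N (x a)) = 0" by (rule sum.neutral) (use z in auto)
    ultimately show ?thesis by simp
  qed
  then have "rad N A x \<le> (\<Sum>\<epsilon>\<in>sg A. (N (\<Sum>a\<in>B. \<epsilon> a *\<^sub>R x a))\<^sup>2) / 2 ^ card A"
    unfolding rad_def
    by (intro divide_right_mono sum_mono power_mono seminorm_on_nonneg[OF N] signed_sum_in[OF sH])
       (use A in auto)
  also have "\<dots> = rad N B x" by (rule rad_restrict) (use A BA in auto)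
  also have "\<dots> \<le> 4 * C / (1 - r) / (1 - r)"
  proof (rule rad_le_of_powr_sum_pos[OF N g C \<beta> p r])
    have "(\<Sum>i\<in>B. N (x i) powr p) \<le> (\<Sum>i\<in>A. N (x i) powr p)"
      by (rule sum_mono2) (use A BA in auto)
    with le show "(\<Sum>i\<in>B. N (x i) powr p) \<le> 1" by simp
  qed (use A in \<open>auto simp: B_def\<close>)
  finally show ?thesis .
qed

text \<open>This is Rademacher type \<open>p\<close> with a constant that depends on
  \<open>C\<close> and \<open>\<beta>\<close> only. By homogeneity the sum of the
  \<open>p\<close>-th powers of the norms may be taken to be \<open>1\<close>, and as
  \<open>p \<le> 2\<close> the \<open>p\<close>-th moment is then at most \<open>1\<close> plus the
  second moment.\<close>

lemma signed_powr_sum_le: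
  assumes N: "seminorm_on H N" and g: "rad_growth N H C \<beta>" and C: "0 \<le> C" and \<beta>: "0 \<le> \<beta>" "\<beta> < 1"
    and p: "p = 1 + (1 - \<beta>) / 4" and r: "r = 2 powr (- (1 - \<beta>) / 4)"
    and A: "finite A" "\<And>i. i \<in> A \<Longrightarrow> x i \<in> H"
  shows "((\<Sum>\<epsilon>\<in>sg A. N (\<Sum>a\<in>A. \<epsilon> a *\<^sub>R x a) powr p) / 2 ^ card A) powr (1 / p)
    \<le> (1 + 4 * C / (1 - r) / (1 - r)) powr (1 / p) * (\<Sum>i\<in>A. N (x i) powr p) powr (1 / p)"
proof -
  define D where "D = 4 * C / (1 - r) / (1 - r)"
  have sH: "subspace H" by (rule seminorm_on_subspace[OF N])
  have p0: "p > 0" "p \<le> 2" using p \<beta> by (simp_all add: field_simps)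
  have norm: "(\<Sum>\<epsilon>\<in>sg A. N (\<Sum>a\<in>A. \<epsilon> a *\<^sub>R x a) powr p) / 2 ^ card A \<le> 1 + D"
    if x: "\<And>i. i \<in> A \<Longrightarrow> x i \<in> H" and le: "(\<Sum>i\<in>A. N (x i) powr p) \<le> 1" for x
  proof -
    have s: "s powr p \<le> 1 + s\<^sup>2" if "0 \<le> s" for s :: real
    proof (cases "s \<le> 1")
      case True
      then have "s powr p \<le> 1" using p0 that by (intro powr_le1) auto
      then show ?thesis using zero_le_power2[of s] by linarith
    next
      case False
      then have "s powr p \<le> s powr 2" using p0 by (intro powr_mono) auto
      then show ?thesis using False by simp
    qed
    have "(\<Sum>\<epsilon>\<in>sg A. N (\<Sum>a\<in>A. \<epsilon> a *\<^sub>R x a) powr p) / 2 ^ card A \<le>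
        (\<Sum>\<epsilon>\<in>sg A. 1 + (N (\<Sum>a\<in>A. \<epsilon> a *\<^sub>R x a))\<^sup>2) / 2 ^ card A"
      by (intro divide_right_mono sum_mono s seminorm_on_nonneg[OF N] signed_sum_in[OF sH])
         (use x in auto)
    also have "\<dots> = 1 + rad N A x"
      using A by (simp add: rad_def sum.distrib card_sg add_divide_distrib)
    also have "\<dots> \<le> 1 + D" unfolding D_def using rad_le_of_powr_sum[OF N g C \<beta> p r A(1) x le] by simp
    finally show ?thesis .
  qed
  define s where "s = (\<Sum>i\<in>A. N (x i) powr p) powr (1 / p)"
  have sp: "(\<Sum>i\<in>A. N (x i) powr p) = s powr p"
    unfolding s_def using p0 by (simp add: powr_powr sum_nonneg)
  have s0: "0 \<le> s" by (simp add: s_def)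
  show ?thesis
  proof (cases "s = 0")
    case True
    then have "N (x i) = 0" if "i \<in> A" for i
      using sp p0 that A(1) by (simp add: sum_nonneg_eq_0_iff)
    then have "N (\<Sum>a\<in>A. \<epsilon> a *\<^sub>R x a) = 0" if "\<epsilon> \<in> sg A" for \<epsilon>
      using seminorm_signed_sum[OF N A(1), of x \<epsilon>] seminorm_on_nonneg[OF N signed_sum_in[OF sH], of A x \<epsilon>]
        A sg_values[OF that] by force
    then show ?thesis by simp
  next
    case False
    then have s1: "s > 0" using s0 by simp
    define y where "y i = (1 / s) *\<^sub>R x i" for i
    have yH: "y i \<in> H" if "i \<in> A" for i unfolding y_def using A(2)[OF that] sH by (rule subspace_scale[rotated])
    have Ny: "N (y i) powr p = N (x i) powr p / s powr p" if "i \<in> A" for i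
      unfolding y_def using seminorm_on_scale[OF N A(2)[OF that]] s1 seminorm_on_nonneg[OF N A(2)[OF that]]
      by (simp add: powr_divide)
    have "(\<Sum>i\<in>A. N (y i) powr p) = (\<Sum>i\<in>A. N (x i) powr p) / s powr p"
      using Ny by (simp add: sum_divide_distrib)
    also have "\<dots> = 1" using sp s1 by simp
    finally have "(\<Sum>\<epsilon>\<in>sg A. N (\<Sum>a\<in>A. \<epsilon> a *\<^sub>R y a) powr p) / 2 ^ card A \<le> 1 + D"
      by (intro norm yH) auto
    moreover have "N (\<Sum>a\<in>A. \<epsilon> a *\<^sub>R y a) powr p = N (\<Sum>a\<in>A. \<epsilon> a *\<^sub>R x a) powr p / s powr p" for \<epsilon>
    proof -
      have e: "(\<Sum>a\<in>A. \<epsilon> a *\<^sub>R y a) = (1 / s) *\<^sub>R (\<Sum>a\<in>A. \<epsilon> a *\<^sub>R x a)"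
        unfolding y_def scaleR_sum_right by (simp add: mult.commute)
      have "(\<Sum>a\<in>A. \<epsilon> a *\<^sub>R x a) \<in> H" by (rule signed_sum_in[OF sH A(2)])
      then show ?thesis unfolding e using seminorm_on_scale[OF N] seminorm_on_nonneg[OF N] s1
        by (simp add: powr_divide)
    qed
    ultimately have "(\<Sum>\<epsilon>\<in>sg A. N (\<Sum>a\<in>A. \<epsilon> a *\<^sub>R x a) powr p) / 2 ^ card A \<le> (1 + D) * s powr p"
      using s1 by (simp add: field_simps flip: sum_divide_distrib)
    then have "((\<Sum>\<epsilon>\<in>sg A. N (\<Sum>a\<in>A. \<epsilon> a *\<^sub>R x a) powr p) / 2 ^ card A) powr (1 / p) \<le> ((1 + D) * s powr p) powr (1 / p)"
      using p0 by (intro powr_mono2) (auto intro!: divide_nonneg_nonneg sum_nonneg)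
    also have "\<dots> = (1 + D) powr (1 / p) * s"
    proof -
      have "0 \<le> D"
      proof -
        have "2 powr (- (1 - \<beta>) / 4) < (2::real) powr 0" using \<beta> by (intro powr_less_mono) auto
        then show ?thesis using C by (simp add: D_def r)
      qed
      then show ?thesis using p0 s1 by (simp add: powr_mult powr_powr)
    qed
    finally show ?thesis by (simp add: D_def s_def)
  qed
qed

section \<open>Consequences of type and duality for Rademacher averages\<close>

text \<open>Type \<open>p\<close> controls only a \<open>p\<close>-th moment of the Rademacher sum
  \<open>s\<close>. Normalise the sum of squared norms to \<open>n\<close>, so that always
  \<open>s \<le> n\<close>. Then the second moment is at most \<open>n\<close> times the first one,
  and \<open>s \<le> \<lambda> + \<lambda>\<^sup>1\<^sup>-\<^sup>p s\<^sup>p\<close> with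
  \<open>\<lambda> = q n / 2\<close> reduces the first moment to the \<open>p\<close>-th one, whose
  contribution is of lower order in \<open>n\<close>.\<close>

lemma rad_bound_of_type:
  assumes ty: "rademacher_type TYPE('x::real_normed_vector) p T" and p: "p > 1" and q: "q > 0"
  shows "\<exists>n0. \<forall>n\<ge>n0. rad_bound (norm :: 'x \<Rightarrow> real) UNIV n (q * real n)"
proof -
  \<comment> \<open>The sum of the \<open>p\<close>-th powers of the norms is at most
    \<open>2 n\<^sup>1\<^sup>+\<^sup>e\<close>. The choice of \<open>e\<close> covers
    \<open>p \<le> 2\<close> and \<open>p > 2\<close> alike, and in both cases the exponent
    \<open>1 - p + e\<close> is negative.\<close>
  define e where "e = max 0 (p / 2 - 1)"
  define T' where "T' = max T 1"
  have N: "seminorm_on UNIV (norm :: 'x \<Rightarrow> real)"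
    by (auto simp: seminorm_on_def norm_triangle_ineq)
  have "p / 2 - 1 \<le> e" unfolding e_def by (rule max.cobounded2)
  then have pe: "p - 2 \<le> 2 * e" by simp
  have e: "1 - p + e < 0" using p by (auto simp: e_def max_def field_simps)
  have "(\<lambda>n. real n powr (1 - p + e)) \<longlonglongrightarrow> 0"
    by (rule tendsto_neg_powr[OF e filterlim_real_sequentially])
  then have lim: "(\<lambda>n. (q / 2) powr (1 - p) * T' powr p * 2 * real n powr (1 - p + e)) \<longlonglongrightarrow> 0"
    by (rule tendsto_mult_right_zero)
  have "eventually (\<lambda>n. (q / 2) powr (1 - p) * T' powr p * 2 * real n powr (1 - p + e) < q / 2) sequentially"
    by (rule order_tendstoD(2)[OF lim]) (use q in auto)
  then obtain n1 where n1: "(q / 2) powr (1 - p) * T' powr p * 2 * real n powr (1 - p + e) < q / 2" if "n \<ge> n1" for n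
    by (auto simp: eventually_sequentially)
  have "rad_bound (norm :: 'x \<Rightarrow> real) UNIV n (q * real n)" if n: "n \<ge> max n1 1" for n
  proof -
    have nn: "n \<ge> n1" "n \<ge> 1" using n by auto
    have main: "rad norm {..<n} x \<le> q * real n * real n" if xn: "(\<Sum>i<n. (norm (x i))\<^sup>2) = real n" for x :: "nat \<Rightarrow> 'x"
    proof -
      define s where "s \<epsilon> = norm (\<Sum>i<n. \<epsilon> i *\<^sub>R x i)" for \<epsilon>
      define lam where "lam = q / 2 * real n"
      have l0: "lam > 0" using q nn by (simp add: lam_def)
      have sn: "s \<epsilon> \<le> real n" if "\<epsilon> \<in> sg {..<n}" for \<epsilon>
      proof -
        have "s \<epsilon> \<le> (\<Sum>i<n. norm (x i))"
          unfolding s_def by (rule seminorm_signed_sum[OF N]) (use sg_values[OF that] in force)+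
        also have "\<dots> \<le> sqrt (real n * (\<Sum>i<n. (norm (x i))\<^sup>2))"
        proof (rule real_le_rsqrt)
          show "(\<Sum>i<n. norm (x i))\<^sup>2 \<le> real n * (\<Sum>i<n. (norm (x i))\<^sup>2)"
            using Cauchy_Schwarz_ineq_sum[of "\<lambda>_. 1" "\<lambda>i. norm (x i)" "{..<n}"] by simp
        qed
        also have "\<dots> = real n" by (simp add: xn)
        finally show ?thesis .
      qed
      have powr_bound: "norm (x i) powr p \<le> 1 + (norm (x i))\<^sup>2 * real n powr e" if "i < n" for i
      proof (cases "norm (x i) \<le> 1")
        case True
        then have "norm (x i) powr p \<le> 1" using p by (intro powr_le1) auto
        moreover have "0 \<le> (norm (x i))\<^sup>2 * real n powr e" by simp
        ultimately show ?thesis by linarith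
      next
        case False
        have "(norm (x i))\<^sup>2 \<le> real n"
          unfolding xn[symmetric] by (rule member_le_sum) (use that in auto)
        then have a: "norm (x i) \<le> real n powr (1/2)" by (simp add: powr_half_sqrt real_le_rsqrt)
        have "norm (x i) powr (p - 2) \<le> norm (x i) powr (2 * e)"
          by (rule powr_mono[OF pe]) (use False in simp)
        also have "\<dots> \<le> (real n powr (1/2)) powr (2 * e)"
          using a by (intro powr_mono2) (auto simp: e_def)
        also have "\<dots> = real n powr e" by (simp add: powr_powr)
        finally have "norm (x i) powr (p - 2) \<le> real n powr e" .
        moreover have "norm (x i) powr p = (norm (x i))\<^sup>2 * norm (x i) powr (p - 2)"
        proof -
          have "(norm (x i))\<^sup>2 = norm (x i) powr 2" using False by simp
          then have "(norm (x i))\<^sup>2 * norm (x i) powr (p - 2) = norm (x i) powr (2 + (p - 2))"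
            by (simp only: powr_add)
          then show ?thesis by simp
        qed
        ultimately have "norm (x i) powr p \<le> (norm (x i))\<^sup>2 * real n powr e"
          by (simp add: mult_left_mono)
        then show ?thesis by linarith
      qed
      have "(\<Sum>i<n. norm (x i) powr p) \<le> (\<Sum>i<n. 1 + (norm (x i))\<^sup>2 * real n powr e)"
        by (rule sum_mono) (use powr_bound in auto)
      also have "\<dots> = real n + real n * real n powr e"
        by (simp add: sum.distrib xn flip: sum_distrib_right)
      also have "\<dots> \<le> 2 * real n * real n powr e"
      proof -
        have "1 \<le> real n powr e" using nn by (intro ge_one_powr_ge_zero) (auto simp: e_def)
        then have "real n * 1 \<le> real n * real n powr e" by (intro mult_left_mono) auto
        then show ?thesis by simp
      qed
      finally have sump: "(\<Sum>i<n. norm (x i) powr p) \<le> 2 * real n * real n powr e" .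
      have sgs: "signs n = (sg {..<n} :: (nat \<Rightarrow> real) set)" by (simp add: signs_def sg_def)
      define m where "m = (\<Sum>\<epsilon>\<in>sg {..<n}. s \<epsilon> powr p) / 2 ^ n"
      have m0: "0 \<le> m" by (auto simp: m_def intro!: divide_nonneg_nonneg sum_nonneg)
      have "m powr (1 / p) \<le> T * (\<Sum>i<n. norm (x i) powr p) powr (1 / p)"
        using ty[unfolded rademacher_type_def, rule_format, of x n] by (simp add: m_def s_def sgs)
      also have "\<dots> \<le> T' * (\<Sum>i<n. norm (x i) powr p) powr (1 / p)"
        by (intro mult_right_mono) (auto simp: T'_def)
      finally have "(m powr (1 / p)) powr p \<le> (T' * (\<Sum>i<n. norm (x i) powr p) powr (1 / p)) powr p"
        using p by (intro powr_mono2) auto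
      moreover have "(m powr (1 / p)) powr p = m" using p m0 by (simp add: powr_powr)
      moreover have "(T' * (\<Sum>i<n. norm (x i) powr p) powr (1 / p)) powr p =
          T' powr p * (\<Sum>i<n. norm (x i) powr p)"
      proof -
        have "(T' * (\<Sum>i<n. norm (x i) powr p) powr (1 / p)) powr p =
            T' powr p * ((\<Sum>i<n. norm (x i) powr p) powr (1 / p)) powr p"
          by (rule powr_mult)
        moreover have "((\<Sum>i<n. norm (x i) powr p) powr (1 / p)) powr p = (\<Sum>i<n. norm (x i) powr p)"
          unfolding powr_powr using p by (simp add: sum_nonneg)
        ultimately show ?thesis by simp
      qed
      ultimately have "m \<le> T' powr p * (\<Sum>i<n. norm (x i) powr p)" by simp
      also have "\<dots> \<le> T' powr p * (2 * real n * real n powr e)" by (intro mult_left_mono sump) auto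
      finally have m: "m \<le> T' powr p * (2 * real n * real n powr e)" .
      have s1: "s \<epsilon> \<le> lam + lam powr (1 - p) * s \<epsilon> powr p" for \<epsilon>
      proof (cases "s \<epsilon> \<le> lam")
        case True
        moreover have "0 \<le> lam powr (1 - p) * s \<epsilon> powr p" by simp
        ultimately show ?thesis by linarith
      next
        case False
        have "s \<epsilon> powr (1 - p) * s \<epsilon> powr p = s \<epsilon> powr (1 - p + p)" by (simp only: powr_add)
        also have "\<dots> = s \<epsilon>" using False l0 by simp
        finally have "s \<epsilon> = s \<epsilon> powr (1 - p) * s \<epsilon> powr p" by simp
        also have "\<dots> \<le> lam powr (1 - p) * s \<epsilon> powr p"
          using False l0 p by (intro mult_right_mono powr_mono2') auto
        finally show ?thesis using l0 by simp
      qed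
      have "rad norm {..<n} x = (\<Sum>\<epsilon>\<in>sg {..<n}. (s \<epsilon>)\<^sup>2) / 2 ^ n" by (simp add: rad_def s_def)
      also have "\<dots> \<le> (\<Sum>\<epsilon>\<in>sg {..<n}. real n * (lam + lam powr (1 - p) * s \<epsilon> powr p)) / 2 ^ n"
      proof (intro divide_right_mono sum_mono)
        fix \<epsilon> :: "nat \<Rightarrow> real" assume e: "\<epsilon> \<in> sg {..<n}"
        have "(s \<epsilon>)\<^sup>2 \<le> real n * s \<epsilon>"
          unfolding power2_eq_square by (rule mult_right_mono[OF sn[OF e]]) (simp add: s_def)
        also have "\<dots> \<le> real n * (lam + lam powr (1 - p) * s \<epsilon> powr p)" by (intro mult_left_mono s1) auto
        finally show "(s \<epsilon>)\<^sup>2 \<le> real n * (lam + lam powr (1 - p) * s \<epsilon> powr p)" .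
      qed auto
      also have "\<dots> = real n * (lam + lam powr (1 - p) * m)"
        by (simp add: m_def sum.distrib card_sg sum_distrib_left[symmetric] add_divide_distrib ring_distribs)
      also have "\<dots> \<le> real n * (lam + q / 2 * real n)"
      proof (intro mult_left_mono add_left_mono)
        have "lam powr (1 - p) * m \<le> lam powr (1 - p) * (T' powr p * (2 * real n * real n powr e))"
          by (intro mult_left_mono m) auto
        also have "\<dots> = (q / 2) powr (1 - p) * T' powr p * 2 * (real n powr (1 - p) * real n powr e) * real n"
        proof -
          have "lam powr (1 - p) = (q / 2) powr (1 - p) * real n powr (1 - p)"
            unfolding lam_def by (rule powr_mult)
          then show ?thesis by (simp only: mult_ac)
        qed
        also have "real n powr (1 - p) * real n powr e = real n powr (1 - p + e)" by (simp only: powr_add)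
        also have "(q / 2) powr (1 - p) * T' powr p * 2 * real n powr (1 - p + e) * real n \<le> q / 2 * real n"
          by (intro mult_right_mono) (use n1[OF nn(1)] in auto)
        finally show "lam powr (1 - p) * m \<le> q / 2 * real n" .
      qed auto
      also have "\<dots> = q * real n * real n" by (simp add: lam_def)
      finally show ?thesis .
    qed
    show ?thesis
      unfolding rad_bound_def
    proof (intro ballI)
      fix x :: "nat \<Rightarrow> 'x"
      define Q where "Q = (\<Sum>i<n. (norm (x i))\<^sup>2)"
      have Q0: "0 \<le> Q" by (auto simp: Q_def sum_nonneg)
      show "rad norm {..<n} x \<le> q * real n * (\<Sum>i<n. (norm (x i))\<^sup>2)"
      proof (cases "Q = 0")
        case True
        then have "x i = 0" if "i < n" for i using that by (simp add: Q_def sum_nonneg_eq_0_iff)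
        then show ?thesis using q by (simp add: rad_def sum_nonneg)
      next
        case False
        define c where "c = sqrt (real n / Q)"
        have c2: "c\<^sup>2 = real n / Q" unfolding c_def using Q0 by simp
        have "rad norm {..<n} (\<lambda>i. c *\<^sub>R x i) \<le> q * real n * real n"
        proof (rule main)
          have "(\<Sum>i<n. (norm (c *\<^sub>R x i))\<^sup>2) = c\<^sup>2 * Q"
            by (simp add: power_mult_distrib Q_def sum_distrib_left)
          then show "(\<Sum>i<n. (norm (c *\<^sub>R x i))\<^sup>2) = real n" using False by (simp add: c2)
        qed
        moreover have "rad norm {..<n} (\<lambda>i. c *\<^sub>R x i) = c\<^sup>2 * rad norm {..<n} x"
        proof -
          have "(\<Sum>a<n. \<epsilon> a *\<^sub>R c *\<^sub>R x a) = c *\<^sub>R (\<Sum>a<n. \<epsilon> a *\<^sub>R x a)" for \<epsilon> :: "nat \<Rightarrow> real"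
            unfolding scaleR_sum_right by (simp add: mult.commute)
          then show ?thesis
            by (simp add: rad_def power_mult_distrib sum_distrib_left)
        qed
        ultimately show ?thesis using Q0 False nn by (simp add: c2 Q_def field_simps)
      qed
    qed
  qed
  then show ?thesis by blast
qed

text \<open>For vectors \<open>y j\<close> indexed by the sign patterns \<open>j\<close> of length
  \<open>n\<close>, let \<open>Y i\<close> be the sum of the \<open>j i *\<^sub>R y j\<close>, and
  let \<open>x i\<close> be almost norming for \<open>Y i\<close>. The sum of the
  \<open>B (x i) (Y i)\<close> equals the sum over \<open>j\<close> of \<open>B\<close> applied to
  \<open>\<Sum>i. j i *\<^sub>R x i\<close> and \<open>y j\<close>, where the first arguments are
  all the signed sums of the \<open>x i\<close>. By Cauchy-Schwarz the bound for \<open>n\<close>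
  vectors in \<open>H\<close> becomes a bound for the \<open>Y i\<close>. Multiplying the
  \<open>y j\<close> by further random signs turns each \<open>Y i\<close> into a Rademacher sum of
  all \<open>2\<^sup>n\<close> vectors.\<close>

lemma rad_bound_dual:
  fixes B :: "'a::real_vector \<Rightarrow> 'b::real_vector \<Rightarrow> real"
  assumes N: "seminorm_on H N" and N': "seminorm_on H' N'"
    and addl: "\<And>x x' y. x \<in> H \<Longrightarrow> x' \<in> H \<Longrightarrow> y \<in> H' \<Longrightarrow> B (x + x') y = B x y + B x' y"
    and scl: "\<And>c x y. x \<in> H \<Longrightarrow> y \<in> H' \<Longrightarrow> B (c *\<^sub>R x) y = c * B x y"
    and addr: "\<And>x y y'. x \<in> H \<Longrightarrow> y \<in> H' \<Longrightarrow> y' \<in> H' \<Longrightarrow> B x (y + y') = B x y + B x y'"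
    and scr: "\<And>c x y. x \<in> H \<Longrightarrow> y \<in> H' \<Longrightarrow> B x (c *\<^sub>R y) = c * B x y"
    and le: "\<And>x y. x \<in> H \<Longrightarrow> y \<in> H' \<Longrightarrow> B x y \<le> N x * N' y"
    and norming: "\<And>y e. y \<in> H' \<Longrightarrow> e < 1 \<Longrightarrow> \<exists>x\<in>H. N x \<le> N' y \<and> e * (N' y)\<^sup>2 \<le> B x y"
    and b: "rad_bound N H n (q * real n)" and q: "0 \<le> q" and n: "0 < n"
  shows "rad_bound N' H' (2 ^ n) (q * real (2 ^ n))"
proof -
  define J where "J = (sg {..<n} :: (nat \<Rightarrow> real) set)"
  have fJ: "finite J" by (simp add: J_def finite_sg)
  have cJ: "card J = 2 ^ n" by (simp add: J_def card_sg)
  have sH: "subspace H" and sH': "subspace H'"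
    using seminorm_on_subspace[OF N] seminorm_on_subspace[OF N'] by auto
  have suml: "B (\<Sum>a\<in>A. c a *\<^sub>R x a) y = (\<Sum>a\<in>A. c a * B (x a) y)"
    if "finite A" "\<And>a. a \<in> A \<Longrightarrow> x a \<in> H" "y \<in> H'" for A :: "nat set" and c x y
    using that(1,2)
  proof (induction A rule: finite_induct)
    case empty
    have "0 \<in> H" using sH by (simp add: subspace_def)
    then show ?case using scl[of 0 y 0] that by simp
  next
    case (insert a A)
    have "(\<Sum>a\<in>A. c a *\<^sub>R x a) \<in> H" by (rule signed_sum_in[OF sH]) (use insert in auto)
    then show ?case using insert that subspace_scale[OF sH] by (simp add: addl scl)
  qed
  have sumr: "B x (\<Sum>a\<in>A. c a *\<^sub>R y a) = (\<Sum>a\<in>A. c a * B x (y a))"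
    if "finite A" "\<And>a. a \<in> A \<Longrightarrow> y a \<in> H'" "x \<in> H" for A :: "(nat \<Rightarrow> real) set" and c x y
    using that(1,2)
  proof (induction A rule: finite_induct)
    case empty
    have "0 \<in> H'" using sH' by (simp add: subspace_def)
    then show ?case using scr[of x 0 0] that by simp
  next
    case (insert a A)
    have "(\<Sum>a\<in>A. c a *\<^sub>R y a) \<in> H'" by (rule signed_sum_in[OF sH']) (use insert in auto)
    then show ?case using insert that subspace_scale[OF sH'] by (simp add: addr scr)
  qed
  \<comment> \<open>The estimate for the sums \<open>Y i\<close>, before randomisation.\<close>
  have pattern: "(\<Sum>i<n. (N' (\<Sum>j\<in>J. j i *\<^sub>R y j))\<^sup>2) \<le> q * real n * real (2 ^ n) * (\<Sum>j\<in>J. (N' (y j))\<^sup>2)"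
    if y: "\<And>j. j \<in> J \<Longrightarrow> y j \<in> H'" for y
  proof -
    define Y where "Y i = (\<Sum>j\<in>J. j i *\<^sub>R y j)" for i
    define P where "P = (\<Sum>i<n. (N' (Y i))\<^sup>2)"
    define R where "R = (\<Sum>j\<in>J. (N' (y j))\<^sup>2)"
    have YH: "Y i \<in> H'" for i unfolding Y_def by (rule signed_sum_in[OF sH' y])
    have P0: "0 \<le> P" "0 \<le> R" by (auto simp: P_def R_def sum_nonneg)
    have eP: "e * P \<le> sqrt R * sqrt (q * real n * real (2 ^ n) * P)" if e: "e < 1" for e
    proof -
      have "\<exists>x. \<forall>i. x i \<in> H \<and> N (x i) \<le> N' (Y i) \<and> e * (N' (Y i))\<^sup>2 \<le> B (x i) (Y i)"
        by (rule choice) (use norming[OF YH e] in auto)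
      then obtain x where x: "\<And>i. x i \<in> H" "\<And>i. N (x i) \<le> N' (Y i)"
        "\<And>i. e * (N' (Y i))\<^sup>2 \<le> B (x i) (Y i)" by blast
      define S where "S j = (\<Sum>i<n. j i *\<^sub>R x i)" for j :: "nat \<Rightarrow> real"
      have SH: "S j \<in> H" for j unfolding S_def by (rule signed_sum_in[OF sH x(1)])
      have "e * P = (\<Sum>i<n. e * (N' (Y i))\<^sup>2)" by (simp add: P_def sum_distrib_left)
      also have "\<dots> \<le> (\<Sum>i<n. B (x i) (Y i))" by (rule sum_mono[OF x(3)])
      also have "\<dots> = (\<Sum>i<n. \<Sum>j\<in>J. j i * B (x i) (y j))"
        unfolding Y_def by (intro sum.cong refl sumr fJ y x(1))
      also have "\<dots> = (\<Sum>j\<in>J. \<Sum>i<n. j i * B (x i) (y j))" by (rule sum.swap)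
      also have "\<dots> = (\<Sum>j\<in>J. B (S j) (y j))"
        unfolding S_def by (intro sum.cong refl suml[symmetric] y x(1)) auto
      also have "\<dots> \<le> (\<Sum>j\<in>J. N (S j) * N' (y j))" by (intro sum_mono le SH y)
      also have "\<dots> \<le> sqrt (\<Sum>j\<in>J. (N (S j))\<^sup>2) * sqrt R"
        using Cauchy_Schwarz_ineq_sum[of "\<lambda>j. N (S j)" "\<lambda>j. N' (y j)" J]
        by (simp add: R_def real_le_rsqrt flip: real_sqrt_mult)
      also have "\<dots> \<le> sqrt (q * real n * real (2 ^ n) * P) * sqrt R"
      proof (intro mult_right_mono real_sqrt_le_mono)
        have "(\<Sum>j\<in>J. (N (S j))\<^sup>2) = 2 ^ n * rad N {..<n} x"
          by (simp add: rad_def J_def S_def)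
        also have "\<dots> \<le> 2 ^ n * (q * real n * (\<Sum>i<n. (N (x i))\<^sup>2))"
        proof (rule mult_left_mono)
          have "x \<in> {..<n} \<rightarrow> H" using x(1) by simp
          then show "rad N {..<n} x \<le> q * real n * (\<Sum>i<n. (N (x i))\<^sup>2)"
            using b unfolding rad_bound_def by blast
        qed simp
        also have "\<dots> \<le> 2 ^ n * (q * real n * P)"
          unfolding P_def using q x seminorm_on_nonneg[OF N x(1)]
          by (intro mult_left_mono sum_mono power_mono) auto
        finally show "(\<Sum>j\<in>J. (N (S j))\<^sup>2) \<le> q * real n * real (2 ^ n) * P" by (simp add: mult_ac)
      qed (simp add: P0)
      finally show ?thesis by (simp add: mult.commute)
    qed
    have "P \<le> sqrt R * sqrt (q * real n * real (2 ^ n) * P)"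
    proof (rule field_le_mult_one_interval)
      fix z :: real assume "0 < z" "z < 1"
      then show "z * P \<le> sqrt R * sqrt (q * real n * real (2 ^ n) * P)" using eP by auto
    qed
    then have "P\<^sup>2 \<le> (sqrt R * sqrt (q * real n * real (2 ^ n) * P))\<^sup>2"
      using P0 by (intro power_mono) auto
    also have "\<dots> = R * (q * real n * real (2 ^ n) * P)"
      using P0 q by (simp add: power_mult_distrib)
    finally have "P * P \<le> (q * real n * real (2 ^ n) * R) * P" by (simp add: power2_eq_square mult_ac)
    then have "P \<le> q * real n * real (2 ^ n) * R"
      using P0 q by (cases "P = 0") auto
    then show ?thesis by (simp add: P_def R_def Y_def)
  qed
  have radJ: "rad N' J y \<le> q * real (2 ^ n) * (\<Sum>j\<in>J. (N' (y j))\<^sup>2)"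
    if y: "\<And>j. j \<in> J \<Longrightarrow> y j \<in> H'" for y
  proof -
    define R where "R = (\<Sum>j\<in>J. (N' (y j))\<^sup>2)"
    have "real n * rad N' J y = (\<Sum>i<n. rad N' J (\<lambda>j. j i *\<^sub>R y j))"
    proof -
      have "rad N' J (\<lambda>j. j i *\<^sub>R y j) = rad N' J y" if "i < n" for i
        by (rule rad_flip) (use that in \<open>auto simp: J_def sg_def\<close>)
      then show ?thesis by simp
    qed
    also have "\<dots> = (\<Sum>\<epsilon>\<in>sg J. \<Sum>i<n. (N' (\<Sum>j\<in>J. j i *\<^sub>R \<epsilon> j *\<^sub>R y j))\<^sup>2) / 2 ^ card J"
      unfolding rad_def sum_divide_distrib[symmetric]
      by (subst sum.swap) (simp add: mult.commute)
    also have "\<dots> \<le> (\<Sum>\<epsilon>\<in>sg J. q * real n * real (2 ^ n) * R) / 2 ^ card J"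
    proof (intro divide_right_mono sum_mono)
      fix \<epsilon> :: "(nat \<Rightarrow> real) \<Rightarrow> real" assume e: "\<epsilon> \<in> sg J"
      have "(\<Sum>i<n. (N' (\<Sum>j\<in>J. j i *\<^sub>R \<epsilon> j *\<^sub>R y j))\<^sup>2) \<le>
          q * real n * real (2 ^ n) * (\<Sum>j\<in>J. (N' (\<epsilon> j *\<^sub>R y j))\<^sup>2)"
        by (rule pattern) (use y subspace_scale[OF sH'] in auto)
      also have "(\<Sum>j\<in>J. (N' (\<epsilon> j *\<^sub>R y j))\<^sup>2) = R"
        unfolding R_def using sg_values[OF e] seminorm_on_scale[OF N' y] by (intro sum.cong refl) force
      finally show "(\<Sum>i<n. (N' (\<Sum>j\<in>J. j i *\<^sub>R \<epsilon> j *\<^sub>R y j))\<^sup>2) \<le> q * real n * real (2 ^ n) * R" .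
    qed auto
    also have "\<dots> = real n * (q * real (2 ^ n) * R)" using fJ by (simp add: card_sg mult_ac)
    finally show ?thesis using n by (simp add: R_def)
  qed
  obtain h where h: "bij_betw h J {..<2 ^ n :: nat}"
    using ex_bij_betw_finite_nat[OF fJ] by (auto simp: cJ atLeast0LessThan)
  show ?thesis
    unfolding rad_bound_def
  proof (intro ballI)
    fix y assume y: "y \<in> {..<2 ^ n :: nat} \<rightarrow> H'"
    have "rad N' {..<2 ^ n} y = rad N' J (\<lambda>j. y (h j))" by (rule rad_reindex[OF h])
    also have "\<dots> \<le> q * real (2 ^ n) * (\<Sum>j\<in>J. (N' (y (h j)))\<^sup>2)"
      by (rule radJ) (use y bij_betwE[OF h] in auto)
    also have "(\<Sum>j\<in>J. (N' (y (h j)))\<^sup>2) = (\<Sum>i<2 ^ n. (N' (y i))\<^sup>2)"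
      by (rule sum.reindex_bij_betw[OF h, of "\<lambda>i. (N' (y i))\<^sup>2"])
    finally show "rad N' {..<2 ^ n} y \<le> q * real (2 ^ n) * (\<Sum>i<2 ^ n. (N' (y i))\<^sup>2)" .
  qed
qed


section \<open>Equivalent norms on a complex Hilbert space\<close>

text \<open>A complex Hilbert space in real terms: \<open>ip\<close> is the real part of the inner
  product, \<open>I\<close> the multiplication by the imaginary unit and \<open>K\<close> a complex
  conjugation. The form may be degenerate, so that \<open>H\<close> can consist of functions where
  the Hilbert space proper consists of classes of functions; completeness refers to the resulting
  seminorm.\<close>

locale cx_hilbert =
  fixes H :: "'f::real_vector set" and ip :: "'f \<Rightarrow> 'f \<Rightarrow> real" and I K :: "'f \<Rightarrow> 'f"
  assumes H: "subspace H"
    and ip_commute: "x \<in> H \<Longrightarrow> y \<in> H \<Longrightarrow> ip x y = ip y x"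
    and ip_add: "x \<in> H \<Longrightarrow> y \<in> H \<Longrightarrow> z \<in> H \<Longrightarrow> ip (x + y) z = ip x z + ip y z"
    and ip_scale: "x \<in> H \<Longrightarrow> y \<in> H \<Longrightarrow> ip (a *\<^sub>R x) y = a * ip x y"
    and ip_nonneg: "x \<in> H \<Longrightarrow> 0 \<le> ip x x"
    and I_in: "x \<in> H \<Longrightarrow> I x \<in> H" and I_add: "I (x + y) = I x + I y"
    and I_scale: "I (a *\<^sub>R x) = a *\<^sub>R I x" and I_I: "I (I x) = - x"
    and ip_I: "x \<in> H \<Longrightarrow> y \<in> H \<Longrightarrow> ip (I x) (I y) = ip x y"
    and K_in: "x \<in> H \<Longrightarrow> K x \<in> H" and K_add: "K (x + y) = K x + K y"
    and K_scale: "K (a *\<^sub>R x) = a *\<^sub>R K x" and K_K: "K (K x) = x" and K_I: "K (I x) = - I (K x)"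
    and ip_K: "x \<in> H \<Longrightarrow> y \<in> H \<Longrightarrow> ip (K x) (K y) = ip x y"
    and complete: "(\<And>n::nat. U n \<in> H) \<Longrightarrow>
        (\<And>e. e > 0 \<Longrightarrow> \<exists>M. \<forall>m\<ge>M. \<forall>n\<ge>M. ip (U m - U n) (U m - U n) < e) \<Longrightarrow>
        \<exists>x\<in>H. (\<lambda>n. ip (U n - x) (U n - x)) \<longlonglongrightarrow> 0"
begin

lemma zero_in [simp]: "0 \<in> H" and add_in [simp]: "x \<in> H \<Longrightarrow> y \<in> H \<Longrightarrow> x + y \<in> H"
  and scale_in [simp]: "x \<in> H \<Longrightarrow> a *\<^sub>R x \<in> H" and diff_in [simp]: "x \<in> H \<Longrightarrow> y \<in> H \<Longrightarrow> x - y \<in> H"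
  and minus_in [simp]: "x \<in> H \<Longrightarrow> - x \<in> H"
  using H subspace_diff[OF H] subspace_neg[OF H] by (auto simp: subspace_def)

declare I_in [simp] K_in [simp]

lemma I_minus: "I (- x) = - I x" using I_scale[of "-1" x] by simp
lemma K_minus: "K (- x) = - K x" using K_scale[of "-1" x] by simp
lemma I_diff: "I (x - y) = I x - I y" using I_add[of x "- y"] by (simp add: I_minus)
lemma K_diff: "K (x - y) = K x - K y" using K_add[of x "- y"] by (simp add: K_minus)
lemma I_zero: "I 0 = 0" using I_scale[of 0 0] by simp
lemma K_zero: "K 0 = 0" using K_scale[of 0 0] by simp

lemma ip_minus: "x \<in> H \<Longrightarrow> y \<in> H \<Longrightarrow> ip (- x) y = - ip x y"
  using ip_scale[of x y "-1"] by simp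
lemma ip_diff: "x \<in> H \<Longrightarrow> y \<in> H \<Longrightarrow> z \<in> H \<Longrightarrow> ip (x - y) z = ip x z - ip y z"
  using ip_add[of x "- y" z] by (simp add: ip_minus)
lemma ip_zero: "y \<in> H \<Longrightarrow> ip 0 y = 0" using ip_scale[of 0 y 0] by simp
lemma ip_add_right: "x \<in> H \<Longrightarrow> y \<in> H \<Longrightarrow> z \<in> H \<Longrightarrow> ip z (x + y) = ip z x + ip z y"
  by (simp add: ip_commute[of z] ip_add)
lemma ip_scale_right: "x \<in> H \<Longrightarrow> y \<in> H \<Longrightarrow> ip y (a *\<^sub>R x) = a * ip y x"
  by (simp add: ip_commute[of y] ip_scale)
lemma ip_minus_right: "x \<in> H \<Longrightarrow> y \<in> H \<Longrightarrow> ip y (- x) = - ip y x"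
  by (simp add: ip_commute[of y] ip_minus)
lemma ip_diff_right: "x \<in> H \<Longrightarrow> y \<in> H \<Longrightarrow> z \<in> H \<Longrightarrow> ip z (x - y) = ip z x - ip z y"
  by (simp add: ip_commute[of z] ip_diff)
lemma ip_zero_right: "y \<in> H \<Longrightarrow> ip y 0 = 0" by (simp add: ip_commute[of y] ip_zero)

lemmas ip_simps = ip_add ip_scale ip_minus ip_diff ip_zero
  ip_add_right ip_scale_right ip_minus_right ip_diff_right ip_zero_right

lemma ip_I_right: "x \<in> H \<Longrightarrow> y \<in> H \<Longrightarrow> ip x (I y) = - ip (I x) y"
  using ip_I[of x "I y"] by (simp add: I_I ip_minus_right)

lemma ip_K_right: "x \<in> H \<Longrightarrow> y \<in> H \<Longrightarrow> ip (K x) y = ip x (K y)"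
  using ip_K[of x "K y"] by (simp add: K_K)

definition hnorm :: "'f \<Rightarrow> real" where "hnorm x = sqrt (ip x x)"

lemma hnorm_sq: "x \<in> H \<Longrightarrow> (hnorm x)\<^sup>2 = ip x x" by (simp add: hnorm_def ip_nonneg)
lemma hnorm_nonneg: "x \<in> H \<Longrightarrow> 0 \<le> hnorm x" by (simp add: hnorm_def ip_nonneg)
lemma hnorm_I: "x \<in> H \<Longrightarrow> hnorm (I x) = hnorm x" by (simp add: hnorm_def ip_I)
lemma hnorm_K: "x \<in> H \<Longrightarrow> hnorm (K x) = hnorm x" by (simp add: hnorm_def ip_K)

lemma Cauchy_Schwarz:
  assumes x: "x \<in> H" and y: "y \<in> H"
  shows "ip x y \<le> hnorm x * hnorm y"
proof -
  have q: "0 \<le> ip x x + 2 * t * ip x y + t\<^sup>2 * ip y y" for t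
  proof -
    have "0 \<le> ip (x + t *\<^sub>R y) (x + t *\<^sub>R y)" by (rule ip_nonneg) (use x y in simp)
    also have "\<dots> = ip x x + 2 * t * ip x y + t\<^sup>2 * ip y y"
      using x y ip_commute[OF y x] by (simp add: ip_simps power2_eq_square algebra_simps)
    finally show ?thesis .
  qed
  have "(ip x y)\<^sup>2 \<le> ip x x * ip y y"
  proof (cases "ip y y = 0")
    case True
    have "ip x y = 0"
    proof (rule ccontr)
      assume n: "ip x y \<noteq> 0"
      have "0 \<le> ip x x + 2 * (- (ip x x + 1) / (2 * ip x y)) * ip x y" using q[of "- (ip x x + 1) / (2 * ip x y)"] True by simp
      also have "\<dots> = -1" using n by simp
      finally show False by simp
    qed
    then show ?thesis by (simp add: True)
  next
    case False
    then have p: "ip y y > 0" using ip_nonneg[OF y] by simp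
    have "0 \<le> ip x x + 2 * (- ip x y / ip y y) * ip x y + (- ip x y / ip y y)\<^sup>2 * ip y y" by (rule q)
    also have "\<dots> = ip x x - (ip x y)\<^sup>2 / ip y y"
      using p by (simp add: power2_eq_square)
    finally show ?thesis using p by (simp add: field_simps)
  qed
  then have "\<bar>ip x y\<bar> \<le> sqrt (ip x x * ip y y)" by (simp add: real_le_rsqrt)
  then show ?thesis by (simp add: hnorm_def real_sqrt_mult)
qed

lemma Cauchy_Schwarz_abs:
  assumes x: "x \<in> H" and y: "y \<in> H"
  shows "\<bar>ip x y\<bar> \<le> hnorm x * hnorm y"
proof -
  have "hnorm (- x) = hnorm x" using x by (simp add: hnorm_def ip_minus ip_minus_right)
  then show ?thesis
    using Cauchy_Schwarz[OF x y] Cauchy_Schwarz[of "- x" y] x y by (simp add: ip_minus abs_le_iff)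
qed

lemma hnorm_seminorm: "seminorm_on H hnorm"
  unfolding seminorm_on_def
proof (intro conjI ballI allI H hnorm_nonneg)
  fix x y assume xy: "x \<in> H" "y \<in> H"
  have "(hnorm (x + y))\<^sup>2 = (hnorm x)\<^sup>2 + 2 * ip x y + (hnorm y)\<^sup>2"
    using xy ip_commute[OF xy] by (simp add: hnorm_sq ip_simps)
  also have "\<dots> \<le> (hnorm x + hnorm y)\<^sup>2"
    using Cauchy_Schwarz[OF xy] by (simp add: power2_sum)
  finally show "hnorm (x + y) \<le> hnorm x + hnorm y"
    by (rule power2_le_imp_le) (use xy hnorm_nonneg in auto)
next
  fix a x assume x: "x \<in> H"
  show "hnorm (a *\<^sub>R x) = \<bar>a\<bar> * hnorm x"
    using x by (simp add: hnorm_def ip_simps real_sqrt_mult flip: mult.assoc)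
qed

text \<open>The point \<open>z\<close> minimises the functional \<open>ip x x - 2 * f x\<close> on
  the closed convex set \<open>C\<close>: minimising sequences are Cauchy by the parallelogram
  identity, and the inequality is the first-order condition along the segment from \<open>z\<close>
  to \<open>k\<close>. For \<open>C = H\<close> this is the Riesz representation of
  \<open>f\<close>; for \<open>f = ip x\<close> it is the projection of \<open>x\<close> to
  \<open>C\<close>.\<close>

lemma variational_inequality:
  assumes C: "C \<subseteq> H" "C \<noteq> {}"
    and conv: "\<And>x y t. x \<in> C \<Longrightarrow> y \<in> C \<Longrightarrow> 0 \<le> t \<Longrightarrow> t \<le> 1 \<Longrightarrow> x + t *\<^sub>R (y - x) \<in> C"
    and closed: "\<And>U x. (\<And>n::nat. U n \<in> C) \<Longrightarrow> x \<in> H \<Longrightarrow> (\<lambda>n. ip (U n - x) (U n - x)) \<longlonglongrightarrow> 0 \<Longrightarrow> x \<in> C"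
    and f_add: "\<And>x y. x \<in> H \<Longrightarrow> y \<in> H \<Longrightarrow> f (x + y) = f x + f y"
    and f_scale: "\<And>a x. x \<in> H \<Longrightarrow> f (a *\<^sub>R x) = a * f x"
    and f_bound: "\<And>x. x \<in> H \<Longrightarrow> f x \<le> B * hnorm x"
  shows "\<exists>z\<in>C. \<forall>k\<in>C. f (k - z) \<le> ip z (k - z)"
proof -
  define Q where "Q x = ip x x - 2 * f x" for x
  have CH: "x \<in> H" if "x \<in> C" for x using that C by auto
  have expand: "Q (z + h) = Q z + ip h h + 2 * ip z h - 2 * f h" if "z \<in> H" "h \<in> H" for z h
    using that ip_commute[OF that] by (simp add: Q_def f_add ip_simps)
  have low: "- B\<^sup>2 \<le> Q x" if "x \<in> C" for x
  proof -
    have "0 \<le> (hnorm x - B)\<^sup>2" by simp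
    also have "\<dots> = ip x x - 2 * (B * hnorm x) + B\<^sup>2" using hnorm_sq[OF CH[OF that]] by (simp add: power2_diff)
    finally show ?thesis using f_bound[OF CH[OF that]] by (simp add: Q_def)
  qed
  define d where "d = (INF x\<in>C. Q x)"
  have bdd: "bdd_below (Q ` C)" by (rule bdd_belowI2[of _ "- B\<^sup>2"]) (rule low)
  have dle: "d \<le> Q x" if "x \<in> C" for x unfolding d_def by (rule cINF_lower[OF bdd that])
  have "\<exists>x\<in>C. Q x < d + 1 / real (Suc n)" for n
    using cINF_less_iff[OF C(2) bdd, of "d + 1 / real (Suc n)"] by (simp add: d_def)
  then obtain U where U: "\<And>n. U n \<in> C" "\<And>n. Q (U n) < d + 1 / real (Suc n)" by metis
  have par: "ip (x - y) (x - y) \<le> 2 * (Q x - d) + 2 * (Q y - d)" if xy: "x \<in> C" "y \<in> C" for x y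
  proof -
    define h where "h = (1 / 2) *\<^sub>R (y - x)"
    have H3: "x \<in> H" "y \<in> H" "h \<in> H" using xy CH by (auto simp: h_def)
    have y: "y = x + 2 *\<^sub>R h" by (simp add: h_def)
    have m: "x + h \<in> C" unfolding h_def by (rule conv) (use xy in auto)
    have "ip (x - y) (x - y) = 4 * ip h h"
    proof -
      have "x - y = (- 2) *\<^sub>R h" by (simp add: h_def)
      then show ?thesis using H3 by (simp only: ip_scale ip_scale_right scale_in)
    qed
    moreover have "Q (x + h) = Q x + ip h h + 2 * ip x h - 2 * f h" by (rule expand) (use H3 in auto)
    moreover have "Q y = Q x + 4 * ip h h + 4 * ip x h - 4 * f h"
      unfolding y using expand[of x "2 *\<^sub>R h"] H3 by (simp add: ip_simps f_scale)
    ultimately have "2 * (Q x - d) + 2 * (Q y - d) = ip (x - y) (x - y) + 4 * (Q (x + h) - d)"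
      by simp
    then show ?thesis using dle[OF m] by simp
  qed
  obtain z where z: "z \<in> H" "(\<lambda>n. ip (U n - z) (U n - z)) \<longlonglongrightarrow> 0"
  proof (rule bexE[OF complete[of U]])
    show "U n \<in> H" for n by (rule CH[OF U(1)])
    fix e :: real assume e: "e > 0"
    obtain M where M: "1 / real (Suc M) < e / 4" using e nat_approx_posE[of "e / 4"] by auto
    have "ip (U m - U n) (U m - U n) < e" if "m \<ge> M" "n \<ge> M" for m n
    proof -
      have "1 / real (Suc m) \<le> 1 / real (Suc M)" "1 / real (Suc n) \<le> 1 / real (Suc M)"
        using that by (auto intro!: divide_left_mono)
      then have "Q (U m) < d + e / 4" "Q (U n) < d + e / 4"
        using U(2)[of m] U(2)[of n] M by linarith+
      then show ?thesis using par[OF U(1) U(1), of m n] by simp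
    qed
    then show "\<exists>M. \<forall>m\<ge>M. \<forall>n\<ge>M. ip (U m - U n) (U m - U n) < e" by blast
  qed auto
  have zC: "z \<in> C" by (rule closed[OF U(1) z])
  have "Q z \<le> d"
  proof (rule LIMSEQ_le_const)
    have h0: "(\<lambda>n. hnorm (U n - z)) \<longlonglongrightarrow> 0"
      using tendsto_real_sqrt[OF z(2)] by (simp add: hnorm_def)
    have "(\<lambda>n. d + 1 / real (Suc n) + 2 * (hnorm z + B) * hnorm (U n - z)) \<longlonglongrightarrow> d + 0 + 2 * (hnorm z + B) * 0"
      by (intro tendsto_intros h0 LIMSEQ_Suc[OF lim_1_over_n])
    then show "(\<lambda>n. d + 1 / real (Suc n) + 2 * (hnorm z + B) * hnorm (U n - z)) \<longlonglongrightarrow> d" by simp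
    have "Q z \<le> d + 1 / real (Suc n) + 2 * (hnorm z + B) * hnorm (U n - z)" for n
    proof -
      define w where "w = U n - z"
      have w: "w \<in> H" "U n = z + w" using CH[OF U(1)] z by (auto simp: w_def)
      have "Q (U n) = Q z + ip w w + 2 * ip z w - 2 * f w" unfolding w(2) by (rule expand) (use w z in auto)
      moreover have "0 \<le> ip w w" by (rule ip_nonneg[OF w(1)])
      moreover have "- ip z w \<le> hnorm z * hnorm w" using Cauchy_Schwarz_abs[OF z(1) w(1)] by linarith
      moreover have "f w \<le> B * hnorm w" by (rule f_bound[OF w(1)])
      ultimately have "Q z \<le> Q (U n) + 2 * (hnorm z * hnorm w) + 2 * (B * hnorm w)" by linarith
      also have "\<dots> \<le> d + 1 / real (Suc n) + 2 * (hnorm z + B) * hnorm w" using U(2)[of n] by (simp add: algebra_simps)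
      finally show ?thesis by (simp add: w_def)
    qed
    then show "\<exists>N. \<forall>n\<ge>N. Q z \<le> d + 1 / real (Suc n) + 2 * (hnorm z + B) * hnorm (U n - z)" by blast
  qed
  then have min: "Q z \<le> Q x" if "x \<in> C" for x using dle[OF that] by simp
  have "f (k - z) \<le> ip z (k - z)" if k: "k \<in> C" for k
  proof (rule ccontr)
    define h where "h = k - z"
    have h: "h \<in> H" using CH[OF k] z by (simp add: h_def)
    define D where "D = f h - ip z h"
    assume "\<not> f (k - z) \<le> ip z (k - z)"
    then have D: "D > 0" by (simp add: D_def h_def)
    \<comment> \<open>A step so short that the quadratic term in \<open>t\<close> does not outweigh the
      linear one.\<close>
    define t where "t = min 1 (D / (ip h h + 1))"
    have hh: "0 \<le> ip h h" by (rule ip_nonneg[OF h])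
    have t: "0 < t" "t \<le> 1" using D hh by (auto simp: t_def)
    have "Q z \<le> Q (z + t *\<^sub>R h)" by (rule min, unfold h_def, rule conv) (use zC k t in auto)
    also have "\<dots> = Q z + t * (t * ip h h - 2 * D)"
      using expand[of z "t *\<^sub>R h"] z h by (simp add: ip_simps f_scale D_def algebra_simps)
    finally have "0 \<le> t * (t * ip h h - 2 * D)" by simp
    then have "2 * D \<le> t * ip h h" using t by (simp add: zero_le_mult_iff)
    also have "\<dots> \<le> D / (ip h h + 1) * ip h h" by (intro mult_right_mono hh) (simp add: t_def)
    also have "\<dots> \<le> D" using D hh by (simp add: field_simps)
    finally show False using D by simp
  qed
  then show ?thesis using zC by blast
qed

lemma Riesz_representation:
  assumes f_add: "\<And>x y. x \<in> H \<Longrightarrow> y \<in> H \<Longrightarrow> f (x + y) = f x + f y"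
    and f_scale: "\<And>a x. x \<in> H \<Longrightarrow> f (a *\<^sub>R x) = a * f x"
    and f_bound: "\<And>x. x \<in> H \<Longrightarrow> f x \<le> B * hnorm x"
  shows "\<exists>z\<in>H. \<forall>x\<in>H. f x = ip x z"
proof -
  obtain z where z: "z \<in> H" "\<And>k. k \<in> H \<Longrightarrow> f (k - z) \<le> ip z (k - z)"
    using variational_inequality[of H f B, OF _ _ _ _ f_add f_scale f_bound] zero_in by fastforce
  have "f x = ip x z" if x: "x \<in> H" for x
  proof -
    have "f x \<le> ip z x" using z(2)[of "z + x"] x z by simp
    moreover have "f (- x) \<le> ip z (- x)" using z(2)[of "z + - x"] x z by simp
    moreover have "f (- x) = - f x" using f_scale[of x "-1"] x by simp
    ultimately show ?thesis using ip_commute[OF x z(1)] x z by (simp add: ip_minus_right)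
  qed
  then show ?thesis using z by blast
qed

text \<open>The complex homogeneous seminorms that are equivalent to the Hilbert seminorm.\<close>

definition cx_norm :: "('f \<Rightarrow> real) \<Rightarrow> bool" where
  "cx_norm N \<longleftrightarrow> seminorm_on H N \<and>
     (\<forall>x\<in>H. \<forall>a b. a\<^sup>2 + b\<^sup>2 = 1 \<longrightarrow> N (a *\<^sub>R x + b *\<^sub>R I x) = N x) \<and>
     (\<exists>c>0. \<forall>x\<in>H. c * hnorm x \<le> N x) \<and> (\<exists>d. \<forall>x\<in>H. N x \<le> d * hnorm x)"

lemma
  assumes "cx_norm N"
  shows cx_norm_seminorm: "seminorm_on H N"
    and cx_norm_rotate: "x \<in> H \<Longrightarrow> a\<^sup>2 + b\<^sup>2 = 1 \<Longrightarrow> N (a *\<^sub>R x + b *\<^sub>R I x) = N x"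
  using assms by (auto simp: cx_norm_def)

lemma cx_norm_zero_iff:
  assumes "cx_norm N" "x \<in> H"
  shows "N x = 0 \<longleftrightarrow> hnorm x = 0"
proof -
  obtain c d where c: "c > 0" "c * hnorm x \<le> N x" and d: "N x \<le> d * hnorm x"
    using assms by (auto simp: cx_norm_def)
  have n: "0 \<le> N x" by (rule seminorm_on_nonneg[OF cx_norm_seminorm[OF assms(1)] assms(2)])
  show ?thesis
  proof
    assume "N x = 0"
    then have "c * hnorm x \<le> 0" using c by simp
    then show "hnorm x = 0" using c(1) hnorm_nonneg[OF assms(2)] by (simp add: mult_le_0_iff)
  next
    assume "hnorm x = 0"
    then show "N x = 0" using d n by simp
  qed
qed

text \<open>The pairing of \<open>x\<close> and \<open>y\<close> through \<open>K\<close> is the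
  real part of a bilinear rather than a sesquilinear form. The dual space is thus again
  \<open>H\<close>, by a complex linear identification.\<close>

definition dual_norm :: "('f \<Rightarrow> real) \<Rightarrow> 'f \<Rightarrow> real" where
  "dual_norm N y = (SUP x\<in>{x \<in> H. N x \<le> 1}. ip x (K y))"

lemma dual_norm_bdd:
  assumes N: "cx_norm N" and y: "y \<in> H"
  shows "bdd_above ((\<lambda>x. ip x (K y)) ` {x \<in> H. N x \<le> 1})"
proof -
  obtain c where c: "c > 0" "\<And>x. x \<in> H \<Longrightarrow> c * hnorm x \<le> N x" using N by (auto simp: cx_norm_def)
  show ?thesis
  proof (rule bdd_aboveI2)
    fix x assume x: "x \<in> {x \<in> H. N x \<le> 1}"
    have "hnorm x \<le> 1 / c" using c(2)[of x] x c(1) by (simp add: field_simps) 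
    then have "hnorm x * hnorm y \<le> 1 / c * hnorm y" by (rule mult_right_mono) (rule hnorm_nonneg[OF y])
    then show "ip x (K y) \<le> 1 / c * hnorm y" using Cauchy_Schwarz[of x "K y"] x y by (simp add: hnorm_K)
  qed
qed

lemma dual_norm_least:
  assumes N: "cx_norm N" and le: "\<And>x. x \<in> H \<Longrightarrow> N x \<le> 1 \<Longrightarrow> ip x (K y) \<le> M"
  shows "dual_norm N y \<le> M"
proof -
  have "0 \<in> {x \<in> H. N x \<le> 1}" using seminorm_on_zero[OF cx_norm_seminorm[OF N]] by simp
  then have "{x \<in> H. N x \<le> 1} \<noteq> {}" by blast
  then show ?thesis unfolding dual_norm_def by (rule cSUP_least) (use le in auto)
qed

lemma dual_norm_upper1:
  assumes N: "cx_norm N" and x: "x \<in> H" "N x \<le> 1" and y: "y \<in> H"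
  shows "ip x (K y) \<le> dual_norm N y"
  unfolding dual_norm_def by (rule cSUP_upper[OF _ dual_norm_bdd[OF N y]]) (use x in auto)

lemma dual_norm_nonneg: "cx_norm N \<Longrightarrow> y \<in> H \<Longrightarrow> 0 \<le> dual_norm N y"
  using dual_norm_upper1[of N 0 y] seminorm_on_zero[OF cx_norm_seminorm, of N] by (simp add: ip_zero)

lemma dual_norm_upper:
  assumes N: "cx_norm N" and x: "x \<in> H" and y: "y \<in> H"
  shows "ip x (K y) \<le> N x * dual_norm N y"
proof (cases "N x = 0")
  case True
  then have "hnorm x = 0" using cx_norm_zero_iff[OF N x] by simp
  then show ?thesis using Cauchy_Schwarz[OF x K_in[OF y]] True by simp
next
  case False
  then have p: "N x > 0" using seminorm_on_nonneg[OF cx_norm_seminorm[OF N] x] by simp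
  have "ip ((1 / N x) *\<^sub>R x) (K y) \<le> dual_norm N y"
    by (rule dual_norm_upper1[OF N _ _ y]) (use x p seminorm_on_scale[OF cx_norm_seminorm[OF N] x] in auto)
  then show ?thesis using x y p by (simp add: ip_simps field_simps)
qed

text \<open>The supremum need not be attained, which is why there is a factor
  \<open>e < 1\<close>.\<close>

lemma dual_norm_norming:
  assumes N: "cx_norm N" and y: "y \<in> H" and e: "e < 1"
  shows "\<exists>x\<in>H. N x \<le> dual_norm N y \<and> e * (dual_norm N y)\<^sup>2 \<le> ip x (K y)"
proof (cases "dual_norm N y = 0")
  case True
  have "N 0 = 0" by (rule seminorm_on_zero[OF cx_norm_seminorm[OF N]])
  then show ?thesis using True y by (intro bexI[of _ 0]) (auto simp: ip_zero)
next
  case False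
  then have p: "dual_norm N y > 0" using dual_norm_nonneg[OF N y] by simp
  then have "e * dual_norm N y < dual_norm N y" using e by simp
  moreover have "{x \<in> H. N x \<le> 1} \<noteq> {}" using seminorm_on_zero[OF cx_norm_seminorm[OF N]] by (auto intro!: exI[of _ 0])
  ultimately obtain x where x: "x \<in> H" "N x \<le> 1" "e * dual_norm N y < ip x (K y)"
    using less_cSUP_iff[OF _ dual_norm_bdd[OF N y], of "e * dual_norm N y"] unfolding dual_norm_def[symmetric] by auto
  have "N (dual_norm N y *\<^sub>R x) \<le> dual_norm N y"
    using seminorm_on_scale[OF cx_norm_seminorm[OF N] x(1), of "dual_norm N y"] p x(2) by simp
  moreover have "e * (dual_norm N y)\<^sup>2 \<le> ip (dual_norm N y *\<^sub>R x) (K y)"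
  proof -
    have "dual_norm N y * (e * dual_norm N y) \<le> dual_norm N y * ip x (K y)" using x(3) p by (intro mult_left_mono) auto
    then show ?thesis using x y by (simp add: ip_simps power2_eq_square mult_ac)
  qed
  ultimately show ?thesis using x(1) by (intro bexI[of _ "dual_norm N y *\<^sub>R x"]) auto
qed

lemma rotate_in [simp]: "x \<in> H \<Longrightarrow> a *\<^sub>R x + b *\<^sub>R I x \<in> H" by simp

lemma rotate_back:
  assumes "a\<^sup>2 + b\<^sup>2 = 1"
  shows "a *\<^sub>R (a *\<^sub>R x + b *\<^sub>R I x) + (- b) *\<^sub>R I (a *\<^sub>R x + b *\<^sub>R I x) = x"
proof -
  have "a *\<^sub>R (a *\<^sub>R x + b *\<^sub>R I x) + (- b) *\<^sub>R I (a *\<^sub>R x + b *\<^sub>R I x) = (a\<^sup>2 + b\<^sup>2) *\<^sub>R x"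
    by (simp add: I_add I_scale I_I scaleR_add_right scaleR_diff_right scaleR_add_left power2_eq_square mult.commute)
  then show ?thesis by (simp add: assms)
qed

lemma ip_K_rotate:
  assumes "x \<in> H" "y \<in> H"
  shows "ip x (K (a *\<^sub>R y + b *\<^sub>R I y)) = ip (a *\<^sub>R x + b *\<^sub>R I x) (K y)"
  using assms by (simp add: K_add K_scale K_I ip_simps ip_I_right)

lemma dual_norm_cx_norm:
  assumes N: "cx_norm N"
  shows "cx_norm (dual_norm N)"
proof -
  note sN = cx_norm_seminorm[OF N]
  have sc: "dual_norm N (a *\<^sub>R y) \<le> \<bar>a\<bar> * dual_norm N y" if y: "y \<in> H" for a y
  proof (rule dual_norm_least[OF N])
    fix x assume x: "x \<in> H" "N x \<le> 1"
    have "ip x (K (a *\<^sub>R y)) = ip (a *\<^sub>R x) (K y)" using x y by (simp add: K_scale ip_simps)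
    also have "\<dots> \<le> N (a *\<^sub>R x) * dual_norm N y" by (rule dual_norm_upper[OF N]) (use x y in auto)
    also have "\<dots> = \<bar>a\<bar> * N x * dual_norm N y" by (simp add: seminorm_on_scale[OF sN x(1)])
    also have "\<dots> \<le> \<bar>a\<bar> * 1 * dual_norm N y"
      by (intro mult_right_mono mult_left_mono x dual_norm_nonneg[OF N y]) auto
    finally show "ip x (K (a *\<^sub>R y)) \<le> \<bar>a\<bar> * dual_norm N y" by simp
  qed
  have "seminorm_on H (dual_norm N)"
    unfolding seminorm_on_def
  proof (intro conjI ballI allI H dual_norm_nonneg[OF N])
    fix x y assume xy: "x \<in> H" "y \<in> H"
    show "dual_norm N (x + y) \<le> dual_norm N x + dual_norm N y"
    proof (rule dual_norm_least[OF N])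
      fix w assume w: "w \<in> H" "N w \<le> 1"
      show "ip w (K (x + y)) \<le> dual_norm N x + dual_norm N y"
        using dual_norm_upper1[OF N w xy(1)] dual_norm_upper1[OF N w xy(2)] w xy by (simp add: K_add ip_simps)
    qed
  next
    fix a y assume y: "y \<in> H"
    show "dual_norm N (a *\<^sub>R y) = \<bar>a\<bar> * dual_norm N y"
    proof (cases "a = 0")
      case True
      then show ?thesis using sc[OF y, of 0] dual_norm_nonneg[OF N zero_in] by simp
    next
      case False
      have "dual_norm N y = dual_norm N ((1 / a) *\<^sub>R (a *\<^sub>R y))" using False by simp
      also have "\<dots> \<le> \<bar>1 / a\<bar> * dual_norm N (a *\<^sub>R y)" by (rule sc) (use y in simp)
      finally have "\<bar>a\<bar> * dual_norm N y \<le> dual_norm N (a *\<^sub>R y)" using False by (simp add: field_simps)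
      then show ?thesis using sc[OF y, of a] by simp
    qed
  qed
  moreover have "dual_norm N (a *\<^sub>R y + b *\<^sub>R I y) = dual_norm N y" if y: "y \<in> H" and ab: "a\<^sup>2 + b\<^sup>2 = 1" for a b y
  proof (rule antisym)
    have le: "dual_norm N (a *\<^sub>R y + b *\<^sub>R I y) \<le> dual_norm N y" if y: "y \<in> H" and ab: "a\<^sup>2 + b\<^sup>2 = 1" for a b y
    proof (rule dual_norm_least[OF N])
      fix x assume x: "x \<in> H" "N x \<le> 1"
      show "ip x (K (a *\<^sub>R y + b *\<^sub>R I y)) \<le> dual_norm N y"
        unfolding ip_K_rotate[OF x(1) y]
        by (rule dual_norm_upper1[OF N]) (use x y ab cx_norm_rotate[OF N x(1) ab] in auto)
    qed
    show "dual_norm N (a *\<^sub>R y + b *\<^sub>R I y) \<le> dual_norm N y" by (rule le[OF y ab])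
    have "dual_norm N (a *\<^sub>R (a *\<^sub>R y + b *\<^sub>R I y) + (- b) *\<^sub>R I (a *\<^sub>R y + b *\<^sub>R I y)) \<le> dual_norm N (a *\<^sub>R y + b *\<^sub>R I y)"
      by (rule le) (use y ab in auto)
    then show "dual_norm N y \<le> dual_norm N (a *\<^sub>R y + b *\<^sub>R I y)" by (simp only: rotate_back[OF ab])
  qed
  moreover obtain c where c: "c > 0" "\<And>x. x \<in> H \<Longrightarrow> c * hnorm x \<le> N x" using N by (auto simp: cx_norm_def)
  have "dual_norm N y \<le> (1 / c) * hnorm y" if y: "y \<in> H" for y
  proof (rule dual_norm_least[OF N])
    fix x assume x: "x \<in> H" "N x \<le> 1"
    have "hnorm x \<le> 1 / c" using c(2)[of x] x c(1) by (simp add: field_simps)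
    then have "hnorm x * hnorm y \<le> 1 / c * hnorm y" by (rule mult_right_mono) (rule hnorm_nonneg[OF y])
    then show "ip x (K y) \<le> 1 / c * hnorm y" using Cauchy_Schwarz[of x "K y"] x y by (simp add: hnorm_K)
  qed
  moreover obtain d where d: "\<And>x. x \<in> H \<Longrightarrow> N x \<le> d * hnorm x" using N unfolding cx_norm_def by blast
  have "(1 / max d 1) * hnorm y \<le> dual_norm N y" if y: "y \<in> H" for y
  proof (cases "hnorm y = 0")
    case True
    then show ?thesis using dual_norm_nonneg[OF N y] by simp
  next
    case False
    then have p: "hnorm y > 0" using hnorm_nonneg[OF y] by simp
    have "hnorm y * hnorm y = ip (K y) (K y)" using hnorm_sq[OF y] y by (simp add: ip_K power2_eq_square)
    also have "\<dots> \<le> N (K y) * dual_norm N y" by (rule dual_norm_upper[OF N]) (use y in auto)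
    also have "\<dots> \<le> (max d 1 * hnorm y) * dual_norm N y"
    proof (rule mult_right_mono[OF _ dual_norm_nonneg[OF N y]])
      have "N (K y) \<le> d * hnorm y" using d[of "K y"] y by (simp add: hnorm_K)
      also have "\<dots> \<le> max d 1 * hnorm y" using p by (intro mult_right_mono) auto
      finally show "N (K y) \<le> max d 1 * hnorm y" .
    qed
    finally have "hnorm y * hnorm y \<le> (max d 1 * dual_norm N y) * hnorm y" by (simp add: mult_ac)
    then have "hnorm y \<le> max d 1 * dual_norm N y" using p by simp
    then show ?thesis by (simp add: field_simps)
  qed
  moreover have "1 / max d 1 > 0" by simp
  ultimately show ?thesis unfolding cx_norm_def by blast
qed

text \<open>The balls of an equivalent norm are closed in the Hilbert space.\<close>

lemma cx_norm_limit:
  assumes N: "cx_norm N" and U: "\<And>n::nat. U n \<in> H" "\<And>n. N (U n) \<le> r" and x: "x \<in> H"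
    and lim: "(\<lambda>n. ip (U n - x) (U n - x)) \<longlonglongrightarrow> 0"
  shows "N x \<le> r"
proof -
  obtain d where d: "\<And>x. x \<in> H \<Longrightarrow> N x \<le> d * hnorm x" using N unfolding cx_norm_def by blast
  have h0: "(\<lambda>n. hnorm (U n - x)) \<longlonglongrightarrow> 0" using tendsto_real_sqrt[OF lim] by (simp add: hnorm_def)
  have "(\<lambda>n. r + d * hnorm (U n - x)) \<longlonglongrightarrow> r + d * 0" by (intro tendsto_intros h0)
  moreover have "N x \<le> r + d * hnorm (U n - x)" for n
  proof -
    have "hnorm (x - U n) = hnorm (U n - x)"
      using seminorm_on_minus[OF hnorm_seminorm, of "U n - x"] U x by simp
    moreover have "N x \<le> N (U n) + N (x - U n)"
      using seminorm_on_triangle[OF cx_norm_seminorm[OF N], of "U n" "x - U n"] U x by simp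
    moreover have "N (x - U n) \<le> d * hnorm (x - U n)" by (rule d) (use U x in simp)
    ultimately show ?thesis using U(2)[of n] by simp
  qed
  ultimately have "N x \<le> r + d * 0" by (intro LIMSEQ_le_const[of _ "r + d * 0" "N x"]) auto
  then show ?thesis by simp
qed

text \<open>The Hilbert space structure replaces the Hahn-Banach theorem. If \<open>r\<close> lies
  strictly between the bidual norm and the norm of \<open>x\<close>, let \<open>z\<close> be the
  projection of \<open>x\<close> to the ball of \<open>N\<close> of radius \<open>r\<close>. The
  vector \<open>w = x - z\<close> separates \<open>x\<close> from the ball, and so
  \<open>K w\<close> is a functional on which \<open>x\<close> takes a larger value than its bidual
  norm permits.\<close>

lemma bidual:
  assumes N: "cx_norm N" and x: "x \<in> H"
  shows "dual_norm (dual_norm N) x = N x"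
proof (rule antisym)
  note sN = cx_norm_seminorm[OF N]
  note N' = dual_norm_cx_norm[OF N]
  show "dual_norm (dual_norm N) x \<le> N x"
  proof (rule dual_norm_least[OF N'])
    fix y assume y: "y \<in> H" "dual_norm N y \<le> 1"
    have "ip y (K x) = ip x (K y)" using ip_K_right[OF y(1) x] ip_commute[of "K y" x] x y by simp
    also have "\<dots> \<le> N x * dual_norm N y" by (rule dual_norm_upper[OF N x y(1)])
    also have "\<dots> \<le> N x * 1" by (rule mult_left_mono[OF y(2) seminorm_on_nonneg[OF sN x]])
    finally show "ip y (K x) \<le> N x" by simp
  qed
  show "N x \<le> dual_norm (dual_norm N) x"
  proof (rule ccontr)
    define s where "s = dual_norm (dual_norm N) x"
    assume "\<not> N x \<le> dual_norm (dual_norm N) x"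
    then obtain r where r: "s < r" "r < N x" using dense[of s "N x"] by (auto simp: s_def)
    have s0: "0 \<le> s" unfolding s_def by (rule dual_norm_nonneg[OF N' x])
    define C where "C = {k \<in> H. N k \<le> r}"
    have "\<exists>z\<in>C. \<forall>k\<in>C. ip x (k - z) \<le> ip z (k - z)"
    proof (rule variational_inequality[where B = "hnorm x"])
      show "C \<subseteq> H" by (auto simp: C_def)
      show "C \<noteq> {}" using seminorm_on_zero[OF sN] r s0 by (auto simp: C_def intro!: exI[of _ 0])
      show "u + t *\<^sub>R (v - u) \<in> C" if "u \<in> C" "v \<in> C" "0 \<le> t" "t \<le> 1" for u v and t :: real
      proof -
        have uv: "u \<in> H" "v \<in> H" "N u \<le> r" "N v \<le> r" using that by (auto simp: C_def)
        have e: "u + t *\<^sub>R (v - u) = (1 - t) *\<^sub>R u + t *\<^sub>R v" by (simp add: algebra_simps)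
        have "N (u + t *\<^sub>R (v - u)) \<le> N ((1 - t) *\<^sub>R u) + N (t *\<^sub>R v)"
          unfolding e by (rule seminorm_on_triangle[OF sN]) (use uv in auto)
        also have "\<dots> = (1 - t) * N u + t * N v"
          using seminorm_on_scale[OF sN uv(1), of "1 - t"] seminorm_on_scale[OF sN uv(2), of t] that by simp
        also have "\<dots> \<le> (1 - t) * r + t * r" using that uv by (intro add_mono mult_left_mono) auto
        finally show ?thesis using uv by (simp add: C_def algebra_simps)
      qed
      show "k \<in> C" if "\<And>n::nat. U n \<in> C" "k \<in> H" "(\<lambda>n. ip (U n - k) (U n - k)) \<longlonglongrightarrow> 0" for U k
        using cx_norm_limit[OF N, of U r k] that by (auto simp: C_def)
    qed (use x in \<open>auto simp: ip_simps Cauchy_Schwarz\<close>)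
    then obtain z where z: "z \<in> H" "N z \<le> r" and zk: "\<And>k. k \<in> C \<Longrightarrow> ip x (k - z) \<le> ip z (k - z)"
      by (auto simp: C_def)
    define w where "w = x - z"
    have w: "w \<in> H" using x z by (simp add: w_def)
    have wk: "ip w k \<le> ip w z" if "k \<in> H" "N k \<le> r" for k
      using zk[of k] that x z by (simp add: C_def w_def ip_simps)
    have wz: "0 \<le> ip w z" using wk[of 0] seminorm_on_zero[OF sN] r s0 w by (simp add: ip_zero_right)
    have "hnorm w \<noteq> 0"
    proof
      assume "hnorm w = 0"
      then have "N w = 0" using cx_norm_zero_iff[OF N w] by simp
      moreover have "N x \<le> N w + N z"
        using seminorm_on_triangle[OF sN w z(1)] by (simp add: w_def)
      ultimately show False using z r by simp
    qed
    then have ww: "ip w w > 0" using hnorm_nonneg[OF w] hnorm_sq[OF w] by (metis less_eq_real_def zero_less_power2)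
    have r0: "r > 0" using r s0 by simp
    have "dual_norm N (K w) \<le> ip w z / r"
    proof (rule dual_norm_least[OF N])
      fix k assume k: "k \<in> H" "N k \<le> 1"
      have "ip w (r *\<^sub>R k) \<le> ip w z"
        by (rule wk) (use k r0 seminorm_on_scale[OF sN k(1), of r] in auto)
      then show "ip k (K (K w)) \<le> ip w z / r"
        using k w r0 ip_commute[OF k(1) w] by (simp add: K_K ip_simps field_simps)
    qed
    then have "dual_norm N (K w) * s \<le> ip w z / r * s" by (rule mult_right_mono[OF _ s0])
    also have "\<dots> \<le> ip w z" using wz r r0 by (simp add: field_simps mult_right_mono)
    finally have "ip (K w) (K x) \<le> ip w z"
      using dual_norm_upper[OF N' K_in[OF w] x] by (simp add: s_def)
    then have "ip w x \<le> ip w z" using w x by (simp add: ip_K)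
    moreover have "ip w x = ip w z + ip w w" using w x z by (simp add: w_def ip_simps)
    ultimately show False using ww by simp
  qed
qed

lemma cx_norm_K:
  assumes N: "cx_norm N"
  shows "cx_norm (\<lambda>x. N (K x))" and "y \<in> H \<Longrightarrow> dual_norm (\<lambda>x. N (K x)) y = dual_norm N (K y)"
proof -
  note sN = cx_norm_seminorm[OF N]
  have "seminorm_on H (\<lambda>x. N (K x))"
    using sN by (auto simp: seminorm_on_def K_add K_scale)
  moreover have "N (K (a *\<^sub>R x + b *\<^sub>R I x)) = N (K x)" if "x \<in> H" "a\<^sup>2 + b\<^sup>2 = 1" for a b x
    using cx_norm_rotate[OF N K_in[OF that(1)], of a "- b"] that by (simp add: K_add K_scale K_I)
  moreover have "\<exists>c>0. \<forall>x\<in>H. c * hnorm x \<le> N (K x)" "\<exists>d. \<forall>x\<in>H. N (K x) \<le> d * hnorm x"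
    using N unfolding cx_norm_def by (metis K_in hnorm_K)+
  ultimately show "cx_norm (\<lambda>x. N (K x))" unfolding cx_norm_def by blast
  assume y: "y \<in> H"
  have "(\<lambda>x. ip x (K y)) ` {x \<in> H. N (K x) \<le> 1} = (\<lambda>x. ip x (K (K y))) ` {x \<in> H. N x \<le> 1}" (is "?A = ?B")
  proof (intro equalityI subsetI)
    fix v assume "v \<in> ?A"
    then obtain x where "x \<in> H" "N (K x) \<le> 1" "v = ip x (K y)" by auto
    then show "v \<in> ?B" using ip_K_right[of x y] y by (intro image_eqI[of _ _ "K x"]) (auto simp: K_K)
  next
    fix v assume "v \<in> ?B"
    then obtain x where "x \<in> H" "N x \<le> 1" "v = ip x (K (K y))" by auto
    then show "v \<in> ?A" using y by (intro image_eqI[of _ _ "K x"]) (auto simp: K_K ip_K)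
  qed
  then show "dual_norm (\<lambda>x. N (K x)) y = dual_norm N (K y)" by (simp add: dual_norm_def)
qed

lemma rad_growth_K:
  assumes "rad_growth N H C \<beta>"
  shows "rad_growth (\<lambda>x. N (K x)) H C \<beta>"
  unfolding rad_growth_def rad_bound_def
proof (intro allI ballI)
  fix n :: nat and x assume x: "x \<in> {..<n} \<rightarrow> H"
  have "K (\<Sum>a\<in>A. \<epsilon> a *\<^sub>R x a) = (\<Sum>a\<in>A. \<epsilon> a *\<^sub>R K (x a))" for \<epsilon> and A :: "nat set"
    by (induction A rule: infinite_finite_induct) (auto simp: K_zero K_add K_scale)
  then have "rad (\<lambda>x. N (K x)) {..<n} x = rad N {..<n} (\<lambda>i. K (x i))" by (simp add: rad_def)
  also have "\<dots> \<le> C * real n powr \<beta> * (\<Sum>i<n. (N (K (x i)))\<^sup>2)"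
    using assms x unfolding rad_growth_def rad_bound_def by (auto simp: Pi_def)
  finally show "rad (\<lambda>x. N (K x)) {..<n} x \<le> C * real n powr \<beta> * (\<Sum>i<n. (N (K (x i)))\<^sup>2)" .
qed

text \<open>Requiring growth of the norm and of its dual norm makes the condition invariant under
  duality.\<close>

definition good_norm :: "real \<Rightarrow> real \<Rightarrow> ('f \<Rightarrow> real) \<Rightarrow> bool" where
  "good_norm C \<beta> N \<longleftrightarrow> cx_norm N \<and> rad_growth N H C \<beta> \<and> rad_growth (dual_norm N) H C \<beta>"

lemma rad_growth_cong:
  assumes "subspace H" "\<And>x. x \<in> H \<Longrightarrow> N x = N' x" "rad_growth N H C \<beta>"
  shows "rad_growth N' H C \<beta>"
  unfolding rad_growth_def rad_bound_def
proof (intro allI ballI)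
  fix n :: nat and x assume x: "x \<in> {..<n} \<rightarrow> H"
  have "N' (\<Sum>a<n. \<epsilon> a *\<^sub>R x a) = N (\<Sum>a<n. \<epsilon> a *\<^sub>R x a)" for \<epsilon>
    by (rule assms(2)[symmetric], rule signed_sum_in[OF assms(1)]) (use x in auto)
  then have "rad N' {..<n} x = rad N {..<n} x" by (simp add: rad_def)
  also have "\<dots> \<le> C * real n powr \<beta> * (\<Sum>i<n. (N (x i))\<^sup>2)"
    using assms(3) x unfolding rad_growth_def rad_bound_def by blast
  also have "(\<Sum>i<n. (N (x i))\<^sup>2) = (\<Sum>i<n. (N' (x i))\<^sup>2)"
    by (intro sum.cong refl arg_cong[where f = "\<lambda>v. v\<^sup>2"] assms(2)) (use x in auto)
  finally show "rad N' {..<n} x \<le> C * real n powr \<beta> * (\<Sum>i<n. (N' (x i))\<^sup>2)" .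
qed

lemma good_norm_dual_norm: "good_norm C \<beta> N \<Longrightarrow> good_norm C \<beta> (dual_norm N)"
  using rad_growth_cong[OF H, of N "dual_norm (dual_norm N)" C \<beta>] bidual[of N] dual_norm_cx_norm[of N]
  by (auto simp: good_norm_def)

lemma good_norm_K: "good_norm C \<beta> N \<Longrightarrow> good_norm C \<beta> (\<lambda>x. N (K x))"
  using rad_growth_cong[OF H, of "\<lambda>x. dual_norm N (K x)" "dual_norm (\<lambda>x. N (K x))" C \<beta>] cx_norm_K[of N]
    rad_growth_K[of N C \<beta>] rad_growth_K[of "dual_norm N" C \<beta>]
  by (auto simp: good_norm_def)

text \<open>A bound for \<open>n\<close> vectors with a factor \<open>q < 1\<close> relative to the
  trivial one gives the same \<open>q\<close> for \<open>2 ^ n\<close> vectors in the dual norm;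
  each of the two then yields a growth exponent less than \<open>1\<close>.\<close>

lemma good_norm_of_bound:
  assumes N: "cx_norm N" and b: "rad_bound N H n (q * real n)" and q: "1 \<le> q * real n" "q < 1" and n: "0 < n"
    and C: "C = max (q * real n) (q * real (2 ^ n))"
    and \<beta>: "\<beta> = max (log (real n) (q * real n)) (log (real (2 ^ n)) (q * real (2 ^ n)))"
  shows "good_norm C \<beta> N"
proof -
  note N' = dual_norm_cx_norm[OF N]
  have q0: "0 < q" using q n by (smt (verit) mult_nonpos_nonneg of_nat_0_le_iff)
  have "real n \<le> real (2 ^ n)" using less_exp[of n] by simp
  then have q2: "1 \<le> q * real (2 ^ n)" using q mult_left_mono[of "real n" "real (2 ^ n)" q] q0 by linarith
  have b': "rad_bound (dual_norm N) H (2 ^ n) (q * real (2 ^ n))"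
    by (rule rad_bound_dual[OF cx_norm_seminorm[OF N] cx_norm_seminorm[OF N'], where B = "\<lambda>x y. ip x (K y)"])
       (use b q0 n dual_norm_upper[OF N] dual_norm_norming[OF N] in \<open>auto simp: ip_simps K_add K_scale\<close>)
  have "rad_growth N H (q * real n) (log (real n) (q * real n))"
    by (rule rad_growth_of_bound[OF cx_norm_seminorm[OF N] b]) (use q n in auto)
  then have 1: "rad_growth N H C \<beta>" by (rule rad_growth_mono) (use q C \<beta> in auto)
  have "rad_growth (dual_norm N) H (q * real (2 ^ n)) (log (real (2 ^ n)) (q * real (2 ^ n)))"
    by (rule rad_growth_of_bound[OF cx_norm_seminorm[OF N'] b']) (use q q2 n in auto)
  then have 2: "rad_growth (dual_norm N) H C \<beta>" by (rule rad_growth_mono) (use q2 C \<beta> in auto)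
  show ?thesis using N 1 2 by (simp add: good_norm_def)
qed

text \<open>The complexification of a norm that is homogeneous over the reals only.\<close>

definition circle_sup :: "('f \<Rightarrow> real) \<Rightarrow> 'f \<Rightarrow> real" where
  "circle_sup N0 x = (SUP p\<in>{p :: real \<times> real. (fst p)\<^sup>2 + (snd p)\<^sup>2 = 1}. N0 (fst p *\<^sub>R x + snd p *\<^sub>R I x))"

lemma circle_sup_least:
  assumes "\<And>a b. a\<^sup>2 + b\<^sup>2 = 1 \<Longrightarrow> N0 (a *\<^sub>R x + b *\<^sub>R I x) \<le> M"
  shows "circle_sup N0 x \<le> M"
proof -
  have "(1, 0) \<in> {p :: real \<times> real. (fst p)\<^sup>2 + (snd p)\<^sup>2 = 1}" by simp
  then have "{p :: real \<times> real. (fst p)\<^sup>2 + (snd p)\<^sup>2 = 1} \<noteq> {}" by blast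
  then show ?thesis unfolding circle_sup_def by (rule cSUP_least) (use assms in auto)
qed

lemma
  assumes N0: "seminorm_on H N0" and x: "x \<in> H"
  shows circle_sup_upper: "a\<^sup>2 + b\<^sup>2 = 1 \<Longrightarrow> N0 (a *\<^sub>R x + b *\<^sub>R I x) \<le> circle_sup N0 x"
    and circle_sup_le: "circle_sup N0 x \<le> N0 x + N0 (I x)"
proof -
  have le: "N0 (a *\<^sub>R x + b *\<^sub>R I x) \<le> N0 x + N0 (I x)" if ab: "a\<^sup>2 + b\<^sup>2 = 1" for a b
  proof -
    have "a\<^sup>2 \<le> 1\<^sup>2" "b\<^sup>2 \<le> 1\<^sup>2" using ab zero_le_power2[of a] zero_le_power2[of b] unfolding one_power2 by linarith+
    then have a1: "\<bar>a\<bar> \<le> 1" "\<bar>b\<bar> \<le> 1" using abs_le_square_iff[of a 1] abs_le_square_iff[of b 1] by auto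
    have "N0 (a *\<^sub>R x + b *\<^sub>R I x) \<le> N0 (a *\<^sub>R x) + N0 (b *\<^sub>R I x)"
      by (rule seminorm_on_triangle[OF N0]) (use x in auto)
    also have "\<dots> = \<bar>a\<bar> * N0 x + \<bar>b\<bar> * N0 (I x)" using x by (simp add: seminorm_on_scale[OF N0])
    also have "\<dots> \<le> 1 * N0 x + 1 * N0 (I x)"
      using x seminorm_on_nonneg[OF N0] by (intro add_mono mult_right_mono a1) auto
    finally show ?thesis by simp
  qed
  show "circle_sup N0 x \<le> N0 x + N0 (I x)" by (rule circle_sup_least) (rule le)
  assume ab: "a\<^sup>2 + b\<^sup>2 = 1"
  have "N0 (fst (a, b) *\<^sub>R x + snd (a, b) *\<^sub>R I x) \<le> circle_sup N0 x"
    unfolding circle_sup_def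
    by (rule cSUP_upper, use ab in simp, rule bdd_aboveI2[of _ _ "N0 x + N0 (I x)"]) (use le in auto)
  then show "N0 (a *\<^sub>R x + b *\<^sub>R I x) \<le> circle_sup N0 x" by simp
qed

lemma circle_sup_ge:
  assumes "seminorm_on H N0" "x \<in> H"
  shows "N0 x \<le> circle_sup N0 x" "N0 (I x) \<le> circle_sup N0 x"
  using circle_sup_upper[OF assms, of 1 0] circle_sup_upper[OF assms, of 0 1] by simp_all

lemma circle_sup_cx_norm:
  assumes N0: "seminorm_on H N0" and c: "c > 0" "\<And>x. x \<in> H \<Longrightarrow> c * hnorm x \<le> N0 x + N0 (I x)"
    and d: "\<And>x. x \<in> H \<Longrightarrow> N0 x \<le> d * hnorm x"
  shows "cx_norm (circle_sup N0)"
proof -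
  have nn: "0 \<le> circle_sup N0 x" if "x \<in> H" for x
    using circle_sup_ge(1)[OF N0 that] seminorm_on_nonneg[OF N0 that] by simp
  have sc: "circle_sup N0 (a *\<^sub>R x) \<le> \<bar>a\<bar> * circle_sup N0 x" if x: "x \<in> H" for a x
  proof (rule circle_sup_least)
    fix s t :: real assume st: "s\<^sup>2 + t\<^sup>2 = 1"
    have "s *\<^sub>R a *\<^sub>R x + t *\<^sub>R I (a *\<^sub>R x) = a *\<^sub>R (s *\<^sub>R x + t *\<^sub>R I x)"
      by (simp add: I_scale scaleR_add_right mult.commute)
    then have "N0 (s *\<^sub>R a *\<^sub>R x + t *\<^sub>R I (a *\<^sub>R x)) = \<bar>a\<bar> * N0 (s *\<^sub>R x + t *\<^sub>R I x)"
      using seminorm_on_scale[OF N0 rotate_in[OF x]] by simp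
    also have "\<dots> \<le> \<bar>a\<bar> * circle_sup N0 x" by (intro mult_left_mono circle_sup_upper[OF N0 x st]) auto
    finally show "N0 (s *\<^sub>R a *\<^sub>R x + t *\<^sub>R I (a *\<^sub>R x)) \<le> \<bar>a\<bar> * circle_sup N0 x" .
  qed
  have "seminorm_on H (circle_sup N0)"
    unfolding seminorm_on_def
  proof (intro conjI ballI allI H nn)
    fix x y assume xy: "x \<in> H" "y \<in> H"
    show "circle_sup N0 (x + y) \<le> circle_sup N0 x + circle_sup N0 y"
    proof (rule circle_sup_least)
      fix s t :: real assume st: "s\<^sup>2 + t\<^sup>2 = 1"
      have "s *\<^sub>R (x + y) + t *\<^sub>R I (x + y) = (s *\<^sub>R x + t *\<^sub>R I x) + (s *\<^sub>R y + t *\<^sub>R I y)"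
        by (simp add: I_add scaleR_add_right)
      then have "N0 (s *\<^sub>R (x + y) + t *\<^sub>R I (x + y)) \<le> N0 (s *\<^sub>R x + t *\<^sub>R I x) + N0 (s *\<^sub>R y + t *\<^sub>R I y)"
        using seminorm_on_triangle[OF N0 rotate_in[OF xy(1)] rotate_in[OF xy(2)]] by simp
      then show "N0 (s *\<^sub>R (x + y) + t *\<^sub>R I (x + y)) \<le> circle_sup N0 x + circle_sup N0 y"
        using circle_sup_upper[OF N0 xy(1) st] circle_sup_upper[OF N0 xy(2) st] by linarith
    qed
  next
    fix a x assume x: "x \<in> H"
    show "circle_sup N0 (a *\<^sub>R x) = \<bar>a\<bar> * circle_sup N0 x"
    proof (cases "a = 0")
      case True
      then show ?thesis using sc[OF x, of 0] nn[OF zero_in] by simp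
    next
      case False
      have "circle_sup N0 x = circle_sup N0 ((1 / a) *\<^sub>R (a *\<^sub>R x))" using False by simp
      also have "\<dots> \<le> \<bar>1 / a\<bar> * circle_sup N0 (a *\<^sub>R x)" by (rule sc) (use x in simp)
      finally have "\<bar>a\<bar> * circle_sup N0 x \<le> circle_sup N0 (a *\<^sub>R x)" using False by (simp add: field_simps)
      then show ?thesis using sc[OF x, of a] by simp
    qed
  qed
  moreover have "circle_sup N0 (a *\<^sub>R y + b *\<^sub>R I y) = circle_sup N0 y" if y: "y \<in> H" and ab: "a\<^sup>2 + b\<^sup>2 = 1" for a b y
  proof (rule antisym)
    have le: "circle_sup N0 (a *\<^sub>R y + b *\<^sub>R I y) \<le> circle_sup N0 y" if y: "y \<in> H" and ab: "a\<^sup>2 + b\<^sup>2 = 1" for a b y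
    proof (rule circle_sup_least)
      fix s t :: real assume st: "s\<^sup>2 + t\<^sup>2 = 1"
      have e: "s *\<^sub>R (a *\<^sub>R y + b *\<^sub>R I y) + t *\<^sub>R I (a *\<^sub>R y + b *\<^sub>R I y) =
          (s * a - t * b) *\<^sub>R y + (s * b + t * a) *\<^sub>R I y"
        by (simp add: I_add I_scale I_I scaleR_add_right scaleR_add_left scaleR_diff_left scaleR_diff_right)
      have "(s * a - t * b)\<^sup>2 + (s * b + t * a)\<^sup>2 = (s\<^sup>2 + t\<^sup>2) * (a\<^sup>2 + b\<^sup>2)"
        by (simp add: power2_eq_square algebra_simps)
      then show "N0 (s *\<^sub>R (a *\<^sub>R y + b *\<^sub>R I y) + t *\<^sub>R I (a *\<^sub>R y + b *\<^sub>R I y)) \<le> circle_sup N0 y"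
        unfolding e by (intro circle_sup_upper[OF N0 y]) (simp add: st ab)
    qed
    show "circle_sup N0 (a *\<^sub>R y + b *\<^sub>R I y) \<le> circle_sup N0 y" by (rule le[OF y ab])
    have "circle_sup N0 (a *\<^sub>R (a *\<^sub>R y + b *\<^sub>R I y) + (- b) *\<^sub>R I (a *\<^sub>R y + b *\<^sub>R I y)) \<le> circle_sup N0 (a *\<^sub>R y + b *\<^sub>R I y)"
      by (rule le) (use y ab in auto)
    then show "circle_sup N0 y \<le> circle_sup N0 (a *\<^sub>R y + b *\<^sub>R I y)" by (simp only: rotate_back[OF ab])
  qed
  moreover have "(c / 2) * hnorm x \<le> circle_sup N0 x" if "x \<in> H" for x
    using c(2)[OF that] circle_sup_ge[OF N0 that] by simp
  moreover have "circle_sup N0 x \<le> (2 * d) * hnorm x" if "x \<in> H" for x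
    using circle_sup_le[OF N0 that] d[OF that] d[OF I_in[OF that]] hnorm_I[OF that] by simp
  moreover have "c / 2 > 0" using c by simp
  ultimately show ?thesis unfolding cx_norm_def by blast
qed

text \<open>The complexified norm is at most the sum of the norms of \<open>x\<close> and
  \<open>I x\<close>, each of which it dominates. This costs a factor \<open>4\<close>.\<close>

lemma circle_sup_rad_bound:
  assumes N0: "seminorm_on H N0" and b: "rad_bound N0 H n c" and c: "0 \<le> c"
  shows "rad_bound (circle_sup N0) H n (4 * c)"
  unfolding rad_bound_def
proof (intro ballI)
  fix x assume x: "x \<in> {..<n} \<rightarrow> H"
  have xi: "x i \<in> H" if "i < n" for i using x that by auto
  have I_sum: "I (\<Sum>a\<in>A. \<epsilon> a *\<^sub>R x a) = (\<Sum>a\<in>A. \<epsilon> a *\<^sub>R I (x a))" for \<epsilon> and A :: "nat set"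
    by (induction A rule: infinite_finite_induct) (auto simp: I_zero I_add I_scale)
  have nn: "0 \<le> circle_sup N0 y" if "y \<in> H" for y
    using circle_sup_ge(1)[OF N0 that] seminorm_on_nonneg[OF N0 that] by simp
  have sq: "(circle_sup N0 y)\<^sup>2 \<le> 2 * (N0 y)\<^sup>2 + 2 * (N0 (I y))\<^sup>2" if y: "y \<in> H" for y
  proof -
    have "(circle_sup N0 y)\<^sup>2 \<le> (N0 y + N0 (I y))\<^sup>2" by (rule power_mono[OF circle_sup_le[OF N0 y] nn[OF y]])
    also have "\<dots> \<le> 2 * (N0 y)\<^sup>2 + 2 * (N0 (I y))\<^sup>2"
      using zero_le_power2[of "N0 y - N0 (I y)"] by (simp add: power2_sum power2_diff)
    finally show ?thesis .
  qed
  have "rad (circle_sup N0) {..<n} x \<le> (\<Sum>\<epsilon>\<in>sg {..<n}. 2 * (N0 (\<Sum>a<n. \<epsilon> a *\<^sub>R x a))\<^sup>2 + 2 * (N0 (\<Sum>a<n. \<epsilon> a *\<^sub>R I (x a)))\<^sup>2) / 2 ^ card {..<n}"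
    unfolding rad_def
  proof (intro divide_right_mono sum_mono)
    fix \<epsilon> :: "nat \<Rightarrow> real"
    have "(\<Sum>a<n. \<epsilon> a *\<^sub>R x a) \<in> H" by (rule signed_sum_in[OF H]) (use xi in auto)
    from sq[OF this] show "(circle_sup N0 (\<Sum>a<n. \<epsilon> a *\<^sub>R x a))\<^sup>2 \<le> 2 * (N0 (\<Sum>a<n. \<epsilon> a *\<^sub>R x a))\<^sup>2 + 2 * (N0 (\<Sum>a<n. \<epsilon> a *\<^sub>R I (x a)))\<^sup>2"
      by (simp add: I_sum)
  qed auto
  also have "\<dots> = 2 * rad N0 {..<n} x + 2 * rad N0 {..<n} (\<lambda>i. I (x i))"
    by (simp add: rad_def sum.distrib add_divide_distrib sum_distrib_left[symmetric])
  also have "\<dots> \<le> 2 * (c * (\<Sum>i<n. (N0 (x i))\<^sup>2)) + 2 * (c * (\<Sum>i<n. (N0 (I (x i)))\<^sup>2))"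
    using b x xi unfolding rad_bound_def by (intro add_mono mult_left_mono) (auto simp: Pi_def)
  also have "\<dots> \<le> 2 * (c * (\<Sum>i<n. (circle_sup N0 (x i))\<^sup>2)) + 2 * (c * (\<Sum>i<n. (circle_sup N0 (x i))\<^sup>2))"
    using c by (intro add_mono mult_left_mono sum_mono power_mono circle_sup_ge[OF N0 xi] seminorm_on_nonneg[OF N0] I_in xi) auto
  finally show "rad (circle_sup N0) {..<n} x \<le> 4 * c * (\<Sum>i<n. (circle_sup N0 (x i))\<^sup>2)" by simp
qed

end


section \<open>Classes of renormed Hilbert spaces\<close>

definition cscale :: "('f \<Rightarrow> 'f) \<Rightarrow> complex \<Rightarrow> 'f \<Rightarrow> 'f::real_vector" where
  "cscale I c x = Re c *\<^sub>R x + Im c *\<^sub>R I x"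

definition some_preimage :: "'f set \<Rightarrow> ('f \<Rightarrow> 'u) \<Rightarrow> 'u \<Rightarrow> 'f" where
  "some_preimage H J a = (SOME x. x \<in> H \<and> J x = a)"

text \<open>The quotient of \<open>H\<close> by its null vectors, where \<open>J x\<close> stands
  for the class of \<open>x\<close>. In this way spaces that arise from different subspaces
  \<open>H\<close> have their carriers in the one type \<open>'u\<close>.\<close>

definition qspace ::
    "'f::real_vector set \<Rightarrow> ('f \<Rightarrow> 'f) \<Rightarrow> ('f \<Rightarrow> real) \<Rightarrow> ('f \<Rightarrow> 'u) \<Rightarrow> 'u cnspace" where
  "qspace H I N J =
     \<lparr>carrier = J ` H, mult = undefined, one = undefined, ring.zero = J 0,
      ring.add = (\<lambda>a b. J (some_preimage H J a + some_preimage H J b)),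
      module.smult = (\<lambda>c a. J (cscale I c (some_preimage H J a))), vnorm = (\<lambda>a. N (some_preimage H J a))\<rparr>"

locale cx_hilbert_code = cx_hilbert H ip I K
  for H :: "'f::real_vector set" and ip :: "'f \<Rightarrow> 'f \<Rightarrow> real" and I K :: "'f \<Rightarrow> 'f" +
  fixes J :: "'f \<Rightarrow> 'u"
  assumes J_eq_iff: "x \<in> H \<Longrightarrow> y \<in> H \<Longrightarrow> J x = J y \<longleftrightarrow> ip (x - y) (x - y) = 0"
begin

lemma cscale_in [simp]: "x \<in> H \<Longrightarrow> cscale I c x \<in> H" by (simp add: cscale_def)
lemma cscale_diff: "cscale I c (x - y) = cscale I c x - cscale I c y"
  by (simp add: cscale_def I_diff scaleR_diff_right)
lemma cscale_add: "cscale I c (x + y) = cscale I c x + cscale I c y"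
  by (simp add: cscale_def I_add scaleR_add_right)
lemma cscale_add_left: "cscale I (c + d) x = cscale I c x + cscale I d x"
  by (simp add: cscale_def scaleR_add_left)
lemma cscale_mult: "cscale I (c * d) x = cscale I c (cscale I d x)"
  by (simp add: cscale_def I_add I_scale I_I scaleR_add_right scaleR_diff_right scaleR_add_left scaleR_diff_left)
lemma cscale_one: "cscale I 1 x = x" by (simp add: cscale_def)
lemma cscale_real: "cscale I (complex_of_real r) x = r *\<^sub>R x" by (simp add: cscale_def)

lemma cx_norm_cscale:
  assumes N: "cx_norm N" and x: "x \<in> H"
  shows "N (cscale I c x) = cmod c * N x"
proof (cases "c = 0")
  case True
  then show ?thesis using seminorm_on_zero[OF cx_norm_seminorm[OF N]] by (simp add: cscale_def)
next
  case False
  define a b where "a = Re c / cmod c" and "b = Im c / cmod c"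
  have ab: "a\<^sup>2 + b\<^sup>2 = 1"
  proof -
    have "(cmod c)\<^sup>2 \<noteq> 0" using False by simp
    then show ?thesis
      unfolding a_def b_def power_divide add_divide_distrib[symmetric] cmod_power2[symmetric] by simp
  qed
  have "cscale I c x = cmod c *\<^sub>R (a *\<^sub>R x + b *\<^sub>R I x)"
    using False by (simp add: cscale_def a_def b_def scaleR_add_right)
  then show ?thesis
    using seminorm_on_scale[OF cx_norm_seminorm[OF N] rotate_in[OF x, of a b], of "cmod c"]
      cx_norm_rotate[OF N x ab] by simp
qed

lemma some_preimage_in [simp]: "a \<in> J ` H \<Longrightarrow> some_preimage H J a \<in> H" and J_some_preimage [simp]: "a \<in> J ` H \<Longrightarrow> J (some_preimage H J a) = a"
proof -
  assume "a \<in> J ` H"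
  then have "\<exists>x. x \<in> H \<and> J x = a" by auto
  then have "some_preimage H J a \<in> H \<and> J (some_preimage H J a) = a" unfolding some_preimage_def by (rule someI_ex)
  then show "some_preimage H J a \<in> H" "J (some_preimage H J a) = a" by auto
qed

lemma J_eq_norm:
  assumes "cx_norm N" "x \<in> H" "y \<in> H"
  shows "J x = J y \<longleftrightarrow> N (x - y) = 0"
  using J_eq_iff[OF assms(2,3)] cx_norm_zero_iff[OF assms(1), of "x - y"] assms
  by (simp add: hnorm_def)

lemma norm_eq_of_J:
  assumes N: "cx_norm N" and xy: "x \<in> H" "y \<in> H" and e: "J x = J y"
  shows "N x = N y"
proof -
  note sN = cx_norm_seminorm[OF N]
  have z: "N (x - y) = 0" "N (y - x) = 0"
    using J_eq_norm[OF N xy] J_eq_norm[OF N xy(2,1)] e by auto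
  show ?thesis
    using seminorm_on_triangle[OF sN, of "x - y" y] seminorm_on_triangle[OF sN, of "y - x" x] xy z by simp
qed

lemma cx_norm_hnorm: "cx_norm hnorm"
proof -
  have "hnorm (a *\<^sub>R x + b *\<^sub>R I x) = hnorm x" if x: "x \<in> H" and ab: "a\<^sup>2 + b\<^sup>2 = 1" for a b x
  proof -
    have "ip x (I x) = - ip (I x) x" by (rule ip_I_right) (use x in auto)
    then have "ip (a *\<^sub>R x + b *\<^sub>R I x) (a *\<^sub>R x + b *\<^sub>R I x) = (a\<^sup>2 + b\<^sup>2) * ip x x"
      using x by (simp add: ip_simps ip_I power2_eq_square algebra_simps)
    then show ?thesis using ab by (simp add: hnorm_def)
  qed
  then show ?thesis
    unfolding cx_norm_def using hnorm_seminorm by (auto intro!: exI[of _ 1] simp: hnorm_nonneg)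
qed

lemma some_preimage_diff:
  assumes N: "cx_norm N" and x: "x \<in> H"
  shows "N (some_preimage H J (J x) - x) = 0"
  using J_eq_norm[OF N, of "some_preimage H J (J x)" x] x by simp

lemma norm_zero_add:
  assumes N: "cx_norm N" and "x \<in> H" "y \<in> H" "N x = 0" "N y = 0"
  shows "N (x + y) = 0"
  using seminorm_on_triangle[OF cx_norm_seminorm[OF N] assms(2,3)]
    seminorm_on_nonneg[OF cx_norm_seminorm[OF N], of "x + y"] assms by simp

lemma q_carrier: "carrier (qspace H I N J) = J ` H" by (simp add: qspace_def)

lemma q_zero: "\<zero>\<^bsub>qspace H I N J\<^esub> = J 0" by (simp add: qspace_def)

context
  fixes N assumes N: "cx_norm N"
begin

abbreviation (input) "E \<equiv> qspace H I N J"

lemma q_add: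
  assumes "x \<in> H" "y \<in> H"
  shows "J x \<oplus>\<^bsub>E\<^esub> J y = J (x + y)"
proof -
  have "N ((some_preimage H J (J x) - x) + (some_preimage H J (J y) - y)) = 0"
    by (rule norm_zero_add[OF N]) (use assms some_preimage_diff[OF N] in auto)
  moreover have "(some_preimage H J (J x) - x) + (some_preimage H J (J y) - y) = (some_preimage H J (J x) + some_preimage H J (J y)) - (x + y)" by simp
  ultimately show ?thesis using assms J_eq_norm[OF N] by (simp add: qspace_def)
qed

lemma q_smult:
  assumes "x \<in> H"
  shows "c \<odot>\<^bsub>E\<^esub> J x = J (cscale I c x)"
proof -
  have "N (cscale I c (some_preimage H J (J x) - x)) = 0"
    using cx_norm_cscale[OF N, of "some_preimage H J (J x) - x" c] assms some_preimage_diff[OF N assms] by simp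
  then show ?thesis using assms J_eq_norm[OF N] by (simp add: qspace_def cscale_diff)
qed

lemma q_norm: "x \<in> H \<Longrightarrow> vnorm E (J x) = N x"
  using norm_eq_of_J[OF N, of "some_preimage H J (J x)" x] by (simp add: qspace_def)

lemma q_abelian_group: "abelian_group E"
proof (rule abelian_groupI)
  show "\<exists>y\<in>carrier E. y \<oplus>\<^bsub>E\<^esub> x = \<zero>\<^bsub>E\<^esub>" if "x \<in> carrier E" for x
  proof -
    from that obtain v where v: "v \<in> H" "x = J v" by (auto simp: q_carrier)
    then show ?thesis by (intro bexI[of _ "J (- v)"]) (auto simp: q_carrier q_add q_zero)
  qed
qed (auto simp: q_carrier q_add q_zero add_ac)

lemma q_module: "Module.module (ring_of_type_algebra :: complex ring) E"
proof (rule Module.moduleI[OF cring_from_type_algebra q_abelian_group])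
qed (auto simp: q_carrier q_add q_smult cscale_add cscale_add_left cscale_mult cscale_one ring_of_type_algebra_def)

lemma q_neg:
  assumes "x \<in> H"
  shows "\<ominus>\<^bsub>E\<^esub> J x = J (- x)"
proof -
  interpret E: abelian_group E by (rule q_abelian_group)
  show ?thesis
    by (rule E.minus_equality) (use assms in \<open>auto simp: q_carrier q_add q_zero\<close>)
qed

lemma q_minus:
  assumes "x \<in> H" "y \<in> H"
  shows "J x \<ominus>\<^bsub>E\<^esub> J y = J (x - y)"
  using assms by (simp add: a_minus_def q_neg q_add)

lemma q_finsum:
  assumes "finite A" "\<And>a. a \<in> A \<Longrightarrow> x a \<in> H"
  shows "(\<Oplus>\<^bsub>E\<^esub>a\<in>A. J (x a)) = J (\<Sum>a\<in>A. x a)"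
proof -
  interpret E: abelian_group E by (rule q_abelian_group)
  show ?thesis
    using assms
  proof (induction A rule: finite_induct)
    case empty
    then show ?case by (simp add: q_zero)
  next
    case (insert a A)
    have "(\<Sum>a\<in>A. x a) \<in> H" by (rule subspace_sum[OF H]) (use insert in auto)
    then show ?case
      using insert E.finsum_insert[of A a "\<lambda>a. J (x a)"] by (auto simp: q_carrier q_add Pi_def)
  qed
qed

lemma q_complex_banach: "complex_banach E"
  unfolding complex_banach_def
proof (intro conjI allI ballI impI q_module)
  note sN = cx_norm_seminorm[OF N]
  fix x assume "x \<in> carrier E"
  then obtain v where v: "v \<in> H" "x = J v" by (auto simp: q_carrier)
  show "0 \<le> vnorm E x" using v by (simp add: q_norm seminorm_on_nonneg[OF sN])
  show "vnorm E x = 0 \<longleftrightarrow> x = \<zero>\<^bsub>E\<^esub>" using v J_eq_norm[OF N v(1) zero_in] by (simp add: q_norm q_zero)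
  show "vnorm E (c \<odot>\<^bsub>E\<^esub> x) = cmod c * vnorm E x" for c
    using v by (simp add: q_norm q_smult cx_norm_cscale[OF N])
  fix y assume "y \<in> carrier E"
  then obtain w where w: "w \<in> H" "y = J w" by (auto simp: q_carrier)
  show "vnorm E (x \<oplus>\<^bsub>E\<^esub> y) \<le> vnorm E x + vnorm E y"
    using v w by (simp add: q_norm q_add seminorm_on_triangle[OF sN])
next
  fix \<sigma> :: "nat \<Rightarrow> 'u"
  assume a: "range \<sigma> \<subseteq> carrier E \<and> (\<forall>e>0. \<exists>M. \<forall>m\<ge>M. \<forall>n\<ge>M. vnorm E (\<sigma> m \<ominus>\<^bsub>E\<^esub> \<sigma> n) < e)"
  have "\<exists>v. \<forall>n. v n \<in> H \<and> \<sigma> n = J (v n)"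
  proof (rule choice, rule allI)
    fix n
    have "\<sigma> n \<in> J ` H" using a by (auto simp: q_carrier)
    then show "\<exists>y. y \<in> H \<and> \<sigma> n = J y" by blast
  qed
  then obtain v where v: "\<And>n. v n \<in> H" "\<And>n. \<sigma> n = J (v n)" by blast
  obtain c where c: "c > 0" "\<And>x. x \<in> H \<Longrightarrow> c * hnorm x \<le> N x" using N unfolding cx_norm_def by blast
  obtain d where d: "\<And>x. x \<in> H \<Longrightarrow> N x \<le> d * hnorm x" using N unfolding cx_norm_def by blast
  have "\<exists>x\<in>H. (\<lambda>n. ip (v n - x) (v n - x)) \<longlonglongrightarrow> 0"
  proof (rule complete[OF v(1)])
    fix e :: real assume e: "e > 0"
    obtain M where M: "\<And>m n. m \<ge> M \<Longrightarrow> n \<ge> M \<Longrightarrow> vnorm E (\<sigma> m \<ominus>\<^bsub>E\<^esub> \<sigma> n) < c * sqrt e"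
      using a e c by (metis mult_pos_pos real_sqrt_gt_zero)
    have "ip (v m - v n) (v m - v n) < e" if "m \<ge> M" "n \<ge> M" for m n
    proof -
      have "N (v m - v n) < c * sqrt e" using M[OF that] v by (simp add: q_minus q_norm)
      then have "c * hnorm (v m - v n) < c * sqrt e" using c(2)[of "v m - v n"] v by simp
      then have "hnorm (v m - v n) < sqrt e" using c(1) by simp
      then show ?thesis by (simp add: hnorm_def)
    qed
    then show "\<exists>M. \<forall>m\<ge>M. \<forall>n\<ge>M. ip (v m - v n) (v m - v n) < e" by blast
  qed
  then obtain x where x: "x \<in> H" "(\<lambda>n. ip (v n - x) (v n - x)) \<longlonglongrightarrow> 0" by blast
  have h0: "(\<lambda>n. d * hnorm (v n - x)) \<longlonglongrightarrow> 0"
    using tendsto_mult_right_zero[OF tendsto_real_sqrt[OF x(2), simplified], of d] by (simp add: hnorm_def)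
  have "(\<lambda>n. N (v n - x)) \<longlonglongrightarrow> 0"
    by (rule tendsto_sandwich[OF _ _ tendsto_const h0])
       (use d v x seminorm_on_nonneg[OF cx_norm_seminorm[OF N]] in auto)
  then show "\<exists>x\<in>carrier E. (\<lambda>n. vnorm E (\<sigma> n \<ominus>\<^bsub>E\<^esub> x)) \<longlonglongrightarrow> 0"
    using x v by (intro bexI[of _ "J x"]) (auto simp: q_carrier q_minus q_norm)
qed

text \<open>The sign patterns of \<open>cn_rademacher_type\<close> are complex valued, those of
  \<open>sg\<close> real valued.\<close>

lemma q_rademacher_type:
  assumes g: "rad_growth N H C \<beta>" and C: "0 \<le> C" and \<beta>: "0 \<le> \<beta>" "\<beta> < 1"
    and p: "p = 1 + (1 - \<beta>) / 4" and r: "r = 2 powr (- (1 - \<beta>) / 4)"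
  shows "cn_rademacher_type E p ((1 + 4 * C / (1 - r) / (1 - r)) powr (1 / p))"
  unfolding cn_rademacher_type_def
proof (intro allI ballI)
  fix n :: nat and x assume x: "x \<in> {..<n} \<rightarrow> carrier E"
  have "\<exists>v. \<forall>i. i < n \<longrightarrow> v i \<in> H \<and> x i = J (v i)"
  proof (rule choice, rule allI)
    fix i
    show "\<exists>y. i < n \<longrightarrow> y \<in> H \<and> x i = J y"
    proof (cases "i < n")
      case True
      then have "x i \<in> J ` H" using x by (auto simp: q_carrier)
      then show ?thesis by blast
    qed simp
  qed
  then obtain v where v: "\<And>i. i < n \<Longrightarrow> v i \<in> H" "\<And>i. i < n \<Longrightarrow> x i = J (v i)" by blast
  have "(\<Sum>\<epsilon>\<in>signs n. vnorm E (\<Oplus>\<^bsub>E\<^esub>i\<in>{..<n}. \<epsilon> i \<odot>\<^bsub>E\<^esub> x i) powr p) =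
      (\<Sum>\<epsilon>\<in>sg {..<n}. N (\<Sum>a<n. \<epsilon> a *\<^sub>R v a) powr p)"
  proof (rule sum.reindex_bij_witness[where i = "\<lambda>\<epsilon>. \<lambda>i\<in>{..<n}. complex_of_real (\<epsilon> i)"
        and j = "\<lambda>\<epsilon>. \<lambda>i\<in>{..<n}. Re (\<epsilon> i)"])
    fix \<epsilon> :: "nat \<Rightarrow> complex" assume e: "\<epsilon> \<in> signs n"
    have v1: "\<epsilon> i = -1 \<or> \<epsilon> i = 1" if "i < n" for i using e that by (auto simp: signs_def)
    show "(\<lambda>i\<in>{..<n}. complex_of_real ((\<lambda>i\<in>{..<n}. Re (\<epsilon> i)) i)) = \<epsilon>"
    proof
      fix i show "(\<lambda>i\<in>{..<n}. complex_of_real ((\<lambda>i\<in>{..<n}. Re (\<epsilon> i)) i)) i = \<epsilon> i"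
        using v1[of i] e by (cases "i < n") (auto simp: signs_def PiE_def extensional_def)
    qed
    show "(\<lambda>i\<in>{..<n}. Re (\<epsilon> i)) \<in> sg {..<n}" using v1 by (fastforce simp: sg_def)
    have "\<epsilon> i \<odot>\<^bsub>E\<^esub> x i = J ((\<lambda>i\<in>{..<n}. Re (\<epsilon> i)) i *\<^sub>R v i)" if "i < n" for i
      using v1[OF that] v[OF that] that by (auto simp: q_smult cscale_def)
    then have "(\<Oplus>\<^bsub>E\<^esub>i\<in>{..<n}. \<epsilon> i \<odot>\<^bsub>E\<^esub> x i) = (\<Oplus>\<^bsub>E\<^esub>i\<in>{..<n}. J ((\<lambda>i\<in>{..<n}. Re (\<epsilon> i)) i *\<^sub>R v i))"
      using v abelian_monoid.finsum_cong'[OF abelian_group.axioms(1)[OF q_abelian_group], of "{..<n}" "{..<n}"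
          "\<lambda>i. J ((\<lambda>i\<in>{..<n}. Re (\<epsilon> i)) i *\<^sub>R v i)" "\<lambda>i. \<epsilon> i \<odot>\<^bsub>E\<^esub> x i"]
      by (simp add: q_carrier Pi_def)
    also have "\<dots> = J (\<Sum>i<n. (\<lambda>i\<in>{..<n}. Re (\<epsilon> i)) i *\<^sub>R v i)"
      by (rule q_finsum) (use v in auto)
    finally show "N (\<Sum>a<n. (\<lambda>i\<in>{..<n}. Re (\<epsilon> i)) a *\<^sub>R v a) powr p =
        vnorm E (\<Oplus>\<^bsub>E\<^esub>i\<in>{..<n}. \<epsilon> i \<odot>\<^bsub>E\<^esub> x i) powr p"
      using signed_sum_in[OF H, of "{..<n}" v] v by (simp add: q_norm del: restrict_apply)
  next
    fix \<epsilon> :: "nat \<Rightarrow> real" assume e: "\<epsilon> \<in> sg {..<n}"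
    have v1: "\<epsilon> i = -1 \<or> \<epsilon> i = 1" if "i < n" for i using sg_values[OF e] that by auto
    show "(\<lambda>i\<in>{..<n}. Re ((\<lambda>i\<in>{..<n}. complex_of_real (\<epsilon> i)) i)) = \<epsilon>"
    proof
      fix i show "(\<lambda>i\<in>{..<n}. Re ((\<lambda>i\<in>{..<n}. complex_of_real (\<epsilon> i)) i)) i = \<epsilon> i"
        using e by (cases "i < n") (auto simp: sg_def PiE_def extensional_def)
    qed
    show "(\<lambda>i\<in>{..<n}. complex_of_real (\<epsilon> i)) \<in> signs n" using v1 by (fastforce simp: signs_def)
  qed
  moreover have "vnorm E (x i) = N (v i)" if "i < n" for i using v[OF that] by (simp add: q_norm)
  moreover have "card {..<n} = n" by simp
  ultimately show "((\<Sum>\<epsilon>\<in>signs n. vnorm E (\<Oplus>\<^bsub>E\<^esub>i\<in>{..<n}. \<epsilon> i \<odot>\<^bsub>E\<^esub> x i) powr p) / 2 ^ n) powr (1 / p)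
          \<le> (1 + 4 * C / (1 - r) / (1 - r)) powr (1 / p) * (\<Sum>i<n. vnorm E (x i) powr p) powr (1 / p)"
    using signed_powr_sum_le[OF cx_norm_seminorm[OF N] g C \<beta> p r, of "{..<n}" v] v by simp
qed

end

text \<open>The complex bilinear form with real part \<open>ip x (K y)\<close>.\<close>

definition bilin :: "'f \<Rightarrow> 'f \<Rightarrow> complex" where
  "bilin x y = Complex (ip x (K y)) (- ip (I x) (K y))"

lemma bilin_add: "x \<in> H \<Longrightarrow> x' \<in> H \<Longrightarrow> y \<in> H \<Longrightarrow> bilin (x + x') y = bilin x y + bilin x' y"
  by (simp add: bilin_def ip_simps I_add complex_eq_iff)

lemma bilin_add_right: "x \<in> H \<Longrightarrow> y \<in> H \<Longrightarrow> y' \<in> H \<Longrightarrow> bilin x (y + y') = bilin x y + bilin x y'"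
  by (simp add: bilin_def ip_simps K_add complex_eq_iff)

lemma bilin_cscale: "x \<in> H \<Longrightarrow> y \<in> H \<Longrightarrow> bilin (cscale I c x) y = c * bilin x y"
  by (simp add: bilin_def cscale_def ip_simps I_add I_scale I_I complex_eq_iff algebra_simps)

lemma bilin_cscale_right: "x \<in> H \<Longrightarrow> y \<in> H \<Longrightarrow> bilin x (cscale I c y) = c * bilin x y"
  by (simp add: bilin_def cscale_def ip_simps K_add K_scale K_I ip_I_right ip_I I_I complex_eq_iff algebra_simps)

text \<open>A rotation of \<open>x\<close> makes the value of the form real and nonnegative.\<close>

lemma bilin_bound:
  assumes N: "cx_norm N" and x: "x \<in> H" and y: "y \<in> H"
  shows "cmod (bilin x y) \<le> N x * dual_norm N y"
proof (cases "bilin x y = 0")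
  case True
  then show ?thesis using seminorm_on_nonneg[OF cx_norm_seminorm[OF N] x] dual_norm_nonneg[OF N y] by simp
next
  case False
  define c where "c = cnj (bilin x y) / cmod (bilin x y)"
  have c1: "cmod c = 1" using False by (simp add: c_def norm_divide)
  have "c * bilin x y = complex_of_real (cmod (bilin x y))"
  proof -
    have "c * bilin x y = bilin x y * cnj (bilin x y) / cmod (bilin x y)" by (simp add: c_def)
    also have "\<dots> = (complex_of_real (cmod (bilin x y)))\<^sup>2 / cmod (bilin x y)"
      unfolding of_real_power[symmetric] complex_norm_square ..
    also have "\<dots> = complex_of_real (cmod (bilin x y))" using False by (simp add: power2_eq_square)
    finally show ?thesis .
  qed
  then have "cmod (bilin x y) = Re (bilin (cscale I c x) y)" using x y by (simp add: bilin_cscale)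
  also have "\<dots> = ip (cscale I c x) (K y)" by (simp add: bilin_def)
  also have "\<dots> \<le> N (cscale I c x) * dual_norm N y" by (rule dual_norm_upper[OF N]) (use x y in auto)
  also have "\<dots> = N x * dual_norm N y" using cx_norm_cscale[OF N x] c1 by simp
  finally show ?thesis .
qed

lemma bilin_cong:
  assumes "x \<in> H" "x' \<in> H" "y \<in> H" "y' \<in> H" "J x = J x'" "J y = J y'"
  shows "bilin x y = bilin x' y'"
proof -
  have h: "hnorm (x - x') = 0" "hnorm (y - y') = 0" using J_eq_iff assms by (auto simp: hnorm_def)
  then have "dual_norm hnorm (y - y') = 0"
    using cx_norm_zero_iff[OF dual_norm_cx_norm[OF cx_norm_hnorm], of "y - y'"] assms by simp
  then have "cmod (bilin (x - x') y) \<le> 0" "cmod (bilin x' (y - y')) \<le> 0"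
    using bilin_bound[OF cx_norm_hnorm, of "x - x'" y] bilin_bound[OF cx_norm_hnorm, of x' "y - y'"] h assms by auto
  moreover have "bilin x y = bilin (x - x') y + bilin x' y" using bilin_add[of "x - x'" x' y] assms by simp
  moreover have "bilin x' y = bilin x' (y - y') + bilin x' y'" using bilin_add_right[of x' "y - y'" y'] assms by simp
  ultimately show ?thesis by simp
qed

definition dual_map :: "'u \<Rightarrow> 'u \<Rightarrow> complex" where
  "dual_map a = (\<lambda>u\<in>J ` H. bilin (some_preimage H J u) (some_preimage H J a))"

lemma dual_map: "x \<in> H \<Longrightarrow> y \<in> H \<Longrightarrow> dual_map (J y) (J x) = bilin x y"
  using bilin_cong[of "some_preimage H J (J x)" x "some_preimage H J (J y)" y] by (simp add: dual_map_def)

lemma dual_map_in: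
  assumes N: "cx_norm N" and y: "y \<in> H"
  shows "dual_map (J y) \<in> carrier (cn_dual (qspace H I N J))"
proof -
  have "dual_map (J y) \<in> extensional (J ` H)" by (simp add: dual_map_def)
  moreover have "cmod (dual_map (J y) u) \<le> dual_norm N y * vnorm (qspace H I N J) u" if "u \<in> J ` H" for u
    using that y bilin_bound[OF N _ y] by (auto simp: dual_map q_norm[OF N] mult.commute)
  then have "\<exists>B. \<forall>u\<in>J ` H. cmod (dual_map (J y) u) \<le> B * vnorm (qspace H I N J) u" by blast
  ultimately show ?thesis
    using y by (simp add: cn_dual_def q_carrier q_add[OF N] q_smult[OF N] dual_map bilin_add bilin_cscale)
qed

text \<open>The Riesz representation gives the real part of the functional, and complex linearity
  recovers the imaginary part from it.\<close>

lemma dual_map_onto: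
  assumes N: "cx_norm N" and \<phi>: "\<phi> \<in> carrier (cn_dual (qspace H I N J))"
  shows "\<exists>y\<in>H. \<phi> = dual_map (J y)"
proof -
  have ext: "\<phi> \<in> extensional (J ` H)"
    and add: "\<And>x y. x \<in> H \<Longrightarrow> y \<in> H \<Longrightarrow> \<phi> (J (x + y)) = \<phi> (J x) + \<phi> (J y)"
    and sc: "\<And>c x. x \<in> H \<Longrightarrow> \<phi> (J (cscale I c x)) = c * \<phi> (J x)"
    using \<phi> by (auto simp: cn_dual_def q_carrier q_add[OF N] q_smult[OF N] simp flip: q_add[OF N] q_smult[OF N])
  obtain B where B: "\<And>x. x \<in> H \<Longrightarrow> cmod (\<phi> (J x)) \<le> B * N x"
  proof -
    from \<phi> have "\<exists>B. \<forall>u\<in>J ` H. cmod (\<phi> u) \<le> B * vnorm (qspace H I N J) u"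
      by (simp add: cn_dual_def q_carrier)
    then obtain B where B: "\<And>u. u \<in> J ` H \<Longrightarrow> cmod (\<phi> u) \<le> B * vnorm (qspace H I N J) u" by blast
    have "cmod (\<phi> (J x)) \<le> B * N x" if "x \<in> H" for x
      using B[of "J x"] that by (simp add: q_norm[OF N])
    then show thesis by (rule that)
  qed
  obtain d where d: "\<And>x. x \<in> H \<Longrightarrow> N x \<le> d * hnorm x" using N unfolding cx_norm_def by blast
  have "\<exists>z\<in>H. \<forall>x\<in>H. Re (\<phi> (J x)) = ip x z"
  proof (rule Riesz_representation[where B = "\<bar>B\<bar> * d"])
    fix x assume x: "x \<in> H"
    have "Re (\<phi> (J x)) \<le> B * N x" using B[OF x] complex_Re_le_cmod[of "\<phi> (J x)"] by linarith
    also have "\<dots> \<le> \<bar>B\<bar> * N x"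
      by (intro mult_right_mono seminorm_on_nonneg[OF cx_norm_seminorm[OF N] x]) auto
    also have "\<dots> \<le> \<bar>B\<bar> * (d * hnorm x)" by (intro mult_left_mono d x) auto
    finally show "Re (\<phi> (J x)) \<le> \<bar>B\<bar> * d * hnorm x" by simp
  next
    show "Re (\<phi> (J (a *\<^sub>R x))) = a * Re (\<phi> (J x))" if "x \<in> H" for a x
      using sc[OF that, of "complex_of_real a"] by (simp add: cscale_real)
  qed (simp add: add)
  then obtain z where z: "z \<in> H" "\<And>x. x \<in> H \<Longrightarrow> Re (\<phi> (J x)) = ip x z" by blast
  have "\<phi> (J x) = bilin x (K z)" if x: "x \<in> H" for x
  proof (rule complex_eqI)
    show "Re (\<phi> (J x)) = Re (bilin x (K z))" using z x by (simp add: bilin_def K_K)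
    have "\<phi> (J (I x)) = \<i> * \<phi> (J x)" using sc[OF x, of \<i>] by (simp add: cscale_def)
    then have "Im (\<phi> (J x)) = - Re (\<phi> (J (I x)))" by simp
    then show "Im (\<phi> (J x)) = Im (bilin x (K z))" using z x by (simp add: bilin_def K_K)
  qed
  then have "\<phi> u = dual_map (J (K z)) u" for u
    using ext z by (cases "u \<in> J ` H") (auto simp: dual_map, simp add: dual_map_def extensional_def)
  then show ?thesis using z by (intro bexI[of _ "K z"]) auto
qed

lemma dual_map_norm:
  assumes N: "cx_norm N" and y: "y \<in> H"
  shows "vnorm (cn_dual (qspace H I N J)) (dual_map (J y)) = dual_norm N y"
proof -
  define U where "U = {u \<in> J ` H. vnorm (qspace H I N J) u \<le> 1}"
  have e: "vnorm (cn_dual (qspace H I N J)) (dual_map (J y)) = (SUP u\<in>U. cmod (dual_map (J y) u))"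
    by (simp add: cn_dual_def U_def q_carrier)
  have "J 0 \<in> U" using seminorm_on_zero[OF cx_norm_seminorm[OF N]] by (simp add: U_def q_norm[OF N])
  then have ne: "U \<noteq> {}" by blast
  have le: "cmod (dual_map (J y) u) \<le> dual_norm N y" if u: "u \<in> U" for u
  proof -
    obtain x where x: "x \<in> H" "u = J x" "N x \<le> 1"
      using u q_norm[OF N] by (force simp: U_def)
    have "cmod (bilin x y) \<le> N x * dual_norm N y" by (rule bilin_bound[OF N x(1) y])
    also have "\<dots> \<le> 1 * dual_norm N y" by (rule mult_right_mono[OF x(3) dual_norm_nonneg[OF N y]])
    finally show ?thesis using x y by (simp add: dual_map)
  qed
  show ?thesis
    unfolding e
  proof (rule antisym)
    show "(SUP u\<in>U. cmod (dual_map (J y) u)) \<le> dual_norm N y" by (rule cSUP_least[OF ne le])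
    show "dual_norm N y \<le> (SUP u\<in>U. cmod (dual_map (J y) u))"
    proof (rule dual_norm_least[OF N])
      fix x assume x: "x \<in> H" "N x \<le> 1"
      have "ip x (K y) \<le> cmod (dual_map (J y) (J x))"
        using complex_Re_le_cmod[of "bilin x y"] x y by (simp add: dual_map) (simp add: bilin_def)
      also have "\<dots> \<le> (SUP u\<in>U. cmod (dual_map (J y) u))"
        by (rule cSUP_upper) (use x le in \<open>auto simp: U_def q_norm[OF N] intro!: bdd_aboveI2\<close>)
      finally show "ip x (K y) \<le> (SUP u\<in>U. cmod (dual_map (J y) u))" .
    qed
  qed
qed

lemma q_dual_isometric:
  assumes N: "cx_norm N"
  shows "cn_isometric (cn_dual (qspace H I N J)) (qspace H I (dual_norm N) J)"
proof -
  note N' = dual_norm_cx_norm[OF N]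
  define D where "D = cn_dual (qspace H I N J)"
  define F where "F = qspace H I (dual_norm N) J"
  define f where "f \<phi> = J (SOME y. y \<in> H \<and> \<phi> = dual_map (J y))" for \<phi>
  have inj: "J y = J y'" if y: "y \<in> H" "y' \<in> H" and e: "dual_map (J y) = dual_map (J y')" for y y'
  proof -
    have "bilin x y = bilin x y'" if "x \<in> H" for x using e that y by (metis dual_map)
    then have "ip x (K y) = ip x (K y')" if "x \<in> H" for x using that by (auto simp: bilin_def)
    then have "ip (K (y - y')) (K (y - y')) = 0" using y by (simp add: K_diff ip_simps)
    then show ?thesis using J_eq_iff[OF y] y by (simp add: ip_K)
  qed
  have f: "f (dual_map (J y)) = J y" if y: "y \<in> H" for y
  proof -
    have "\<exists>z. z \<in> H \<and> dual_map (J y) = dual_map (J z)" using y by blast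
    then have "(SOME z. z \<in> H \<and> dual_map (J y) = dual_map (J z)) \<in> H \<and>
        dual_map (J y) = dual_map (J (SOME z. z \<in> H \<and> dual_map (J y) = dual_map (J z)))" by (rule someI_ex)
    then have "J y = J (SOME z. z \<in> H \<and> dual_map (J y) = dual_map (J z))"
      using inj[OF y] by blast
    then show ?thesis by (simp only: f_def)
  qed
  have cD: "carrier D = {dual_map (J y) | y. y \<in> H}"
    using dual_map_in[OF N] dual_map_onto[OF N] by (auto simp: D_def)
  have cF: "carrier F = J ` H" by (simp add: F_def q_carrier)
  have addD: "dual_map (J y) \<oplus>\<^bsub>D\<^esub> dual_map (J y') = dual_map (J (y + y'))" if "y \<in> H" "y' \<in> H" for y y'
  proof
    fix u
    show "(dual_map (J y) \<oplus>\<^bsub>D\<^esub> dual_map (J y')) u = dual_map (J (y + y')) u"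
    proof (cases "u \<in> J ` H")
      case True
      then show ?thesis using that by (auto simp: D_def cn_dual_def q_carrier dual_map bilin_add_right)
    next
      case False
      then show ?thesis by (simp add: D_def cn_dual_def q_carrier dual_map_def)
    qed
  qed
  have smD: "c \<odot>\<^bsub>D\<^esub> dual_map (J y) = dual_map (J (cscale I c y))" if "y \<in> H" for y c
  proof
    fix u
    show "(c \<odot>\<^bsub>D\<^esub> dual_map (J y)) u = dual_map (J (cscale I c y)) u"
    proof (cases "u \<in> J ` H")
      case True
      then show ?thesis using that by (auto simp: D_def cn_dual_def q_carrier dual_map bilin_cscale_right)
    next
      case False
      then show ?thesis by (simp add: D_def cn_dual_def q_carrier dual_map_def)
    qed
  qed
  have "cn_linear D F f"
    unfolding cn_linear_def
    by (auto simp: cD cF f addD smD) (auto simp: F_def q_add[OF N'] q_smult[OF N'])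
  moreover have "bij_betw f (carrier D) (carrier F)"
    unfolding bij_betw_def
  proof
    show "inj_on f (carrier D)"
    proof (rule inj_onI)
      fix \<phi> \<psi> assume "\<phi> \<in> carrier D" "\<psi> \<in> carrier D" and e: "f \<phi> = f \<psi>"
      then obtain y z where y: "y \<in> H" "\<phi> = dual_map (J y)" and z: "z \<in> H" "\<psi> = dual_map (J z)"
        unfolding cD by blast
      have "J y = J z" using e f[OF y(1)] f[OF z(1)] by (simp only: y(2) z(2))
      then show "\<phi> = \<psi>" by (simp only: y(2) z(2))
    qed
    show "f ` carrier D = carrier F"
    proof -
      have "carrier D = (\<lambda>y. dual_map (J y)) ` H" unfolding cD by blast
      then have "f ` carrier D = (\<lambda>y. f (dual_map (J y))) ` H" by (simp add: image_image)
      also have "\<dots> = J ` H" by (rule image_cong) (use f in auto)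
      finally show ?thesis by (simp add: cF)
    qed
  qed
  moreover have "vnorm F (f \<phi>) = vnorm D \<phi>" if \<phi>: "\<phi> \<in> carrier D" for \<phi>
  proof -
    obtain y where y: "y \<in> H" "\<phi> = dual_map (J y)" using \<phi> unfolding cD by blast
    show ?thesis
      unfolding y(2) f[OF y(1)] unfolding F_def D_def q_norm[OF N' y(1)] dual_map_norm[OF N y(1)] ..
  qed
  ultimately show ?thesis unfolding cn_isometric_def D_def F_def by blast
qed

lemma q_conj_isometric:
  assumes N: "cx_norm N"
  shows "cn_isometric (cn_conj (qspace H I N J)) (qspace H I (\<lambda>x. N (K x)) J)"
proof -
  note N' = cx_norm_K(1)[OF N]
  define D where "D = cn_conj (qspace H I N J)"
  define F where "F = qspace H I (\<lambda>x. N (K x)) J"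
  define f where "f a = J (K (some_preimage H J a))" for a
  have JK: "J (K x) = J (K y)" if "x \<in> H" "y \<in> H" "J x = J y" for x y
    using J_eq_iff[of x y] J_eq_iff[of "K x" "K y"] that ip_K[of "x - y" "x - y"] by (simp add: K_diff)
  have f: "f (J x) = J (K x)" if "x \<in> H" for x
    unfolding f_def by (rule JK) (use that in auto)
  have cD: "carrier D = J ` H" by (simp add: D_def cn_conj_def q_carrier)
  have cF: "carrier F = J ` H" by (simp add: F_def q_carrier)
  have aD: "J x \<oplus>\<^bsub>D\<^esub> J y = J (x + y)" if "x \<in> H" "y \<in> H" for x y
    using q_add[OF N that] by (simp add: D_def cn_conj_def)
  have sD: "c \<odot>\<^bsub>D\<^esub> J x = J (cscale I (cnj c) x)" if "x \<in> H" for x c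
    using q_smult[OF N that] by (simp add: D_def cn_conj_def)
  have nD: "vnorm D (J x) = N x" if "x \<in> H" for x
    using q_norm[OF N that] by (simp add: D_def cn_conj_def)
  have Kc: "K (cscale I (cnj c) x) = cscale I c (K x)" for c x
    by (simp add: cscale_def K_add K_diff K_scale K_I K_minus)
  have "cn_linear D F f"
    unfolding cn_linear_def
    by (auto simp: cD cF f aD sD) (auto simp: F_def q_add[OF N'] q_smult[OF N'] K_add Kc)
  moreover have "bij_betw f (carrier D) (carrier F)"
    unfolding cD cF
  proof (rule bij_betw_byWitness[where f' = f])
    show "\<forall>a\<in>J ` H. f (f a) = a" by (auto simp: f K_K)
  qed (auto simp: f K_K)
  moreover have "vnorm F (f a) = vnorm D a" if "a \<in> carrier D" for a
    using that by (auto simp: cD f nD F_def q_norm[OF N'] K_K)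
  ultimately show ?thesis unfolding cn_isometric_def D_def F_def by blast
qed

end

text \<open>One type of vectors suffices for all dimensions, because the spaces of square integrable
  functions used later are subspaces of a single function type.\<close>

definition hilbert_class ::
    "'f::real_vector itself \<Rightarrow> real \<Rightarrow> real \<Rightarrow> 'u cnspace set" where
  "hilbert_class _ C \<beta> = {E. \<exists>(H :: 'f set) ip I K J N.
     cx_hilbert_code H ip I K J \<and> cx_hilbert.good_norm H ip I K C \<beta> N \<and> E = qspace H I N J}"

lemma hilbert_classE:
  assumes "E \<in> hilbert_class TYPE('f::real_vector) C \<beta>"
  obtains H ip I K J N where "cx_hilbert_code (H :: 'f set) ip I K J"
    "cx_hilbert.good_norm H ip I K C \<beta> N" "E = qspace H I N J"
  using assms by (auto simp: hilbert_class_def)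

lemma hilbert_classI:
  "cx_hilbert_code (H :: 'f::real_vector set) ip I K J \<Longrightarrow> cx_hilbert.good_norm H ip I K C \<beta> N \<Longrightarrow>
    qspace H I N J \<in> hilbert_class TYPE('f) C \<beta>"
  unfolding hilbert_class_def by blast

lemma hilbert_class_banach:
  assumes "E \<in> hilbert_class TYPE('f::real_vector) C \<beta>"
  shows "complex_banach E"
  using assms
proof (rule hilbert_classE)
  fix H ip I K J N
  assume a: "cx_hilbert_code (H :: 'f set) ip I K J" and "cx_hilbert.good_norm H ip I K C \<beta> N"
    and "E = qspace H I N J"
  interpret cx_hilbert_code H ip I K J by (rule a)
  show ?thesis using q_complex_banach \<open>good_norm C \<beta> N\<close> \<open>E = _\<close> by (simp add: good_norm_def)
qed

lemma hilbert_class_type: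
  assumes "0 \<le> C" "0 \<le> \<beta>" "\<beta> < 1"
  shows "class_type_gt_1 (hilbert_class TYPE('f::real_vector) C \<beta>)"
proof -
  define p where "p = 1 + (1 - \<beta>) / 4"
  define r where "r = 2 powr (- (1 - \<beta>) / 4)"
  have "cn_rademacher_type E p ((1 + 4 * C / (1 - r) / (1 - r)) powr (1 / p))"
    if "E \<in> hilbert_class TYPE('f) C \<beta>" for E
    using that
  proof (rule hilbert_classE)
    fix H ip I K J N
    assume a: "cx_hilbert_code (H :: 'f set) ip I K J" and "cx_hilbert.good_norm H ip I K C \<beta> N"
      and "E = qspace H I N J"
    interpret cx_hilbert_code H ip I K J by (rule a)
    show ?thesis
      using q_rademacher_type[OF _ _ assms p_def r_def] \<open>good_norm C \<beta> N\<close> \<open>E = _\<close> by (simp add: good_norm_def)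
  qed
  moreover have "p > 1" using assms by (simp add: p_def)
  ultimately show ?thesis unfolding class_type_gt_1_def by blast
qed

text \<open>The dual carries the dual norm and the conjugate space the norm composed with
  \<open>K\<close>.\<close>

lemma hilbert_class_stable: "class_stable (hilbert_class TYPE('f::real_vector) C \<beta> :: 'u cnspace set)"
  unfolding class_stable_def
proof (intro ballI)
  let ?\<E> = "hilbert_class TYPE('f) C \<beta> :: 'u cnspace set"
  fix E assume "E \<in> ?\<E>"
  then show "(\<exists>F\<in>?\<E>. cn_isometric (cn_dual E) F) \<and> (\<exists>F\<in>?\<E>. cn_isometric (cn_conj E) F)"
  proof (rule hilbert_classE)
    fix H ip I K J N
    assume a: "cx_hilbert_code (H :: 'f set) ip I K J" and "cx_hilbert.good_norm H ip I K C \<beta> N"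
      and E: "E = qspace H I N J"
    interpret cx_hilbert_code H ip I K J by (rule a)
    have g: "good_norm C \<beta> N" by fact
    then have N: "cx_norm N" by (simp add: good_norm_def)
    have 1: "cn_isometric (cn_dual E) (qspace H I (dual_norm N) J)" unfolding E by (rule q_dual_isometric[OF N])
    have 2: "cn_isometric (cn_conj E) (qspace H I (\<lambda>x. N (K x)) J)" unfolding E by (rule q_conj_isometric[OF N])
    have 3: "qspace H I (dual_norm N) J \<in> hilbert_class TYPE('f) C \<beta>" by (rule hilbert_classI[OF a good_norm_dual_norm[OF g]])
    have 4: "qspace H I (\<lambda>x. N (K x)) J \<in> hilbert_class TYPE('f) C \<beta>" by (rule hilbert_classI[OF a good_norm_K[OF g]])
    show ?thesis using 1 2 3 4 by blast
  qed
qed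


section \<open>A uniform gap from property (T)\<close>

definition l1norm :: "('g \<Rightarrow> complex) \<Rightarrow> real" where
  "l1norm f = (\<Sum>g\<in>supp f. cmod (f g))"

lemma group_algebra_carrierD:
  "f \<in> carrier (group_algebra G) \<Longrightarrow> finite (supp f)"
  "f \<in> carrier (group_algebra G) \<Longrightarrow> supp f \<subseteq> carrier G"
  by (simp_all add: group_algebra_def)

lemma group_algebra_diff:
  assumes "f \<in> carrier (group_algebra G)" "h \<in> carrier (group_algebra G)"
  shows "(\<lambda>g. f g - h g) \<in> carrier (group_algebra G)"
proof -
  have "supp (\<lambda>g. f g - h g) \<subseteq> supp f \<union> supp h" by auto
  then show ?thesis
    using assms finite_subset[of "supp (\<lambda>g. f g - h g)" "supp f \<union> supp h"]
    by (auto simp: group_algebra_def)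
qed

context cx_hilbert_code
begin

lemma cscale_in_sum: "(\<And>g. g \<in> A \<Longrightarrow> v g \<in> H) \<Longrightarrow> (\<Sum>g\<in>A. cscale I (f g) (v g)) \<in> H"
  by (rule subspace_sum[OF H]) simp

lemma sum_cscale_diff:
  "(\<Sum>g\<in>A. cscale I (f g - h g) (v g)) = (\<Sum>g\<in>A. cscale I (f g) (v g)) - (\<Sum>g\<in>A. cscale I (h g) (v g))"
proof -
  have "cscale I (a - b) x = cscale I a x - cscale I b x" for a b x
    by (simp add: cscale_def scaleR_diff_left)
  then show ?thesis by (simp add: sum_subtractf)
qed

lemma norm_sum_cscale:
  assumes N: "cx_norm N" and "finite A" "\<And>g. g \<in> A \<Longrightarrow> v g \<in> H" "\<And>g. g \<in> A \<Longrightarrow> N (v g) \<le> M"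
  shows "N (\<Sum>g\<in>A. cscale I (f g) (v g)) \<le> (\<Sum>g\<in>A. cmod (f g)) * M"
proof -
  have "N (\<Sum>g\<in>A. cscale I (f g) (v g)) \<le> (\<Sum>g\<in>A. N (cscale I (f g) (v g)))"
    by (rule seminorm_on_sum[OF cx_norm_seminorm[OF N] assms(2)]) (use assms in simp)
  also have "\<dots> \<le> (\<Sum>g\<in>A. cmod (f g) * M)"
    by (rule sum_mono) (use assms in \<open>simp add: cx_norm_cscale[OF N] mult_left_mono\<close>)
  finally show ?thesis by (simp add: sum_distrib_right)
qed

context
  fixes N G \<pi> assumes N: "cx_norm N" and rep: "isometric_rep G (qspace H I N J) \<pi>"
begin

abbreviation (input) "QE \<equiv> qspace H I N J"

lemma rep_in: "g \<in> carrier G \<Longrightarrow> x \<in> H \<Longrightarrow> \<pi> g (J x) \<in> J ` H"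
  using rep group_action.element_image[of G "carrier QE" \<pi> g "J x"] by (auto simp: isometric_rep_def q_carrier)

lemma rep_norm: "g \<in> carrier G \<Longrightarrow> x \<in> H \<Longrightarrow> N (some_preimage H J (\<pi> g (J x))) = N x"
proof -
  assume a: "g \<in> carrier G" "x \<in> H"
  have "vnorm QE (\<pi> g (J x)) = vnorm QE (J x)" using rep a by (auto simp: isometric_rep_def q_carrier)
  then show "N (some_preimage H J (\<pi> g (J x))) = N x"
    using q_norm[OF N a(2)] q_norm[OF N, of "some_preimage H J (\<pi> g (J x))"] rep_in[OF a] by simp
qed

lemma q_rep_op:
  assumes x: "x \<in> H" and A: "finite A" "supp f \<subseteq> A" "A \<subseteq> carrier G"
  shows "rep_op QE \<pi> f (J x) = J (\<Sum>g\<in>A. cscale I (f g) (some_preimage H J (\<pi> g (J x))))"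
proof -
  define v where "v g = some_preimage H J (\<pi> g (J x))" for g
  have v: "v g \<in> H" "\<pi> g (J x) = J (v g)" if "g \<in> A" for g
    using rep_in[of g x] that A x by (auto simp: v_def)
  have s: "finite (supp f)" using A finite_subset by auto
  interpret E: abelian_group QE by (rule q_abelian_group[OF N])
  have "rep_op QE \<pi> f (J x) = (\<Oplus>\<^bsub>QE\<^esub>g\<in>supp f. J (cscale I (f g) (v g)))"
    unfolding rep_op_def
    by (rule E.finsum_cong') (use v A in \<open>auto simp: q_carrier q_smult[OF N]\<close>)
  also have "\<dots> = J (\<Sum>g\<in>supp f. cscale I (f g) (v g))"
    by (rule q_finsum[OF N s]) (use v A in auto)
  also have "(\<Sum>g\<in>supp f. cscale I (f g) (v g)) = (\<Sum>g\<in>A. cscale I (f g) (v g))"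
    by (rule sum.mono_neutral_left) (use A in \<open>auto simp: cscale_def\<close>)
  finally show ?thesis by (simp add: v_def)
qed

lemma q_rep_op_in:
  assumes "x \<in> H" "f \<in> carrier (group_algebra G)"
  shows "rep_op QE \<pi> f (J x) \<in> J ` H"
proof -
  note s = group_algebra_carrierD[OF assms(2)]
  have "some_preimage H J (\<pi> g (J x)) \<in> H" if "g \<in> supp f" for g
    by (rule some_preimage_in, rule rep_in) (use that s assms in auto)
  then have "(\<Sum>g\<in>supp f. cscale I (f g) (some_preimage H J (\<pi> g (J x)))) \<in> H" by (rule cscale_in_sum)
  then show ?thesis unfolding q_rep_op[OF assms(1) s(1) order_refl s(2)] by (rule imageI)
qed

lemma q_rep_op_diff:
  assumes x: "x \<in> H" and f: "f \<in> carrier (group_algebra G)" and h: "h \<in> carrier (group_algebra G)"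
  shows "rep_op QE \<pi> f (J x) \<ominus>\<^bsub>QE\<^esub> rep_op QE \<pi> h (J x) = rep_op QE \<pi> (\<lambda>g. f g - h g) (J x)"
proof -
  define A where "A = supp f \<union> supp h"
  have A: "finite A" "supp f \<subseteq> A" "supp h \<subseteq> A" "A \<subseteq> carrier G" "supp (\<lambda>g. f g - h g) \<subseteq> A"
  proof -
    show "finite A" unfolding A_def by (intro finite_UnI group_algebra_carrierD(1)[OF f] group_algebra_carrierD(1)[OF h])
    show "supp f \<subseteq> A" "supp h \<subseteq> A" unfolding A_def by (rule Un_upper1, rule Un_upper2)
    show "A \<subseteq> carrier G" unfolding A_def by (intro Un_least group_algebra_carrierD(2) f h)
    show "supp (\<lambda>g. f g - h g) \<subseteq> A" unfolding A_def by auto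
  qed
  have v: "some_preimage H J (\<pi> g (J x)) \<in> H" if "g \<in> A" for g using rep_in[of g x] that A x by auto
  show ?thesis
    unfolding q_rep_op[OF x A(1,2,4)] q_rep_op[OF x A(1,3,4)] q_rep_op[OF x A(1,5,4)] sum_cscale_diff
    by (rule q_minus[OF N]; rule cscale_in_sum; rule v)
qed

lemma q_rep_op_le_l1:
  assumes x: "x \<in> H" and f: "f \<in> carrier (group_algebra G)"
  shows "vnorm QE (rep_op QE \<pi> f (J x)) \<le> l1norm f * N x"
proof -
  note s = group_algebra_carrierD[OF f]
  have v: "some_preimage H J (\<pi> g (J x)) \<in> H" "N (some_preimage H J (\<pi> g (J x))) \<le> N x" if "g \<in> supp f" for g
    using rep_in[of g x] rep_norm[of g x] that s x by auto
  show ?thesis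
    unfolding q_rep_op[OF x s(1) order_refl s(2)] l1norm_def
    using norm_sum_cscale[OF N s(1), of "\<lambda>g. some_preimage H J (\<pi> g (J x))" "N x" f] v
      cscale_in_sum[of "supp f" "\<lambda>g. some_preimage H J (\<pi> g (J x))" f]
    by (subst q_norm[OF N]) auto
qed

lemma l1norm_nonneg: "0 \<le> l1norm f" by (simp add: l1norm_def sum_nonneg)

lemma q_rep_op_le_op_norm:
  assumes x: "x \<in> H" "N x \<le> 1" and f: "f \<in> carrier (group_algebra G)"
  shows "vnorm QE (rep_op QE \<pi> f (J x)) \<le> op_norm QE (rep_op QE \<pi> f)"
  unfolding op_norm_def
proof (rule cSUP_upper)
  show "J x \<in> {x \<in> carrier QE. vnorm QE x \<le> 1}" using x by (simp add: q_carrier q_norm[OF N])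
  show "bdd_above ((\<lambda>x. vnorm QE (rep_op QE \<pi> f x)) ` {x \<in> carrier QE. vnorm QE x \<le> 1})"
  proof (rule bdd_aboveI2)
    fix u assume "u \<in> {x \<in> carrier QE. vnorm QE x \<le> 1}"
    then obtain y where y: "y \<in> H" "u = J y" "N y \<le> 1" using q_norm[OF N] by (force simp: q_carrier)
    show "vnorm QE (rep_op QE \<pi> f u) \<le> l1norm f * 1"
      unfolding y(2) using q_rep_op_le_l1[OF y(1) f] mult_left_mono[OF y(3) l1norm_nonneg[of f]] by linarith
  qed
qed

lemma q_op_norm_le:
  assumes f: "f \<in> carrier (group_algebra G)"
  shows "op_norm QE (rep_op QE \<pi> f) \<le> l1norm f"
  unfolding op_norm_def
proof (rule cSUP_least)
  have "J 0 \<in> {x \<in> carrier QE. vnorm QE x \<le> 1}"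
    using seminorm_on_zero[OF cx_norm_seminorm[OF N]] by (simp add: q_carrier q_norm[OF N])
  then show "{x \<in> carrier QE. vnorm QE x \<le> 1} \<noteq> {}" by blast
  fix u assume "u \<in> {x \<in> carrier QE. vnorm QE x \<le> 1}"
  then obtain y where y: "y \<in> H" "u = J y" "N y \<le> 1" using q_norm[OF N] by (force simp: q_carrier)
  show "vnorm QE (rep_op QE \<pi> f u) \<le> l1norm f"
    unfolding y(2) using q_rep_op_le_l1[OF y(1) f] mult_left_mono[OF y(3) l1norm_nonneg[of f]] by linarith
qed

lemma q_rep_op_scale:
  assumes x: "x \<in> H" and f: "f \<in> carrier (group_algebra G)"
  shows "vnorm QE (rep_op QE \<pi> f (J (r *\<^sub>R x))) = \<bar>r\<bar> * vnorm QE (rep_op QE \<pi> f (J x))"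
proof -
  note s = group_algebra_carrierD[OF f]
  interpret E: abelian_group QE by (rule q_abelian_group[OF N])
  define v where "v g = some_preimage H J (\<pi> g (J x))" for g
  have v: "v g \<in> H" "\<pi> g (J x) = J (v g)" if "g \<in> supp f" for g
    using rep_in[of g x] that s x by (auto simp: v_def)
  have r: "\<pi> g (J (r *\<^sub>R x)) = J (r *\<^sub>R v g)" if "g \<in> supp f" for g
  proof -
    have "\<pi> g (complex_of_real r \<odot>\<^bsub>QE\<^esub> J x) = complex_of_real r \<odot>\<^bsub>QE\<^esub> \<pi> g (J x)"
      using rep that s x by (auto simp: isometric_rep_def cn_linear_def q_carrier)
    then show ?thesis using x v[OF that] by (simp add: q_smult[OF N] cscale_real)
  qed
  have c: "cscale I a (r *\<^sub>R y) = r *\<^sub>R cscale I a y" for a y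
    by (simp add: cscale_def I_scale scaleR_add_right mult.commute)
  have "rep_op QE \<pi> f (J (r *\<^sub>R x)) = (\<Oplus>\<^bsub>QE\<^esub>g\<in>supp f. J (r *\<^sub>R cscale I (f g) (v g)))"
    unfolding rep_op_def
    by (rule E.finsum_cong') (use v s in \<open>auto simp: q_carrier q_smult[OF N] r c\<close>)
  also have "\<dots> = J (\<Sum>g\<in>supp f. r *\<^sub>R cscale I (f g) (v g))"
    by (rule q_finsum[OF N s(1)]) (use v in auto)
  also have "\<dots> = J (r *\<^sub>R (\<Sum>g\<in>supp f. cscale I (f g) (v g)))" by (simp add: scaleR_sum_right)
  finally show ?thesis
    unfolding q_rep_op[OF x s(1) order_refl s(2)] v_def[symmetric]
    using v cscale_in_sum[of "supp f" v f]
    by (simp add: q_norm[OF N] seminorm_on_scale[OF cx_norm_seminorm[OF N]])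
qed

end

end

text \<open>Isometric representations act with norm at most the \<open>\<ell>\<^sup>1\<close> norm,
  so the supremum that defines the norm of the class is a supremum of a bounded set.\<close>

lemma class_norm_bdd:
  assumes f: "f \<in> carrier (group_algebra G)"
  shows "bdd_above (insert 0 {op_norm E (rep_op E \<pi> f) | E \<pi>.
    E \<in> (hilbert_class TYPE('f::real_vector) C \<beta> :: 'u cnspace set) \<and> isometric_rep G E \<pi>})"
    and "class_norm G (hilbert_class TYPE('f) C \<beta> :: 'u cnspace set) f \<le> l1norm f"
proof -
  let ?S = "{op_norm E (rep_op E \<pi> f) | E \<pi>.
    E \<in> (hilbert_class TYPE('f::real_vector) C \<beta> :: 'u cnspace set) \<and> isometric_rep G E \<pi>}"
  have le: "v \<le> l1norm f" if v: "v \<in> insert 0 ?S" for v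
  proof (cases "v = 0")
    case True
    then show ?thesis by (simp add: l1norm_def sum_nonneg)
  next
    case False
    then obtain E \<pi> where E: "E \<in> (hilbert_class TYPE('f) C \<beta> :: 'u cnspace set)" "isometric_rep G E \<pi>"
      "v = op_norm E (rep_op E \<pi> f)" using v by blast
    from E(1) show ?thesis
    proof (rule hilbert_classE)
      fix H ip I K J N
      assume a: "cx_hilbert_code (H :: 'f set) ip I K J" and "cx_hilbert.good_norm H ip I K C \<beta> N"
        and "E = qspace H I N J"
      interpret cx_hilbert_code H ip I K J by (rule a)
      show ?thesis using q_op_norm_le[OF _ _ f] \<open>good_norm C \<beta> N\<close> \<open>E = _\<close> E by (simp add: good_norm_def)
    qed
  qed
  then show "bdd_above (insert 0 ?S)" by (rule bdd_aboveI)
  show "class_norm G (hilbert_class TYPE('f) C \<beta> :: 'u cnspace set) f \<le> l1norm f"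
    unfolding class_norm_def by (rule cSup_least) (use le in blast)+
qed

lemma (in cx_hilbert_code) q_rep_op_le_class_norm:
  assumes g: "good_norm C \<beta> N" and rep: "isometric_rep G (qspace H I N J) \<pi>"
    and x: "x \<in> H" and f: "f \<in> carrier (group_algebra G)"
  shows "vnorm (qspace H I N J) (rep_op (qspace H I N J) \<pi> f (J x)) \<le>
    class_norm G (hilbert_class TYPE('f) C \<beta> :: 'u cnspace set) f * N x"
proof -
  let ?E = "qspace H I N J"
  have N: "cx_norm N" using g by (simp add: good_norm_def)
  note sN = cx_norm_seminorm[OF N]
  have E: "?E \<in> hilbert_class TYPE('f) C \<beta>" by (rule hilbert_classI[OF cx_hilbert_code_axioms g])
  show ?thesis
  proof (cases "N x = 0")
    case True
    then show ?thesis using q_rep_op_le_l1[OF N rep x f] by simp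
  next
    case False
    then have p: "N x > 0" using seminorm_on_nonneg[OF sN x] by simp
    have "vnorm ?E (rep_op ?E \<pi> f (J ((1 / N x) *\<^sub>R x))) \<le> op_norm ?E (rep_op ?E \<pi> f)"
      by (rule q_rep_op_le_op_norm[OF N rep _ _ f]) (use x p seminorm_on_scale[OF sN x] in auto)
    also have "\<dots> \<le> class_norm G (hilbert_class TYPE('f) C \<beta> :: 'u cnspace set) f"
      unfolding class_norm_def
      by (rule cSup_upper[OF _ class_norm_bdd(1)[OF f]]) (use E rep in blast)
    finally have "(1 / N x) * vnorm ?E (rep_op ?E \<pi> f (J x)) \<le>
        class_norm G (hilbert_class TYPE('f) C \<beta> :: 'u cnspace set) f"
      using q_rep_op_scale[OF N rep x f, of "1 / N x"] p by simp
    then show ?thesis using p by (simp add: field_simps)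
  qed
qed

text \<open>An element of the completed group algebra is a class of Cauchy sequences; it acts as the
  pointwise limit of the operators along any sequence in the class. Completeness of the space gives
  existence of the limit, and sequences in the null ideal act by operators that tend to
  zero.\<close>

lemma (in cx_hilbert_code) class_rep_op_limit:
  assumes g: "good_norm C \<beta> N" and rep: "isometric_rep G (qspace H I N J) \<pi>"
    and v: "v \<in> carrier (cauchy_ring G (hilbert_class TYPE('f) C \<beta> :: 'u cnspace set))"
    and p: "p = null_ideal G (hilbert_class TYPE('f) C \<beta> :: 'u cnspace set) +>\<^bsub>cauchy_ring G (hilbert_class TYPE('f) C \<beta> :: 'u cnspace set)\<^esub> v"
    and x: "x \<in> H"
  shows "\<exists>y\<in>H. class_rep_op (qspace H I N J) \<pi> p (J x) = J y \<and>
    (\<lambda>n. vnorm (qspace H I N J) (rep_op (qspace H I N J) \<pi> (v n) (J x) \<ominus>\<^bsub>qspace H I N J\<^esub> J y)) \<longlonglongrightarrow> 0"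
proof -
  let ?E = "qspace H I N J"
  define \<E> where "\<E> = (hilbert_class TYPE('f) C \<beta> :: 'u cnspace set)"
  have N: "cx_norm N" using g by (simp add: good_norm_def)
  note sN = cx_norm_seminorm[OF N]
  have cn: "vnorm ?E (rep_op ?E \<pi> f (J x)) \<le> class_norm G \<E> f * N x" if "f \<in> carrier (group_algebra G)" for f
    unfolding \<E>_def by (rule q_rep_op_le_class_norm[OF g rep x that])
  have vG: "v n \<in> carrier (group_algebra G)" for n using v by (auto simp: cauchy_ring_def)
  have vC: "\<exists>M. \<forall>m\<ge>M. \<forall>n\<ge>M. class_norm G \<E> (\<lambda>g. v m g - v n g) < e" if "e > 0" for e
    using v that by (auto simp: cauchy_ring_def \<E>_def)
  define w where "w n = some_preimage H J (rep_op ?E \<pi> (v n) (J x))" for n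
  have w: "w n \<in> H" "rep_op ?E \<pi> (v n) (J x) = J (w n)" for n
    using q_rep_op_in[OF N rep x vG] by (auto simp: w_def)
  have Nx: "0 \<le> N x" by (rule seminorm_on_nonneg[OF sN x])
  have "\<exists>y\<in>carrier ?E. (\<lambda>n. vnorm ?E (rep_op ?E \<pi> (v n) (J x) \<ominus>\<^bsub>?E\<^esub> y)) \<longlonglongrightarrow> 0"
  proof -
    have "range (\<lambda>n. rep_op ?E \<pi> (v n) (J x)) \<subseteq> carrier ?E"
      using w by (auto simp: q_carrier)
    moreover have "\<exists>M. \<forall>m\<ge>M. \<forall>n\<ge>M. vnorm ?E (rep_op ?E \<pi> (v m) (J x) \<ominus>\<^bsub>?E\<^esub> rep_op ?E \<pi> (v n) (J x)) < e"
      if e: "e > 0" for e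
    proof -
      obtain M where M: "\<And>m n. m \<ge> M \<Longrightarrow> n \<ge> M \<Longrightarrow> class_norm G \<E> (\<lambda>g. v m g - v n g) < e / (N x + 1)"
        using vC[of "e / (N x + 1)"] e Nx by auto
      have "vnorm ?E (rep_op ?E \<pi> (v m) (J x) \<ominus>\<^bsub>?E\<^esub> rep_op ?E \<pi> (v n) (J x)) < e" if "m \<ge> M" "n \<ge> M" for m n
      proof -
        have "vnorm ?E (rep_op ?E \<pi> (v m) (J x) \<ominus>\<^bsub>?E\<^esub> rep_op ?E \<pi> (v n) (J x)) \<le>
            class_norm G \<E> (\<lambda>g. v m g - v n g) * N x"
          unfolding q_rep_op_diff[OF N rep x vG vG] by (rule cn[OF group_algebra_diff[OF vG vG]])
        also have "\<dots> \<le> e / (N x + 1) * N x" by (intro mult_right_mono less_imp_le[OF M[OF that]] Nx)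
        also have "\<dots> < e" using e Nx by (simp add: field_simps)
        finally show ?thesis .
      qed
      then show ?thesis by blast
    qed
    ultimately show ?thesis
      using q_complex_banach[OF N] unfolding complex_banach_def by blast
  qed
  then obtain y where y: "y \<in> H" "(\<lambda>n. vnorm ?E (rep_op ?E \<pi> (v n) (J x) \<ominus>\<^bsub>?E\<^esub> J y)) \<longlonglongrightarrow> 0"
    by (auto simp: q_carrier)
  then have lim: "(\<lambda>n. N (w n - y)) \<longlonglongrightarrow> 0" using w by (simp add: q_minus[OF N] q_norm[OF N])
  have all: "(\<lambda>n. vnorm ?E (rep_op ?E \<pi> (u n) (J x) \<ominus>\<^bsub>?E\<^esub> J y)) \<longlonglongrightarrow> 0" if u: "u \<in> p" for u
  proof -
    obtain h where h: "h \<in> null_ideal G \<E>" "u = h \<oplus>\<^bsub>cauchy_ring G \<E>\<^esub> v"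
      using u unfolding p \<E>_def[symmetric] by (auto simp: a_r_coset_def')
    have hG: "h n \<in> carrier (group_algebra G)" for n using h(1) by (auto simp: null_ideal_def cauchy_ring_def)
    have hnorm: "(\<lambda>n. class_norm G \<E> (h n)) \<longlonglongrightarrow> 0" using h(1) by (simp add: null_ideal_def)
    have un: "u n = (\<lambda>g. h n g + v n g)" for n using h(2) by (simp add: cauchy_ring_def group_algebra_def)
    have uG: "u n \<in> carrier (group_algebra G)" for n
    proof -
      have "supp (u n) \<subseteq> supp (h n) \<union> supp (v n)" unfolding un by auto
      then show ?thesis
        using group_algebra_carrierD[OF hG[of n]] group_algebra_carrierD[OF vG[of n]]
          finite_subset[of "supp (u n)" "supp (h n) \<union> supp (v n)"] by (auto simp: group_algebra_def)
    qed
    define z where "z n = some_preimage H J (rep_op ?E \<pi> (u n) (J x))" for n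
    have z: "z n \<in> H" "rep_op ?E \<pi> (u n) (J x) = J (z n)" for n
      using q_rep_op_in[OF N rep x uG] by (auto simp: z_def)
    have zw: "N (z n - w n) \<le> class_norm G \<E> (h n) * N x" for n
    proof -
      have "(\<lambda>g. u n g - v n g) = h n" by (simp add: un)
      then have "rep_op ?E \<pi> (u n) (J x) \<ominus>\<^bsub>?E\<^esub> rep_op ?E \<pi> (v n) (J x) = rep_op ?E \<pi> (h n) (J x)"
        using q_rep_op_diff[OF N rep x uG vG, of n n] by simp
      then have "vnorm ?E (J (z n) \<ominus>\<^bsub>?E\<^esub> J (w n)) \<le> class_norm G \<E> (h n) * N x"
        using cn[OF hG[of n]] z w by simp
      then show ?thesis using z w by (simp add: q_minus[OF N] q_norm[OF N])
    qed
    have b: "N (z n - y) \<le> class_norm G \<E> (h n) * N x + N (w n - y)" for n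
      using seminorm_on_triangle[OF sN, of "z n - w n" "w n - y"] zw[of n] z w y by simp
    have "(\<lambda>n. class_norm G \<E> (h n) * N x + N (w n - y)) \<longlonglongrightarrow> 0 * N x + 0"
      by (intro tendsto_intros hnorm lim)
    then have u0: "(\<lambda>n. class_norm G \<E> (h n) * N x + N (w n - y)) \<longlonglongrightarrow> 0" by simp
    have "0 \<le> N (z n - y)" for n by (rule seminorm_on_nonneg[OF sN]) (use z y in auto)
    then have "(\<lambda>n. N (z n - y)) \<longlonglongrightarrow> 0"
      using b by (intro tendsto_sandwich[OF _ _ tendsto_const u0] always_eventually allI)
    then show ?thesis using z y by (simp add: q_minus[OF N] q_norm[OF N])
  qed
  have vp: "v \<in> p"
  proof -
    define h where "h = (\<lambda>(n::nat) (g::'a). 0::complex)"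
    have z: "(\<lambda>g. 0) \<in> carrier (group_algebra G)" by (simp add: group_algebra_def)
    have "class_norm G \<E> (\<lambda>g. 0) \<le> 0"
      using class_norm_bdd(2)[OF z, where ?'f = 'f and ?'u = 'u and C = C and \<beta> = \<beta>] by (simp add: \<E>_def l1norm_def)
    moreover have "0 \<le> class_norm G \<E> (\<lambda>g. 0)"
      unfolding class_norm_def \<E>_def by (rule cSup_upper[OF _ class_norm_bdd(1)[OF z]]) simp
    ultimately have "class_norm G \<E> (\<lambda>g. 0) = 0" by simp
    then have "h \<in> null_ideal G \<E>" using z by (auto simp: null_ideal_def cauchy_ring_def h_def)
    moreover have "v = h \<oplus>\<^bsub>cauchy_ring G \<E>\<^esub> v" by (simp add: cauchy_ring_def group_algebra_def h_def)
    ultimately show ?thesis unfolding p \<E>_def[symmetric] a_r_coset_def' by blast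
  qed
  have "class_rep_op ?E \<pi> p (J x) = J y"
    unfolding class_rep_op_def
  proof (rule the_equality)
    show "J y \<in> carrier ?E \<and> (\<forall>u\<in>p. (\<lambda>n. vnorm ?E (rep_op ?E \<pi> (u n) (J x) \<ominus>\<^bsub>?E\<^esub> J y)) \<longlonglongrightarrow> 0)"
      using y all by (auto simp: q_carrier)
    fix a assume a: "a \<in> carrier ?E \<and> (\<forall>u\<in>p. (\<lambda>n. vnorm ?E (rep_op ?E \<pi> (u n) (J x) \<ominus>\<^bsub>?E\<^esub> a)) \<longlonglongrightarrow> 0)"
    then obtain y' where y': "y' \<in> H" "a = J y'" by (auto simp: q_carrier)
    have lim': "(\<lambda>n. N (w n - y')) \<longlonglongrightarrow> 0"
      using a vp w y' by (auto simp: q_minus[OF N] q_norm[OF N])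
    have "N (y' - y) \<le> N (w n - y') + N (w n - y)" for n
      using seminorm_on_triangle[OF sN, of "- (w n - y')" "w n - y"] seminorm_on_minus[OF sN, of "w n - y'"] w y y' by simp
    moreover have "(\<lambda>n. N (w n - y') + N (w n - y)) \<longlonglongrightarrow> 0 + 0" by (intro tendsto_intros lim lim')
    ultimately have "N (y' - y) \<le> 0 + 0" by (intro LIMSEQ_le_const[of _ "0 + 0" "N (y' - y)"]) auto
    then have "N (y' - y) = 0" using seminorm_on_nonneg[OF sN, of "y' - y"] y y' by simp
    then show "a = J y" using J_eq_norm[OF N y'(1) y(1)] y' by simp
  qed
  then show ?thesis using y by blast
qed

text \<open>The properties of a Koopman representation from which the gap is derived:
  \<open>\<rho>\<close> is an isometric representation on \<open>H\<close> with the norm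
  \<open>N\<close>, the operator \<open>m\<close> is the mean, and \<open>e\<close> is the constant
  function \<open>1\<close>. Ergodicity is the assumption \<open>m_fixed\<close> that an invariant
  vector agrees with its mean.\<close>

locale equivariant_system = cx_hilbert_code H ip I K J
  for H :: "'f::real_vector set" and ip I K and J :: "'f \<Rightarrow> 'u" +
  fixes C \<beta> :: real and N :: "'f \<Rightarrow> real"
    and G :: "('g, 'r) monoid_scheme" and \<rho> :: "'g \<Rightarrow> 'f \<Rightarrow> 'f" and m :: "'f \<Rightarrow> 'f" and D :: real and e :: 'f
  assumes good: "good_norm C \<beta> N"
    and G: "group G"
    and \<rho>_in: "g \<in> carrier G \<Longrightarrow> x \<in> H \<Longrightarrow> \<rho> g x \<in> H"
    and \<rho>_add: "\<rho> g (x + y) = \<rho> g x + \<rho> g y"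
    and \<rho>_scale: "\<rho> g (a *\<^sub>R x) = a *\<^sub>R \<rho> g x"
    and \<rho>_I: "\<rho> g (I x) = I (\<rho> g x)"
    and \<rho>_mult: "g \<in> carrier G \<Longrightarrow> h \<in> carrier G \<Longrightarrow> \<rho> (g \<otimes>\<^bsub>G\<^esub> h) x = \<rho> g (\<rho> h x)"
    and \<rho>_one: "\<rho> \<one>\<^bsub>G\<^esub> x = x"
    and \<rho>_norm: "g \<in> carrier G \<Longrightarrow> x \<in> H \<Longrightarrow> N (\<rho> g x) = N x"
    and m_in: "x \<in> H \<Longrightarrow> m x \<in> H"
    and m_add: "x \<in> H \<Longrightarrow> y \<in> H \<Longrightarrow> m (x + y) = m x + m y"
    and m_scale: "x \<in> H \<Longrightarrow> m (a *\<^sub>R x) = a *\<^sub>R m x"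
    and m_I: "x \<in> H \<Longrightarrow> m (I x) = I (m x)"
    and m_bound: "x \<in> H \<Longrightarrow> N (m x) \<le> D * N x"
    and m_\<rho>: "g \<in> carrier G \<Longrightarrow> x \<in> H \<Longrightarrow> m (\<rho> g x) = m x"
    and m_fixed: "x \<in> H \<Longrightarrow> (\<And>g. g \<in> carrier G \<Longrightarrow> N (\<rho> g x - x) = 0) \<Longrightarrow> N (x - m x) = 0"
    and e: "e \<in> H" "0 < N e" and e_fixed: "g \<in> carrier G \<Longrightarrow> \<rho> g e = e"
begin

lemma N: "cx_norm N" using good by (simp add: good_norm_def)
lemmas sN = cx_norm_seminorm[OF N]

lemma \<rho>_minus: "\<rho> g (- x) = - \<rho> g x" using \<rho>_scale[of g "-1" x] by simp
lemma \<rho>_diff: "\<rho> g (x - y) = \<rho> g x - \<rho> g y" using \<rho>_add[of g x "- y"] by (simp add: \<rho>_minus)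

lemma N_diff_commute: "x \<in> H \<Longrightarrow> y \<in> H \<Longrightarrow> N (x - y) = N (y - x)"
  using seminorm_on_minus[OF sN, of "x - y"] by simp

definition quotient_rep :: "'g \<Rightarrow> 'u \<Rightarrow> 'u" where
  "quotient_rep g = (\<lambda>a\<in>J ` H. J (\<rho> g (some_preimage H J a)))"

lemma quotient_rep: "g \<in> carrier G \<Longrightarrow> x \<in> H \<Longrightarrow> quotient_rep g (J x) = J (\<rho> g x)"
proof -
  assume a: "g \<in> carrier G" "x \<in> H"
  have "N (\<rho> g (some_preimage H J (J x)) - \<rho> g x) = N (some_preimage H J (J x) - x)"
    using \<rho>_norm[OF a(1), of "some_preimage H J (J x) - x"] a by (simp add: \<rho>_diff)
  also have "\<dots> = 0" by (rule some_preimage_diff[OF N a(2)])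
  finally show ?thesis
    using J_eq_norm[OF N, of "\<rho> g (some_preimage H J (J x))" "\<rho> g x"] a \<rho>_in by (simp add: quotient_rep_def)
qed

lemma \<rho>_cscale: "\<rho> g (cscale I c x) = cscale I c (\<rho> g x)"
  by (simp add: cscale_def \<rho>_add \<rho>_scale \<rho>_I)

lemma isometric: "isometric_rep G (qspace H I N J) quotient_rep"
proof -
  interpret G: group G by (rule G)
  have bij: "quotient_rep g \<in> Bij (J ` H)" if g: "g \<in> carrier G" for g
  proof -
    have "bij_betw (quotient_rep g) (J ` H) (J ` H)"
    proof (rule bij_betw_byWitness[where f' = "quotient_rep (inv\<^bsub>G\<^esub> g)"])
      show "\<forall>a\<in>J ` H. quotient_rep (inv\<^bsub>G\<^esub> g) (quotient_rep g a) = a"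
        using g \<rho>_mult[of "inv\<^bsub>G\<^esub> g" g] by (auto simp: quotient_rep \<rho>_in \<rho>_one)
      show "\<forall>a\<in>J ` H. quotient_rep g (quotient_rep (inv\<^bsub>G\<^esub> g) a) = a"
        using g \<rho>_mult[of g "inv\<^bsub>G\<^esub> g"] by (auto simp: quotient_rep \<rho>_in \<rho>_one)
    qed (use g in \<open>auto simp: quotient_rep \<rho>_in\<close>)
    then show ?thesis by (simp add: Bij_def quotient_rep_def)
  qed
  have "group_hom G (BijGroup (J ` H)) quotient_rep"
  proof (intro group_hom.intro group_hom_axioms.intro G group_BijGroup, rule homI)
    fix g h assume g: "g \<in> carrier G" and h: "h \<in> carrier G"
    show "quotient_rep (g \<otimes>\<^bsub>G\<^esub> h) = quotient_rep g \<otimes>\<^bsub>BijGroup (J ` H)\<^esub> quotient_rep h"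
    proof
      fix a
      show "quotient_rep (g \<otimes>\<^bsub>G\<^esub> h) a = (quotient_rep g \<otimes>\<^bsub>BijGroup (J ` H)\<^esub> quotient_rep h) a"
      proof (cases "a \<in> J ` H")
        case True
        then show ?thesis
          using bij[OF g] bij[OF h] g h by (auto simp: BijGroup_def compose_def quotient_rep \<rho>_in \<rho>_mult)
      next
        case False
        then show ?thesis using bij[OF g] bij[OF h] by (simp add: BijGroup_def compose_def quotient_rep_def)
      qed
    qed
  qed (use bij in \<open>simp add: BijGroup_def\<close>)
  then have "group_action G (carrier (qspace H I N J)) quotient_rep" by (simp add: group_action_def q_carrier)
  moreover have "cn_linear (qspace H I N J) (qspace H I N J) (quotient_rep g)" if "g \<in> carrier G" for g
    using that by (auto simp: cn_linear_def q_carrier quotient_rep \<rho>_in q_add[OF N] q_smult[OF N] \<rho>_add \<rho>_cscale)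
  moreover have "vnorm (qspace H I N J) (quotient_rep g u) = vnorm (qspace H I N J) u"
    if "g \<in> carrier G" "u \<in> carrier (qspace H I N J)" for g u
    using that by (auto simp: q_carrier quotient_rep \<rho>_in q_norm[OF N] \<rho>_norm)
  ultimately show ?thesis by (simp add: isometric_rep_def)
qed

text \<open>The action of the group algebra before passing to the quotient.\<close>

definition R :: "('g \<Rightarrow> complex) \<Rightarrow> 'f \<Rightarrow> 'f" where
  "R f x = (\<Sum>g\<in>supp f. cscale I (f g) (\<rho> g x))"

lemma R_in: "f \<in> carrier (group_algebra G) \<Longrightarrow> x \<in> H \<Longrightarrow> R f x \<in> H"
  unfolding R_def by (rule cscale_in_sum) (use group_algebra_carrierD \<rho>_in in blast)

lemma rep_op_R:
  assumes f: "f \<in> carrier (group_algebra G)" and x: "x \<in> H"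
  shows "rep_op (qspace H I N J) quotient_rep f (J x) = J (R f x)"
proof -
  note s = group_algebra_carrierD[OF f]
  interpret E: abelian_group "qspace H I N J" by (rule q_abelian_group[OF N])
  have "rep_op (qspace H I N J) quotient_rep f (J x) = (\<Oplus>\<^bsub>qspace H I N J\<^esub>g\<in>supp f. J (cscale I (f g) (\<rho> g x)))"
    unfolding rep_op_def
    by (rule E.finsum_cong') (use s x \<rho>_in in \<open>auto simp: q_carrier q_smult[OF N] quotient_rep subset_iff\<close>)
  also have "\<dots> = J (R f x)"
    unfolding R_def by (rule q_finsum[OF N s(1)]) (use s x \<rho>_in in \<open>auto simp: subset_iff\<close>)
  finally show ?thesis .
qed

lemma m_sum:
  assumes "finite A" "\<And>g. g \<in> A \<Longrightarrow> v g \<in> H"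
  shows "m (\<Sum>g\<in>A. cscale I (f g) (v g)) = (\<Sum>g\<in>A. cscale I (f g) (m (v g)))"
  using assms
proof (induction A rule: finite_induct)
  case empty
  then show ?case using m_scale[of 0 0] by simp
next
  case (insert a A)
  have "(\<Sum>g\<in>A. cscale I (f g) (v g)) \<in> H" by (rule cscale_in_sum) (use insert in auto)
  moreover have "m (cscale I c x) = cscale I c (m x)" if "x \<in> H" for c x
    using that by (simp add: cscale_def m_add m_scale m_I)
  ultimately show ?case using insert by (simp add: m_add)
qed

lemma sum_cscale_const: "(\<Sum>g\<in>A. cscale I (f g) x) = cscale I (\<Sum>g\<in>A. f g) x"
  by (simp add: cscale_def sum.distrib scaleR_sum_left)

text \<open>Let \<open>P\<close> be the projection to the invariant vectors. It vanishes on vectors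
  \<open>x\<close> of mean zero, because \<open>P x\<close> is invariant and, as a limit of
  combinations of translates of \<open>x\<close>, again of mean zero. So \<open>f\<close> maps
  \<open>x\<close> to a vector of norm at most \<open>N x / 4\<close>. On the other hand
  \<open>P\<close> fixes \<open>e\<close>, so the sum \<open>\<sigma>\<close> of the values of
  \<open>f\<close> satisfies \<open>\<bar>\<sigma> - 1\<bar> \<le> 1/4\<close>. Therefore the
  difference of \<open>\<sigma> x\<close> and \<open>f x\<close>, which is a combination of the
  displacements of \<open>x\<close>, has norm at least \<open>N x / 2\<close>.\<close>

lemma gap_of_approximation:
  assumes f: "f \<in> carrier (group_algebra G)" and V: "\<And>n::nat. V n \<in> carrier (group_algebra G)"
    and proj: "projection_onto (qspace H I N J) P (invariant_vectors G (qspace H I N J) quotient_rep)"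
    and lim: "\<And>x. x \<in> H \<Longrightarrow>
      (\<lambda>n. vnorm (qspace H I N J) (rep_op (qspace H I N J) quotient_rep (V n) (J x) \<ominus>\<^bsub>qspace H I N J\<^esub> P (J x))) \<longlonglongrightarrow> 0"
    and near: "\<And>x. x \<in> H \<Longrightarrow>
      vnorm (qspace H I N J) (rep_op (qspace H I N J) quotient_rep f (J x) \<ominus>\<^bsub>qspace H I N J\<^esub> P (J x)) \<le> N x / 4"
    and x: "x \<in> H" "N (m x) = 0"
  shows "N x \<le> 2 * (\<Sum>g\<in>supp f. cmod (f g) * N (x - \<rho> g x))"
proof -
  let ?E = "qspace H I N J"
  note s = group_algebra_carrierD[OF f]
  have inv: "P (J z) \<in> invariant_vectors G ?E quotient_rep" if "z \<in> H" for z
    using proj that by (auto simp: projection_onto_def q_carrier)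
  \<comment> \<open>The representative \<open>w\<close> of \<open>P (J x)\<close> is null: it agrees with
    its mean, which is a limit of zeros.\<close>
  obtain w where w: "w \<in> H" "P (J x) = J w" using inv[OF x(1)] by (auto simp: invariant_vectors_def q_carrier)
  have l: "(\<lambda>n. N (R (V n) x - w)) \<longlonglongrightarrow> 0"
    using lim[OF x(1)] w x R_in[OF V x(1)] by (simp add: rep_op_R[OF V] q_minus[OF N] q_norm[OF N])
  have "N (w - m w) = 0"
  proof (rule m_fixed[OF w(1)])
    fix g assume g: "g \<in> carrier G"
    have "quotient_rep g (J w) = J w" using inv[OF x(1)] g w by (simp add: invariant_vectors_def)
    then show "N (\<rho> g w - w) = 0" using g w J_eq_norm[OF N, of "\<rho> g w" w] \<rho>_in by (simp add: quotient_rep)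
  qed
  moreover have "N (m w) = 0"
  proof -
    have mR: "N (m (R (V n) x)) = 0" for n
    proof -
      note sV = group_algebra_carrierD[OF V[of n]]
      have "m (R (V n) x) = (\<Sum>g\<in>supp (V n). cscale I (V n g) (m (\<rho> g x)))"
        unfolding R_def by (rule m_sum[OF sV(1)]) (use sV \<rho>_in x in blast)
      also have "\<dots> = (\<Sum>g\<in>supp (V n). cscale I (V n g) (m x))"
        by (rule sum.cong[OF refl], subst m_\<rho>) (use sV x in auto)
      finally show ?thesis using x by (simp add: sum_cscale_const cx_norm_cscale[OF N] m_in)
    qed
    have b: "N (m w) \<le> D * N (R (V n) x - w)" for n
    proof -
      have Rn: "R (V n) x \<in> H" by (rule R_in[OF V x(1)])
      have "m w = m (w - R (V n) x) + m (R (V n) x)" using m_add[of "w - R (V n) x" "R (V n) x"] w Rn by simp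
      then have "N (m w) \<le> N (m (w - R (V n) x)) + N (m (R (V n) x))"
        using seminorm_on_triangle[OF sN, of "m (w - R (V n) x)" "m (R (V n) x)"] w Rn m_in by simp
      also have "\<dots> \<le> D * N (w - R (V n) x)" using mR m_bound[of "w - R (V n) x"] w Rn by simp
      finally show ?thesis using N_diff_commute[OF w(1) Rn] by simp
    qed
    have "(\<lambda>n. D * N (R (V n) x - w)) \<longlonglongrightarrow> D * 0" by (intro tendsto_intros l)
    then have "N (m w) \<le> D * 0" by (rule LIMSEQ_le_const) (use b in blast)
    then show ?thesis using seminorm_on_nonneg[OF sN m_in[OF w(1)]] by simp
  qed
  ultimately have "N w \<le> 0" using seminorm_on_triangle[OF sN, of "w - m w" "m w"] w m_in by simp
  then have Nw: "N w = 0" using seminorm_on_nonneg[OF sN w(1)] by simp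
  have Rx: "N (R f x) \<le> N x / 4"
  proof -
    have "N (R f x - w) \<le> N x / 4"
      using near[OF x(1)] w x R_in[OF f x(1)] by (simp add: rep_op_R[OF f] q_minus[OF N] q_norm[OF N])
    then show ?thesis using seminorm_on_triangle[OF sN, of "R f x - w" w] w R_in[OF f x(1)] Nw by simp
  qed
  \<comment> \<open>Testing on \<open>e\<close> shows that the total mass of \<open>f\<close> is close to
    \<open>1\<close>.\<close>
  define \<sigma> where "\<sigma> = (\<Sum>g\<in>supp f. f g)"
  have "J e \<in> invariant_vectors G ?E quotient_rep"
    using e e_fixed by (auto simp: invariant_vectors_def q_carrier quotient_rep)
  then obtain a where a: "a \<in> carrier ?E" "J e = P a" using proj by (auto simp: projection_onto_def)
  then have Pe: "P (J e) = J e" using proj by (auto simp: projection_onto_def)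
  have "R f e = cscale I \<sigma> e"
  proof -
    have "R f e = (\<Sum>g\<in>supp f. cscale I (f g) e)"
      unfolding R_def by (rule sum.cong[OF refl], subst e_fixed) (use s in auto)
    then show ?thesis by (simp add: sum_cscale_const \<sigma>_def)
  qed
  then have "N (cscale I \<sigma> e - e) \<le> N e / 4"
    using near[OF e(1)] Pe e R_in[OF f e(1)] by (simp add: rep_op_R[OF f] q_minus[OF N] q_norm[OF N])
  moreover have "cscale I \<sigma> e - e = cscale I (\<sigma> - 1) e" by (simp add: cscale_def scaleR_diff_left)
  ultimately have "cmod (\<sigma> - 1) \<le> 1 / 4" using e by (simp add: cx_norm_cscale[OF N])
  then have \<sigma>: "cmod \<sigma> \<ge> 3 / 4" using norm_triangle_ineq2[of 1 "1 - \<sigma>"] by (simp add: norm_minus_commute)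
  have "cscale I \<sigma> x - R f x = (\<Sum>g\<in>supp f. cscale I (f g) (x - \<rho> g x))"
    by (simp add: cscale_diff sum_subtractf sum_cscale_const \<sigma>_def R_def)
  moreover have "N (\<Sum>g\<in>supp f. cscale I (f g) (x - \<rho> g x)) \<le> (\<Sum>g\<in>supp f. N (cscale I (f g) (x - \<rho> g x)))"
    by (rule seminorm_on_sum[OF sN s(1)]) (use s x \<rho>_in in \<open>auto simp: subset_iff\<close>)
  moreover have "(\<Sum>g\<in>supp f. N (cscale I (f g) (x - \<rho> g x))) = (\<Sum>g\<in>supp f. cmod (f g) * N (x - \<rho> g x))"
    by (rule sum.cong[OF refl], rule cx_norm_cscale[OF N]) (use s x \<rho>_in in \<open>auto simp: subset_iff\<close>)
  moreover have "N (cscale I \<sigma> x) \<le> N (cscale I \<sigma> x - R f x) + N (R f x)"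
    using seminorm_on_triangle[OF sN, of "cscale I \<sigma> x - R f x" "R f x"] x R_in[OF f x(1)] by simp
  moreover have "N (cscale I \<sigma> x) = cmod \<sigma> * N x" by (rule cx_norm_cscale[OF N x(1)])
  moreover have "3 / 4 * N x \<le> cmod \<sigma> * N x" by (rule mult_right_mono[OF \<sigma> seminorm_on_nonneg[OF sN x(1)]])
  ultimately show ?thesis using Rx by simp
qed

lemma displacement_mult:
  assumes "g \<in> carrier G" "h \<in> carrier G" "x \<in> H"
  shows "N (x - \<rho> (g \<otimes>\<^bsub>G\<^esub> h) x) \<le> N (x - \<rho> g x) + N (x - \<rho> h x)"
proof -
  have "N (x - \<rho> (g \<otimes>\<^bsub>G\<^esub> h) x) \<le> N (x - \<rho> g x) + N (\<rho> g (x - \<rho> h x))"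
    using seminorm_on_triangle[OF sN, of "x - \<rho> g x" "\<rho> g (x - \<rho> h x)"] assms \<rho>_in
    by (simp add: \<rho>_mult \<rho>_diff)
  then show ?thesis using \<rho>_norm[OF assms(1), of "x - \<rho> h x"] assms \<rho>_in by simp
qed

lemma displacement_inv:
  assumes g: "g \<in> carrier G" and x: "x \<in> H"
  shows "N (x - \<rho> (inv\<^bsub>G\<^esub> g) x) = N (x - \<rho> g x)"
proof -
  interpret G: group G by (rule G)
  have "N (x - \<rho> (inv\<^bsub>G\<^esub> g) x) = N (\<rho> g (x - \<rho> (inv\<^bsub>G\<^esub> g) x))"
    using \<rho>_norm[OF g, of "x - \<rho> (inv\<^bsub>G\<^esub> g) x"] g x \<rho>_in by simp
  also have "\<rho> g (x - \<rho> (inv\<^bsub>G\<^esub> g) x) = \<rho> g x - x"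
    using \<rho>_mult[of g "inv\<^bsub>G\<^esub> g" x] g by (simp add: \<rho>_diff \<rho>_one)
  also have "N (\<rho> g x - x) = N (x - \<rho> g x)" by (rule N_diff_commute) (use g x \<rho>_in in auto)
  finally show ?thesis .
qed

end

text \<open>The properties of the function \<open>g \<mapsto> N (x - \<rho> g x)\<close> that bound
  it by its values on generators.\<close>

definition displacement :: "('g, 'r) monoid_scheme \<Rightarrow> 'g set \<Rightarrow> ('g \<Rightarrow> real) \<Rightarrow> bool" where
  "displacement G S \<delta> \<longleftrightarrow> (\<forall>s\<in>S. 0 \<le> \<delta> s) \<and> \<delta> \<one>\<^bsub>G\<^esub> \<le> 0 \<and>
    (\<forall>g\<in>carrier G. \<forall>h\<in>carrier G. \<delta> (g \<otimes>\<^bsub>G\<^esub> h) \<le> \<delta> g + \<delta> h) \<and>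
    (\<forall>g\<in>carrier G. \<delta> (inv\<^bsub>G\<^esub> g) = \<delta> g)"

text \<open>The quantification over all \<open>\<delta>\<close> makes \<open>k\<close> independent
  of the representation and of the vector.\<close>

definition length_bound :: "('g, 'r) monoid_scheme \<Rightarrow> 'g set \<Rightarrow> 'g \<Rightarrow> real \<Rightarrow> bool" where
  "length_bound G S g k \<longleftrightarrow> 0 \<le> k \<and>
    (\<forall>\<delta>. displacement G S \<delta> \<longrightarrow> \<delta> g \<le> k * (\<Sum>s\<in>S. \<delta> s))"

text \<open>The length of a word that represents \<open>g\<close> serves as
  \<open>k\<close>.\<close>

lemma generate_length:
  assumes g: "g \<in> generate G S" and G: "group G" and S: "S \<subseteq> carrier G" "finite S"
  shows "\<exists>k. length_bound G S g k"
  using g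
proof (induction rule: generate.induct)
  case one
  show ?case by (intro exI[of _ 0]) (auto simp: length_bound_def displacement_def)
next
  case (incl h)
  then have "length_bound G S h 1"
    using S by (auto simp: length_bound_def displacement_def intro!: member_le_sum)
  then show ?case ..
next
  case (inv h)
  then have "length_bound G S (inv\<^bsub>G\<^esub> h) 1"
    using S by (auto simp: length_bound_def displacement_def subset_iff intro!: member_le_sum)
  then show ?case ..
next
  case (eng g h)
  interpret G: group G by (rule G)
  have c: "g \<in> carrier G" "h \<in> carrier G"
    using eng.hyps G.generate_in_carrier[OF S(1)] by auto
  from eng.IH obtain k l where k: "length_bound G S g k" and l: "length_bound G S h l" by blast
  have "length_bound G S (g \<otimes>\<^bsub>G\<^esub> h) (k + l)"
    unfolding length_bound_def
  proof (intro conjI allI impI)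
    show "0 \<le> k + l" using k l by (simp add: length_bound_def)
    fix \<delta> assume d: "displacement G S \<delta>"
    have "\<delta> (g \<otimes>\<^bsub>G\<^esub> h) \<le> \<delta> g + \<delta> h" using d c by (simp add: displacement_def)
    moreover have "\<delta> g \<le> k * (\<Sum>s\<in>S. \<delta> s)" "\<delta> h \<le> l * (\<Sum>s\<in>S. \<delta> s)"
      using k l d by (simp_all add: length_bound_def)
    ultimately show "\<delta> (g \<otimes>\<^bsub>G\<^esub> h) \<le> (k + l) * (\<Sum>s\<in>S. \<delta> s)" by (simp add: distrib_right)
  qed
  then show ?case ..
qed

text \<open>The element \<open>f\<close> that approximates the idempotent is chosen for the class as
  a whole, before any representation is given. This is the reason why \<open>\<kappa>\<close>
  depends on \<open>C\<close> and \<open>\<beta>\<close>, but not on the norm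
  \<open>N\<close>.\<close>

theorem property_T_gap:
  fixes G :: "('g, 'r) monoid_scheme"
  assumes T: "banach_property_T TYPE('u) G" and C: "0 \<le> C" and \<beta>: "0 \<le> \<beta>" "\<beta> < 1"
    and G: "group G" and S: "finite S" "S \<subseteq> carrier G" "generate G S = carrier G"
  shows "\<exists>\<kappa>\<ge>0. \<forall>(H :: 'f::real_vector set) ip I K (J :: 'f \<Rightarrow> 'u) N \<rho> m D e.
    equivariant_system H ip I K J C \<beta> N G \<rho> m D e \<longrightarrow>
    (\<forall>x\<in>H. N (m x) = 0 \<longrightarrow> N x \<le> \<kappa> * (\<Sum>s\<in>S. N (x - \<rho> s x)))"
proof -
  define \<E> where "\<E> = (hilbert_class TYPE('f) C \<beta> :: 'u cnspace set)"
  have "(\<forall>E\<in>\<E>. complex_banach E) \<and> class_type_gt_1 \<E> \<and> class_stable \<E>"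
    unfolding \<E>_def using hilbert_class_banach hilbert_class_type[OF C \<beta>] hilbert_class_stable by blast
  from T[unfolded banach_property_T_def, rule_format, OF this]
  obtain p where p: "p \<in> carrier (class_algebra G \<E>)"
    and proj0: "\<forall>E\<in>\<E>. \<forall>\<pi>. isometric_rep G E \<pi> \<longrightarrow>
      projection_onto E (class_rep_op E \<pi> p) (invariant_vectors G E \<pi>)" by auto
  note proj = proj0[rule_format]
  obtain v where v: "v \<in> carrier (cauchy_ring G \<E>)" "p = null_ideal G \<E> +>\<^bsub>cauchy_ring G \<E>\<^esub> v"
    using p by (auto simp: class_algebra_def FactRing_def A_RCOSETS_def')
  have vG: "v n \<in> carrier (group_algebra G)" for n using v by (auto simp: cauchy_ring_def)
  have "\<exists>M. \<forall>m\<ge>M. \<forall>n\<ge>M. class_norm G \<E> (\<lambda>g. v m g - v n g) < 1 / 4"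
  proof -
    have "\<forall>e>0. \<exists>M. \<forall>m\<ge>M. \<forall>n\<ge>M. class_norm G \<E> (\<lambda>g. v m g - v n g) < e"
      using v(1) by (simp add: cauchy_ring_def)
    from this[rule_format, of "1 / 4"] show ?thesis by simp
  qed
  then obtain M where M: "\<And>m n. m \<ge> M \<Longrightarrow> n \<ge> M \<Longrightarrow> class_norm G \<E> (\<lambda>g. v m g - v n g) < 1 / 4" by blast
  define f where "f = v M"
  have f: "f \<in> carrier (group_algebra G)" unfolding f_def by (rule vG)
  note s = group_algebra_carrierD[OF f]
  have "\<exists>k. \<forall>g. g \<in> carrier G \<longrightarrow> length_bound G S g (k g)"
  proof (rule choice, rule allI)
    fix g
    show "\<exists>k. g \<in> carrier G \<longrightarrow> length_bound G S g k"
      using generate_length[OF _ G S(2,1), of g] S(3) by (cases "g \<in> carrier G") auto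
  qed
  then obtain k where k: "\<And>g. g \<in> carrier G \<Longrightarrow> length_bound G S g (k g)" by auto
  have k0: "0 \<le> k g" if "g \<in> carrier G" for g using k[OF that] by (simp add: length_bound_def)
  define \<kappa> where "\<kappa> = 2 * (\<Sum>g\<in>supp f. cmod (f g) * k g)"
  have \<kappa>0: "0 \<le> \<kappa>" unfolding \<kappa>_def using s k0 by (auto intro!: sum_nonneg mult_nonneg_nonneg)
  have "N x \<le> \<kappa> * (\<Sum>s\<in>S. N (x - \<rho> s x))"
    if sys: "equivariant_system (H :: 'f set) ip I K (J :: 'f \<Rightarrow> 'u) C \<beta> N G \<rho> m D e"
      and x: "x \<in> H" "N (m x) = 0" for H ip I K J N \<rho> m D e x
  proof -
    interpret equivariant_system H ip I K J C \<beta> N G \<rho> m D e by (rule sys)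
    let ?E = "qspace H I N J"
    have E: "?E \<in> \<E>" unfolding \<E>_def by (rule hilbert_classI[OF cx_hilbert_code_axioms good])
    define P where "P = class_rep_op ?E quotient_rep p"
    have P: "\<exists>y\<in>H. P (J z) = J y \<and> (\<lambda>n. vnorm ?E (rep_op ?E quotient_rep (v n) (J z) \<ominus>\<^bsub>?E\<^esub> J y)) \<longlonglongrightarrow> 0"
      if "z \<in> H" for z
      unfolding P_def by (rule class_rep_op_limit[OF good isometric _ _ that]) (use v in \<open>simp_all add: \<E>_def\<close>)
    have near: "vnorm ?E (rep_op ?E quotient_rep f (J z) \<ominus>\<^bsub>?E\<^esub> P (J z)) \<le> N z / 4" if z: "z \<in> H" for z
    proof -
      obtain y where y: "y \<in> H" "P (J z) = J y"
        "(\<lambda>n. vnorm ?E (rep_op ?E quotient_rep (v n) (J z) \<ominus>\<^bsub>?E\<^esub> J y)) \<longlonglongrightarrow> 0" using P[OF z] by blast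
      have l: "(\<lambda>n. N (R (v n) z - y)) \<longlonglongrightarrow> 0"
        using y(3) y(1) z R_in[OF vG z] by (simp add: rep_op_R[OF vG] q_minus[OF N] q_norm[OF N])
      have "N (R f z - y) \<le> N z / 4 + N (R (v n) z - y)" if n: "n \<ge> M" for n
      proof -
        have "vnorm ?E (rep_op ?E quotient_rep f (J z) \<ominus>\<^bsub>?E\<^esub> rep_op ?E quotient_rep (v n) (J z)) \<le>
            class_norm G \<E> (\<lambda>g. f g - v n g) * N z"
          unfolding q_rep_op_diff[OF N isometric z f vG] \<E>_def
          by (rule q_rep_op_le_class_norm[OF good isometric z group_algebra_diff[OF f vG]])
        also have "\<dots> \<le> 1 / 4 * N z"
          unfolding f_def by (intro mult_right_mono less_imp_le[OF M] seminorm_on_nonneg[OF sN z] n order_refl)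
        finally have "N (R f z - R (v n) z) \<le> N z / 4"
          using z R_in[OF vG z] R_in[OF f z] by (simp add: rep_op_R[OF vG] rep_op_R[OF f] q_minus[OF N] q_norm[OF N])
        then show ?thesis
          using seminorm_on_triangle[OF sN, of "R f z - R (v n) z" "R (v n) z - y"] R_in[OF f z] R_in[OF vG z] y by simp
      qed
      moreover have "(\<lambda>n. N z / 4 + N (R (v n) z - y)) \<longlonglongrightarrow> N z / 4 + 0" by (intro tendsto_intros l)
      ultimately have "N (R f z - y) \<le> N z / 4 + 0" by (intro LIMSEQ_le_const[of _ "N z / 4 + 0" "N (R f z - y)"]) auto
      then show ?thesis using z y R_in[OF f z] by (simp add: rep_op_R[OF f] q_minus[OF N] q_norm[OF N])
    qed
    have "N x \<le> 2 * (\<Sum>g\<in>supp f. cmod (f g) * N (x - \<rho> g x))"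
    proof (rule gap_of_approximation[OF f vG _ _ near x])
      show "projection_onto ?E P (invariant_vectors G ?E quotient_rep)"
        unfolding P_def by (rule proj[OF E isometric])
      show "(\<lambda>n. vnorm ?E (rep_op ?E quotient_rep (v n) (J z) \<ominus>\<^bsub>?E\<^esub> P (J z))) \<longlonglongrightarrow> 0" if "z \<in> H" for z
        using P[OF that] by auto
    qed
    also have "\<dots> \<le> 2 * (\<Sum>g\<in>supp f. cmod (f g) * (k g * (\<Sum>s\<in>S. N (x - \<rho> s x))))"
    proof (intro mult_left_mono sum_mono)
      fix g assume "g \<in> supp f"
      then have g: "g \<in> carrier G" using s by auto
      have "displacement G S (\<lambda>g. N (x - \<rho> g x))"
        unfolding displacement_def
      proof (intro conjI ballI)
        show "0 \<le> N (x - \<rho> s x)" if "s \<in> S" for s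
          by (rule seminorm_on_nonneg[OF sN]) (use that S(2) x \<rho>_in in auto)
        show "N (x - \<rho> \<one>\<^bsub>G\<^esub> x) \<le> 0" by (simp add: \<rho>_one seminorm_on_zero[OF sN])
      qed (use displacement_mult displacement_inv x in auto)
      then show "N (x - \<rho> g x) \<le> k g * (\<Sum>s\<in>S. N (x - \<rho> s x))"
        using k[OF g, unfolded length_bound_def, THEN conjunct2, rule_format, of "\<lambda>g. N (x - \<rho> g x)"] by simp
    qed auto
    also have "\<dots> = \<kappa> * (\<Sum>s\<in>S. N (x - \<rho> s x))"
      by (simp add: \<kappa>_def sum_distrib_right mult.assoc)
    finally show ?thesis .
  qed
  then show ?thesis using \<kappa>0 by blast
qed


section \<open>Hilbert spaces of square integrable functions\<close>

definition sq_int :: "'y measure \<Rightarrow> ('y \<Rightarrow> complex) \<Rightarrow> bool" where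
  "sq_int M f \<longleftrightarrow> f \<in> borel_measurable M \<and> integrable M (\<lambda>y. (cmod (f y))\<^sup>2)"

lemma sq_int_measurable: "sq_int M f \<Longrightarrow> f \<in> borel_measurable M"
  by (simp add: sq_int_def)

lemma sq_int_integrable: "sq_int M f \<Longrightarrow> integrable M (\<lambda>y. (cmod (f y))\<^sup>2)"
  by (simp add: sq_int_def)

lemma sq_int_add:
  assumes "sq_int M f" "sq_int M g"
  shows "sq_int M (\<lambda>y. f y + g y)"
  unfolding sq_int_def
proof
  have [measurable]: "f \<in> borel_measurable M" "g \<in> borel_measurable M" using assms by (auto simp: sq_int_def)
  show "(\<lambda>y. f y + g y) \<in> borel_measurable M" by measurable
  show "integrable M (\<lambda>y. (cmod (f y + g y))\<^sup>2)"
  proof (rule Bochner_Integration.integrable_bound)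
    show "integrable M (\<lambda>y. 2 * (cmod (f y))\<^sup>2 + 2 * (cmod (g y))\<^sup>2)"
      using assms by (auto simp: sq_int_def)
    have "(cmod (f y + g y))\<^sup>2 \<le> 2 * (cmod (f y))\<^sup>2 + 2 * (cmod (g y))\<^sup>2" for y
    proof -
      have "(cmod (f y + g y))\<^sup>2 \<le> (cmod (f y) + cmod (g y))\<^sup>2" by (intro power_mono norm_triangle_ineq) auto
      also have "\<dots> \<le> 2 * (cmod (f y))\<^sup>2 + 2 * (cmod (g y))\<^sup>2"
        using zero_le_power2[of "cmod (f y) - cmod (g y)"] by (simp add: power2_sum power2_diff)
      finally show ?thesis .
    qed
    then show "AE y in M. norm ((cmod (f y + g y))\<^sup>2) \<le> norm (2 * (cmod (f y))\<^sup>2 + 2 * (cmod (g y))\<^sup>2)" by simp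
  qed measurable
qed

lemma sq_int_mult: "sq_int M f \<Longrightarrow> sq_int M (\<lambda>y. c * f y)"
  by (auto simp: sq_int_def norm_mult power_mult_distrib)

lemma sq_int_scaleR: "sq_int M f \<Longrightarrow> sq_int M (\<lambda>y. a *\<^sub>R f y)"
  using sq_int_mult[of M f "complex_of_real a"] by (simp add: scaleR_conv_of_real)

lemma sq_int_cnj: "sq_int M f \<Longrightarrow> sq_int M (\<lambda>y. cnj (f y))"
  using measurable_compose[OF sq_int_measurable borel_measurable_continuous_onI[OF linear_continuous_on[OF bounded_linear_cnj]]]
  by (simp add: sq_int_def)

lemma sq_int_diff: "sq_int M f \<Longrightarrow> sq_int M g \<Longrightarrow> sq_int M (\<lambda>y. f y - g y)"
  using sq_int_add[of M f "\<lambda>y. (-1) * g y"] sq_int_mult[of M g "-1"] by simp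

lemma sq_int_product:
  assumes "sq_int M f" "sq_int M g"
  shows "integrable M (\<lambda>y. Re (f y * cnj (g y)))"
proof (rule Bochner_Integration.integrable_bound)
  have [measurable]: "f \<in> borel_measurable M" "g \<in> borel_measurable M" "(\<lambda>y. cnj (g y)) \<in> borel_measurable M"
    using assms sq_int_cnj[of M g] by (auto simp: sq_int_def)
  show "integrable M (\<lambda>y. (cmod (f y))\<^sup>2 + (cmod (g y))\<^sup>2)" using assms by (auto simp: sq_int_def)
  show "(\<lambda>y. Re (f y * cnj (g y))) \<in> borel_measurable M" by measurable
  have "\<bar>Re (f y * cnj (g y))\<bar> \<le> (cmod (f y))\<^sup>2 + (cmod (g y))\<^sup>2" for y
  proof -
    have "\<bar>Re (f y * cnj (g y))\<bar> \<le> cmod (f y) * cmod (g y)"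
      using abs_Re_le_cmod[of "f y * cnj (g y)"] by (simp add: norm_mult)
    also have "\<dots> \<le> (cmod (f y))\<^sup>2 + (cmod (g y))\<^sup>2"
    proof -
      have "2 * (cmod (f y) * cmod (g y)) \<le> (cmod (f y))\<^sup>2 + (cmod (g y))\<^sup>2"
        using sum_squares_bound[of "cmod (f y)" "cmod (g y)"] by simp
      moreover have "0 \<le> cmod (f y) * cmod (g y)" by simp
      ultimately show ?thesis by linarith
    qed
    finally show ?thesis .
  qed
  then show "AE y in M. norm (Re (f y * cnj (g y))) \<le> norm ((cmod (f y))\<^sup>2 + (cmod (g y))\<^sup>2)" by simp
qed

context prob_space
begin

lemma sq_int_imp_integrable:
  assumes "sq_int M f"
  shows "integrable M f"
proof (rule Bochner_Integration.integrable_bound)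
  show "integrable M (\<lambda>y. 1 + (cmod (f y))\<^sup>2)" using assms by (auto simp: sq_int_def)
  show "f \<in> borel_measurable M" using assms by (auto simp: sq_int_def)
  have "cmod (f y) \<le> 1 + (cmod (f y))\<^sup>2" for y
  proof -
    have "2 * cmod (f y) \<le> 1 + (cmod (f y))\<^sup>2" using sum_squares_bound[of 1 "cmod (f y)"] by simp
    then show ?thesis using norm_ge_zero[of "f y"] by linarith
  qed
  then show "AE y in M. norm (f y) \<le> norm (1 + (cmod (f y))\<^sup>2)" by simp
qed

lemma sq_int_const: "sq_int M (\<lambda>_. c)" by (simp add: sq_int_def)

text \<open>Along a subsequence the successive distances are at most
  \<open>2\<^sup>-\<^sup>i\<close>, so almost everywhere the increments are summable and the
  subsequence converges. Fatou's lemma shows that the pointwise limit is also the limit in mean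
  square.\<close>

lemma Riesz_Fischer:
  fixes f :: "nat \<Rightarrow> 'a \<Rightarrow> complex"
  assumes f: "\<And>n. sq_int M (f n)"
    and cauchy: "\<And>e. e > 0 \<Longrightarrow> \<exists>L. \<forall>m\<ge>L. \<forall>n\<ge>L. (\<integral>y. (cmod (f m y - f n y))\<^sup>2 \<partial>M) < e"
  shows "\<exists>g. sq_int M g \<and> (\<lambda>n. \<integral>y. (cmod (f n y - g y))\<^sup>2 \<partial>M) \<longlonglongrightarrow> 0"
proof -
  have fm[measurable]: "f n \<in> borel_measurable M" for n using f by (simp add: sq_int_def)
  have di: "integrable M (\<lambda>y. (cmod (f m y - f n y))\<^sup>2)" for m n
    by (rule sq_int_integrable[OF sq_int_diff[OF f f]])
  have "\<exists>L. \<forall>i. \<forall>m\<ge>L i. \<forall>n\<ge>L i. (\<integral>y. (cmod (f m y - f n y))\<^sup>2 \<partial>M) < (1 / 4) ^ i"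
    by (rule choice) (use cauchy in simp)
  then obtain L where L: "\<And>i m n. m \<ge> L i \<Longrightarrow> n \<ge> L i \<Longrightarrow> (\<integral>y. (cmod (f m y - f n y))\<^sup>2 \<partial>M) < (1 / 4) ^ i"
    by blast
  \<comment> \<open>Sums of the \<open>L j\<close> give indices that are also increasing in
    \<open>i\<close>.\<close>
  define r where "r i = (\<Sum>j\<le>i. L j)" for i
  have rL: "L i \<le> r i" for i unfolding r_def by (rule member_le_sum) auto
  have rmono: "r i \<le> r j" if "i \<le> j" for i j unfolding r_def by (rule sum_mono2) (use that in auto)
  define d where "d i y = cmod (f (r (Suc i)) y - f (r i) y)" for i y
  have dm[measurable]: "d i \<in> borel_measurable M" for i unfolding d_def by measurable
  have dsq: "(\<integral>y. (d i y)\<^sup>2 \<partial>M) \<le> (1 / 4) ^ i" for i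
    unfolding d_def by (rule less_imp_le, rule L) (use rL[of i] rmono[of i "Suc i"] in auto)
  have dint: "(\<integral>\<^sup>+y. ennreal (d i y) \<partial>M) \<le> ennreal ((1 / 2) ^ i)" for i
  proof -
    \<comment> \<open>The inequality of the means takes the place of Cauchy-Schwarz.\<close>
    have bnd: "d i y \<le> (2 ^ i * (d i y)\<^sup>2 + (1 / 2) ^ i) / 2" for y
    proof -
      have "0 \<le> (2 ^ i * d i y - 1)\<^sup>2 * (1 / 2) ^ i" by simp
      also have "\<dots> = 2 ^ i * (d i y)\<^sup>2 - 2 * d i y + (1 / 2) ^ i"
        by (simp add: power2_eq_square field_simps power_divide)
      finally show ?thesis by simp
    qed
    have int: "integrable M (\<lambda>y. (2 ^ i * (d i y)\<^sup>2 + (1 / 2) ^ i) / 2)"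
      unfolding d_def using di by simp
    have "(\<integral>\<^sup>+y. ennreal (d i y) \<partial>M) \<le> (\<integral>\<^sup>+y. ennreal ((2 ^ i * (d i y)\<^sup>2 + (1 / 2) ^ i) / 2) \<partial>M)"
      by (intro nn_integral_mono ennreal_leI bnd)
    also have "\<dots> = ennreal (\<integral>y. (2 ^ i * (d i y)\<^sup>2 + (1 / 2) ^ i) / 2 \<partial>M)"
      by (rule nn_integral_eq_integral[OF int]) simp
    also have "(\<integral>y. (2 ^ i * (d i y)\<^sup>2 + (1 / 2) ^ i) / 2 \<partial>M) = (2 ^ i * (\<integral>y. (d i y)\<^sup>2 \<partial>M) + (1 / 2) ^ i) / 2"
      unfolding d_def using di by (simp add: prob_space)
    also have "ennreal \<dots> \<le> ennreal ((1 / 2) ^ i)"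
    proof (rule ennreal_leI)
      have "2 ^ i * (\<integral>y. (d i y)\<^sup>2 \<partial>M) \<le> 2 ^ i * (1 / 4) ^ i" by (intro mult_left_mono dsq) auto
      also have "(2::real) ^ i * (1 / 4) ^ i = (1 / 2) ^ i" by (simp flip: power_mult_distrib)
      finally show "(2 ^ i * (\<integral>y. (d i y)\<^sup>2 \<partial>M) + (1 / 2) ^ i) / 2 \<le> (1 / 2) ^ i" by simp
    qed
    finally show ?thesis .
  qed
  have "(\<integral>\<^sup>+y. suminf (\<lambda>i. ennreal (d i y)) \<partial>M) = suminf (\<lambda>i. \<integral>\<^sup>+y. ennreal (d i y) \<partial>M)"
    by (rule nn_integral_suminf) measurable
  also have "\<dots> \<le> suminf (\<lambda>i. ennreal ((1 / 2) ^ i))" by (intro suminf_le dint) auto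
  also have "\<dots> = ennreal (suminf (\<lambda>i. (1 / 2) ^ i))" by (rule suminf_ennreal2) (auto intro: summable_geometric)
  finally have "(\<integral>\<^sup>+y. suminf (\<lambda>i. ennreal (d i y)) \<partial>M) \<noteq> \<infinity>" by (auto simp: top_unique)
  then have "AE y in M. suminf (\<lambda>i. ennreal (d i y)) \<noteq> \<infinity>" by (intro nn_integral_PInf_AE) auto
  then have conv: "AE y in M. convergent (\<lambda>i. f (r i) y)"
  proof eventually_elim
    case (elim y)
    have "summable (\<lambda>i. d i y)"
      by (rule summable_suminf_not_top) (use elim in \<open>auto simp: d_def\<close>)
    then have "summable (\<lambda>i. f (r (Suc i)) y - f (r i) y)" unfolding d_def by (rule summable_norm_cancel)
    then have "convergent (\<lambda>n. \<Sum>i<n. f (r (Suc i)) y - f (r i) y)" by (simp add: summable_iff_convergent)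
    then have "convergent (\<lambda>n. f (r n) y - f (r 0) y)" by (simp add: sum_lessThan_telescope[of "\<lambda>i. f (r i) y"])
    then have "convergent (\<lambda>n. (f (r n) y - f (r 0) y) + f (r 0) y)" by (intro convergent_add convergent_const)
    then show ?case by simp
  qed
  define g where "g y = lim (\<lambda>i. f (r i) y)" for y
  have gm[measurable]: "g \<in> borel_measurable M" unfolding g_def by measurable
  have lim: "AE y in M. (\<lambda>i. f (r i) y) \<longlonglongrightarrow> g y"
    using conv by eventually_elim (simp add: g_def convergent_LIMSEQ_iff)
  have bound: "(\<integral>\<^sup>+y. ennreal ((cmod (f n y - g y))\<^sup>2) \<partial>M) \<le> ennreal ((1 / 4) ^ i)" if n: "n \<ge> L i" for n i
  proof -
    have "(\<integral>\<^sup>+y. ennreal ((cmod (f n y - g y))\<^sup>2) \<partial>M) =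
        (\<integral>\<^sup>+y. liminf (\<lambda>k. ennreal ((cmod (f n y - f (r k) y))\<^sup>2)) \<partial>M)"
    proof (rule nn_integral_cong_AE, use lim in eventually_elim)
      case (elim y)
      have "(\<lambda>k. ennreal ((cmod (f n y - f (r k) y))\<^sup>2)) \<longlonglongrightarrow> ennreal ((cmod (f n y - g y))\<^sup>2)"
        by (intro tendsto_ennrealI tendsto_power tendsto_norm tendsto_diff tendsto_const elim)
      from lim_imp_Liminf[OF _ this] show ?case by simp
    qed
    also have "\<dots> \<le> liminf (\<lambda>k. \<integral>\<^sup>+y. ennreal ((cmod (f n y - f (r k) y))\<^sup>2) \<partial>M)"
      by (rule nn_integral_liminf) measurable
    also have "\<dots> \<le> liminf (\<lambda>k. ennreal ((1 / 4) ^ i))"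
    proof (rule Liminf_mono, rule eventually_sequentiallyI[of i])
      fix k assume k: "i \<le> k"
      have "L i \<le> r k" using rL[of i] rmono[OF k] by simp
      then have "(\<integral>y. (cmod (f n y - f (r k) y))\<^sup>2 \<partial>M) < (1 / 4) ^ i" by (rule L[OF n])
      then show "(\<integral>\<^sup>+y. ennreal ((cmod (f n y - f (r k) y))\<^sup>2) \<partial>M) \<le> ennreal ((1 / 4) ^ i)"
        by (subst nn_integral_eq_integral[OF di]) (auto intro: ennreal_leI)
    qed
    also have "\<dots> = ennreal ((1 / 4) ^ i)" by (simp add: Liminf_const)
    finally show ?thesis .
  qed
  have dg: "sq_int M (\<lambda>y. f n y - g y)" if n: "n \<ge> L 0" for n
    unfolding sq_int_def
  proof
    have "(\<integral>\<^sup>+y. ennreal ((cmod (f n y - g y))\<^sup>2) \<partial>M) < \<infinity>"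
      using bound[OF n] by (rule le_less_trans) simp
    then show "integrable M (\<lambda>y. (cmod (f n y - g y))\<^sup>2)"
      by (intro integrableI_bounded) auto
  qed measurable
  have g: "sq_int M g"
    using sq_int_diff[OF f[of "L 0"] dg[of "L 0"]] by simp
  have "(\<lambda>n. \<integral>y. (cmod (f n y - g y))\<^sup>2 \<partial>M) \<longlonglongrightarrow> 0"
  proof (rule LIMSEQ_I)
    fix e :: real assume e: "e > 0"
    obtain i where i: "(1 / 4 :: real) ^ i < e" using real_arch_pow_inv[OF e, of "1 / 4"] by auto
    have "(\<integral>y. (cmod (f n y - g y))\<^sup>2 \<partial>M) < e" if n: "n \<ge> L i" for n
    proof -
      have "ennreal (\<integral>y. (cmod (f n y - g y))\<^sup>2 \<partial>M) \<le> ennreal ((1 / 4) ^ i)"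
        using bound[OF n] by (subst (asm) nn_integral_eq_integral[OF sq_int_integrable[OF sq_int_diff[OF f g]]]) auto
      then have "(\<integral>y. (cmod (f n y - g y))\<^sup>2 \<partial>M) \<le> (1 / 4) ^ i" by (subst (asm) ennreal_le_iff) auto
      then show ?thesis using i by simp
    qed
    then show "\<exists>no. \<forall>n\<ge>no. norm ((\<integral>y. (cmod (f n y - g y))\<^sup>2 \<partial>M) - 0) < e" by auto
  qed
  then show ?thesis using g by blast
qed

end

text \<open>Vector valued functions are given by their first \<open>k\<close> coordinates and vanish
  in the others. Thus the spaces for all \<open>k\<close> are subspaces of one type.\<close>

definition L2 :: "'y measure \<Rightarrow> nat \<Rightarrow> ('y \<Rightarrow> nat \<Rightarrow> complex) set" where
  "L2 M k = {h. (\<forall>j<k. sq_int M (\<lambda>y. h y j)) \<and> (\<forall>j\<ge>k. \<forall>y. h y j = 0)}"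

definition L2_ip :: "'y measure \<Rightarrow> nat \<Rightarrow> ('y \<Rightarrow> nat \<Rightarrow> complex) \<Rightarrow> ('y \<Rightarrow> nat \<Rightarrow> complex) \<Rightarrow> real" where
  "L2_ip M k h h' = (\<Sum>j<k. \<integral>y. Re (h y j * cnj (h' y j)) \<partial>M)"

definition L2_I :: "('y \<Rightarrow> nat \<Rightarrow> complex) \<Rightarrow> 'y \<Rightarrow> nat \<Rightarrow> complex" where
  "L2_I h = (\<lambda>y j. \<i> * h y j)"

definition L2_K :: "('y \<Rightarrow> nat \<Rightarrow> complex) \<Rightarrow> 'y \<Rightarrow> nat \<Rightarrow> complex" where
  "L2_K h = (\<lambda>y j. cnj (h y j))"

lemma L2D: "h \<in> L2 M k \<Longrightarrow> j < k \<Longrightarrow> sq_int M (\<lambda>y. h y j)" "h \<in> L2 M k \<Longrightarrow> k \<le> j \<Longrightarrow> h y j = 0"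
  by (auto simp: L2_def)

lemma L2_ip_self: "L2_ip M k h h = (\<Sum>j<k. \<integral>y. (cmod (h y j))\<^sup>2 \<partial>M)"
proof -
  have "Re (z * cnj z) = (cmod z)\<^sup>2" for z by (simp flip: complex_norm_square of_real_power)
  then show ?thesis by (simp add: L2_ip_def)
qed

lemma (in prob_space) L2_cx_hilbert: "cx_hilbert (L2 M k) (L2_ip M k) L2_I L2_K"
proof
  show "subspace (L2 M k)"
    unfolding subspace_def
    by (auto simp: L2_def scaleR_fun_def sq_int_const sq_int_add sq_int_scaleR)
  show "L2_ip M k x y = L2_ip M k y x" for x y
  proof -
    have "Re (a * cnj b) = Re (b * cnj a)" for a b by simp
    then show ?thesis unfolding L2_ip_def by presburger
  qed
  show "L2_ip M k (x + y) z = L2_ip M k x z + L2_ip M k y z"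
    if "x \<in> L2 M k" "y \<in> L2 M k" "z \<in> L2 M k" for x y z
  proof -
    have "(\<integral>v. Re ((x + y) v j * cnj (z v j)) \<partial>M) = (\<integral>v. Re (x v j * cnj (z v j)) \<partial>M) + (\<integral>v. Re (y v j * cnj (z v j)) \<partial>M)"
      if j: "j < k" for j
    proof -
      have "Re ((x + y) v j * cnj (z v j)) = Re (x v j * cnj (z v j)) + Re (y v j * cnj (z v j))" for v
        by (simp add: algebra_simps)
      then show ?thesis
        using Bochner_Integration.integral_add[OF sq_int_product[OF L2D(1)[OF \<open>x \<in> _\<close> j] L2D(1)[OF \<open>z \<in> _\<close> j]]
          sq_int_product[OF L2D(1)[OF \<open>y \<in> _\<close> j] L2D(1)[OF \<open>z \<in> _\<close> j]]] by presburger
    qed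
    then show ?thesis by (simp add: L2_ip_def sum.distrib)
  qed
  show "L2_ip M k (a *\<^sub>R x) y = a * L2_ip M k x y" for a x y
  proof -
    have "Re ((a *\<^sub>R x) v j * cnj (y v j)) = a * Re (x v j * cnj (y v j))" for v j
      by (simp add: scaleR_fun_def algebra_simps)
    then show ?thesis by (simp only: L2_ip_def integral_mult_right_zero sum_distrib_left)
  qed
  show "0 \<le> L2_ip M k x x" for x unfolding L2_ip_self by (intro sum_nonneg) auto
  show "L2_I x \<in> L2 M k" if "x \<in> L2 M k" for x using that by (auto simp: L2_def L2_I_def sq_int_mult)
  show "L2_I (x + y) = L2_I x + L2_I y" for x y :: "'a \<Rightarrow> nat \<Rightarrow> complex" by (auto simp: L2_I_def fun_eq_iff distrib_left)
  show "L2_I (a *\<^sub>R x) = a *\<^sub>R L2_I x" for a and x :: "'a \<Rightarrow> nat \<Rightarrow> complex" by (auto simp: L2_I_def scaleR_fun_def)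
  show "L2_I (L2_I x) = - x" for x :: "'a \<Rightarrow> nat \<Rightarrow> complex" by (auto simp: L2_I_def fun_eq_iff simp flip: mult.assoc)
  show "L2_ip M k (L2_I x) (L2_I y) = L2_ip M k x y" for x y
  proof -
    have "Re (\<i> * a * cnj (\<i> * b)) = Re (a * cnj b)" for a b by simp
    then show ?thesis by (simp only: L2_ip_def L2_I_def)
  qed
  show "L2_K x \<in> L2 M k" if "x \<in> L2 M k" for x using that by (auto simp: L2_def L2_K_def sq_int_cnj)
  show "L2_K (x + y) = L2_K x + L2_K y" for x y :: "'a \<Rightarrow> nat \<Rightarrow> complex" by (auto simp: L2_K_def fun_eq_iff)
  show "L2_K (a *\<^sub>R x) = a *\<^sub>R L2_K x" for a and x :: "'a \<Rightarrow> nat \<Rightarrow> complex" by (auto simp: L2_K_def scaleR_fun_def)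
  show "L2_K (L2_K x) = x" for x :: "'a \<Rightarrow> nat \<Rightarrow> complex" by (auto simp: L2_K_def)
  show "L2_K (L2_I x) = - L2_I (L2_K x)" for x :: "'a \<Rightarrow> nat \<Rightarrow> complex" by (auto simp: L2_K_def L2_I_def fun_eq_iff)
  show "L2_ip M k (L2_K x) (L2_K y) = L2_ip M k x y" for x y
  proof -
    have "Re (cnj a * cnj (cnj b)) = Re (a * cnj b)" for a b by simp
    then show ?thesis by (simp only: L2_ip_def L2_K_def)
  qed
  fix U :: "nat \<Rightarrow> 'a \<Rightarrow> nat \<Rightarrow> complex"
  assume U: "\<And>n. U n \<in> L2 M k"
    and c: "\<And>e. e > 0 \<Longrightarrow> \<exists>L. \<forall>m\<ge>L. \<forall>n\<ge>L. L2_ip M k (U m - U n) (U m - U n) < e"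
  have ip: "L2_ip M k (U m - U n) (U m - U n) = (\<Sum>j<k. \<integral>y. (cmod (U m y j - U n y j))\<^sup>2 \<partial>M)" for m n
    by (simp add: L2_ip_self)
  have "\<exists>g. sq_int M g \<and> (\<lambda>n. \<integral>y. (cmod (U n y j - g y))\<^sup>2 \<partial>M) \<longlonglongrightarrow> 0" if j: "j < k" for j
  proof (rule Riesz_Fischer)
    show "sq_int M (\<lambda>y. U n y j)" for n by (rule L2D(1)[OF U j])
    fix e :: real assume "e > 0"
    then obtain L where L: "\<And>m n. m \<ge> L \<Longrightarrow> n \<ge> L \<Longrightarrow> L2_ip M k (U m - U n) (U m - U n) < e"
      using c by blast
    have "(\<integral>y. (cmod (U m y j - U n y j))\<^sup>2 \<partial>M) < e" if "m \<ge> L" "n \<ge> L" for m n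
    proof -
      have "(\<integral>y. (cmod (U m y j - U n y j))\<^sup>2 \<partial>M) \<le> (\<Sum>j<k. \<integral>y. (cmod (U m y j - U n y j))\<^sup>2 \<partial>M)"
        by (rule member_le_sum[of j "{..<k}" "\<lambda>j. \<integral>y. (cmod (U m y j - U n y j))\<^sup>2 \<partial>M"]) (use j in auto)
      then show ?thesis using L[OF that] by (simp add: ip)
    qed
    then show "\<exists>L. \<forall>m\<ge>L. \<forall>n\<ge>L. (\<integral>y. (cmod (U m y j - U n y j))\<^sup>2 \<partial>M) < e" by blast
  qed
  then have "\<forall>j. \<exists>g. j < k \<longrightarrow> sq_int M g \<and> (\<lambda>n. \<integral>y. (cmod (U n y j - g y))\<^sup>2 \<partial>M) \<longlonglongrightarrow> 0" by blast
  then obtain g where g: "\<And>j. j < k \<Longrightarrow> sq_int M (g j)"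
    "\<And>j. j < k \<Longrightarrow> (\<lambda>n. \<integral>y. (cmod (U n y j - g j y))\<^sup>2 \<partial>M) \<longlonglongrightarrow> 0"
    using choice[of "\<lambda>j g. j < k \<longrightarrow> sq_int M g \<and> (\<lambda>n. \<integral>y. (cmod (U n y j - g y))\<^sup>2 \<partial>M) \<longlonglongrightarrow> 0"] by auto
  define x where "x = (\<lambda>y j. if j < k then g j y else 0)"
  have "x \<in> L2 M k" using g(1) by (auto simp: L2_def x_def)
  moreover have "L2_ip M k (U n - x) (U n - x) = (\<Sum>j<k. \<integral>y. (cmod (U n y j - g j y))\<^sup>2 \<partial>M)" for n
    unfolding L2_ip_self by (rule sum.cong) (auto simp: x_def)
  moreover have "(\<lambda>n. \<Sum>j<k. \<integral>y. (cmod (U n y j - g j y))\<^sup>2 \<partial>M) \<longlonglongrightarrow> (\<Sum>j<k. 0)"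
    by (rule tendsto_sum) (use g(2) in auto)
  ultimately show "\<exists>x\<in>L2 M k. (\<lambda>n. L2_ip M k (U n - x) (U n - x)) \<longlonglongrightarrow> 0"
    by (intro bexI[of _ x]) (simp only: sum.neutral_const, assumption)
qed

lemma (in prob_space) AE_zero_of_set_integrals:
  fixes f :: "'a \<Rightarrow> real"
  assumes f: "integrable M f" and z: "\<And>A. A \<in> sets M \<Longrightarrow> (\<integral>y. indicator A y * f y \<partial>M) = 0"
  shows "AE y in M. f y = 0"
proof -
  have [measurable]: "f \<in> borel_measurable M" using f by auto
  have half: "AE y in M. \<not> 0 < h y"
    if h: "integrable M h" and z: "\<And>A. A \<in> sets M \<Longrightarrow> (\<integral>y. indicator A y * h y \<partial>M) = 0" for h :: "'a \<Rightarrow> real"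
  proof -
    have [measurable]: "h \<in> borel_measurable M" using h by auto
    define A where "A = {y \<in> space M. 0 < h y}"
    have A: "A \<in> sets M" unfolding A_def by measurable
    have "AE y in M. indicator A y * h y = 0"
    proof (rule integral_nonneg_eq_0_iff_AE[THEN iffD1])
      show "integrable M (\<lambda>y. indicator A y * h y)" using integrable_mult_indicator[OF A h] by simp
      show "AE y in M. 0 \<le> indicator A y * h y" by (auto simp: A_def indicator_def)
      show "(\<integral>y. indicator A y * h y \<partial>M) = 0" by (rule z[OF A])
    qed
    then show ?thesis using AE_space by eventually_elim (auto simp: A_def indicator_def split: if_splits)
  qed
  have 1: "AE y in M. \<not> 0 < f y" by (rule half[OF f z])
  have 2: "AE y in M. \<not> 0 < - f y" by (rule half) (use f z in auto)
  from 1 2 show ?thesis by eventually_elim auto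
qed

text \<open>Balls of radius \<open>1/(n+1)\<close> around the points of finite nets form a countable
  base.\<close>

lemma compact_metric_countable_base:
  assumes "compact (UNIV :: 'y::metric_space set)"
  shows "\<exists>\<B> :: 'y set set. countable \<B> \<and> (\<forall>B\<in>\<B>. open B) \<and>
    (\<forall>U. open U \<longrightarrow> U = \<Union>{B \<in> \<B>. B \<subseteq> U})"
proof -
  have "\<exists>F. \<forall>n. finite (F n) \<and> (UNIV :: 'y set) \<subseteq> (\<Union>x\<in>F n. ball x (1 / real (Suc n)))"
  proof (rule choice, rule allI)
    fix n
    show "\<exists>F. finite F \<and> (UNIV :: 'y set) \<subseteq> (\<Union>x\<in>F. ball x (1 / real (Suc n)))"
      using seq_compact_imp_totally_bounded[OF compact_imp_seq_compact[OF assms], rule_format, of "1 / real (Suc n)"] by auto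
  qed
  then obtain F where F: "\<And>n. finite (F n)" "\<And>n. (UNIV :: 'y set) \<subseteq> (\<Union>x\<in>F n. ball x (1 / real (Suc n)))" by blast
  define \<B> where "\<B> = (\<Union>n. (\<lambda>x. ball x (1 / real (Suc n))) ` F n)"
  have "countable \<B>" unfolding \<B>_def
    by (rule countable_UN[OF countableI_type], rule countable_image, rule countable_finite, rule F(1))
  moreover have "U = \<Union>{B \<in> \<B>. B \<subseteq> U}" if U: "open U" for U
  proof (intro equalityI subsetI)
    fix y assume y: "y \<in> U"
    obtain e where e: "e > 0" "ball y e \<subseteq> U" using U y openE by blast
    obtain n where n: "1 / real (Suc n) < e / 2" using nat_approx_posE[of "e / 2"] e by auto
    obtain x where x: "x \<in> F n" "y \<in> ball x (1 / real (Suc n))" using F(2)[of n] by blast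
    have "ball x (1 / real (Suc n)) \<subseteq> ball y e"
    proof
      fix z assume "z \<in> ball x (1 / real (Suc n))"
      then have "dist y z < 1 / real (Suc n) + 1 / real (Suc n)"
        using x(2) dist_triangle[of y z x] by (simp add: dist_commute)
      then have "dist y z < e" using n by linarith
      then show "z \<in> ball y e" by simp
    qed
    then show "y \<in> \<Union>{B \<in> \<B>. B \<subseteq> U}" using e x unfolding \<B>_def by blast
  qed auto
  moreover have "\<forall>B\<in>\<B>. open B" by (auto simp: \<B>_def)
  ultimately show ?thesis by blast
qed

text \<open>The finite unions of members of a countable base are countable in number. The integrals
  over them determine those over open sets by monotone limits, and hence those over Borel sets by
  Dynkin's lemma.\<close>

lemma compact_metric_determining_sets:
  fixes M :: "'y::metric_space measure"
  assumes comp: "compact (UNIV :: 'y set)" and M: "prob_space M" "sets M = sets borel"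
  shows "\<exists>B :: nat \<Rightarrow> 'y set. (\<forall>i. B i \<in> sets M) \<and>
    (\<forall>f :: 'y \<Rightarrow> real. integrable M f \<longrightarrow> (\<forall>i. (\<integral>y. indicator (B i) y * f y \<partial>M) = 0) \<longrightarrow> (AE y in M. f y = 0))"
proof -
  interpret prob_space M by (rule M(1))
  obtain \<B> :: "'y set set" where \<B>: "countable \<B>" "\<And>B. B \<in> \<B> \<Longrightarrow> open B"
    "\<And>U. open U \<Longrightarrow> U = \<Union>{B \<in> \<B>. B \<subseteq> U}" using compact_metric_countable_base[OF comp] by blast
  define \<U> where "\<U> = Union ` {\<F>. finite \<F> \<and> \<F> \<subseteq> \<B>}"
  have cU: "countable \<U>" unfolding \<U>_def by (intro countable_image countable_Collect_finite_subset \<B>(1))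
  have "{} \<in> \<U>" unfolding \<U>_def by (intro image_eqI[of _ _ "{}"]) auto
  then have ne: "\<U> \<noteq> {}" by blast
  define B where "B = from_nat_into \<U>"
  have rB: "range B = \<U>" unfolding B_def by (rule range_from_nat_into[OF ne cU])
  have opn: "open V" if "V \<in> \<U>" for V using that \<B>(2) by (auto simp: \<U>_def)
  have sM: "space M = UNIV" using sets_eq_imp_space_eq[OF M(2)] by simp
  have main: "AE y in M. f y = 0"
    if f: "integrable M f" and z: "\<And>i. (\<integral>y. indicator (B i) y * f y \<partial>M) = 0" for f :: "'y \<Rightarrow> real"
  proof (rule AE_zero_of_set_integrals[OF f])
    have zU: "(\<integral>y. indicator V y * f y \<partial>M) = 0" if V: "V \<in> \<U>" for V
    proof -
      obtain i where "V = B i" using V rB by blast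
      then show ?thesis using z by simp
    qed
    have si: "set_integrable M A f" if "A \<in> sets M" for A
      using integrable_mult_indicator[OF that f] by (simp add: set_integrable_def)
    have "f \<in> borel_measurable M" using f by auto
    have opnz: "(LINT y:U|M. f y) = 0" if U: "open U" for U
    proof (cases "{B \<in> \<B>. B \<subseteq> U} = {}")
      case True
      then have "\<Union>{B \<in> \<B>. B \<subseteq> U} = {}" by (simp only: Union_empty)
      then have "U = {}" using \<B>(3)[OF U] by simp
      then show ?thesis by (simp add: set_lebesgue_integral_def)
    next
      case False
      define b where "b = from_nat_into {B \<in> \<B>. B \<subseteq> U}"
      have cnt: "countable {B \<in> \<B>. B \<subseteq> U}" using \<B>(1) by auto
      have rb: "range b = {B \<in> \<B>. B \<subseteq> U}" unfolding b_def by (rule range_from_nat_into[OF False cnt])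
      define A where "A n = (\<Union>i\<le>n. b i)" for n :: nat
      have AU: "A n \<in> \<U>" for n
      proof -
        have "b i \<in> \<B>" for i using rb by auto
        then show ?thesis unfolding \<U>_def A_def by (intro image_eqI[of _ _ "b ` {..n}"]) auto
      qed
      have "(\<Union>n. A n) = \<Union>(range b)" by (auto simp: A_def)
      also have "\<dots> = U" unfolding rb using \<B>(3)[OF U] by simp
      finally have UA: "(\<Union>n. A n) = U" .
      have "(\<lambda>n. LINT y:(A n)|M. f y) \<longlonglongrightarrow> (LINT y:(\<Union>n. A n)|M. f y)"
      proof (rule set_integral_cont_up)
        show "A n \<in> sets M" for n using opn[OF AU] by (simp add: M(2))
        show "incseq A" unfolding incseq_def A_def by force
        show "set_integrable M (\<Union>n. A n) f" unfolding UA by (rule si) (use U in \<open>simp add: M(2)\<close>)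
      qed
      moreover have "(LINT y:(A n)|M. f y) = 0" for n using zU[OF AU] by (simp add: set_lebesgue_integral_def)
      ultimately show ?thesis unfolding UA by (simp add: LIMSEQ_const_iff)
    qed
    have dyn: "(LINT y:A|M. f y) = 0" if "A \<in> sigma_sets UNIV {U. open U}" for A
    proof (rule sigma_sets_induct_disjoint[where A = A and G = "{U. open U}" and \<Omega> = UNIV])
      show "Int_stable {U. open (U :: 'y set)}" by (auto simp: Int_stable_def)
      show "A \<in> sigma_sets UNIV {U. open U}" by (rule that)
      show "(LINT y:U|M. f y) = 0" if "U \<in> {U. open U}" for U using opnz that by auto
      show "(LINT y:{}|M. f y) = 0" by (simp add: set_lebesgue_integral_def)
    next
      fix A :: "'y set" assume A: "A \<in> sigma_sets UNIV {U. open U}" and iA: "(LINT y:A|M. f y) = 0"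
      have As: "A \<in> sets M" using A by (simp add: M(2) borel_def)
      have "(LINT y:(UNIV - A) \<union> A|M. f y) = (LINT y:(UNIV - A)|M. f y) + (LINT y:A|M. f y)"
        by (rule set_integral_Un) (use As si sets.compl_sets[OF As] sM in auto)
      then show "(LINT y:(UNIV - A)|M. f y) = 0" using opnz[of UNIV] iA by simp
    next
      fix A :: "nat \<Rightarrow> 'y set"
      assume d: "disjoint_family A" and A: "range A \<subseteq> sigma_sets UNIV {U. open U}" and iA: "\<And>i. (LINT y:A i|M. f y) = 0"
      have As: "A i \<in> sets M" for i using A by (auto simp: M(2) borel_def)
      have "(LINT y:(\<Union>i. A i)|M. f y) = suminf (\<lambda>i. LINT y:A i|M. f y)"
        by (rule lebesgue_integral_countable_add) (use As d si in \<open>auto simp: disjoint_family_on_def\<close>)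
      then show "(LINT y:(\<Union>i. A i)|M. f y) = 0" by (simp add: iA)
    qed auto
    show "(\<integral>y. indicator A y * f y \<partial>M) = 0" if "A \<in> sets M" for A
      using dyn[of A] that by (simp add: M(2) borel_def set_lebesgue_integral_def)
  qed
  have "B i \<in> sets M" for i
  proof -
    have "B i \<in> \<U>" unfolding rB[symmetric] by (rule rangeI)
    from opn[OF this] show ?thesis by (simp add: M(2))
  qed
  then have 1: "\<forall>i. B i \<in> sets M" by (rule allI)
  have 2: "\<forall>f :: 'y \<Rightarrow> real. integrable M f \<longrightarrow> (\<forall>i. (\<integral>y. indicator (B i) y * f y \<partial>M) = 0) \<longrightarrow>
      (AE y in M. f y = 0)"
  proof (rule allI, rule impI, rule impI)
    fix f :: "'y \<Rightarrow> real" assume f: "integrable M f" and z: "\<forall>i. (\<integral>y. indicator (B i) y * f y \<partial>M) = 0"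
    show "AE y in M. f y = 0" by (rule main[OF f z[THEN spec]])
  qed
  show ?thesis by (rule exI[where x = B], rule conjI[OF 1 2])
qed

text \<open>The integrals of the real and imaginary parts of the coordinates over the sets
  \<open>B i\<close> are countably many real numbers \<open>P h\<close> that determine the class of
  \<open>h\<close>. Their Dedekind cuts together form one set \<open>c h\<close> of natural numbers,
  which can be encoded as a real number and so as an element of \<open>'u\<close>.\<close>

lemma L2_code_exists:
  fixes M :: "'y::metric_space measure"
  assumes comp: "compact (UNIV :: 'y set)" and M: "prob_space M" "sets M = sets borel"
    and u: "\<exists>\<iota> :: real \<Rightarrow> 'u. inj \<iota>"
  shows "\<exists>J :: ('y \<Rightarrow> nat \<Rightarrow> complex) \<Rightarrow> 'u. cx_hilbert_code (L2 M k) (L2_ip M k) L2_I L2_K J"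
proof -
  interpret prob_space M by (rule M(1))
  interpret cx_hilbert "L2 M k" "L2_ip M k" L2_I L2_K by (rule L2_cx_hilbert)
  obtain B :: "nat \<Rightarrow> 'y set" where B: "\<And>i. B i \<in> sets M" and
    det: "\<And>f :: 'y \<Rightarrow> real. integrable M f \<Longrightarrow> (\<And>i. (\<integral>y. indicator (B i) y * f y \<partial>M) = 0) \<Longrightarrow> AE y in M. f y = 0"
  proof -
    obtain B :: "nat \<Rightarrow> 'y set" where B: "(\<forall>i. B i \<in> sets M) \<and> (\<forall>f :: 'y \<Rightarrow> real. integrable M f \<longrightarrow>
        (\<forall>i. (\<integral>y. indicator (B i) y * f y \<partial>M) = 0) \<longrightarrow> (AE y in M. f y = 0))"
      using compact_metric_determining_sets[OF comp M] ..
    show thesis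
      by (rule that[OF B[THEN conjunct1, rule_format] B[THEN conjunct2, rule_format]])
  qed
  obtain \<iota> :: "real \<Rightarrow> 'u" where \<iota>: "inj \<iota>" using u by blast
  have "(UNIV :: nat set set) \<lesssim> (UNIV :: real set)" by (rule eqpoll_imp_lepoll[OF nat_sets_eqpoll_reals])
  then obtain e :: "nat set \<Rightarrow> real" where e: "inj e" by (auto simp: lepoll_def)
  define P where "P h = (\<lambda>(i, j, b). \<integral>y. indicator (B i) y * (if b then Re (h y j) else Im (h y j)) \<partial>M)"
    for h :: "'y \<Rightarrow> nat \<Rightarrow> complex"
  define c where "c h = {n. case from_nat n of (t, q) \<Rightarrow> real_of_rat q < P h t}"
    for h :: "'y \<Rightarrow> nat \<Rightarrow> complex"
  define J where "J h = \<iota> (e (c h))" for h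
  have cP: "c h = c h' \<longleftrightarrow> P h = P h'" for h h'
  proof
    assume eq: "c h = c h'"
    have le: "P h t \<le> P h' t" if eq: "c h = c h'" for h h' t
    proof (rule ccontr)
      assume "\<not> P h t \<le> P h' t"
      then obtain q where q: "P h' t < real_of_rat q" "real_of_rat q < P h t"
        using of_rat_dense[of "P h' t" "P h t"] by auto
      have "to_nat (t, q) \<in> c h" using q by (simp add: c_def)
      then have "to_nat (t, q) \<in> c h'" using eq by simp
      then show False using q by (simp add: c_def)
    qed
    show "P h = P h'" by (rule ext) (use le[OF eq] le[OF eq[symmetric]] in \<open>auto intro: antisym\<close>)
  qed (simp add: c_def)
  have J: "J h = J h' \<longleftrightarrow> P h = P h'" for h h'
    using \<iota> e cP by (auto simp: J_def inj_eq)
  have "J h = J h' \<longleftrightarrow> L2_ip M k (h - h') (h - h') = 0" if h: "h \<in> L2 M k" "h' \<in> L2 M k" for h h'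
  proof -
    define f where "f j y = h y j - h' y j" for j y
    have fs: "sq_int M (f j)" if "j < k" for j unfolding f_def by (intro sq_int_diff L2D(1)[OF _ that] h)
    have fi: "integrable M (f j)" if "j < k" for j by (rule sq_int_imp_integrable[OF fs[OF that]])
    have "L2_ip M k (h - h') (h - h') = 0 \<longleftrightarrow> (\<forall>j<k. (\<integral>y. (cmod (f j y))\<^sup>2 \<partial>M) = 0)"
      by (auto simp: L2_ip_self f_def sum_nonneg_eq_0_iff)
    also have "\<dots> \<longleftrightarrow> (\<forall>j<k. AE y in M. f j y = 0)"
      using integral_nonneg_eq_0_iff_AE[OF sq_int_integrable[OF fs]] by simp
    also have "\<dots> \<longleftrightarrow> P h = P h'"
    proof
      assume z: "\<forall>j<k. AE y in M. f j y = 0"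
      show "P h = P h'"
      proof
        fix t :: "nat \<times> nat \<times> bool"
        obtain i j b where t: "t = (i, j, b)" by (cases t)
        show "P h t = P h' t"
        proof (cases "j < k")
          case True
          have [measurable]: "(\<lambda>y. h y j) \<in> borel_measurable M" "(\<lambda>y. h' y j) \<in> borel_measurable M" "B i \<in> sets M"
            using L2D(1)[OF _ True] h B by (auto simp: sq_int_def)
          have "AE y in M. f j y = 0" using z True by blast
          then show ?thesis
            unfolding P_def t by (simp only: prod.case, intro integral_cong_AE)
              (measurable, auto simp: f_def elim: eventually_mono)
        next
          case False
          then have "h y j = 0" "h' y j = 0" for y using L2D(2)[OF h(1)] L2D(2)[OF h(2)] by auto
          then show ?thesis by (simp only: P_def t prod.case)
        qed
      qed
    next
      assume eq: "P h = P h'"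
      have hi: "integrable M (\<lambda>y. h y j)" "integrable M (\<lambda>y. h' y j)" if "j < k" for j
        using sq_int_imp_integrable L2D(1)[OF _ that] h by auto
      have "AE y in M. f j y = 0" if j: "j < k" for j
      proof -
        have ind: "integrable M (\<lambda>y. indicator (B i) y * g y)" if "integrable M g" for g :: "'y \<Rightarrow> real" and i
          using integrable_mult_indicator[OF B that] by simp
        have R: "AE y in M. Re (f j y) = 0"
        proof (rule det)
          show "integrable M (\<lambda>y. Re (f j y))" using fi[OF j] by simp
          fix i
          have "P h (i, j, True) = P h' (i, j, True)" using eq by simp
          then have "(\<integral>y. indicator (B i) y * Re (h y j) \<partial>M) - (\<integral>y. indicator (B i) y * Re (h' y j) \<partial>M) = 0"
            by (simp add: P_def)
          then show "(\<integral>y. indicator (B i) y * Re (f j y) \<partial>M) = 0"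
            using Bochner_Integration.integral_diff[OF ind[of "\<lambda>y. Re (h y j)" i] ind[of "\<lambda>y. Re (h' y j)" i]] hi[OF j]
            by (simp add: f_def right_diff_distrib)
        qed
        have I: "AE y in M. Im (f j y) = 0"
        proof (rule det)
          show "integrable M (\<lambda>y. Im (f j y))" using fi[OF j] by simp
          fix i
          have "P h (i, j, False) = P h' (i, j, False)" using eq by simp
          then have "(\<integral>y. indicator (B i) y * Im (h y j) \<partial>M) - (\<integral>y. indicator (B i) y * Im (h' y j) \<partial>M) = 0"
            by (simp add: P_def)
          then show "(\<integral>y. indicator (B i) y * Im (f j y) \<partial>M) = 0"
            using Bochner_Integration.integral_diff[OF ind[of "\<lambda>y. Im (h y j)" i] ind[of "\<lambda>y. Im (h' y j)" i]] hi[OF j]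
            by (simp add: f_def right_diff_distrib)
        qed
        from R I show ?thesis by eventually_elim (simp add: complex_eq_iff)
      qed
      then show "\<forall>j<k. AE y in M. f j y = 0" by blast
    qed
    finally show ?thesis using J by simp
  qed
  then have "cx_hilbert_code (L2 M k) (L2_ip M k) L2_I L2_K J"
    by unfold_locales
  then show ?thesis by blast
qed


section \<open>Functions with values in a finite-dimensional subspace\<close>

text \<open>The norm of the linear combination is a continuous function of the coefficients that is
  positive on the compact unit sphere.\<close>

lemma independent_norm_lower_bound:
  fixes v :: "nat \<Rightarrow> 'x::real_normed_vector"
  assumes inj: "inj_on v {..<k}" and ind: "independent (v ` {..<k})"
  shows "\<exists>\<delta>>0. \<forall>a. \<delta>\<^sup>2 * (\<Sum>j<k. (a j)\<^sup>2) \<le> (norm (\<Sum>j<k. a j *\<^sub>R v j))\<^sup>2"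
proof -
  define S where "S = {a :: nat \<Rightarrow> real. (\<forall>j\<ge>k. a j = 0) \<and> (\<Sum>j<k. (a j)\<^sup>2) = 1}"
  define F where "F a = norm (\<Sum>j<k. a j *\<^sub>R v j)" for a :: "nat \<Rightarrow> real"
  have coord: "continuous_on UNIV (\<lambda>a :: nat \<Rightarrow> real. a j)" for j by simp
  have F: "continuous_on UNIV F"
    unfolding F_def by (intro continuous_intros coord)
  define P where "P = (\<Pi>\<^sub>E j\<in>UNIV. if j < k then {-1..1::real} else {0})"
  have "compactin (product_topology (\<lambda>_. euclidean) UNIV) P"
    unfolding P_def compactin_PiE by auto
  then have cP: "compact P" by (simp add: euclidean_product_topology)
  have "closed ((\<Inter>j\<in>{k..}. (\<lambda>a. a j) -` {0}) \<inter> (\<lambda>a. \<Sum>j<k. (a j)\<^sup>2) -` {1::real})"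
    by (intro closed_Int closed_INT ballI closed_vimage) (auto intro!: continuous_intros coord)
  also have "(\<Inter>j\<in>{k..}. (\<lambda>a. a j) -` {0}) \<inter> (\<lambda>a. \<Sum>j<k. (a j)\<^sup>2) -` {1::real} = S"
    by (auto simp: S_def)
  finally have cS: "closed S" .
  have "S \<subseteq> P"
  proof
    fix a assume a: "a \<in> S"
    have "\<bar>a j\<bar> \<le> 1" if "j < k" for j
    proof -
      have "(a j)\<^sup>2 \<le> (\<Sum>j<k. (a j)\<^sup>2)" by (rule member_le_sum) (use that in auto)
      then have "(a j)\<^sup>2 \<le> 1\<^sup>2" using a by (simp add: S_def)
      then show ?thesis by (metis abs_1 abs_le_square_iff)
    qed
    then show "a \<in> P" using a by (auto simp: P_def S_def PiE_def abs_le_iff)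
  qed
  then have compS: "compact S" using compact_Int_closed[OF cP cS] by (simp add: Int_absorb1)
  have pos: "F a > 0" if a: "a \<in> S" for a
  proof -
    have "\<exists>j<k. a j \<noteq> 0"
    proof (rule ccontr)
      assume "\<not> ?thesis"
      then have "(\<Sum>j<k. (a j)\<^sup>2) = 0" by (intro sum.neutral) auto
      then show False using a by (simp add: S_def)
    qed
    then obtain i where i: "i < k" "a i \<noteq> 0" by blast
    have "(\<Sum>j<k. a j *\<^sub>R v j) \<noteq> 0"
    proof
      assume z: "(\<Sum>j<k. a j *\<^sub>R v j) = 0"
      define b where "b x = a (inv_into {..<k} v x)" for x
      have bv: "b (v j) = a j" if "j < k" for j using inj that by (simp add: b_def inv_into_f_f)
      have "(\<Sum>x\<in>v ` {..<k}. b x *\<^sub>R x) = (\<Sum>j<k. b (v j) *\<^sub>R v j)" by (rule sum.reindex[OF inj, unfolded o_def])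
      also have "\<dots> = 0" using z bv by simp
      finally have "b (v i) = 0"
        using ind i unfolding independent_explicit_finite_subsets by blast
      then show False using bv[OF i(1)] i by simp
    qed
    then show ?thesis by (simp add: F_def)
  qed
  obtain \<delta> where \<delta>: "\<delta> > 0" "\<And>a. a \<in> S \<Longrightarrow> \<delta> \<le> F a"
  proof (cases "S = {}")
    case True
    then show ?thesis using that[of 1] by simp
  next
    case False
    then obtain s where s: "s \<in> S" "\<And>a. a \<in> S \<Longrightarrow> F s \<le> F a"
      using continuous_attains_inf[OF compS False continuous_on_subset[OF F]] by blast
    show ?thesis by (rule that[OF pos[OF s(1)] s(2)])
  qed
  have "\<delta>\<^sup>2 * (\<Sum>j<k. (a j)\<^sup>2) \<le> (norm (\<Sum>j<k. a j *\<^sub>R v j))\<^sup>2" for a :: "nat \<Rightarrow> real"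
  proof -
    define t where "t = sqrt (\<Sum>j<k. (a j)\<^sup>2)"
    have t2: "t\<^sup>2 = (\<Sum>j<k. (a j)\<^sup>2)" unfolding t_def by (simp add: sum_nonneg)
    show ?thesis
    proof (cases "t = 0")
      case True
      then show ?thesis using t2 by simp
    next
      case False
      then have tp: "t > 0" unfolding t_def by (simp add: less_le sum_nonneg)
      define b where "b = (\<lambda>j. if j < k then a j / t else 0)"
      have "(\<Sum>j<k. (b j)\<^sup>2) = (\<Sum>j<k. (a j)\<^sup>2) / t\<^sup>2"
        by (simp add: b_def power_divide sum_divide_distrib)
      also have "\<dots> = 1" using t2 tp by (metis divide_self_if power_not_zero less_irrefl)
      finally have bS: "b \<in> S" by (simp add: S_def b_def)
      have "F b = norm ((1 / t) *\<^sub>R (\<Sum>j<k. a j *\<^sub>R v j))"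
        unfolding F_def scaleR_sum_right by (intro arg_cong[where f = norm] sum.cong) (auto simp: b_def)
      also have "\<dots> = norm (\<Sum>j<k. a j *\<^sub>R v j) / t" using tp by simp
      finally have "F b * t = norm (\<Sum>j<k. a j *\<^sub>R v j)" using tp by (simp add: field_simps)
      then have "\<delta> * t \<le> norm (\<Sum>j<k. a j *\<^sub>R v j)" using mult_right_mono[OF \<delta>(2)[OF bS], of t] tp by simp
      then have "(\<delta> * t)\<^sup>2 \<le> (norm (\<Sum>j<k. a j *\<^sub>R v j))\<^sup>2" using \<delta>(1) tp by (intro power_mono) auto
      then show ?thesis by (simp add: power_mult_distrib t2)
    qed
  qed
  then show ?thesis using \<delta>(1) by blast
qed

text \<open>The coefficients are complex because the Hilbert space is, but the values lie in a real
  Banach space; the norm so obtained is complexified by \<open>circle_sup\<close>.\<close>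

definition lincomb :: "(nat \<Rightarrow> 'x::real_normed_vector) \<Rightarrow> nat \<Rightarrow> (nat \<Rightarrow> complex) \<Rightarrow> 'x" where
  "lincomb v k a = (\<Sum>j<k. Re (a j) *\<^sub>R v j)"

text \<open>The norm in \<open>L\<^sup>2(Y; X)\<close> of the function whose coordinates with
  respect to \<open>v\<close> are the real parts of \<open>h\<close>.\<close>

definition L2_span_norm :: "'y measure \<Rightarrow> (nat \<Rightarrow> 'x::real_normed_vector) \<Rightarrow> nat \<Rightarrow> ('y \<Rightarrow> nat \<Rightarrow> complex) \<Rightarrow> real" where
  "L2_span_norm M v k h = sqrt (\<integral>y. (norm (lincomb v k (h y)))\<^sup>2 \<partial>M)"

lemma lincomb_add: "lincomb v k (a + b) = lincomb v k a + lincomb v k b"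
  by (simp add: lincomb_def scaleR_add_left sum.distrib)

lemma lincomb_scale: "lincomb v k (c *\<^sub>R a) = c *\<^sub>R lincomb v k a"
  by (simp add: lincomb_def scaleR_fun_def scaleR_sum_right)

lemma lincomb_sum: "lincomb v k (\<Sum>a\<in>A. c a *\<^sub>R x a) = (\<Sum>a\<in>A. c a *\<^sub>R lincomb v k (x a))"
proof -
  have "lincomb v k 0 = 0" by (simp add: lincomb_def)
  then show ?thesis by (induction A rule: infinite_finite_induct) (auto simp: lincomb_add lincomb_scale)
qed

lemma norm_lincomb_sq_le: "(norm (lincomb v k a))\<^sup>2 \<le> (\<Sum>j<k. (norm (v j))\<^sup>2) * (\<Sum>j<k. (cmod (a j))\<^sup>2)"
proof -
  have "norm (lincomb v k a) \<le> (\<Sum>j<k. norm (v j) * cmod (a j))"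
    unfolding lincomb_def
    by (rule order.trans[OF norm_sum sum_mono]) (simp add: abs_Re_le_cmod mult.commute mult_left_mono)
  then have "(norm (lincomb v k a))\<^sup>2 \<le> (\<Sum>j<k. norm (v j) * cmod (a j))\<^sup>2" by (intro power_mono) auto
  also have "\<dots> \<le> (\<Sum>j<k. (norm (v j))\<^sup>2) * (\<Sum>j<k. (cmod (a j))\<^sup>2)" by (rule Cauchy_Schwarz_ineq_sum)
  finally show ?thesis .
qed

context prob_space
begin

lemma norm_lincomb_measurable:
  assumes h: "h \<in> L2 M k"
  shows "(\<lambda>y. norm (lincomb v k (h y))) \<in> borel_measurable M"
proof -
  have c: "(\<lambda>y. Re (h y j)) \<in> borel_measurable M" for j
  proof (cases "j < k")
    case True
    then have [measurable]: "(\<lambda>y. h y j) \<in> borel_measurable M" using L2D(1)[OF h] by (simp add: sq_int_def)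
    show ?thesis by measurable
  next
    case False
    then have "(\<lambda>y. Re (h y j)) = (\<lambda>y. 0)" using L2D(2)[OF h] by simp
    then show ?thesis by simp
  qed
  have m: "(\<lambda>y j. Re (h y j)) \<in> borel_measurable M" by (rule measurable_coordinatewise_then_product[OF c])
  have "continuous_on UNIV (\<lambda>a :: nat \<Rightarrow> real. norm (\<Sum>j<k. a j *\<^sub>R v j))"
    by (intro continuous_intros continuous_on_product_coordinates)
  then have "(\<lambda>a :: nat \<Rightarrow> real. norm (\<Sum>j<k. a j *\<^sub>R v j)) \<in> borel_measurable borel"
    by (rule borel_measurable_continuous_onI)
  from measurable_compose[OF m this] show ?thesis by (simp add: lincomb_def)
qed

lemma sum_sq_integrable: "h \<in> L2 M k \<Longrightarrow> integrable M (\<lambda>y. \<Sum>j<k. (cmod (h y j))\<^sup>2)"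
  by (intro Bochner_Integration.integrable_sum sq_int_integrable) (auto simp: L2_def)

lemma norm_lincomb_integrable:
  assumes h: "h \<in> L2 M k"
  shows "integrable M (\<lambda>y. (norm (lincomb v k (h y)))\<^sup>2)"
proof (rule Bochner_Integration.integrable_bound)
  show "integrable M (\<lambda>y. (\<Sum>j<k. (norm (v j))\<^sup>2) * (\<Sum>j<k. (cmod (h y j))\<^sup>2))"
    using sum_sq_integrable[OF h] by simp
  show "(\<lambda>y. (norm (lincomb v k (h y)))\<^sup>2) \<in> borel_measurable M"
    using norm_lincomb_measurable[OF h, of v] by measurable
  show "AE y in M. norm ((norm (lincomb v k (h y)))\<^sup>2) \<le> norm ((\<Sum>j<k. (norm (v j))\<^sup>2) * (\<Sum>j<k. (cmod (h y j))\<^sup>2))"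
    using norm_lincomb_sq_le[of v k] by (simp add: sum_nonneg)
qed

lemma L2_span_norm_sq: "h \<in> L2 M k \<Longrightarrow> (L2_span_norm M v k h)\<^sup>2 = (\<integral>y. (norm (lincomb v k (h y)))\<^sup>2 \<partial>M)"
  by (simp add: L2_span_norm_def)

lemma Minkowski_L2:
  fixes p q :: "'a \<Rightarrow> real"
  assumes [measurable]: "p \<in> borel_measurable M" "q \<in> borel_measurable M"
    and "integrable M (\<lambda>y. (p y)\<^sup>2)" "integrable M (\<lambda>y. (q y)\<^sup>2)"
  shows "sqrt (\<integral>y. (p y + q y)\<^sup>2 \<partial>M) \<le> sqrt (\<integral>y. (p y)\<^sup>2 \<partial>M) + sqrt (\<integral>y. (q y)\<^sup>2 \<partial>M)"
proof -
  interpret L: cx_hilbert "L2 M 1" "L2_ip M 1" L2_I L2_K by (rule L2_cx_hilbert)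
  define P where "P f = (\<lambda>y (j::nat). if j = 0 then complex_of_real (f y) else 0)" for f :: "'a \<Rightarrow> real"
  have P: "P p \<in> L2 M 1" "P q \<in> L2 M 1" using assms by (auto simp: P_def L2_def sq_int_def)
  have hnorm: "L.hnorm (P f) = sqrt (\<integral>y. (f y)\<^sup>2 \<partial>M)" for f
    unfolding L.hnorm_def L2_ip_self by (simp add: P_def)
  have "P p + P q = P (\<lambda>y. p y + q y)" by (auto simp: P_def fun_eq_iff)
  then show ?thesis using seminorm_on_triangle[OF L.hnorm_seminorm P] by (simp only: hnorm)
qed

lemma L2_span_norm_seminorm: "seminorm_on (L2 M k) (L2_span_norm M v k)"
proof -
  interpret L: cx_hilbert "L2 M k" "L2_ip M k" L2_I L2_K by (rule L2_cx_hilbert)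
  show ?thesis
    unfolding seminorm_on_def
  proof (intro conjI ballI allI L.H)
    show "0 \<le> L2_span_norm M v k h" for h by (simp add: L2_span_norm_def)
    show "L2_span_norm M v k (a *\<^sub>R h) = \<bar>a\<bar> * L2_span_norm M v k h" for a h
    proof -
      have "(norm (lincomb v k ((a *\<^sub>R h) y)))\<^sup>2 = a\<^sup>2 * (norm (lincomb v k (h y)))\<^sup>2" for y
        using lincomb_scale[of v k a "h y"] by (simp add: scaleR_fun_def power_mult_distrib)
      then show ?thesis by (simp add: L2_span_norm_def real_sqrt_mult)
    qed
    fix h h' assume h: "h \<in> L2 M k" "h' \<in> L2 M k"
    have "(\<integral>y. (norm (lincomb v k ((h + h') y)))\<^sup>2 \<partial>M) \<le> (\<integral>y. (norm (lincomb v k (h y)) + norm (lincomb v k (h' y)))\<^sup>2 \<partial>M)"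
    proof (rule integral_mono)
      show "integrable M (\<lambda>y. (norm (lincomb v k ((h + h') y)))\<^sup>2)"
        by (rule norm_lincomb_integrable) (use h L.add_in in blast)
      have [measurable]: "(\<lambda>y. norm (lincomb v k (h y))) \<in> borel_measurable M" "(\<lambda>y. norm (lincomb v k (h' y))) \<in> borel_measurable M"
        using norm_lincomb_measurable h by auto
      show "integrable M (\<lambda>y. (norm (lincomb v k (h y)) + norm (lincomb v k (h' y)))\<^sup>2)"
      proof (rule Bochner_Integration.integrable_bound)
        show "integrable M (\<lambda>y. 2 * (norm (lincomb v k (h y)))\<^sup>2 + 2 * (norm (lincomb v k (h' y)))\<^sup>2)"
          by (intro Bochner_Integration.integrable_add Bochner_Integration.integrable_mult_right norm_lincomb_integrable h)
        have "(a + b)\<^sup>2 \<le> 2 * a\<^sup>2 + 2 * b\<^sup>2" for a b :: real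
          using zero_le_power2[of "a - b"] by (simp add: power2_sum power2_diff)
        then show "AE y in M. norm ((norm (lincomb v k (h y)) + norm (lincomb v k (h' y)))\<^sup>2) \<le>
            norm (2 * (norm (lincomb v k (h y)))\<^sup>2 + 2 * (norm (lincomb v k (h' y)))\<^sup>2)" by simp
      qed measurable
      show "(norm (lincomb v k ((h + h') y)))\<^sup>2 \<le> (norm (lincomb v k (h y)) + norm (lincomb v k (h' y)))\<^sup>2" for y
        using norm_triangle_ineq[of "lincomb v k (h y)" "lincomb v k (h' y)"] by (simp add: lincomb_add power_mono)
    qed
    then have "L2_span_norm M v k (h + h') \<le> sqrt (\<integral>y. (norm (lincomb v k (h y)) + norm (lincomb v k (h' y)))\<^sup>2 \<partial>M)"
      by (simp add: L2_span_norm_def)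
    also have "\<dots> \<le> L2_span_norm M v k h + L2_span_norm M v k h'"
      unfolding L2_span_norm_def by (rule Minkowski_L2) (use norm_lincomb_measurable norm_lincomb_integrable h in auto)
    finally show "L2_span_norm M v k (h + h') \<le> L2_span_norm M v k h + L2_span_norm M v k h'" .
  qed
qed

lemma L2_span_norm_upper:
  assumes h: "h \<in> L2 M k"
  shows "L2_span_norm M v k h \<le> sqrt (\<Sum>j<k. (norm (v j))\<^sup>2) * sqrt (L2_ip M k h h)"
proof -
  have "(\<integral>y. (norm (lincomb v k (h y)))\<^sup>2 \<partial>M) \<le> (\<integral>y. (\<Sum>j<k. (norm (v j))\<^sup>2) * (\<Sum>j<k. (cmod (h y j))\<^sup>2) \<partial>M)"
    by (rule integral_mono[OF norm_lincomb_integrable[OF h]]) (use sum_sq_integrable[OF h] norm_lincomb_sq_le in auto)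
  also have "\<dots> = (\<Sum>j<k. (norm (v j))\<^sup>2) * L2_ip M k h h"
    using L2D(1)[OF h] by (simp add: L2_ip_self sq_int_integrable)
  finally show ?thesis by (simp add: L2_span_norm_def flip: real_sqrt_mult)
qed

text \<open>The imaginary part of \<open>h\<close> is, up to sign, the real part of
  \<open>L2_I h\<close>.\<close>

lemma L2_span_norm_lower:
  assumes h: "h \<in> L2 M k" and \<delta>: "\<delta> > 0"
    and low: "\<And>a. \<delta>\<^sup>2 * (\<Sum>j<k. (a j)\<^sup>2) \<le> (norm (\<Sum>j<k. a j *\<^sub>R v j))\<^sup>2"
  shows "\<delta> * sqrt (L2_ip M k h h) \<le> L2_span_norm M v k h + L2_span_norm M v k (L2_I h)"
proof -
  interpret L: cx_hilbert "L2 M k" "L2_ip M k" L2_I L2_K by (rule L2_cx_hilbert)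
  have Ih: "L2_I h \<in> L2 M k" using h by simp
  have pt: "\<delta>\<^sup>2 * (\<Sum>j<k. (cmod (h y j))\<^sup>2) \<le> (norm (lincomb v k (h y)))\<^sup>2 + (norm (lincomb v k (L2_I h y)))\<^sup>2" for y
  proof -
    have "\<delta>\<^sup>2 * (\<Sum>j<k. (cmod (h y j))\<^sup>2) = \<delta>\<^sup>2 * (\<Sum>j<k. (Re (h y j))\<^sup>2) + \<delta>\<^sup>2 * (\<Sum>j<k. (Re (L2_I h y j))\<^sup>2)"
      by (simp add: cmod_power2 sum.distrib distrib_left L2_I_def)
    then show ?thesis using low[of "\<lambda>j. Re (h y j)"] low[of "\<lambda>j. Re (L2_I h y j)"] by (simp add: lincomb_def)
  qed
  have "\<delta>\<^sup>2 * L2_ip M k h h = (\<integral>y. \<delta>\<^sup>2 * (\<Sum>j<k. (cmod (h y j))\<^sup>2) \<partial>M)"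
    using L2D(1)[OF h] by (simp add: L2_ip_self sq_int_integrable)
  also have "\<dots> \<le> (\<integral>y. (norm (lincomb v k (h y)))\<^sup>2 + (norm (lincomb v k (L2_I h y)))\<^sup>2 \<partial>M)"
    by (rule integral_mono)
       (use sum_sq_integrable[OF h] pt in \<open>auto intro!: Bochner_Integration.integrable_add norm_lincomb_integrable h Ih\<close>)
  also have "\<dots> = (L2_span_norm M v k h)\<^sup>2 + (L2_span_norm M v k (L2_I h))\<^sup>2"
    using norm_lincomb_integrable[OF h, of v] norm_lincomb_integrable[OF Ih, of v] by (simp add: L2_span_norm_def)
  also have "\<dots> \<le> (L2_span_norm M v k h + L2_span_norm M v k (L2_I h))\<^sup>2"
    by (simp add: power2_sum L2_span_norm_def)
  finally have "sqrt (\<delta>\<^sup>2 * L2_ip M k h h) \<le> \<bar>L2_span_norm M v k h + L2_span_norm M v k (L2_I h)\<bar>"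
    by (metis real_sqrt_abs real_sqrt_le_iff)
  then show ?thesis using \<delta> by (simp add: real_sqrt_mult L2_span_norm_def)
qed

text \<open>Integrate the inequality for the values at a point.\<close>

lemma L2_span_norm_rad_bound:
  assumes b: "rad_bound (norm :: 'x \<Rightarrow> real) UNIV n c"
  shows "rad_bound (L2_span_norm M (v :: nat \<Rightarrow> 'x::real_normed_vector) k) (L2 M k) n c"
  unfolding rad_bound_def
proof (intro ballI)
  interpret L: cx_hilbert "L2 M k" "L2_ip M k" L2_I L2_K by (rule L2_cx_hilbert)
  fix x assume x: "x \<in> {..<n} \<rightarrow> L2 M k"
  have xi: "x i \<in> L2 M k" if "i < n" for i using x that by auto
  have S: "(\<Sum>a<n. \<epsilon> a *\<^sub>R x a) \<in> L2 M k" for \<epsilon> by (rule signed_sum_in[OF L.H]) (use xi in auto)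
  have ev: "lincomb v k ((\<Sum>a<n. \<epsilon> a *\<^sub>R x a) y) = (\<Sum>a<n. \<epsilon> a *\<^sub>R lincomb v k (x a y))" for \<epsilon> y
  proof -
    have "(\<Sum>a\<in>A. \<epsilon> a *\<^sub>R x a) y = (\<Sum>a\<in>A. \<epsilon> a *\<^sub>R x a y)" for A
      by (induction A rule: infinite_finite_induct) (auto simp: scaleR_fun_def)
    then show ?thesis by (simp add: lincomb_sum)
  qed
  have int: "integrable M (\<lambda>y. (norm (\<Sum>a<n. \<epsilon> a *\<^sub>R lincomb v k (x a y)))\<^sup>2)" for \<epsilon>
    using norm_lincomb_integrable[OF S, of v \<epsilon>] by (simp add: ev)
  have "rad (L2_span_norm M v k) {..<n} x =
      (\<Sum>\<epsilon>\<in>sg {..<n}. \<integral>y. (norm (\<Sum>a<n. \<epsilon> a *\<^sub>R lincomb v k (x a y)))\<^sup>2 \<partial>M) / 2 ^ card {..<n}"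
    using S by (simp add: rad_def L2_span_norm_sq ev)
  also have "\<dots> = (\<integral>y. rad norm {..<n} (\<lambda>i. lincomb v k (x i y)) \<partial>M)"
    using int by (simp add: rad_def)
  also have "\<dots> \<le> (\<integral>y. c * (\<Sum>i<n. (norm (lincomb v k (x i y)))\<^sup>2) \<partial>M)"
  proof (rule integral_mono)
    show "integrable M (\<lambda>y. rad norm {..<n} (\<lambda>i. lincomb v k (x i y)))" using int by (simp add: rad_def)
    show "integrable M (\<lambda>y. c * (\<Sum>i<n. (norm (lincomb v k (x i y)))\<^sup>2))"
      by (intro Bochner_Integration.integrable_mult_right Bochner_Integration.integrable_sum norm_lincomb_integrable xi) simp
    show "rad norm {..<n} (\<lambda>i. lincomb v k (x i y)) \<le> c * (\<Sum>i<n. (norm (lincomb v k (x i y)))\<^sup>2)" for y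
      using b by (simp add: rad_bound_def)
  qed
  also have "\<dots> = c * (\<Sum>i<n. (L2_span_norm M v k (x i))\<^sup>2)"
    using norm_lincomb_integrable[OF xi, where v = v] by (simp add: L2_span_norm_sq[OF xi])
  finally show "rad (L2_span_norm M v k) {..<n} x \<le> c * (\<Sum>i<n. (L2_span_norm M v k (x i))\<^sup>2)" .
qed

lemma norm_mean_sq_le:
  assumes f: "sq_int M f"
  shows "(cmod (\<integral>y. f y \<partial>M))\<^sup>2 \<le> (\<integral>y. (cmod (f y))\<^sup>2 \<partial>M)"
proof -
  have fi: "integrable M (\<lambda>y. cmod (f y))" using sq_int_imp_integrable[OF f] by simp
  define s where "s = (\<integral>y. cmod (f y) \<partial>M)"
  have "0 \<le> (\<integral>y. (cmod (f y) - s)\<^sup>2 \<partial>M)" by simp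
  also have "\<dots> = (\<integral>y. (cmod (f y))\<^sup>2 + s\<^sup>2 - 2 * s * cmod (f y) \<partial>M)" by (simp add: power2_diff mult_ac)
  also have "\<dots> = (\<integral>y. (cmod (f y))\<^sup>2 \<partial>M) + s\<^sup>2 - 2 * s * s"
    using fi sq_int_integrable[OF f] by (simp add: s_def prob_space)
  finally have "s\<^sup>2 \<le> (\<integral>y. (cmod (f y))\<^sup>2 \<partial>M)" by (simp add: power2_eq_square)
  moreover have "cmod (\<integral>y. f y \<partial>M) \<le> s" unfolding s_def by (rule integral_norm_bound)
  ultimately show ?thesis by (meson norm_ge_zero order.trans power_mono)
qed

end

section \<open>The Koopman representation and its spectral gap\<close>

lemma countable_generate:
  assumes G: "group G" and S: "finite S" "S \<subseteq> carrier G"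
  shows "countable (generate G S)"
proof -
  interpret G: group G by (rule G)
  define A where "A = S \<union> (\<lambda>s. inv\<^bsub>G\<^esub> s) ` S"
  have A: "countable A" "A \<subseteq> carrier G" using S by (auto simp: A_def countable_finite)
  define w where "w xs = foldr (\<lambda>a b. a \<otimes>\<^bsub>G\<^esub> b) xs \<one>\<^bsub>G\<^esub>" for xs
  have wc: "w xs \<in> carrier G" if "set xs \<subseteq> A" for xs
    using that A by (induction xs) (auto simp: w_def)
  have wapp: "w (xs @ ys) = w xs \<otimes>\<^bsub>G\<^esub> w ys" if "set xs \<subseteq> A" "set ys \<subseteq> A" for xs ys
    using that(1)
  proof (induction xs)
    case Nil
    then show ?case using wc[OF that(2)] by (simp add: w_def)
  next
    case (Cons a xs)
    have "w (a # xs @ ys) = a \<otimes>\<^bsub>G\<^esub> w (xs @ ys)" by (simp add: w_def)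
    also have "\<dots> = a \<otimes>\<^bsub>G\<^esub> (w xs \<otimes>\<^bsub>G\<^esub> w ys)" using Cons by simp
    also have "\<dots> = a \<otimes>\<^bsub>G\<^esub> w xs \<otimes>\<^bsub>G\<^esub> w ys" using Cons A wc[OF that(2)] wc[of xs] by (subst G.m_assoc) auto
    also have "a \<otimes>\<^bsub>G\<^esub> w xs = w (a # xs)" by (simp add: w_def)
    finally show ?case by simp
  qed
  have "g \<in> w ` lists A" if "g \<in> generate G S" for g
    using that
  proof (induction rule: generate.induct)
    case one
    show ?case by (intro image_eqI[of _ _ "[]"]) (auto simp: w_def)
  next
    case (incl h)
    then show ?case using S by (intro image_eqI[of _ _ "[h]"]) (auto simp: w_def A_def subset_iff)
  next
    case (inv h)
    then show ?case using S by (intro image_eqI[of _ _ "[inv\<^bsub>G\<^esub> h]"]) (auto simp: w_def A_def subset_iff)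
  next
    case (eng g h)
    then obtain xs ys where "xs \<in> lists A" "ys \<in> lists A" "g = w xs" "h = w ys" by auto
    then show ?case using wapp[of xs ys] by (intro image_eqI[of _ _ "xs @ ys"]) (auto simp: lists_eq_set)
  qed
  then have "generate G S \<subseteq> w ` lists A" by blast
  moreover have "countable (w ` lists A)" using A by simp
  ultimately show ?thesis by (rule countable_subset)
qed

locale pmp_action = prob_space M + G: group G
  for M :: "'y measure" and G :: "('g, 'r) monoid_scheme" +
  fixes \<phi> :: "'g \<Rightarrow> 'y \<Rightarrow> 'y"
  assumes space_M: "space M = UNIV"
    and action: "group_action G UNIV \<phi>"
    and preserves: "preserves_measure G \<phi> M"
    and ergodic: "ergodic_action G \<phi> M"
    and countable: "countable (carrier G)"
begin

lemma \<phi>_measurable: "g \<in> carrier G \<Longrightarrow> \<phi> g \<in> measurable M M"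
  using preserves by (simp add: preserves_measure_def)

lemma \<phi>_distr: "g \<in> carrier G \<Longrightarrow> distr M M (\<phi> g) = M"
  using preserves by (simp add: preserves_measure_def)

lemma \<phi>_mult: "g \<in> carrier G \<Longrightarrow> h \<in> carrier G \<Longrightarrow> \<phi> (g \<otimes>\<^bsub>G\<^esub> h) y = \<phi> g (\<phi> h y)"
  by (rule group_action.composition_rule[OF action]) auto

lemma \<phi>_one: "\<phi> \<one>\<^bsub>G\<^esub> y = y"
  using group_action.id_eq_one[OF action] by (metis restrict_UNIV)

lemma \<phi>_inv: "g \<in> carrier G \<Longrightarrow> \<phi> (inv\<^bsub>G\<^esub> g) (\<phi> g y) = y" "g \<in> carrier G \<Longrightarrow> \<phi> g (\<phi> (inv\<^bsub>G\<^esub> g) y) = y"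
  using \<phi>_mult[of "inv\<^bsub>G\<^esub> g" g y] \<phi>_mult[of g "inv\<^bsub>G\<^esub> g" y] by (simp_all add: \<phi>_one)

lemma integral_\<phi>:
  fixes f :: "'y \<Rightarrow> 'b::{banach, second_countable_topology}"
  assumes g: "g \<in> carrier G" and f: "f \<in> borel_measurable M"
  shows "(\<integral>y. f (\<phi> g y) \<partial>M) = (\<integral>y. f y \<partial>M)"
  using integral_distr[OF \<phi>_measurable[OF g] f] by (simp add: \<phi>_distr[OF g])

lemma integrable_\<phi>:
  fixes f :: "'y \<Rightarrow> 'b::{banach, second_countable_topology}"
  assumes g: "g \<in> carrier G" and f: "integrable M f"
  shows "integrable M (\<lambda>y. f (\<phi> g y))"
  using integrable_distr[OF \<phi>_measurable[OF g], of f] f by (simp add: \<phi>_distr[OF g])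

text \<open>Ergodicity speaks of sets that are invariant on the nose. The points whose whole orbit
  lies in \<open>A\<close> form such a set, and it differs from \<open>A\<close> by a null set since
  the group is countable.\<close>

lemma invariant_set_trivial:
  assumes A: "A \<in> sets M" and inv: "\<And>g. g \<in> carrier G \<Longrightarrow> AE y in M. \<phi> g y \<in> A \<longleftrightarrow> y \<in> A"
  shows "(AE y in M. y \<in> A) \<or> (AE y in M. y \<notin> A)"
proof -
  define A' where "A' = {y. \<forall>g\<in>carrier G. \<phi> g y \<in> A}"
  have "A' = (\<Inter>g\<in>carrier G. \<phi> g -` A \<inter> space M)" by (auto simp: A'_def space_M)
  moreover have "(\<Inter>g\<in>carrier G. \<phi> g -` A \<inter> space M) \<in> sets M"
    by (rule sets.countable_INT''[OF _ countable, of M "\<lambda>g. \<phi> g -` A \<inter> space M"])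
       (use measurable_sets[OF \<phi>_measurable A] space_M sets.top[of M] in auto)
  ultimately have A's: "A' \<in> sets M" by simp
  have sub: "\<phi> g ` A' \<subseteq> A'" if g: "g \<in> carrier G" for g
    using g by (auto simp: A'_def simp flip: \<phi>_mult)
  have "\<phi> g ` A' = A'" if g: "g \<in> carrier G" for g
  proof
    show "A' \<subseteq> \<phi> g ` A'"
    proof
      fix y assume "y \<in> A'"
      then have "\<phi> (inv\<^bsub>G\<^esub> g) y \<in> A'" using sub[of "inv\<^bsub>G\<^esub> g"] g by auto
      then show "y \<in> \<phi> g ` A'" using \<phi>_inv(2)[OF g, of y] by (metis imageI)
    qed
  qed (rule sub[OF g])
  then have "measure M A' = 0 \<or> measure M (space M - A') = 0"
    using ergodic A's by (simp add: ergodic_action_def)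
  then have "emeasure M A' = 0 \<or> emeasure M (space M - A') = 0" by (simp add: emeasure_eq_measure)
  then have "(AE y in M. y \<notin> A') \<or> (AE y in M. y \<in> A')"
  proof
    assume "emeasure M A' = 0"
    then show ?thesis using AE_not_in[of A' M] A's by (simp add: null_sets_def)
  next
    assume "emeasure M (space M - A') = 0"
    then have "AE y in M. y \<notin> space M - A'" using AE_not_in[of "space M - A'" M] A's by (simp add: null_sets_def sets.compl_sets)
    then show ?thesis by (simp add: space_M)
  qed
  moreover have "AE y in M. y \<in> A' \<longleftrightarrow> y \<in> A"
  proof -
    have "AE y in M. \<forall>g\<in>carrier G. \<phi> g y \<in> A \<longleftrightarrow> y \<in> A"
      by (rule AE_ball_countable[OF countable, THEN iffD2]) (use inv in auto)
    then show ?thesis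
    proof eventually_elim
      case (elim y)
      then show ?case using G.one_closed by (auto simp: A'_def)
    qed
  qed
  ultimately show ?thesis
  proof (elim disjE)
    assume "AE y in M. y \<in> A' \<longleftrightarrow> y \<in> A" "AE y in M. y \<notin> A'"
    then have "AE y in M. y \<notin> A" by eventually_elim simp
    then show ?thesis ..
  next
    assume "AE y in M. y \<in> A' \<longleftrightarrow> y \<in> A" "AE y in M. y \<in> A'"
    then have "AE y in M. y \<in> A" by eventually_elim simp
    then show ?thesis ..
  qed
qed

text \<open>The sublevel sets of \<open>f\<close> have measure \<open>0\<close> or \<open>1\<close>,
  and the mean value of \<open>f\<close> tells which.\<close>

lemma invariant_function_constant:
  fixes f :: "'y \<Rightarrow> real"
  assumes f: "integrable M f" and inv: "\<And>g. g \<in> carrier G \<Longrightarrow> AE y in M. f (\<phi> g y) = f y"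
  shows "AE y in M. f y = (\<integral>y. f y \<partial>M)"
proof -
  have [measurable]: "f \<in> borel_measurable M" using f by auto
  define E where "E = (\<integral>y. f y \<partial>M)"
  have triv: "(AE y in M. f y < q) \<or> (AE y in M. q \<le> f y)" for q
  proof -
    have "{y. f y < q} = {y \<in> space M. f y < q}" by (simp add: space_M)
    also have "\<dots> \<in> sets M" by measurable
    finally have "{y. f y < q} \<in> sets M" .
    then have "(AE y in M. y \<in> {y. f y < q}) \<or> (AE y in M. y \<notin> {y. f y < q})"
    proof (rule invariant_set_trivial)
      fix g assume "g \<in> carrier G"
      from inv[OF this] show "AE y in M. \<phi> g y \<in> {y. f y < q} \<longleftrightarrow> y \<in> {y. f y < q}" by eventually_elim simp
    qed
    then show ?thesis by (simp add: not_less)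
  qed
  have upper: "E \<le> q" if "AE y in M. f y \<le> q" for q
    using integral_mono_AE[OF f integrable_const[of q] that] by (simp add: E_def prob_space)
  have lower: "q \<le> E" if "AE y in M. q \<le> f y" for q
    using integral_mono_AE[OF integrable_const[of q] f that] by (simp add: E_def prob_space)
  have lo: "AE y in M. E - 1 / real (Suc n) \<le> f y" for n
  proof -
    have "\<not> (AE y in M. f y < E - 1 / real (Suc n))"
    proof
      assume "AE y in M. f y < E - 1 / real (Suc n)"
      then have "AE y in M. f y \<le> E - 1 / real (Suc n)" by eventually_elim simp
      from upper[OF this] have "1 / real (Suc n) \<le> 0" by linarith
      moreover have "1 / real (Suc n) > 0" by simp
      ultimately show False by linarith
    qed
    then show ?thesis using triv by blast
  qed
  have hi: "AE y in M. f y < E + 1 / real (Suc n)" for n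
  proof -
    have "\<not> (AE y in M. E + 1 / real (Suc n) \<le> f y)"
    proof
      assume "AE y in M. E + 1 / real (Suc n) \<le> f y"
      from lower[OF this] have "1 / real (Suc n) \<le> 0" by linarith
      moreover have "1 / real (Suc n) > 0" by simp
      ultimately show False by linarith
    qed
    then show ?thesis using triv by blast
  qed
  have "AE y in M. \<forall>n. E - 1 / real (Suc n) \<le> f y \<and> f y < E + 1 / real (Suc n)"
    unfolding AE_all_countable using lo hi by (auto intro: AE_conjI)
  then show ?thesis
  proof eventually_elim
    case (elim y)
    have l: "(\<lambda>n. 1 / real (Suc n)) \<longlonglongrightarrow> 0" by (rule LIMSEQ_Suc[OF lim_1_over_n])
    have "(\<lambda>n. E - 1 / real (Suc n)) \<longlonglongrightarrow> E - 0" "(\<lambda>n. E + 1 / real (Suc n)) \<longlonglongrightarrow> E + 0"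
      by (intro tendsto_intros l)+
    moreover have "\<exists>n0. \<forall>n\<ge>n0. E - 1 / real (Suc n) \<le> f y" "\<exists>n0. \<forall>n\<ge>n0. f y \<le> E + 1 / real (Suc n)"
      using elim by (blast intro: less_imp_le)+
    ultimately have "E - 0 \<le> f y" "f y \<le> E + 0"
      using LIMSEQ_le_const2[of _ "E - 0" "f y"] LIMSEQ_le_const[of _ "E + 0" "f y"] by blast+
    then show ?case by (simp add: E_def)
  qed
qed

definition koopman :: "'g \<Rightarrow> ('y \<Rightarrow> nat \<Rightarrow> complex) \<Rightarrow> 'y \<Rightarrow> nat \<Rightarrow> complex" where
  "koopman g h = (\<lambda>y. h (\<phi> (inv\<^bsub>G\<^esub> g) y))"

definition mean :: "('y \<Rightarrow> nat \<Rightarrow> complex) \<Rightarrow> 'y \<Rightarrow> nat \<Rightarrow> complex" where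
  "mean h = (\<lambda>_ j. \<integral>y. h y j \<partial>M)"

lemma koopman_in:
  assumes "g \<in> carrier G" "h \<in> L2 M k"
  shows "koopman g h \<in> L2 M k"
proof -
  have "sq_int M (\<lambda>y. h (\<phi> (inv\<^bsub>G\<^esub> g) y) j)" if "j < k" for j
    using measurable_compose[OF \<phi>_measurable[OF G.inv_closed[OF assms(1)]] sq_int_measurable[OF L2D(1)[OF assms(2) that]]]
      integrable_\<phi>[OF G.inv_closed[OF assms(1)] sq_int_integrable[OF L2D(1)[OF assms(2) that]]]
    by (simp add: sq_int_def)
  then show ?thesis using assms(2) by (auto simp: koopman_def L2_def)
qed

lemma L2_span_norm_koopman:
  assumes "g \<in> carrier G" "h \<in> L2 M k"
  shows "L2_span_norm M v k (koopman g h) = L2_span_norm M v k h"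
proof -
  have "(\<lambda>y. (norm (lincomb v k (h y)))\<^sup>2) \<in> borel_measurable M"
    using norm_lincomb_measurable[OF assms(2), of v] by measurable
  then show ?thesis
    using integral_\<phi>[OF G.inv_closed[OF assms(1)], of "\<lambda>y. (norm (lincomb v k (h y)))\<^sup>2"]
    by (simp add: L2_span_norm_def koopman_def)
qed

lemma mean_in: "h \<in> L2 M k \<Longrightarrow> mean h \<in> L2 M k"
  by (auto simp: mean_def L2_def sq_int_const)

text \<open>Ergodicity, in the form of the constancy of invariant functions, identifies the
  invariant vectors. The mean is bounded for the norm at hand because it is a contraction of the
  Hilbert space.\<close>

lemma koopman_system:
  fixes v :: "nat \<Rightarrow> 'x::real_normed_vector"
  assumes J: "cx_hilbert_code (L2 M k) (L2_ip M k) L2_I L2_K J"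
    and good: "cx_hilbert.good_norm (L2 M k) (L2_ip M k) L2_I L2_K C \<beta> (cx_hilbert.circle_sup L2_I (L2_span_norm M v k))"
    and k: "0 < k"
  shows "\<exists>D. equivariant_system (L2 M k) (L2_ip M k) L2_I L2_K J C \<beta> (cx_hilbert.circle_sup L2_I (L2_span_norm M v k)) G koopman mean D
    (\<lambda>y j. if j = 0 then 1 else 0)"
proof -
  interpret cx_hilbert_code "L2 M k" "L2_ip M k" L2_I L2_K J by (rule J)
  define N where "N = circle_sup (L2_span_norm M v k)"
  have gN: "good_norm C \<beta> N" using good by (simp add: N_def)
  then have N: "cx_norm N" by (simp add: good_norm_def)
  obtain c where c: "c > 0" "\<And>x. x \<in> L2 M k \<Longrightarrow> c * hnorm x \<le> N x" using N unfolding cx_norm_def by blast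
  obtain d where d: "\<And>x. x \<in> L2 M k \<Longrightarrow> N x \<le> d * hnorm x" using N unfolding cx_norm_def by blast
  have fixed: "N (x - mean x) = 0" if x: "x \<in> L2 M k" and inv: "\<And>g. g \<in> carrier G \<Longrightarrow> N (koopman g x - x) = 0" for x
  proof -
    have AEk: "AE y in M. x (\<phi> g y) j = x y j" if g: "g \<in> carrier G" and j: "j < k" for g j
    proof -
      define g' where "g' = inv\<^bsub>G\<^esub> g"
      have g': "g' \<in> carrier G" "inv\<^bsub>G\<^esub> g' = g" using g by (auto simp: g'_def)
      have in2: "koopman g' x - x \<in> L2 M k" using koopman_in[OF g'(1) x] x by simp
      have "hnorm (koopman g' x - x) = 0" using inv[OF g'(1)] cx_norm_zero_iff[OF N in2] by simp
      then have "(\<Sum>j<k. \<integral>y. (cmod ((koopman g' x - x) y j))\<^sup>2 \<partial>M) = 0" by (simp add: hnorm_def L2_ip_self)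
      then have "(\<integral>y. (cmod ((koopman g' x - x) y j))\<^sup>2 \<partial>M) = 0" using j by (simp add: sum_nonneg_eq_0_iff)
      then have "AE y in M. (cmod ((koopman g' x - x) y j))\<^sup>2 = 0"
        by (subst (asm) integral_nonneg_eq_0_iff_AE[OF sq_int_integrable[OF L2D(1)[OF in2 j]]]) auto
      then show ?thesis by eventually_elim (simp add: koopman_def g')
    qed
    have "AE y in M. x y j = (\<integral>y. x y j \<partial>M)" if j: "j < k" for j
    proof -
      have xi: "integrable M (\<lambda>y. x y j)" by (rule sq_int_imp_integrable[OF L2D(1)[OF x j]])
      have "AE y in M. Re (x y j) = (\<integral>y. Re (x y j) \<partial>M)"
      proof (rule invariant_function_constant)
        fix g assume "g \<in> carrier G"
        from AEk[OF this j] show "AE y in M. Re (x (\<phi> g y) j) = Re (x y j)" by eventually_elim simp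
      qed (use xi in simp)
      moreover have "AE y in M. Im (x y j) = (\<integral>y. Im (x y j) \<partial>M)"
      proof (rule invariant_function_constant)
        fix g assume "g \<in> carrier G"
        from AEk[OF this j] show "AE y in M. Im (x (\<phi> g y) j) = Im (x y j)" by eventually_elim simp
      qed (use xi in simp)
      ultimately show ?thesis by eventually_elim (simp add: complex_eq_iff xi)
    qed
    then have "(\<integral>y. (cmod ((x - mean x) y j))\<^sup>2 \<partial>M) = 0" if "j < k" for j
      using that by (intro integral_eq_zero_AE) (auto simp: mean_def elim!: eventually_mono)
    then have "hnorm (x - mean x) = 0" by (simp add: hnorm_def L2_ip_self)
    then show ?thesis using cx_norm_zero_iff[OF N, of "x - mean x"] x mean_in by simp
  qed
  have meas: "(\<lambda>y. x y j) \<in> borel_measurable M" if "x \<in> L2 M k" "j < k" for x j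
    using L2D(1)[OF that] by (simp add: sq_int_def)
  have e: "(\<lambda>y j. if j = 0 then 1 else 0) \<in> L2 M k" using k by (auto simp: L2_def sq_int_const)
  have "hnorm (\<lambda>y j. if j = 0 then 1 else 0) = 1"
  proof -
    have "(\<Sum>j<k. \<integral>y. (cmod (if j = 0 then 1 else 0))\<^sup>2 \<partial>M) = (\<Sum>j<k. if j = 0 then 1 else 0)"
      by (rule sum.cong) (auto simp: prob_space)
    then show ?thesis using k by (simp add: hnorm_def L2_ip_self)
  qed
  then have epos: "0 < N (\<lambda>y j. if j = 0 then 1 else 0)" using c(2)[OF e] c(1) by simp
  have "equivariant_system (L2 M k) (L2_ip M k) L2_I L2_K J C \<beta> N G koopman mean (\<bar>d\<bar> / c) (\<lambda>y j. if j = 0 then 1 else 0)"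
  proof (intro equivariant_system.intro J equivariant_system_axioms.intro gN G.group_axioms fixed e epos)
    show "koopman g x \<in> L2 M k" if "g \<in> carrier G" "x \<in> L2 M k" for g x by (rule koopman_in[OF that])
    show "koopman g (x + y) = koopman g x + koopman g y" for g x y by (auto simp: koopman_def fun_eq_iff)
    show "koopman g (a *\<^sub>R x) = a *\<^sub>R koopman g x" for g a x by (auto simp: koopman_def scaleR_fun_def)
    show kI: "koopman g (L2_I x) = L2_I (koopman g x)" for g x by (simp add: koopman_def L2_I_def)
    show "koopman (g \<otimes>\<^bsub>G\<^esub> h) x = koopman g (koopman h x)" if "g \<in> carrier G" "h \<in> carrier G" for g h x
      using that by (simp add: koopman_def G.inv_mult_group \<phi>_mult)
    show "koopman \<one>\<^bsub>G\<^esub> x = x" for x by (simp add: koopman_def \<phi>_one)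
    show "N (koopman g x) = N x" if g: "g \<in> carrier G" and x: "x \<in> L2 M k" for g x
    proof -
      have "L2_span_norm M v k (a *\<^sub>R koopman g x + b *\<^sub>R L2_I (koopman g x)) = L2_span_norm M v k (a *\<^sub>R x + b *\<^sub>R L2_I x)" for a b
      proof -
        have "a *\<^sub>R koopman g x + b *\<^sub>R L2_I (koopman g x) = koopman g (a *\<^sub>R x + b *\<^sub>R L2_I x)"
          by (auto simp: koopman_def L2_I_def scaleR_fun_def fun_eq_iff)
        then show ?thesis using L2_span_norm_koopman[OF g, of "a *\<^sub>R x + b *\<^sub>R L2_I x" k v] x by simp
      qed
      then show ?thesis unfolding N_def circle_sup_def by presburger
    qed
    show "mean x \<in> L2 M k" if "x \<in> L2 M k" for x by (rule mean_in[OF that])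
    show "mean (x + y) = mean x + mean y" if "x \<in> L2 M k" "y \<in> L2 M k" for x y
    proof (intro ext)
      fix u j
      show "mean (x + y) u j = (mean x + mean y) u j"
        using that sq_int_imp_integrable[OF L2D(1)[OF that(1)]] sq_int_imp_integrable[OF L2D(1)[OF that(2)]] L2D(2)[OF that(1)] L2D(2)[OF that(2)]
        by (cases "j < k") (simp_all add: mean_def)
    qed
    show "mean (a *\<^sub>R x) = a *\<^sub>R mean x" for a x by (simp add: mean_def scaleR_fun_def)
    show "mean (L2_I x) = L2_I (mean x)" for x by (simp add: mean_def L2_I_def)
    show "mean (koopman g x) = mean x" if "g \<in> carrier G" "x \<in> L2 M k" for g x
    proof (intro ext)
      fix u j
      show "mean (koopman g x) u j = mean x u j"
        using integral_\<phi>[OF G.inv_closed[OF that(1)] meas[OF that(2)]] L2D(2)[OF that(2)]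
        by (cases "j < k") (simp_all add: mean_def koopman_def)
    qed
    show "N (mean x) \<le> \<bar>d\<bar> / c * N x" if x: "x \<in> L2 M k" for x
    proof -
      have "L2_ip M k (mean x) (mean x) \<le> L2_ip M k x x"
        unfolding L2_ip_self
        by (rule sum_mono) (use norm_mean_sq_le[OF L2D(1)[OF x]] in \<open>simp add: mean_def prob_space\<close>)
      then have "hnorm (mean x) \<le> hnorm x" by (simp add: hnorm_def)
      moreover have "N (mean x) \<le> d * hnorm (mean x)" by (rule d[OF mean_in[OF x]])
      moreover have "d * hnorm (mean x) \<le> \<bar>d\<bar> * hnorm (mean x)"
        by (rule mult_right_mono) (use hnorm_nonneg[OF mean_in[OF x]] in auto)
      moreover have "\<bar>d\<bar> * hnorm (mean x) \<le> \<bar>d\<bar> * hnorm x" using \<open>hnorm (mean x) \<le> hnorm x\<close> by (intro mult_left_mono) auto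
      moreover have "\<bar>d\<bar> * hnorm x \<le> \<bar>d\<bar> * (N x / c)"
        using c(2)[OF x] c(1) by (intro mult_left_mono) (auto simp: field_simps)
      ultimately show ?thesis by simp
    qed
    show "koopman g (\<lambda>y j. if j = 0 then 1 else 0) = (\<lambda>y j. if j = 0 then 1 else 0)" for g
      by (simp add: koopman_def)
  qed
  then show ?thesis unfolding N_def by blast
qed

end

text \<open>The values of \<open>g\<close> span a finite-dimensional space with a basis
  \<open>v\<close>, and \<open>g\<close> is given by its coordinates. The norm of
  \<open>L\<^sup>2\<close> functions with values in this span, once complexified, is good for
  constants \<open>C\<close> and \<open>\<beta> < 1\<close> that depend on \<open>X\<close> alone,
  and so the gap of the class applies with a uniform constant.\<close>

theorem spectral_gap:
  fixes M :: "'y::metric_space measure" and G :: "('g, 'r) monoid_scheme"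
  assumes comp: "compact (UNIV :: 'y set)" and act: "pmp_action M G \<phi>" and M: "sets M = sets borel"
    and S: "finite S" "S \<subseteq> carrier G" "\<forall>s\<in>S. inv\<^bsub>G\<^esub> s \<in> S" "generate G S = carrier G"
    and u: "\<exists>\<iota> :: real \<Rightarrow> 'u. inj \<iota>" and T: "banach_property_T TYPE('u) G"
    and ty: "nontrivial_type TYPE('x::banach)"
  shows "\<exists>\<kappa>\<ge>0. \<forall>g :: 'y \<Rightarrow> 'x. simple_function M g \<longrightarrow>
    (\<exists>c. (\<integral>y. (norm (g y - c))\<^sup>2 \<partial>M) \<le> \<kappa> * (\<Sum>s\<in>S. \<integral>y. (norm (g y - g (\<phi> s y)))\<^sup>2 \<partial>M))"
proof -
  interpret pmp_action M G \<phi> by (rule act)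
  obtain p T where p: "p > 1" "rademacher_type TYPE('x) p T" using ty by (auto simp: nontrivial_type_def)
  \<comment> \<open>Complexification multiplies the factor by \<open>4\<close>, so \<open>1 / 8\<close>
    leaves \<open>1 / 2\<close>. With \<open>n \<ge> 2\<close> the bound \<open>n / 2\<close> is at
    least \<open>1\<close>, and its logarithm to base \<open>n\<close> is a nonnegative exponent
    less than \<open>1\<close>.\<close>
  obtain n0 where n0: "\<And>n. n \<ge> n0 \<Longrightarrow> rad_bound (norm :: 'x \<Rightarrow> real) UNIV n (1 / 8 * real n)"
    using rad_bound_of_type[OF p(2,1), of "1 / 8"] by auto
  define n where "n = max n0 2"
  have n: "n \<ge> n0" "n \<ge> 2" by (auto simp: n_def)
  define C where "C = max (1 / 2 * real n) (1 / 2 * real (2 ^ n))"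
  define \<beta> where "\<beta> = max (log (real n) (1 / 2 * real n)) (log (real (2 ^ n)) (1 / 2 * real (2 ^ n)))"
  have b0: "rad_bound (norm :: 'x \<Rightarrow> real) UNIV n (1 / 8 * real n)" by (rule n0[OF n(1)])
  have lg: "0 \<le> log a (1 / 2 * a) \<and> log a (1 / 2 * a) < 1" if "a \<ge> 2" for a :: real
  proof
    show "0 \<le> log a (1 / 2 * a)" using that by simp
    have "log a (1 / 2 * a) < log a a" using that by (subst log_less_cancel_iff) auto
    then show "log a (1 / 2 * a) < 1" using that by simp
  qed
  have "(2::real) ^ 1 \<le> 2 ^ n" using n by (intro power_increasing) auto
  then have lg2: "0 \<le> log (real (2 ^ n)) (1 / 2 * real (2 ^ n))" "log (real (2 ^ n)) (1 / 2 * real (2 ^ n)) < 1"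
    using lg[of "real (2 ^ n)"] by simp_all
  have lg1: "0 \<le> log (real n) (1 / 2 * real n)" "log (real n) (1 / 2 * real n) < 1"
    using lg[of "real n"] n by simp_all
  have C0: "0 \<le> C" by (simp add: C_def le_max_iff_disj)
  have \<beta>: "0 \<le> \<beta>" "\<beta> < 1"
    unfolding \<beta>_def le_max_iff_disj max_less_iff_conj using lg1 lg2 by blast+
  from property_T_gap[OF T C0 \<beta> G.group_axioms S(1,2,4), where ?'f = "'y \<Rightarrow> nat \<Rightarrow> complex"]
  obtain \<kappa> where \<kappa>: "\<kappa> \<ge> 0" and gap0: "\<forall>(H :: ('y \<Rightarrow> nat \<Rightarrow> complex) set) ip I K (J :: _ \<Rightarrow> 'u) N \<rho> m D e.
    equivariant_system H ip I K J C \<beta> N G \<rho> m D e \<longrightarrow>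
    (\<forall>x\<in>H. N (m x) = 0 \<longrightarrow> N x \<le> \<kappa> * (\<Sum>s\<in>S. N (x - \<rho> s x)))" by (elim exE conjE)
  note gap = gap0[rule_format]
  have "\<exists>c. (\<integral>y. (norm (g y - c))\<^sup>2 \<partial>M) \<le> \<kappa>\<^sup>2 * real (card S) * (\<Sum>s\<in>S. \<integral>y. (norm (g y - g (\<phi> s y)))\<^sup>2 \<partial>M)"
    if g: "simple_function M g" for g :: "'y \<Rightarrow> 'x"
  proof -
    obtain B where B: "B \<subseteq> range g" "independent B" "range g \<subseteq> span B"
      by (rule basis_exists[of "range g"])
    have "finite (range g)" using simple_functionD(1)[OF g] by (simp add: space_M)
    then have fB: "finite B" using B(1) finite_subset by blast
    obtain v where v: "bij_betw v {..<card B} B" using ex_bij_betw_nat_finite[OF fB] by (auto simp: atLeast0LessThan)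
    define k where "k = card B"
    define a where "a j y = representation B (g y) (v j)" for j y
    have ga: "g y = (\<Sum>j<k. a j y *\<^sub>R v j)" for y
    proof -
      have "g y = (\<Sum>b\<in>B. representation B (g y) b *\<^sub>R b)"
        by (rule real_vector.sum_representation_eq[symmetric]) (use B fB in auto)
      also have "\<dots> = (\<Sum>j<k. a j y *\<^sub>R v j)"
        unfolding a_def k_def
        by (rule sum.reindex_bij_betw[OF v, of "\<lambda>b. representation B (g y) b *\<^sub>R b", symmetric])
      finally show ?thesis .
    qed
    show ?thesis
    proof (cases "k = 0")
      case True
      then have "g y = 0" for y using ga by simp
      then show ?thesis by (intro exI[of _ 0]) simp
    next
      case False
      obtain J where J: "cx_hilbert_code (L2 M k) (L2_ip M k) L2_I L2_K (J :: _ \<Rightarrow> 'u)"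
        using L2_code_exists[OF comp prob_space_axioms M u] by blast
      interpret L: cx_hilbert_code "L2 M k" "L2_ip M k" L2_I L2_K J by (rule J)
      define N0 where "N0 = L2_span_norm M v k"
      have sN0: "seminorm_on (L2 M k) N0" unfolding N0_def by (rule L2_span_norm_seminorm)
      obtain \<delta> where \<delta>: "\<delta> > 0" "\<And>a. \<delta>\<^sup>2 * (\<Sum>j<k. (a j)\<^sup>2) \<le> (norm (\<Sum>j<k. a j *\<^sub>R v j))\<^sup>2"
        using independent_norm_lower_bound[of v k] v B(2) by (auto simp: k_def bij_betw_def)
      have N: "L.cx_norm (L.circle_sup N0)"
        by (rule L.circle_sup_cx_norm[OF sN0 \<delta>(1), where d = "sqrt (\<Sum>j<k. (norm (v j))\<^sup>2)"])
           (use L2_span_norm_lower[OF _ \<delta>] L2_span_norm_upper in \<open>auto simp: N0_def L.hnorm_def\<close>)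
      have "rad_bound (L.circle_sup N0) (L2 M k) n (4 * (1 / 8 * real n))"
        by (rule L.circle_sup_rad_bound[OF sN0]) (use L2_span_norm_rad_bound[OF b0] in \<open>auto simp: N0_def\<close>)
      then have "rad_bound (L.circle_sup N0) (L2 M k) n (1 / 2 * real n)" by simp
      then have good: "L.good_norm C \<beta> (L.circle_sup N0)"
        by (rule L.good_norm_of_bound[OF N]) (use n in \<open>auto simp: C_def \<beta>_def\<close>)
      obtain D where sys: "equivariant_system (L2 M k) (L2_ip M k) L2_I L2_K J C \<beta> (L.circle_sup N0) G koopman mean D
          (\<lambda>y j. if j = 0 then 1 else 0)"
        using koopman_system[OF J good[unfolded N0_def]] False unfolding N0_def by blast
      have asf: "simple_function M (\<lambda>y. a j y)" for j
        unfolding a_def by (rule simple_function_compose1[OF g, of "\<lambda>z. representation B z (v j)"])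
      have asq: "sq_int M (\<lambda>y. complex_of_real (a j y))" for j
      proof -
        have [measurable]: "a j \<in> borel_measurable M" using borel_measurable_simple_function[OF asf] .
        have "finite (a j ` space M)" by (rule simple_functionD(1)[OF asf])
        then obtain b where b: "\<And>y. y \<in> space M \<Longrightarrow> \<bar>a j y\<bar> \<le> b"
          using finite_imp_bounded[of "a j ` space M"] by (auto simp: bounded_iff)
        have "integrable M (\<lambda>y. (cmod (complex_of_real (a j y)))\<^sup>2)"
        proof (rule integrable_const_bound[of _ "b\<^sup>2"])
          have "(a j y)\<^sup>2 \<le> b\<^sup>2" if "y \<in> space M" for y
            using power_mono[OF b[OF that], of 2] by simp
          then show "AE y in M. norm ((cmod (complex_of_real (a j y)))\<^sup>2) \<le> b\<^sup>2" by (intro AE_I2) simp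
        qed measurable
        then show ?thesis by (simp add: sq_int_def)
      qed
      \<comment> \<open>The coordinates of \<open>g\<close>, made to have mean zero.\<close>
      define x where "x = (\<lambda>y j. if j < k then complex_of_real (a j y - (\<integral>y. a j y \<partial>M)) else 0)"
      have ai: "integrable M (a j)" for j
        using sq_int_imp_integrable[OF asq[of j]] by (simp add: complex_of_real_integrable_eq)
      have x: "x \<in> L2 M k"
        using sq_int_diff[OF asq sq_int_const] by (auto simp: x_def L2_def)
      have "(\<integral>y. x y j \<partial>M) = 0" for j
      proof (cases "j < k")
        case True
        have "(\<integral>y. x y j \<partial>M) = complex_of_real (\<integral>y. a j y - (\<integral>y. a j y \<partial>M) \<partial>M)"
          unfolding x_def using True by (simp only: if_True integral_complex_of_real)
        also have "(\<integral>y. a j y - (\<integral>y. a j y \<partial>M) \<partial>M) = 0" using ai[of j] by (simp add: prob_space)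
        finally show ?thesis by simp
      qed (simp add: x_def)
      then have "mean x = 0" by (simp add: mean_def fun_eq_iff)
      then have mz: "L.circle_sup N0 (mean x) = 0" using seminorm_on_zero[OF L.cx_norm_seminorm[OF N]] by simp
      have "L.circle_sup N0 x \<le> \<kappa> * (\<Sum>s\<in>S. L.circle_sup N0 (x - koopman s x))" by (rule gap[OF sys x mz])
      moreover have "N0 x \<le> L.circle_sup N0 x" by (rule L.circle_sup_ge(1)[OF sN0 x])
      \<comment> \<open>The coordinates are real, so passing to the complexification does not increase the
        norm.\<close>
      moreover have "L.circle_sup N0 (x - koopman s x) \<le> N0 (x - koopman s x)" if "s \<in> S" for s
      proof -
        have in2: "x - koopman s x \<in> L2 M k" using koopman_in[OF _ x] that S x by auto
        have "lincomb v k (L2_I (x - koopman s x) y) = 0" for y by (simp add: lincomb_def L2_I_def x_def koopman_def)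
        then have "N0 (L2_I (x - koopman s x)) = 0" by (simp add: N0_def L2_span_norm_def)
        then show ?thesis using L.circle_sup_le[OF sN0 in2] by simp
      qed
      ultimately have main: "N0 x \<le> \<kappa> * (\<Sum>s\<in>S. N0 (x - koopman s x))"
        using \<kappa> by (meson mult_left_mono order.trans sum_mono)
      define c where "c = (\<Sum>j<k. (\<integral>y. a j y \<partial>M) *\<^sub>R v j)"
      have "lincomb v k (x y) = g y - c" for y
        by (simp add: lincomb_def x_def ga c_def scaleR_diff_left sum_subtractf)
      then have Nx: "(N0 x)\<^sup>2 = (\<integral>y. (norm (g y - c))\<^sup>2 \<partial>M)" by (simp add: N0_def L2_span_norm_def)
      have Ns: "(N0 (x - koopman s x))\<^sup>2 = (\<integral>y. (norm (g y - g (\<phi> (inv\<^bsub>G\<^esub> s) y)))\<^sup>2 \<partial>M)" for s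
      proof -
        have "lincomb v k ((x - koopman s x) y) = g y - g (\<phi> (inv\<^bsub>G\<^esub> s) y)" for y
          by (simp add: lincomb_def x_def koopman_def ga scaleR_diff_left flip: sum_subtractf)
        then show ?thesis by (simp add: N0_def L2_span_norm_def)
      qed
      have nn: "0 \<le> N0 h" for h by (simp add: N0_def L2_span_norm_def)
      have "(N0 x)\<^sup>2 \<le> (\<kappa> * (\<Sum>s\<in>S. N0 (x - koopman s x)))\<^sup>2" by (rule power_mono[OF main nn])
      also have "\<dots> = \<kappa>\<^sup>2 * (\<Sum>s\<in>S. 1 * N0 (x - koopman s x))\<^sup>2" by (simp add: power_mult_distrib)
      also have "\<dots> \<le> \<kappa>\<^sup>2 * ((\<Sum>s\<in>S. 1\<^sup>2) * (\<Sum>s\<in>S. (N0 (x - koopman s x))\<^sup>2))"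
        by (intro mult_left_mono Cauchy_Schwarz_ineq_sum) auto
      also have "(\<Sum>s\<in>S. (N0 (x - koopman s x))\<^sup>2) = (\<Sum>s\<in>S. \<integral>y. (norm (g y - g (\<phi> s y)))\<^sup>2 \<partial>M)"
        unfolding Ns
        by (rule sum.reindex_bij_witness[where i = "\<lambda>s. inv\<^bsub>G\<^esub> s" and j = "\<lambda>s. inv\<^bsub>G\<^esub> s"])
           (use S in \<open>auto simp: subset_iff\<close>)
      finally have "(N0 x)\<^sup>2 \<le> \<kappa>\<^sup>2 * real (card S) * (\<Sum>s\<in>S. \<integral>y. (norm (g y - g (\<phi> s y)))\<^sup>2 \<partial>M)" by simp
      then show ?thesis unfolding Nx by blast
    qed
  qed
  then show ?thesis by (intro exI[of _ "\<kappa>\<^sup>2 * real (card S)"]) auto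
qed


section \<open>Warped balls\<close>

text \<open>A path in the warped cone and its cost \<open>r\<close>. The warped distance is at least
  the infimum of these costs, which turns upper bounds for it into explicit paths.\<close>

inductive chain :: "('g \<Rightarrow> 'y::metric_space \<Rightarrow> 'y) \<Rightarrow> 'g set \<Rightarrow> real \<Rightarrow> 'y \<Rightarrow> 'y \<Rightarrow> real \<Rightarrow> bool"
  for \<phi> S t x where
  stay: "chain \<phi> S t x x 0"
| move: "chain \<phi> S t x y r \<Longrightarrow> chain \<phi> S t x z (r + t * dist y z)"
| jump: "chain \<phi> S t x y r \<Longrightarrow> s \<in> S \<Longrightarrow> chain \<phi> S t x (\<phi> s y) (r + 1)"

lemma chain_nonneg: "chain \<phi> S t x y r \<Longrightarrow> 0 < t \<Longrightarrow> 0 \<le> r"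
  by (induction rule: chain.induct) auto

lemma chain_trans:
  assumes "chain \<phi> S t y z q" "chain \<phi> S t x y r"
  shows "chain \<phi> S t x z (r + q)"
  using assms
proof (induction rule: chain.induct)
  case stay
  then show ?case by simp
next
  case (move y' q' z)
  then show ?case using chain.move[of \<phi> S t x y' "r + q'" z] by (simp add: add.assoc)
next
  case (jump y' q' s)
  then show ?case using chain.jump[of \<phi> S t x y' "r + q'" s] by (simp add: add.assoc)
qed

lemma chain_direct: "chain \<phi> S t x y (t * dist x y)"
  using chain.move[OF chain.stay, of \<phi> S t x y] by simp

lemma chain_sym:
  assumes "chain \<phi> S t x y r" and inv: "\<And>s y. s \<in> S \<Longrightarrow> \<exists>s'\<in>S. \<phi> s' (\<phi> s y) = y"
  shows "chain \<phi> S t y x r"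
  using assms(1)
proof (induction rule: chain.induct)
  case stay
  show ?case by (rule chain.stay)
next
  case (move y r z)
  have "chain \<phi> S t z y (t * dist y z)" using chain_direct[of \<phi> S t z y] by (simp add: dist_commute)
  from chain_trans[OF move.IH this] show ?case by (simp add: add.commute)
next
  case (jump y r s)
  obtain s' where s': "s' \<in> S" "\<phi> s' (\<phi> s y) = y" using inv[OF jump.hyps(2)] by blast
  have "chain \<phi> S t (\<phi> s y) y 1"
    using chain.jump[OF chain.stay s'(1), of \<phi> t "\<phi> s y"] s'(2) by simp
  from chain_trans[OF jump.IH this] show ?case by (simp add: add.commute)
qed

text \<open>The infimum of the costs of chains obeys both conditions on the warped metric and is
  symmetric and subadditive. The maximum with \<open>min (t * dist x y) 1\<close>, which is a metric
  under both bounds, separates points. So it is an admissible metric, and the warped distance is at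
  least the infimum.\<close>

lemma chain_of_warped_dist:
  fixes \<phi> :: "'g \<Rightarrow> 'y::metric_space \<Rightarrow> 'y"
  assumes t: "0 < t" and inv: "\<And>s y. s \<in> S \<Longrightarrow> \<exists>s'\<in>S. \<phi> s' (\<phi> s y) = y"
    and less: "warped_dist \<phi> S t x y < B"
  shows "\<exists>r<B. chain \<phi> S t x y r"
proof -
  define D where "D u v = Inf {r. chain \<phi> S t u v r}" for u v
  define D0 where "D0 u v = min (t * dist u v) 1" for u v :: 'y
  have bdd: "bdd_below {r. chain \<phi> S t u v r}" for u v
    by (rule bdd_belowI[of _ 0]) (use chain_nonneg t in auto)
  have ne: "{r. chain \<phi> S t u v r} \<noteq> {}" for u v using chain_direct by blast
  have le: "D u v \<le> r" if "chain \<phi> S t u v r" for u v r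
    unfolding D_def by (rule cInf_lower) (use that bdd in auto)
  have nn: "0 \<le> D u v" for u v
    unfolding D_def by (rule cInf_greatest[OF ne]) (use chain_nonneg t in auto)
  have sym: "D u v = D v u" for u v
  proof -
    have "{r. chain \<phi> S t u v r} = {r. chain \<phi> S t v u r}" using chain_sym[OF _ inv] by blast
    then show ?thesis by (simp add: D_def)
  qed
  have approx: "\<exists>r. chain \<phi> S t u v r \<and> r < D u v + e" if "e > 0" for u v e
    using cInf_lessD[OF ne, of u v "D u v + e"] that by (auto simp: D_def)
  have tri: "D u w \<le> D u v + D v w" for u v w
  proof (rule field_le_epsilon)
    fix e :: real assume e: "0 < e"
    obtain r q where r: "chain \<phi> S t u v r" "r < D u v + e / 2" and q: "chain \<phi> S t v w q" "q < D v w + e / 2"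
      using approx[of "e / 2" u v] approx[of "e / 2" v w] e by auto
    have "D u w \<le> r + q" by (rule le[OF chain_trans[OF q(1) r(1)]])
    also have "\<dots> \<le> (D u v + e / 2) + (D v w + e / 2)" using r(2) q(2) by simp
    finally show "D u w \<le> D u v + D v w + e" by simp
  qed
  have D0tri: "D0 u w \<le> D0 u v + D0 v w" for u v w
  proof -
    have "t * dist u w \<le> t * dist u v + t * dist v w"
      using t dist_triangle[of u w v] by (simp flip: distrib_left)
    moreover have "0 \<le> t * dist u v" "0 \<le> t * dist v w" using t by auto
    ultimately show ?thesis unfolding D0_def by (auto simp: min_def)
  qed
  \<comment> \<open>\<open>D\<close> itself is only known to be a pseudometric.\<close>
  define D1 where "D1 u v = max (D u v) (D0 u v)" for u v
  have "Metric_space UNIV D1"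
  proof
    fix u v w
    show "0 \<le> D1 u v" unfolding D1_def using nn[of u v] by (simp add: le_max_iff_disj)
    show "D1 u v = D1 v u" by (simp add: D1_def sym[of u v] D0_def dist_commute)
    show "D1 u v = 0 \<longleftrightarrow> u = v"
    proof
      assume "D1 u v = 0"
      then have "D0 u v \<le> 0" by (simp add: D1_def max_def split: if_splits)
      then show "u = v" using t by (auto simp: D0_def min_def mult_le_0_iff split: if_splits)
    next
      assume "u = v"
      then have "D u v \<le> 0" using le[OF chain.stay] by simp
      then show "D1 u v = 0" using nn[of u v] \<open>u = v\<close> by (simp add: D1_def D0_def)
    qed
    have "D u w \<le> D1 u v + D1 v w" using tri[of u w v] unfolding D1_def by linarith
    moreover have "D0 u w \<le> D1 u v + D1 v w" using D0tri[of u w v] unfolding D1_def by linarith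
    ultimately show "D1 u w \<le> D1 u v + D1 v w" unfolding D1_def[of u w] by simp
  qed
  moreover have "D1 u v \<le> t * dist u v" for u v
    using le[OF chain_direct] by (simp add: D1_def D0_def)
  moreover have "D1 u (\<phi> s u) \<le> 1" if "s \<in> S" for u s
    using le[OF chain.jump[OF chain.stay that]] by (simp add: D1_def D0_def)
  ultimately have "warped_metric \<phi> S t D1" by (simp add: warped_metric_def)
  from warped_dist_largest[OF t this, of x y] have "D x y < B" using less by (simp add: D1_def)
  then show ?thesis using approx[of "B - D x y" x y] by auto
qed

text \<open>The jumps of the chain form the word \<open>ws\<close>, of length at most
  \<open>r\<close>. If all moves are omitted, the end point changes by at most the sum of their
  lengths, each stretched by the at most \<open>r\<close> later jumps.\<close>

lemma chain_word:
  assumes "chain \<phi> S t x y r" and t: "0 < t" and L: "1 \<le> L"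
    and lip: "\<And>s u v. s \<in> S \<Longrightarrow> dist (\<phi> s u) (\<phi> s v) \<le> L * dist u v"
  shows "\<exists>ws\<in>lists S. real (length ws) \<le> r \<and> dist (foldr \<phi> ws x) y \<le> L powr r * r / t"
  using assms(1)
proof (induction rule: chain.induct)
  case stay
  show ?case by (intro bexI[of _ "[]"]) auto
next
  case (move y r z)
  have r0: "0 \<le> r" by (rule chain_nonneg[OF move.hyps(1) t])
  from move.IH obtain ws where ws: "ws \<in> lists S" "real (length ws) \<le> r"
    "dist (foldr \<phi> ws x) y \<le> L powr r * r / t" by blast
  define r' where "r' = r + t * dist y z"
  have rr: "r \<le> r'" using t by (simp add: r'_def)
  have Lr: "L powr r \<le> L powr r'" using L rr by (intro powr_mono) auto
  have one: "1 \<le> L powr r'" using L r0 rr by (intro ge_one_powr_ge_zero) auto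
  have "dist (foldr \<phi> ws x) z \<le> L powr r * r / t + dist y z"
    using ws(3) dist_triangle[of "foldr \<phi> ws x" z y] by linarith
  also have "\<dots> \<le> L powr r' * r / t + L powr r' * dist y z"
    using mult_right_mono[OF Lr r0] mult_right_mono[OF one, of "dist y z"] t
    by (intro add_mono divide_right_mono) auto
  also have "\<dots> = L powr r' * (r / t + dist y z)" by (simp only: distrib_left times_divide_eq_right)
  also have "r / t + dist y z = r' / t" using t by (simp add: r'_def add_divide_distrib)
  also have "L powr r' * (r' / t) = L powr r' * r' / t" by simp
  finally show ?case using ws rr unfolding r'_def by (intro bexI[of _ ws]) auto
next
  case (jump y r s)
  have r0: "0 \<le> r" by (rule chain_nonneg[OF jump.hyps(1) t])
  from jump.IH obtain ws where ws: "ws \<in> lists S" "real (length ws) \<le> r"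
    "dist (foldr \<phi> ws x) y \<le> L powr r * r / t" by blast
  have "dist (foldr \<phi> (s # ws) x) (\<phi> s y) \<le> L * dist (foldr \<phi> ws x) y"
    using lip[OF jump.hyps(2)] by simp
  also have "\<dots> \<le> L * (L powr r * r / t)" using ws(3) L by (intro mult_left_mono) auto
  also have "\<dots> = L powr (r + 1) * r / t" using L by (simp add: powr_add)
  also have "\<dots> \<le> L powr (r + 1) * (r + 1) / t"
    using t by (intro divide_right_mono mult_left_mono) auto
  finally show ?case using ws jump.hyps(2) by (intro bexI[of _ "s # ws"]) auto
qed

text \<open>The factor \<open>2\<close> makes room for a strict inequality.\<close>

lemma warped_ball_subset:
  assumes t: "0 < t" and inv: "\<And>s y. s \<in> S \<Longrightarrow> \<exists>s'\<in>S. \<phi> s' (\<phi> s y) = y" and L: "1 \<le> L"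
    and lip: "\<And>s u v. s \<in> S \<Longrightarrow> dist (\<phi> s u) (\<phi> s v) \<le> L * dist u v" and B: "0 < B"
  shows "{y. warped_dist \<phi> S t x y < B} \<subseteq>
    (\<Union>ws\<in>{ws. set ws \<subseteq> S \<and> length ws \<le> nat \<lfloor>B\<rfloor>}. ball (foldr \<phi> ws x) (2 * L powr B * B / t))"
proof
  fix y assume "y \<in> {y. warped_dist \<phi> S t x y < B}"
  then have "warped_dist \<phi> S t x y < B" by simp
  from chain_of_warped_dist[OF t inv this] obtain r where r: "r < B" "chain \<phi> S t x y r" by blast
  have r0: "0 \<le> r" by (rule chain_nonneg[OF r(2) t])
  obtain ws where ws: "ws \<in> lists S" "real (length ws) \<le> r" "dist (foldr \<phi> ws x) y \<le> L powr r * r / t"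
    using chain_word[OF r(2) t L lip] by blast
  have "L powr r * r / t \<le> L powr B * B / t"
    using r r0 L t by (intro divide_right_mono mult_mono powr_mono) auto
  also have "\<dots> < 2 * L powr B * B / t"
  proof -
    have "0 < L powr B * B / t" using L B t by simp
    moreover have "2 * L powr B * B / t = 2 * (L powr B * B / t)" by simp
    moreover have "w < 2 * w" if "0 < w" for w :: real using that by simp
    ultimately show ?thesis by (simp only:)
  qed
  finally have "y \<in> ball (foldr \<phi> ws x) (2 * L powr B * B / t)" using ws(3) by simp
  moreover have "length ws \<le> nat \<lfloor>B\<rfloor>" using ws(2) r by (simp add: le_nat_floor)
  ultimately show "y \<in> (\<Union>ws\<in>{ws. set ws \<subseteq> S \<and> length ws \<le> nat \<lfloor>B\<rfloor>}. ball (foldr \<phi> ws x) (2 * L powr B * B / t))"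
    using ws(1) by (auto simp: in_lists_conv_set subset_iff)
qed

lemma warped_dist_facts:
  assumes "0 < t"
  shows "0 \<le> warped_dist \<phi> S t x y" "warped_dist \<phi> S t x y = warped_dist \<phi> S t y x"
    "warped_dist \<phi> S t x z \<le> warped_dist \<phi> S t x y + warped_dist \<phi> S t y z"
    "warped_dist \<phi> S t x x = 0" "warped_dist \<phi> S t x y \<le> t * dist x y"
    "s \<in> S \<Longrightarrow> warped_dist \<phi> S t x (\<phi> s x) \<le> 1"
proof -
  have w: "warped_metric \<phi> S t (warped_dist \<phi> S t)" by (rule warped_dist_metric[OF assms])
  interpret W: Metric_space UNIV "warped_dist \<phi> S t" using w by (simp add: warped_metric_def)
  show "0 \<le> warped_dist \<phi> S t x y" "warped_dist \<phi> S t x y = warped_dist \<phi> S t y x"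
    "warped_dist \<phi> S t x z \<le> warped_dist \<phi> S t x y + warped_dist \<phi> S t y z"
    "warped_dist \<phi> S t x x = 0"
    using W.triangle[of x y z] by (simp_all add: W.commute)
  show "warped_dist \<phi> S t x y \<le> t * dist x y" "s \<in> S \<Longrightarrow> warped_dist \<phi> S t x (\<phi> s x) \<le> 1"
    using w by (auto simp: warped_metric_def)
qed

lemma open_warped_ball:
  fixes \<phi> :: "'g \<Rightarrow> 'y::metric_space \<Rightarrow> 'y"
  assumes t: "0 < t"
  shows "open {y. warped_dist \<phi> S t x y < B}"
proof (rule openI)
  fix y assume "y \<in> {y. warped_dist \<phi> S t x y < B}"
  then have d: "0 < B - warped_dist \<phi> S t x y" by simp
  have "ball y ((B - warped_dist \<phi> S t x y) / t) \<subseteq> {y. warped_dist \<phi> S t x y < B}"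
  proof
    fix z assume "z \<in> ball y ((B - warped_dist \<phi> S t x y) / t)"
    then have "t * dist y z < B - warped_dist \<phi> S t x y" using t by (simp add: pos_less_divide_eq mult.commute)
    then show "z \<in> {y. warped_dist \<phi> S t x y < B}"
      using warped_dist_facts(3)[OF t, of \<phi> S x z y] warped_dist_facts(5)[OF t, of \<phi> S y z] by simp
  qed
  then show "\<exists>e>0. ball y e \<subseteq> {y. warped_dist \<phi> S t x y < B}" using d t by (intro exI conjI) auto
qed

text \<open>A warped ball contains a ball of radius \<open>B / t\<close> and is covered by boundedly
  many balls whose radius is a constant multiple of that one. Ahlfors regularity compares their
  measures.\<close>

lemma warped_ball_measure:
  fixes \<phi> :: "'g \<Rightarrow> 'y::metric_space \<Rightarrow> 'y"
  assumes \<mu>: "prob_space \<mu>" "sets \<mu> = sets borel"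
    and c: "0 < c" and C: "1 \<le> C"
    and reg: "\<And>y r. 0 < r \<Longrightarrow> r \<le> 2 * d \<Longrightarrow>
      c * r powr m \<le> measure \<mu> (ball y r) \<and> measure \<mu> (ball y r) \<le> C * c * r powr m"
    and t: "0 < t" and S: "finite S" and inv: "\<And>s y. s \<in> S \<Longrightarrow> \<exists>s'\<in>S. \<phi> s' (\<phi> s y) = y" and L: "1 \<le> L"
    and lip: "\<And>s u v. s \<in> S \<Longrightarrow> dist (\<phi> s u) (\<phi> s v) \<le> L * dist u v" and B: "0 < B"
    and small: "2 * L powr B * B / t \<le> 2 * d"
  shows "c * (B / t) powr m \<le> measure \<mu> {y. warped_dist \<phi> S t x y < B}"
    and "measure \<mu> {y. warped_dist \<phi> S t x y < B} \<le>
      real (card {ws. set ws \<subseteq> S \<and> length ws \<le> nat \<lfloor>B\<rfloor>}) * (C * c * (2 * L powr B * B / t) powr m)"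
proof -
  interpret prob_space \<mu> by (rule \<mu>(1))
  have op: "A \<in> sets \<mu>" if "open A" for A using that by (simp add: \<mu>(2))
  have U: "{y. warped_dist \<phi> S t x y < B} \<in> sets \<mu>" by (rule op[OF open_warped_ball[OF t]])
  have "1 \<le> L powr B" using L B by (intro ge_one_powr_ge_zero) auto
  then have "B * 1 \<le> B * (2 * L powr B)" using B by (intro mult_left_mono) auto
  then have "B / t \<le> 2 * L powr B * B / t" using t by (intro divide_right_mono) (auto simp: mult_ac)
  then have small': "B / t \<le> 2 * d" using small by simp
  have "ball x (B / t) \<subseteq> {y. warped_dist \<phi> S t x y < B}"
  proof
    fix y assume "y \<in> ball x (B / t)"
    then have "t * dist x y < B" using t by (simp add: pos_less_divide_eq mult.commute)
    then show "y \<in> {y. warped_dist \<phi> S t x y < B}" using warped_dist_facts(5)[OF t, of \<phi> S x y] by simp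
  qed
  then have "measure \<mu> (ball x (B / t)) \<le> measure \<mu> {y. warped_dist \<phi> S t x y < B}"
    by (rule finite_measure_mono[OF _ U])
  moreover have "c * (B / t) powr m \<le> measure \<mu> (ball x (B / t))"
    using reg[of "B / t" x] small' B t by simp
  ultimately show "c * (B / t) powr m \<le> measure \<mu> {y. warped_dist \<phi> S t x y < B}" by linarith
  let ?W = "{ws. set ws \<subseteq> S \<and> length ws \<le> nat \<lfloor>B\<rfloor>}"
  let ?r = "2 * L powr B * B / t"
  have fW: "finite ?W" by (rule finite_lists_length_le[OF S])
  have r0: "0 < ?r" using L B t by simp
  have "measure \<mu> {y. warped_dist \<phi> S t x y < B} \<le> measure \<mu> (\<Union>ws\<in>?W. ball (foldr \<phi> ws x) ?r)"
    by (rule finite_measure_mono[OF warped_ball_subset[OF t inv L lip B]]) (auto intro!: op)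
  also have "\<dots> \<le> (\<Sum>ws\<in>?W. measure \<mu> (ball (foldr \<phi> ws x) ?r))"
    by (rule finite_measure_subadditive_finite[OF fW]) (auto intro!: op)
  also have "\<dots> \<le> (\<Sum>ws\<in>?W. C * c * ?r powr m)"
    by (rule sum_mono) (use reg[OF r0 small] in blast)
  finally show "measure \<mu> {y. warped_dist \<phi> S t x y < B} \<le> real (card ?W) * (C * c * ?r powr m)" by simp
qed

section \<open>Poincare inequalities on graphs\<close>

text \<open>The ball of radius \<open>R\<close> in the graph metric.\<close>

definition nbhd :: "('v \<Rightarrow> 'v \<Rightarrow> bool) \<Rightarrow> nat \<Rightarrow> 'v \<Rightarrow> 'v set" where
  "nbhd E R x = {y. \<exists>n\<le>R. (E ^^ n) x y}"

definition energy :: "'v set \<Rightarrow> ('v \<Rightarrow> 'v \<Rightarrow> bool) \<Rightarrow> ('v \<Rightarrow> 'x::real_normed_vector) \<Rightarrow> real" where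
  "energy V E f = (\<Sum>(x, y) \<in> {(x, y) \<in> V \<times> V. E x y}. (norm (f x - f y))\<^sup>2)"

text \<open>The part of the energy near \<open>z\<close>. It controls the increments of
  \<open>f\<close> from \<open>z\<close>, and its sum over \<open>z\<close> is controlled by the
  energy.\<close>

definition local_energy ::
    "'v set \<Rightarrow> ('v \<Rightarrow> 'v \<Rightarrow> bool) \<Rightarrow> nat \<Rightarrow> ('v \<Rightarrow> 'x::real_normed_vector) \<Rightarrow> 'v \<Rightarrow> real" where
  "local_energy V E R f z = (\<Sum>(x, y) \<in> {(x, y) \<in> V \<times> V. E x y}. if x \<in> nbhd E R z then (norm (f x - f y))\<^sup>2 else 0)"

lemma graph_relpow_in: "graph_on V E \<Longrightarrow> x \<in> V \<Longrightarrow> (E ^^ n) x y \<Longrightarrow> y \<in> V"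
proof (induction n arbitrary: y)
  case (Suc n)
  then obtain z where "(E ^^ n) x z" "E z y" by auto
  then show ?case using Suc.prems(1) unfolding graph_on_def by blast
qed simp

lemma graph_relpow_sym:
  assumes "graph_on V E" "(E ^^ n) x y"
  shows "(E ^^ n) y x"
  using assms(2)
proof (induction n arbitrary: y)
  case (Suc n)
  then obtain z where z: "(E ^^ n) x z" "E z y" by auto
  have "E y z" using z assms(1) by (auto simp: graph_on_def)
  then show ?case using Suc.IH[OF z(1)] by (rule relpowp_Suc_I2)
qed simp

lemma nbhd_sym: "graph_on V E \<Longrightarrow> y \<in> nbhd E R x \<longleftrightarrow> x \<in> nbhd E R y"
  using graph_relpow_sym by (fastforce simp: nbhd_def)

lemma nbhd_self: "x \<in> nbhd E R x"
  unfolding nbhd_def by (intro CollectI exI[of _ 0]) simp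

lemma nbhd_subset: "graph_on V E \<Longrightarrow> x \<in> V \<Longrightarrow> nbhd E R x \<subseteq> V"
  using graph_relpow_in by (fastforce simp: nbhd_def)

lemma card_nbhd:
  assumes G: "graph_on V E" and deg: "\<And>x. x \<in> V \<Longrightarrow> finite {y. E x y} \<and> card {y. E x y} \<le> k" and x: "x \<in> V"
  shows "finite (nbhd E R x) \<and> card (nbhd E R x) \<le> (k + 1) ^ R"
proof (induction R)
  case 0
  have "nbhd E 0 x = {x}" by (auto simp: nbhd_def)
  then show ?case by simp
next
  case (Suc R)
  have sub: "nbhd E (Suc R) x \<subseteq> (\<Union>y\<in>nbhd E R x. insert y {z. E y z})"
  proof
    fix z assume "z \<in> nbhd E (Suc R) x"
    then obtain n where n: "n \<le> Suc R" "(E ^^ n) x z" by (auto simp: nbhd_def)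
    show "z \<in> (\<Union>y\<in>nbhd E R x. insert y {z. E y z})"
    proof (cases n)
      case 0
      then show ?thesis using n nbhd_self[of x E R] by auto
    next
      case (Suc m)
      then obtain y where y: "(E ^^ m) x y" "E y z" using n by auto
      then have "y \<in> nbhd E R x" using n Suc by (auto simp: nbhd_def)
      then show ?thesis using y by auto
    qed
  qed
  have f: "finite (insert y {z. E y z}) \<and> card (insert y {z. E y z}) \<le> k + 1" if "y \<in> nbhd E R x" for y
  proof -
    have "y \<in> V" using nbhd_subset[OF G x] that by blast
    from deg[OF this] have d: "finite {z. E y z}" "card {z. E y z} \<le> k" by blast+
    have "card (insert y {z. E y z}) \<le> Suc (card {z. E y z})" using d(1) by (simp add: card_insert_if)
    then show ?thesis using d by simp
  qed
  have fin: "finite (\<Union>y\<in>nbhd E R x. insert y {z. E y z})"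
    by (rule finite_UN_I[OF Suc[THEN conjunct1] f[THEN conjunct1]])
  have "card (nbhd E (Suc R) x) \<le> card (\<Union>y\<in>nbhd E R x. insert y {z. E y z})" by (rule card_mono[OF fin sub])
  also have "\<dots> \<le> (\<Sum>y\<in>nbhd E R x. card (insert y {z. E y z}))" by (rule card_UN_le[OF Suc[THEN conjunct1]])
  also have "\<dots> \<le> (\<Sum>y\<in>nbhd E R x. k + 1)" by (rule sum_mono[OF f[THEN conjunct2]])
  also have "\<dots> = card (nbhd E R x) * (k + 1)" by simp
  also have "\<dots> \<le> (k + 1) ^ R * (k + 1)" by (rule mult_right_mono[OF Suc[THEN conjunct2]]) simp
  finally show ?case using finite_subset[OF sub fin] by (simp add: mult.commute)
qed

lemma nbhd_of_path_dist:
  assumes c: "connected_graph_on V E" and xy: "x \<in> V" "y \<in> V" and d: "path_dist E x y \<le> real R"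
  shows "y \<in> nbhd E R x"
proof -
  have "E\<^sup>*\<^sup>* x y" using c xy by (auto simp: connected_graph_on_def)
  then obtain n where "(E ^^ n) x y" using rtranclp_power[of E x y] by blast
  then have "(E ^^ (LEAST n. (E ^^ n) x y)) x y" by (rule LeastI)
  then show ?thesis using d by (auto simp: nbhd_def path_dist_def)
qed

lemma local_energy_nonneg: "0 \<le> local_energy V E R f z"
  unfolding local_energy_def by (intro sum_nonneg) auto

lemma local_energy_le: "finite V \<Longrightarrow> local_energy V E R f z \<le> energy V E f"
  unfolding local_energy_def energy_def by (intro sum_mono) auto

text \<open>A path of at most \<open>R\<close> edges joins \<open>z\<close> to \<open>y\<close>, and
  the square of the increment along each of them is bounded by the local energy.\<close>

lemma norm_diff_le_local_energy:
  assumes G: "graph_on V E" "finite V" and z: "z \<in> V" and y: "y \<in> nbhd E R z"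
  shows "(norm (f z - f y))\<^sup>2 \<le> (real R)\<^sup>2 * local_energy V E R f z"
proof -
  let ?Q = "local_energy V E R f z"
  have edge: "norm (f x - f y) \<le> sqrt ?Q" if x: "x \<in> nbhd E R z" and e: "E x y" for x y
  proof (rule real_le_rsqrt)
    have "finite {(x, y) \<in> V \<times> V. E x y}" by (rule finite_subset[of _ "V \<times> V"]) (use G in auto)
    moreover have "x \<in> V" "y \<in> V" using e G(1) unfolding graph_on_def by blast+
    then have "(x, y) \<in> {(x, y) \<in> V \<times> V. E x y}" using e by simp
    moreover have "0 \<le> (case p of (x, y) \<Rightarrow> if x \<in> nbhd E R z then (norm (f x - f y))\<^sup>2 else 0)" for p
      by (cases p) simp
    ultimately have "(case (x, y) of (x, y) \<Rightarrow> if x \<in> nbhd E R z then (norm (f x - f y))\<^sup>2 else 0) \<le> ?Q"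
      unfolding local_energy_def by (intro member_le_sum)
    then show "(norm (f x - f y))\<^sup>2 \<le> ?Q" using x by simp
  qed
  have "norm (f z - f y) \<le> real n * sqrt ?Q" if "(E ^^ n) z y" "n \<le> R" for n y
    using that
  proof (induction n arbitrary: y)
    case (Suc n)
    then obtain x where x: "(E ^^ n) z x" "E x y" by auto
    have "x \<in> nbhd E R z" unfolding nbhd_def
      by (rule CollectI, rule exI[of _ n]) (use x(1) Suc.prems in simp)
    then have "norm (f x - f y) \<le> sqrt ?Q" using edge x(2) by blast
    moreover have "norm (f z - f x) \<le> real n * sqrt ?Q" using Suc.IH[OF x(1)] Suc.prems by simp
    moreover have "norm (f z - f y) \<le> norm (f z - f x) + norm (f x - f y)"
      using norm_triangle_ineq[of "f z - f x" "f x - f y"] by simp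
    ultimately show ?case by (simp add: distrib_right)
  qed simp
  then obtain n where n: "n \<le> R" "norm (f z - f y) \<le> real n * sqrt ?Q" using y by (auto simp: nbhd_def)
  have "real n * sqrt ?Q \<le> real R * sqrt ?Q" using n(1) local_energy_nonneg by (intro mult_right_mono) auto
  then have "(norm (f z - f y))\<^sup>2 \<le> (real R * sqrt ?Q)\<^sup>2" using n(2) by (intro power_mono) auto
  then show ?thesis using local_energy_nonneg[of V E R f z] by (simp add: power_mult_distrib)
qed

text \<open>An edge counts for the centres in a ball around its starting point.\<close>

lemma sum_local_energy_le:
  assumes G: "graph_on V E" "finite V" and P: "\<And>x. x \<in> V \<Longrightarrow> card (nbhd E R x) \<le> P"
  shows "(\<Sum>z\<in>V. local_energy V E R f z) \<le> real P * energy V E f"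
proof -
  let ?Ed = "{(x, y) \<in> V \<times> V. E x y}"
  have "(\<Sum>z\<in>V. local_energy V E R f z) =
      (\<Sum>p\<in>?Ed. \<Sum>z\<in>V. case p of (x, y) \<Rightarrow> if x \<in> nbhd E R z then (norm (f x - f y))\<^sup>2 else 0)"
    unfolding local_energy_def by (rule sum.swap)
  also have "\<dots> \<le> (\<Sum>p\<in>?Ed. real P * (case p of (x, y) \<Rightarrow> (norm (f x - f y))\<^sup>2))"
  proof (rule sum_mono)
    fix p assume "p \<in> ?Ed"
    then obtain x y where p: "p = (x, y)" "x \<in> V" by auto
    have "(\<Sum>z\<in>V. if x \<in> nbhd E R z then (norm (f x - f y))\<^sup>2 else 0) =
        real (card {z \<in> V. x \<in> nbhd E R z}) * (norm (f x - f y))\<^sup>2"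
      using G(2) by (simp add: sum.If_cases Int_def)
    also have "{z \<in> V. x \<in> nbhd E R z} = nbhd E R x"
      using nbhd_sym[OF G(1), of x R] nbhd_subset[OF G(1) p(2), of R] by blast
    also have "real (card (nbhd E R x)) * (norm (f x - f y))\<^sup>2 \<le> real P * (norm (f x - f y))\<^sup>2"
      using P[OF p(2)] by (intro mult_right_mono) auto
    finally show "(\<Sum>z\<in>V. case p of (x, y) \<Rightarrow> if x \<in> nbhd E R z then (norm (f x - f y))\<^sup>2 else 0) \<le>
        real P * (case p of (x, y) \<Rightarrow> (norm (f x - f y))\<^sup>2)" using p by simp
  qed
  also have "\<dots> = real P * energy V E f" by (simp add: energy_def sum_distrib_left)
  finally show ?thesis .
qed

lemma sum_pairs_le:
  fixes f :: "'v \<Rightarrow> 'x::real_normed_vector"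
  assumes "finite V"
  shows "(\<Sum>(x, y) \<in> V \<times> V. (norm (f x - f y))\<^sup>2) \<le> 4 * real (card V) * (\<Sum>x\<in>V. (norm (f x - c))\<^sup>2)"
proof -
  have "(norm (f x - f y))\<^sup>2 \<le> 2 * (norm (f x - c))\<^sup>2 + 2 * (norm (f y - c))\<^sup>2" for x y
  proof -
    have "norm (f x - f y) \<le> norm (f x - c) + norm (f y - c)"
      using norm_triangle_ineq4[of "f x - c" "f y - c"] by simp
    then have "(norm (f x - f y))\<^sup>2 \<le> (norm (f x - c) + norm (f y - c))\<^sup>2" by (intro power_mono) auto
    also have "\<dots> \<le> 2 * (norm (f x - c))\<^sup>2 + 2 * (norm (f y - c))\<^sup>2"
      using zero_le_power2[of "norm (f x - c) - norm (f y - c)"] by (simp add: power2_sum power2_diff)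
    finally show ?thesis .
  qed
  then have "(\<Sum>x\<in>V. \<Sum>y\<in>V. (norm (f x - f y))\<^sup>2) \<le>
      (\<Sum>x\<in>V. \<Sum>y\<in>V. 2 * (norm (f x - c))\<^sup>2 + 2 * (norm (f y - c))\<^sup>2)" by (intro sum_mono)
  also have "\<dots> = 4 * real (card V) * (\<Sum>x\<in>V. (norm (f x - c))\<^sup>2)"
    by (simp add: sum.distrib sum_distrib_left[symmetric])
  finally show ?thesis by (simp add: sum.cartesian_product)
qed

text \<open>Let \<open>g y\<close> be the value of \<open>f\<close> at a vertex \<open>p y\<close>
  with \<open>y \<in> U (p y)\<close>. The vertices chosen for \<open>y\<close> and
  \<open>T s y\<close> are at distance at most \<open>R\<close>, so the displacements of
  \<open>g\<close> are bounded by local energies of \<open>f\<close>, and the gap on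
  \<open>M\<close> bounds the deviation of \<open>g\<close> from some \<open>c\<close>. On
  \<open>U v\<close> the value \<open>f v\<close> differs from \<open>g\<close> by a local energy
  too; integration over \<open>U v\<close>, whose measure is at least \<open>a\<close>, and
  summation over \<open>v\<close> bound the deviation of \<open>f\<close> from \<open>c\<close>, as
  each point lies in at most \<open>P\<close> of these sets.\<close>

lemma (in prob_space) Poincare_transfer:
  fixes f :: "'v \<Rightarrow> 'x::banach" and T :: "'s \<Rightarrow> 'a \<Rightarrow> 'a"
  assumes sp: "space M = UNIV" and G: "graph_on V E" "finite V"
    and P: "\<And>x. x \<in> V \<Longrightarrow> card (nbhd E R x) \<le> P" "\<And>x. x \<in> V \<Longrightarrow> finite (nbhd E R x)"
    and U: "\<And>v. v \<in> V \<Longrightarrow> U v \<in> sets M" "\<And>v. v \<in> V \<Longrightarrow> a \<le> measure M (U v)" "\<And>v. v \<in> V \<Longrightarrow> measure M (U v) \<le> b"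
    and cover: "\<And>y. \<exists>v\<in>V. y \<in> U v"
    and near: "\<And>v w y. v \<in> V \<Longrightarrow> w \<in> V \<Longrightarrow> y \<in> U v \<Longrightarrow> y \<in> U w \<Longrightarrow> w \<in> nbhd E R v"
    and near_T: "\<And>s v w y. s \<in> S \<Longrightarrow> v \<in> V \<Longrightarrow> w \<in> V \<Longrightarrow> y \<in> U v \<Longrightarrow> T s y \<in> U w \<Longrightarrow> w \<in> nbhd E R v"
    and T: "\<And>s. s \<in> S \<Longrightarrow> T s \<in> measurable M M"
    and a: "0 < a" and \<kappa>: "0 \<le> \<kappa>"
    and gap: "\<And>g :: 'a \<Rightarrow> 'x. simple_function M g \<Longrightarrow>
      \<exists>c. (\<integral>y. (norm (g y - c))\<^sup>2 \<partial>M) \<le> \<kappa> * (\<Sum>s\<in>S. \<integral>y. (norm (g y - g (T s y)))\<^sup>2 \<partial>M)"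
  shows "(\<Sum>(x, y) \<in> V \<times> V. (norm (f x - f y))\<^sup>2) \<le>
    4 * (b / a) * (2 * (real R)\<^sup>2 * real P + 2 * (real P)\<^sup>2 * \<kappa> * real (card S) * (real R)\<^sup>2) * real (card V) * energy V E f"
proof -
  define Q where "Q z = local_energy V E R f z" for z
  define En where "En = energy V E f"
  have Q0: "0 \<le> Q z" for z unfolding Q_def by (rule local_energy_nonneg)
  have QP: "(\<Sum>z\<in>V. Q z) \<le> real P * En" unfolding Q_def En_def by (rule sum_local_energy_le[OF G P(1)])
  have near_f: "(norm (f v - f w))\<^sup>2 \<le> (real R)\<^sup>2 * Q v" if "v \<in> V" "w \<in> nbhd E R v" for v w
    unfolding Q_def by (rule norm_diff_le_local_energy[OF G that])
  have V0: "V \<noteq> {}" using cover by blast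
  have b0: "0 \<le> b" using V0 U(3) measure_nonneg[of M] by (meson all_not_in_conv order.trans)
  \<comment> \<open>The first vertex \<open>v\<close> in some enumeration with \<open>y \<in> U v\<close>
    depends measurably on \<open>y\<close>.\<close>
  obtain h where h: "bij_betw h {..<card V} V"
    using ex_bij_betw_nat_finite[OF G(2)] by (auto simp: atLeast0LessThan)
  have hV: "h i \<in> V" if "i < card V" for i using bij_betwE[OF h] that by auto
  define idx where "idx y = (LEAST i. i < card V \<and> y \<in> U (h i))" for y
  have idx: "idx y < card V \<and> y \<in> U (h (idx y))" for y
  proof -
    obtain v where v: "v \<in> V" "y \<in> U v" using cover by blast
    have "v \<in> h ` {..<card V}" using v(1) bij_betw_imp_surj_on[OF h] by simp
    then obtain i where "i < card V" "h i = v" by auto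
    then have "i < card V \<and> y \<in> U (h i)" using v by simp
    then show ?thesis unfolding idx_def by (rule LeastI)
  qed
  define p where "p y = h (idx y)" for y
  have p: "p y \<in> V" "y \<in> U (p y)" for y using idx[of y] hV by (auto simp: p_def)
  have idx_simple: "simple_function M idx"
    unfolding simple_function_def
  proof
    have "idx ` space M \<subseteq> {..<card V}" using idx by auto
    then show "finite (idx ` space M)" by (rule finite_subset) simp
    show "\<forall>x\<in>idx ` space M. idx -` {x} \<inter> space M \<in> sets M"
    proof
      fix i assume "i \<in> idx ` space M"
      then have i: "i < card V" using idx by auto
      have "idx -` {i} \<inter> space M = U (h i) - (\<Union>j<i. U (h j))"
      proof (intro equalityI subsetI)
        fix y assume "y \<in> idx -` {i} \<inter> space M"
        then have e: "idx y = i" by simp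
        have "y \<notin> U (h j)" if "j < i" for j
          using not_less_Least[of j "\<lambda>i. i < card V \<and> y \<in> U (h i)"] that e i unfolding idx_def by auto
        then show "y \<in> U (h i) - (\<Union>j<i. U (h j))" using idx[of y] e by auto
      next
        fix y assume y: "y \<in> U (h i) - (\<Union>j<i. U (h j))"
        have "idx y = i" unfolding idx_def
          by (rule Least_equality) (use y i in \<open>auto simp: not_less[symmetric]\<close>)
        then show "y \<in> idx -` {i} \<inter> space M" by (simp add: sp)
      qed
      also have "\<dots> \<in> sets M"
        by (intro sets.Diff sets.finite_UN U(1) hV) (use i in auto)
      finally show "idx -` {i} \<inter> space M \<in> sets M" .
    qed
  qed
  define g where "g y = f (p y)" for y
  have g: "simple_function M g"
    unfolding g_def p_def by (rule simple_function_compose1[OF idx_simple, of "\<lambda>i. f (h i)"])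
  obtain c where c: "(\<integral>y. (norm (g y - c))\<^sup>2 \<partial>M) \<le> \<kappa> * (\<Sum>s\<in>S. \<integral>y. (norm (g y - g (T s y)))\<^sup>2 \<partial>M)"
    using gap[OF g] by blast
  have bounded_int: "integrable M F" if "simple_function M F" for F :: "'a \<Rightarrow> real"
  proof -
    have "finite (F ` space M)" by (rule simple_functionD(1)[OF that])
    then obtain B where B: "\<And>y. y \<in> space M \<Longrightarrow> \<bar>F y\<bar> \<le> B"
      using finite_imp_bounded[of "F ` space M"] by (auto simp: bounded_iff)
    show ?thesis
      by (rule integrable_const_bound[of _ B]) (use B borel_measurable_simple_function[OF that] in auto)
  qed
  have gc_int: "integrable M (\<lambda>y. (norm (g y - c))\<^sup>2)"
    by (rule bounded_int, rule simple_function_compose1[OF g, of "\<lambda>z. (norm (z - c))\<^sup>2"])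
  have ind_int: "integrable M (\<lambda>y. k * indicator (U v) y)" if "v \<in> V" for v and k :: real
    using U(1)[OF that] by (intro integrable_mult_right integrable_real_indicator) (auto simp: emeasure_eq_measure)
  have ind_eq: "(\<integral>y. k * indicator (U v) y \<partial>M) = k * measure M (U v)" if "v \<in> V" for v and k :: real
    using U(1)[OF that] by (simp add: sp)
  have disp: "(\<integral>y. (norm (g y - g (T s y)))\<^sup>2 \<partial>M) \<le> b * ((real R)\<^sup>2 * (real P * En))" if s: "s \<in> S" for s
  proof -
    have pt: "(norm (g y - g (T s y)))\<^sup>2 \<le> (\<Sum>v\<in>V. ((real R)\<^sup>2 * Q v) * indicator (U v) y)" for y
    proof -
      have "(norm (g y - g (T s y)))\<^sup>2 \<le> (real R)\<^sup>2 * Q (p y)"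
        unfolding g_def by (rule near_f[OF p(1)], rule near_T[OF s p(1) p(1) p(2)], rule p(2))
      also have "\<dots> = ((real R)\<^sup>2 * Q (p y)) * indicator (U (p y)) y" using p(2)[of y] by simp
      also have "\<dots> \<le> (\<Sum>v\<in>V. ((real R)\<^sup>2 * Q v) * indicator (U v) y)"
        by (rule member_le_sum[of "p y" V "\<lambda>v. ((real R)\<^sup>2 * Q v) * indicator (U v) y"])
           (use p(1) G(2) Q0 in auto)
      finally show ?thesis .
    qed
    have "(\<integral>y. (norm (g y - g (T s y)))\<^sup>2 \<partial>M) \<le> (\<integral>y. (\<Sum>v\<in>V. ((real R)\<^sup>2 * Q v) * indicator (U v) y) \<partial>M)"
    proof (rule integral_mono)
      have "simple_function M (\<lambda>y. g (T s y))"
        by (rule simple_function_comp[OF T[OF s] g, unfolded o_def])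
      then have "simple_function M (\<lambda>y. (norm (g y - g (T s y)))\<^sup>2)"
        by (rule simple_function_compose2[OF g, of _ "\<lambda>u v. (norm (u - v))\<^sup>2"])
      then show "integrable M (\<lambda>y. (norm (g y - g (T s y)))\<^sup>2)" by (rule bounded_int)
      show "integrable M (\<lambda>y. \<Sum>v\<in>V. ((real R)\<^sup>2 * Q v) * indicator (U v) y)"
        by (rule Bochner_Integration.integrable_sum, rule ind_int)
    qed (rule pt)
    also have "\<dots> = (\<Sum>v\<in>V. ((real R)\<^sup>2 * Q v) * measure M (U v))"
      by (subst Bochner_Integration.integral_sum[OF ind_int], assumption, rule sum.cong[OF refl ind_eq])
    also have "\<dots> \<le> (\<Sum>v\<in>V. ((real R)\<^sup>2 * Q v) * b)"
      by (intro sum_mono mult_left_mono U(3)) (use Q0 in auto)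
    also have "\<dots> = b * ((real R)\<^sup>2 * (\<Sum>v\<in>V. Q v))" by (simp add: sum_distrib_left sum_distrib_right mult_ac)
    also have "\<dots> \<le> b * ((real R)\<^sup>2 * (real P * En))" by (intro mult_left_mono QP b0) auto
    finally show ?thesis .
  qed
  have c2: "(\<integral>y. (norm (g y - c))\<^sup>2 \<partial>M) \<le> \<kappa> * (real (card S) * (b * ((real R)\<^sup>2 * (real P * En))))"
  proof -
    have "(\<Sum>s\<in>S. \<integral>y. (norm (g y - g (T s y)))\<^sup>2 \<partial>M) \<le> (\<Sum>s\<in>S. b * ((real R)\<^sup>2 * (real P * En)))"
      by (rule sum_mono[OF disp])
    then have "\<kappa> * (\<Sum>s\<in>S. \<integral>y. (norm (g y - g (T s y)))\<^sup>2 \<partial>M) \<le> \<kappa> * (\<Sum>s\<in>S. b * ((real R)\<^sup>2 * (real P * En)))"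
      by (rule mult_left_mono[OF _ \<kappa>])
    then show ?thesis using c by simp
  qed
  have "a * (norm (f x - c))\<^sup>2 \<le> 2 * (real R)\<^sup>2 * Q x * b + 2 * (\<integral>y. indicator (U x) y * (norm (g y - c))\<^sup>2 \<partial>M)"
    if x: "x \<in> V" for x
  proof -
    have gi: "integrable M (\<lambda>y. indicator (U x) y * (norm (g y - c))\<^sup>2)"
      using integrable_mult_indicator[OF U(1)[OF x] gc_int] by simp
    have pt: "(norm (f x - c))\<^sup>2 * indicator (U x) y \<le>
        (2 * (real R)\<^sup>2 * Q x) * indicator (U x) y + 2 * (indicator (U x) y * (norm (g y - c))\<^sup>2)" for y
    proof (cases "y \<in> U x")
      case True
      have "norm (f x - c) \<le> norm (f x - g y) + norm (g y - c)"
        using norm_triangle_ineq[of "f x - g y" "g y - c"] by simp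
      then have "(norm (f x - c))\<^sup>2 \<le> (norm (f x - g y) + norm (g y - c))\<^sup>2" by (intro power_mono) auto
      also have "\<dots> \<le> 2 * (norm (f x - g y))\<^sup>2 + 2 * (norm (g y - c))\<^sup>2"
        using zero_le_power2[of "norm (f x - g y) - norm (g y - c)"] by (simp add: power2_sum power2_diff)
      also have "(norm (f x - g y))\<^sup>2 \<le> (real R)\<^sup>2 * Q x"
        unfolding g_def by (rule near_f[OF x], rule near[OF x p(1) True p(2)])
      finally show ?thesis using True by simp
    qed simp
    have "a * (norm (f x - c))\<^sup>2 \<le> (norm (f x - c))\<^sup>2 * measure M (U x)"
      using mult_right_mono[OF U(2)[OF x], of "(norm (f x - c))\<^sup>2"] by (simp add: mult.commute)
    also have "\<dots> = (\<integral>y. (norm (f x - c))\<^sup>2 * indicator (U x) y \<partial>M)" by (rule ind_eq[OF x, symmetric])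
    also have "\<dots> \<le> (\<integral>y. (2 * (real R)\<^sup>2 * Q x) * indicator (U x) y + 2 * (indicator (U x) y * (norm (g y - c))\<^sup>2) \<partial>M)"
      by (rule integral_mono[OF ind_int[OF x] _ pt]) (use ind_int[OF x] gi in auto)
    also have "\<dots> = (2 * (real R)\<^sup>2 * Q x) * measure M (U x) + 2 * (\<integral>y. indicator (U x) y * (norm (g y - c))\<^sup>2 \<partial>M)"
      using ind_int[OF x, of "2 * (real R)\<^sup>2 * Q x"] gi
      by (subst Bochner_Integration.integral_add) (simp_all add: ind_eq[OF x] sp)
    also have "(2 * (real R)\<^sup>2 * Q x) * measure M (U x) \<le> (2 * (real R)\<^sup>2 * Q x) * b"
      by (intro mult_left_mono U(3)[OF x]) (use Q0 in auto)
    finally show ?thesis by simp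
  qed
  then have "(\<Sum>x\<in>V. a * (norm (f x - c))\<^sup>2) \<le>
      (\<Sum>x\<in>V. 2 * (real R)\<^sup>2 * Q x * b + 2 * (\<integral>y. indicator (U x) y * (norm (g y - c))\<^sup>2 \<partial>M))"
    by (rule sum_mono)
  also have "\<dots> = 2 * (real R)\<^sup>2 * b * (\<Sum>x\<in>V. Q x) + 2 * (\<Sum>x\<in>V. \<integral>y. indicator (U x) y * (norm (g y - c))\<^sup>2 \<partial>M)"
  proof -
    have "2 * (real R)\<^sup>2 * Q x * b = 2 * (real R)\<^sup>2 * b * Q x" for x by simp
    then show ?thesis by (simp only: sum.distrib sum_distrib_left)
  qed
  also have "(\<Sum>x\<in>V. \<integral>y. indicator (U x) y * (norm (g y - c))\<^sup>2 \<partial>M) = (\<integral>y. (\<Sum>x\<in>V. indicator (U x) y * (norm (g y - c))\<^sup>2) \<partial>M)"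
    by (rule Bochner_Integration.integral_sum[symmetric])
       (use integrable_mult_indicator[OF U(1) gc_int] in simp)
  also have "\<dots> \<le> (\<integral>y. real P * (norm (g y - c))\<^sup>2 \<partial>M)"
  proof (rule integral_mono)
    show "integrable M (\<lambda>y. \<Sum>x\<in>V. indicator (U x) y * (norm (g y - c))\<^sup>2)"
      by (rule Bochner_Integration.integrable_sum) (use integrable_mult_indicator[OF U(1) gc_int] in simp)
    show "integrable M (\<lambda>y. real P * (norm (g y - c))\<^sup>2)" using gc_int by simp
    fix y
    have "(\<Sum>x\<in>V. indicator (U x) y) = real (card {x \<in> V. y \<in> U x})"
      using G(2) by (simp add: indicator_def sum.If_cases Int_def)
    also have "card {x \<in> V. y \<in> U x} \<le> card (nbhd E R (p y))"
      by (rule card_mono[OF P(2)[OF p(1)]]) (use near[OF p(1) _ p(2)] in auto)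
    also have "card (nbhd E R (p y)) \<le> P" by (rule P(1)[OF p(1)])
    finally have "(\<Sum>x\<in>V. indicator (U x) y) \<le> real P" by simp
    then show "(\<Sum>x\<in>V. indicator (U x) y * (norm (g y - c))\<^sup>2) \<le> real P * (norm (g y - c))\<^sup>2"
      by (subst sum_distrib_right[symmetric]) (rule mult_right_mono, auto)
  qed
  also have "(\<integral>y. real P * (norm (g y - c))\<^sup>2 \<partial>M) = real P * (\<integral>y. (norm (g y - c))\<^sup>2 \<partial>M)" by simp
  also have "\<dots> \<le> real P * (\<kappa> * (real (card S) * (b * ((real R)\<^sup>2 * (real P * En)))))"
    by (rule mult_left_mono[OF c2]) simp
  also have "2 * (real R)\<^sup>2 * b * (\<Sum>x\<in>V. Q x) \<le> 2 * (real R)\<^sup>2 * b * (real P * En)"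
    by (rule mult_left_mono[OF QP]) (use b0 in simp)
  finally have "a * (\<Sum>x\<in>V. (norm (f x - c))\<^sup>2) \<le>
      b * (2 * (real R)\<^sup>2 * real P + 2 * (real P)\<^sup>2 * \<kappa> * real (card S) * (real R)\<^sup>2) * En"
    by (simp add: sum_distrib_left algebra_simps power2_eq_square)
  then have main: "(\<Sum>x\<in>V. (norm (f x - c))\<^sup>2) \<le>
      (b / a) * (2 * (real R)\<^sup>2 * real P + 2 * (real P)\<^sup>2 * \<kappa> * real (card S) * (real R)\<^sup>2) * En"
    using a by (simp add: pos_le_divide_eq mult.commute)
  have "(\<Sum>(x, y) \<in> V \<times> V. (norm (f x - f y))\<^sup>2) \<le> 4 * real (card V) * (\<Sum>x\<in>V. (norm (f x - c))\<^sup>2)"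
    by (rule sum_pairs_le[OF G(2)])
  also have "\<dots> \<le> 4 * real (card V) *
      ((b / a) * (2 * (real R)\<^sup>2 * real P + 2 * (real P)\<^sup>2 * \<kappa> * real (card S) * (real R)\<^sup>2) * En)"
    by (rule mult_left_mono[OF main]) simp
  finally show ?thesis by (simp only: En_def mult_ac)
qed


section \<open>Expanders from warped cones\<close>

theorem corollary1p2:
  fixes \<mu> :: "'y::metric_space measure"
    and G :: "('g, 'r) monoid_scheme"
    and \<phi> :: "'g \<Rightarrow> 'y \<Rightarrow> 'y"
    and S :: "'g set"
    and V :: "real \<Rightarrow> 'v set"
    and E :: "real \<Rightarrow> 'v \<Rightarrow> 'v \<Rightarrow> bool"
  assumes "compact (UNIV :: 'y set)"
    and "geodesic_space TYPE('y)"
    and "\<exists>x y :: 'y. x \<noteq> y"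
    and "prob_space \<mu>"
    and "sets \<mu> = sets borel"
    and "ahlfors_regular \<mu>"
    and "group G"
    and "finite S" and "S \<subseteq> carrier G" and "\<forall>s\<in>S. inv\<^bsub>G\<^esub> s \<in> S"
    and "generate G S = carrier G"
    and "acts_by_lipschitz_homeos G \<phi>"
    and "preserves_measure G \<phi> \<mu>"
    and "ergodic_action G \<phi> \<mu>"
    and "\<exists>\<iota> :: real \<Rightarrow> 'u. inj \<iota>"
    and "banach_property_T TYPE('u) G"
    and "\<forall>t>0. connected_graph_on (V t) (E t)"
    and "uniformly_bounded_degree {0<..} V E"
    and "quasi_isometric_families {0<..} V (\<lambda>t. path_dist (E t))
           (\<lambda>t. UNIV :: 'y set) (\<lambda>t. warped_dist \<phi> S t)"
    and "nontrivial_type TYPE('x::banach)"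
  shows "expander_wrt TYPE('x) {0<..} V E"
proof -
  note comp = assms(1) and prob = assms(4) and borel = assms(5) and grp = assms(7)
    and S = assms(8,9) and conn = assms(17)[rule_format]
  interpret prob_space \<mu> by (rule prob)
  have sp: "space \<mu> = UNIV" using sets_eq_imp_space_eq[OF borel] by simp
  have "countable (carrier G)" using countable_generate[OF grp S] assms(11) by simp
  then have act: "pmp_action \<mu> G \<phi>"
    using assms(12,13,14) sp prob grp
    by (simp add: pmp_action_def pmp_action_axioms_def acts_by_lipschitz_homeos_def)
  interpret pmp_action \<mu> G \<phi> by (rule act)
  have inv: "\<exists>s'\<in>S. \<phi> s' (\<phi> s y) = y" if "s \<in> S" for s y
    using \<phi>_inv(1)[of s y] assms(10) S that by blast
  have "\<exists>l. \<forall>s. s \<in> S \<longrightarrow> (l s)-lipschitz_on UNIV (\<phi> s)"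
    by (rule choice) (use assms(12) S in \<open>auto simp: acts_by_lipschitz_homeos_def\<close>)
  then obtain l where l: "\<And>s. s \<in> S \<Longrightarrow> (l s)-lipschitz_on UNIV (\<phi> s)" by blast
  have l0: "0 \<le> l s" if "s \<in> S" for s using lipschitz_on_nonneg[OF l[OF that]] .
  define L where "L = 1 + (\<Sum>s\<in>S. l s)"
  have L: "1 \<le> L" using l0 by (simp add: L_def sum_nonneg)
  have lip: "dist (\<phi> s u) (\<phi> s v) \<le> L * dist u v" if "s \<in> S" for s u v
  proof -
    have "dist (\<phi> s u) (\<phi> s v) \<le> l s * dist u v" using lipschitz_onD[OF l[OF that], of u v] by simp
    also have "\<dots> \<le> L * dist u v"
    proof (rule mult_right_mono)
      have "l s \<le> (\<Sum>s\<in>S. l s)" by (rule member_le_sum) (use that l0 S in auto)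
      then show "l s \<le> L" by (simp add: L_def)
    qed simp
    finally show ?thesis .
  qed
  obtain k where k: "\<And>t x. t > 0 \<Longrightarrow> x \<in> V t \<Longrightarrow> finite {y. E t x y} \<and> card {y. E t x y} \<le> k"
    using assms(18) by (auto simp: uniformly_bounded_degree_def)
  obtain A C B where A: "0 \<le> A" and C: "1 \<le> C" and B: "0 < B"
    and qi: "\<And>t. t > 0 \<Longrightarrow> \<exists>f. is_quasi_isometry A B C (V t) (path_dist (E t)) UNIV (warped_dist \<phi> S t) f"
    using assms(19) by (auto simp: quasi_isometric_families_def)
  define q where "q t = (SOME f. is_quasi_isometry A B C (V t) (path_dist (E t)) UNIV (warped_dist \<phi> S t) f)" for t
  have q: "is_quasi_isometry A B C (V t) (path_dist (E t)) UNIV (warped_dist \<phi> S t) (q t)" if "t > 0" for t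
    unfolding q_def by (rule someI_ex[OF qi[OF that]])
  obtain c m C2 where c: "0 < c" and m: "0 < m" and C2: "1 \<le> C2"
    and reg: "\<And>y r. 0 < r \<Longrightarrow> r \<le> 2 * diameter (UNIV :: 'y set) \<Longrightarrow>
      c * r powr m \<le> measure \<mu> (ball y r) \<and> measure \<mu> (ball y r) \<le> C2 * c * r powr m"
    using assms(6) unfolding ahlfors_regular_def by blast
  obtain \<kappa> where \<kappa>: "0 \<le> \<kappa>" and gap: "\<And>g :: 'y \<Rightarrow> 'x. simple_function \<mu> g \<Longrightarrow>
    \<exists>c. (\<integral>y. (norm (g y - c))\<^sup>2 \<partial>\<mu>) \<le> \<kappa> * (\<Sum>s\<in>S. \<integral>y. (norm (g y - g (\<phi> s y)))\<^sup>2 \<partial>\<mu>)"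
    using spectral_gap[OF comp act borel S assms(10,11,15,16,20)] by blast
  define d where "d = diameter (UNIV :: 'y set)"
  have dd: "dist x y \<le> d" for x y :: 'y
    unfolding d_def by (rule diameter_bounded_bound) (use compact_imp_bounded[OF comp] in auto)
  obtain x0 y0 :: 'y where "x0 \<noteq> y0" using assms(3) by blast
  then have d0: "0 < d" using dd[of x0 y0] zero_less_dist_iff[of x0 y0] by linarith
  have G: "graph_on (V t) (E t)" if "t > 0" for t using conn[OF that] by (simp add: connected_graph_on_def)
  have near: "y \<in> nbhd (E t) (nat \<lceil>C * (r + A)\<rceil>) x"
    if t: "t > 0" and xy: "x \<in> V t" "y \<in> V t" and r: "warped_dist \<phi> S t (q t x) (q t y) \<le> r" for t x y r
  proof (rule nbhd_of_path_dist[OF conn[OF t] xy])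
    have "path_dist (E t) x y / C - A \<le> warped_dist \<phi> S t (q t x) (q t y)"
      using q[OF t] xy by (simp add: is_quasi_isometry_def)
    then have "path_dist (E t) x y / C \<le> r + A" using r by linarith
    then have "path_dist (E t) x y \<le> C * (r + A)" using C by (simp add: pos_divide_le_eq mult.commute)
    then show "path_dist (E t) x y \<le> real (nat \<lceil>C * (r + A)\<rceil>)" by linarith
  qed
  have cover: "\<exists>v\<in>V t. warped_dist \<phi> S t (q t v) y < B" if t: "t > 0" for t y
  proof -
    obtain v where "v \<in> V t" "warped_dist \<phi> S t y (q t v) < B"
      using q[OF t] unfolding is_quasi_isometry_def by blast
    then show ?thesis using warped_dist_facts(2)[OF t, of \<phi> S y "q t v"] by (intro bexI[of _ v]) auto
  qed
  have V0: "V t \<noteq> {}" if "t > 0" for t using cover[OF that] by blast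
  have far: "V t \<subseteq> nbhd (E t) (nat \<lceil>C * (r * d + A)\<rceil>) x" if t: "t > 0" "t \<le> r" and x: "x \<in> V t" for t r x
  proof
    fix y assume y: "y \<in> V t"
    have "warped_dist \<phi> S t (q t x) (q t y) \<le> t * dist (q t x) (q t y)" by (rule warped_dist_facts(5)[OF t(1)])
    also have "\<dots> \<le> r * d" using t dd d0 by (intro mult_mono) auto
    finally show "y \<in> nbhd (E t) (nat \<lceil>C * (r * d + A)\<rceil>) x" by (rule near[OF t(1) x y])
  qed
  have ball: "finite (nbhd (E t) R x)" "card (nbhd (E t) R x) \<le> (k + 1) ^ R" if "t > 0" "x \<in> V t" for t R x
    using card_nbhd[OF G[OF that(1)] k[OF that(1)] that(2), of R] by auto
  have fin: "finite (V t)" if t: "t > 0" for t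
  proof -
    obtain x where "x \<in> V t" using V0[OF t] by blast
    then show ?thesis using finite_subset[OF far[OF t order_refl] ball(1)[OF t]] by blast
  qed
  \<comment> \<open>The bounds \<open>a t\<close> and \<open>b t\<close> for the measures of the sets
    \<open>U t v\<close> have a ratio that does not depend on \<open>t\<close>. They hold for
    \<open>t \<ge> t0\<close>, where the radius \<open>2 * L powr B * B / t\<close> is at most twice
    the diameter.\<close>
  define U where "U t v = {y. warped_dist \<phi> S t (q t v) y < B}" for t v
  define W where "W = real (card {ws. set ws \<subseteq> S \<and> length ws \<le> nat \<lfloor>B\<rfloor>})"
  define a where "a t = c * (B / t) powr m" for t
  define b where "b t = W * (C2 * c * (2 * L powr B * B / t) powr m)" for t
  define t0 where "t0 = L powr B * B / d"
  have t0: "0 < t0" using L B d0 by (simp add: t0_def)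
  have U_meas: "U t v \<in> sets \<mu>" if "t > 0" for t v
    unfolding U_def borel by (rule borel_open) (rule open_warped_ball[OF that])
  have U_bounds: "a t \<le> measure \<mu> (U t v)" "measure \<mu> (U t v) \<le> b t" if t: "t \<ge> t0" for t v
  proof -
    have t1: "0 < t" using t t0 by simp
    have "L powr B * B \<le> d * t" using t d0 by (simp add: t0_def pos_divide_le_eq mult.commute)
    then have "2 * L powr B * B / t \<le> 2 * d" using t1 by (simp add: pos_divide_le_eq)
    note bnds = warped_ball_measure[OF prob borel c C2 reg[folded d_def] t1 S(1) inv L lip B this, of "q t v"]
    from bnds show "a t \<le> measure \<mu> (U t v)" "measure \<mu> (U t v) \<le> b t"
      by (simp_all add: a_def b_def U_def W_def)
  qed
  have L2: "0 < 2 * L powr B" using L by simp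
  have a0: "0 < a t" if "t > 0" for t using that c B by (simp add: a_def)
  have ratio: "b t / a t = W * C2 * (2 * L powr B) powr m" if t: "t > 0" for t
  proof -
    have "2 * L powr B * B / t = 2 * L powr B * (B / t)" by simp
    then have "(2 * L powr B * B / t) powr m = (2 * L powr B) powr m * (B / t) powr m" by (simp only: powr_mult)
    moreover have "0 < (B / t) powr m" using B t by simp
    ultimately show ?thesis using c by (simp add: a_def b_def)
  qed
  \<comment> \<open>If points of \<open>U t v\<close> and \<open>U t w\<close> are at warped distance at
    most \<open>1\<close>, then \<open>q t v\<close> and \<open>q t w\<close> are at distance at
    most \<open>2 * B + 1\<close>, and the vertices \<open>v\<close> and \<open>w\<close> at
    distance at most \<open>R\<close>.\<close>
  define R where "R = nat \<lceil>C * (2 * B + 1 + A)\<rceil>"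
  define P where "P = (k + 1) ^ R"
  define K1 where "K1 = 4 * (W * C2 * (2 * L powr B) powr m) *
    (2 * (real R)\<^sup>2 * real P + 2 * (real P)\<^sup>2 * \<kappa> * real (card S) * (real R)\<^sup>2)"
  \<comment> \<open>For \<open>t \<le> t0\<close> the diameter of \<open>tY\<close> is at most
    \<open>t0 * d\<close>, so the whole graph is a ball of radius \<open>R0\<close>.\<close>
  define R0 where "R0 = nat \<lceil>C * (t0 * d + A)\<rceil>"
  define P0 where "P0 = (k + 1) ^ R0"
  define K where "K = K1 + real P0 * (real R0)\<^sup>2 + 1"
  have W0: "0 \<le> W" by (simp add: W_def)
  have K10: "0 \<le> K1" unfolding K1_def using W0 C2 \<kappa> by (intro mult_nonneg_nonneg add_nonneg_nonneg) auto
  have K0: "0 < K" using K10 by (simp add: K_def add_nonneg_pos)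
  have energy0: "0 \<le> energy (V t) (E t) f" for t and f :: "'v \<Rightarrow> 'x"
    unfolding energy_def by (intro sum_nonneg) auto
  have large: "(\<Sum>(x, y) \<in> V t \<times> V t. (norm (f x - f y))\<^sup>2) \<le> K1 * real (card (V t)) * energy (V t) (E t) f"
    if t: "t \<ge> t0" for t and f :: "'v \<Rightarrow> 'x"
  proof -
    have t1: "t > 0" using t t0 by simp
    note wd = warped_dist_facts[OF t1]
    have nearR: "w \<in> nbhd (E t) R v"
      if "v \<in> V t" "w \<in> V t" "y \<in> U t v" "z \<in> U t w" "warped_dist \<phi> S t y z \<le> 1" for v w y z
      unfolding R_def
    proof (rule near[OF t1 that(1,2)])
      have "warped_dist \<phi> S t (q t v) (q t w) \<le> warped_dist \<phi> S t (q t v) y + warped_dist \<phi> S t y (q t w)"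
        by (rule wd(3))
      also have "warped_dist \<phi> S t y (q t w) \<le> warped_dist \<phi> S t y z + warped_dist \<phi> S t z (q t w)"
        by (rule wd(3))
      finally show "warped_dist \<phi> S t (q t v) (q t w) \<le> 2 * B + 1"
        using that wd(2)[of \<phi> S "q t w" z] by (simp add: U_def)
    qed
    have "(\<Sum>(x, y) \<in> V t \<times> V t. (norm (f x - f y))\<^sup>2) \<le>
      4 * (b t / a t) * (2 * (real R)\<^sup>2 * real P + 2 * (real P)\<^sup>2 * \<kappa> * real (card S) * (real R)\<^sup>2) *
        real (card (V t)) * energy (V t) (E t) f"
    proof (rule Poincare_transfer[OF sp G[OF t1] fin[OF t1], where U = "U t" and T = \<phi> and S = S])
      show "card (nbhd (E t) R x) \<le> P" "finite (nbhd (E t) R x)" if "x \<in> V t" for x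
        using ball[OF t1 that] by (auto simp: P_def)
      show "\<exists>v\<in>V t. y \<in> U t v" for y using cover[OF t1] by (simp add: U_def)
      show "w \<in> nbhd (E t) R v" if "v \<in> V t" "w \<in> V t" "y \<in> U t v" "y \<in> U t w" for v w y
        by (rule nearR[OF that]) (simp add: wd(4))
      show "w \<in> nbhd (E t) R v" if "s \<in> S" "v \<in> V t" "w \<in> V t" "y \<in> U t v" "\<phi> s y \<in> U t w" for s v w y
        by (rule nearR[OF that(2-5) wd(6)[OF that(1)]])
      show "\<phi> s \<in> measurable \<mu> \<mu>" if "s \<in> S" for s by (rule \<phi>_measurable) (use that S in auto)
    qed (use U_meas[OF t1] U_bounds[OF t] a0[OF t1] \<kappa> gap in auto)
    then show ?thesis by (simp only: ratio[OF t1] K1_def)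
  qed
  have small: "(\<Sum>(x, y) \<in> V t \<times> V t. (norm (f x - f y))\<^sup>2) \<le>
      real P0 * (real R0)\<^sup>2 * real (card (V t)) * energy (V t) (E t) f"
    if t: "0 < t" "t \<le> t0" for t and f :: "'v \<Rightarrow> 'x"
  proof -
    let ?En = "energy (V t) (E t) f"
    have sub: "V t \<subseteq> nbhd (E t) R0 x" if "x \<in> V t" for x
      unfolding R0_def by (rule far[OF t that])
    have pair: "(norm (f x - f y))\<^sup>2 \<le> (real R0)\<^sup>2 * ?En" if "x \<in> V t" "y \<in> V t" for x y
    proof -
      have "y \<in> nbhd (E t) R0 x" using sub that by blast
      then have "(norm (f x - f y))\<^sup>2 \<le> (real R0)\<^sup>2 * local_energy (V t) (E t) R0 f x"
        by (rule norm_diff_le_local_energy[OF G[OF t(1)] fin[OF t(1)] that(1)])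
      also have "\<dots> \<le> (real R0)\<^sup>2 * ?En"
        by (rule mult_left_mono[OF local_energy_le[OF fin[OF t(1)]]]) simp
      finally show ?thesis .
    qed
    obtain x where x: "x \<in> V t" using V0[OF t(1)] by blast
    have "card (V t) \<le> card (nbhd (E t) R0 x)" by (rule card_mono[OF ball(1)[OF t(1) x] sub[OF x]])
    also have "\<dots> \<le> P0" unfolding P0_def by (rule ball(2)[OF t(1) x])
    finally have cV: "real (card (V t)) \<le> real P0" by simp
    have "(\<Sum>(x, y) \<in> V t \<times> V t. (norm (f x - f y))\<^sup>2) \<le> (\<Sum>p \<in> V t \<times> V t. (real R0)\<^sup>2 * ?En)"
      by (rule sum_mono) (use pair in auto)
    also have "\<dots> = real (card (V t)) * (real (card (V t)) * ((real R0)\<^sup>2 * ?En))"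
      by (simp add: card_cartesian_product)
    also have "\<dots> \<le> real P0 * (real (card (V t)) * ((real R0)\<^sup>2 * ?En))"
      by (rule mult_right_mono[OF cV]) (use energy0 in auto)
    finally show ?thesis by (simp only: mult_ac)
  qed
  have poincare: "1 / K / real (card (V t)) * (\<Sum>(x, y) \<in> V t \<times> V t. (norm (f x - f y))\<^sup>2) \<le> energy (V t) (E t) f"
    if t: "t > 0" for t and f :: "'v \<Rightarrow> 'x"
  proof -
    let ?n = "real (card (V t))" and ?En = "energy (V t) (E t) f"
    have n: "0 < ?n" using V0[OF t] fin[OF t] by (simp add: card_gt_0_iff)
    have nE: "0 \<le> ?n * ?En" using energy0 by simp
    have "(\<Sum>(x, y) \<in> V t \<times> V t. (norm (f x - f y))\<^sup>2) \<le> K * (?n * ?En)"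
    proof (cases "t \<ge> t0")
      case True
      have "K1 * (?n * ?En) \<le> K * (?n * ?En)" by (rule mult_right_mono[OF _ nE]) (simp add: K_def)
      then show ?thesis using large[OF True, of f] by (simp add: mult.assoc)
    next
      case False
      have "real P0 * (real R0)\<^sup>2 * (?n * ?En) \<le> K * (?n * ?En)"
        by (rule mult_right_mono[OF _ nE]) (use K10 in \<open>simp add: K_def\<close>)
      then show ?thesis using small[OF t, of f] False by (simp add: mult.assoc)
    qed
    then have "1 / (K * ?n) * (\<Sum>(x, y) \<in> V t \<times> V t. (norm (f x - f y))\<^sup>2) \<le> 1 / (K * ?n) * (K * (?n * ?En))"
      using K0 n by (intro mult_left_mono) auto
    also have "\<dots> = ?En" using K0 n by simp
    finally show ?thesis by simp
  qed
  \<comment> \<open>The sets \<open>U t v\<close> cover \<open>Y\<close>, and each has measure at most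
    \<open>b t\<close>, which is a constant over \<open>t powr m\<close>.\<close>
  have unb: "\<exists>t\<in>{0<..}. card (V t) > N" for N
  proof -
    define K2 where "K2 = W * (C2 * c * (2 * L powr B * B) powr m)"
    have K2: "0 \<le> K2" using W0 C2 c by (simp add: K2_def)
    define w where "w = K2 * (real N + 1) + 1"
    have w: "0 < w" using K2 by (simp add: w_def add_nonneg_pos)
    define t where "t = max t0 (w powr (1 / m))"
    have t: "t \<ge> t0" "t > 0" using t0 by (auto simp: t_def)
    have "w = (w powr (1 / m)) powr m" using w m by (simp add: powr_powr)
    also have "\<dots> \<le> t powr m" using m by (intro powr_mono2) (auto simp: t_def)
    finally have tw: "w \<le> t powr m" .
    have bt: "b t = K2 / t powr m"
    proof -
      have "(2 * L powr B * B / t) powr m = (2 * L powr B * B) powr m / t powr m"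
        by (rule powr_divide)
      then show ?thesis by (simp add: b_def K2_def)
    qed
    have "1 = measure \<mu> (\<Union>v\<in>V t. U t v)"
    proof -
      have "(\<Union>v\<in>V t. U t v) = space \<mu>" using cover[OF t(2)] by (auto simp: U_def sp)
      then show ?thesis by (simp add: prob_space)
    qed
    also have "\<dots> \<le> (\<Sum>v\<in>V t. measure \<mu> (U t v))"
      by (rule finite_measure_subadditive_finite[OF fin[OF t(2)]]) (use U_meas[OF t(2)] in auto)
    also have "\<dots> \<le> (\<Sum>v\<in>V t. b t)" by (rule sum_mono[OF U_bounds(2)[OF t(1)]])
    also have "\<dots> = real (card (V t)) * K2 / t powr m" by (simp add: bt)
    finally have "t powr m \<le> real (card (V t)) * K2" using t by (simp add: pos_le_divide_eq)
    then have "K2 * (real N + 1) < K2 * real (card (V t))" using tw by (simp add: w_def mult.commute)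
    then have "real N + 1 < real (card (V t))" using K2 by (rule mult_left_less_imp_less)
    then have "card (V t) > N" by linarith
    then show ?thesis using t(2) by (intro bexI[of _ t]) auto
  qed
  show ?thesis
    unfolding expander_wrt_def
  proof (intro conjI)
    show "\<forall>i\<in>{0<..}. graph_on (V i) (E i) \<and> finite (V i)" using G fin by auto
    show "uniformly_bounded_degree {0<..} V E" by (rule assms(18))
    show "\<forall>N. \<exists>i\<in>{0<..}. card (V i) > N" using unb by blast
    show "\<exists>\<eta>>0. \<forall>i\<in>{0<..}. \<forall>f :: 'v \<Rightarrow> 'x.
        (\<Sum>(x, y) \<in> {(x, y) \<in> V i \<times> V i. E i x y}. (norm (f x - f y))\<^sup>2)
          \<ge> \<eta> / real (card (V i)) * (\<Sum>(x, y) \<in> V i \<times> V i. (norm (f x - f y))\<^sup>2)"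
    proof (intro exI[of _ "1 / K"] conjI ballI allI)
      show "1 / K > 0" using K0 by simp
      fix t :: real and f :: "'v \<Rightarrow> 'x" assume "t \<in> {0<..}"
      then show "1 / K / real (card (V t)) * (\<Sum>(x, y) \<in> V t \<times> V t. (norm (f x - f y))\<^sup>2) \<le>
          (\<Sum>(x, y) \<in> {(x, y) \<in> V t \<times> V t. E t x y}. (norm (f x - f y))\<^sup>2)"
        using poincare[of t f] by (simp add: energy_def)
    qed
  qed
qed


end
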